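(* Let $\{x_1,\dots,x_m\}$ be a bivariate sample from the pole distribution for $n=2$, i.e. an i.i.d. sample in $\mathbb{R}^2$ with spherical density with radial function $f(r)=\frac{1}{(1+r^2)^2}$, and consider testing the null hypothesis that the center of the distribution is $\underline 0$ against the alternative that it is not. Let $\mathcal{P}^{(m)}$ be the sequence of tests based on $Q^{(m)}_{f_*}(\underline 0)$ with $f_*(r)=\frac{1}{(1+r^2)^2}$, and $\mathcal{W}^{(m)}$ the sequence of tests of van der Waerden type based on $Q^{(m)}_{f_*}(\underline 0)$ with $f_*(r)=e^{-r^2/2}$. Then the asymptotic Pitman relative efficiency of $\mathcal{P}^{(m)}$ with respect to $\mathcal{W}^{(m)}$ satisfies $$\mathrm{ARE}(\mathcal{P}^{(m)},\mathcal{W}^{(m)})\approx1.44 .$$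
   Context: Pole distribution, $n=2$: the pole is $a_1/a_0$ for complex data $(a_0,a_1)$; for centered spherical data its density on $\mathbb{C}\cong\mathbb{R}^2$ is $\frac{1}{\pi(1+|z|^2)^2}$, i.e. the spherical density centered at $\underline 0$ with radial function $f(r)=\frac1{(1+r^2)^2}$. Under the alternatives the observations have the same density translated to a center $\mu\ne\underline 0$. Test statistic: for a radial function $f_*$, let $g(r)=rf_*(r)/\int_0^\infty sf_*(s)\,ds$, let $\tilde g$ be the distribution function of $g$, and let $J_{2,f_*}=-2\frac{(f_*^{1/2})'}{f_*^{1/2}}\circ\tilde g^{-1}$ on $(0,1)$. Then $$Q^{(m)}_{f_*}(\underline 0)=\frac{2}{m\,E[J_{2,f_*}^2(u)]}\sum_{i,j=1}^mJ_{2,f_*}\!\left(\frac{\hat R_i(\underline 0)}{m+1}\right)J_{2,f_*}\!\left(\frac{\hat R_j(\underline 0)}{m+1}\right)\cos\!\left(\pi p^{(m)}_{ij}(\underline 0)\right),$$ with $u$ uniform on $(0,1)$. Here $\hat R_i(\underline 0)$ are the pseudo-Mahalanobis ranks: the rank of $(x_i^T\hat\Sigma^{-1}x_i)^{1/2}$ among $(x_j^T\hat\Sigma^{-1}x_j)^{1/2}$, $j=1,\dots,m$, with $\hat\Sigma$ Tyler's affine-equivariant estimator of scatter about $\underline 0$; and $p^{(m)}_{ij}(\underline 0)$ are Randles' normalized interdirections: $p^{(m)}_{ii}=0$ and, for $i\ne j$, $p^{(m)}_{ij}=(q_{ij}+1)/m$ where $q_{ij}$ is the number of indices $l\notin\{i,j\}$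 such that the line through $\underline 0$ and $x_l$ separates $x_i$ from $x_j$. The test rejects the null hypothesis when $Q^{(m)}_{f_*}(\underline 0)$ exceeds the $(1-\beta)$-quantile of the chi-square distribution with $2$ degrees of freedom ($\beta$ is the asymptotic level). The asymptotic Pitman relative efficiency of a first sequence of tests with respect to a second is the limit, along local alternatives with center $\mu=m^{-1/2}\tau$, $\tau\in\mathbb{R}^2\setminus\{\underline 0\}$, of the ratio of the sample size needed by the second sequence to that needed by the first to attain the same power at the same asymptotic level. The symbol $\approx 1.44$ means that the value equals $1.44$ after rounding to two decimals. *)

theory Defs
  imports "HOL-Probability.Probability"
begin

section \<open>The pole distribution for \<open>n = 2\<close>\<close>

definition pole_radial :: "real \<Rightarrow> real" where
  "pole_radial r = 1 / (1 + r\<^sup>2)\<^sup>2"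

definition gauss_radial :: "real \<Rightarrow> real" where
  "gauss_radial r = exp (- (r\<^sup>2) / 2)"

text \<open>The factor \<open>1 / pi\<close> normalises \<open>z \<mapsto> pole_radial (norm z)\<close> to a probability density on the plane.\<close>

definition pole_density :: "real^2 \<Rightarrow> real^2 \<Rightarrow> real" where
  "pole_density \<mu> z = pole_radial (norm (z - \<mu>)) / pi"

definition pole_sample :: "nat \<Rightarrow> real^2 \<Rightarrow> (nat \<Rightarrow> real^2) measure" where
  "pole_sample m \<mu> = PiM {..<m} (\<lambda>_. density lborel (\<lambda>z. ennreal (pole_density \<mu> z)))"


section \<open>Score functions\<close>

definition radial_pdf :: "(real \<Rightarrow> real) \<Rightarrow> real \<Rightarrow> real" where
  "radial_pdf f r = r * f r / (LINT s:{0<..}|lborel. s * f s)"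

definition radial_cdf :: "(real \<Rightarrow> real) \<Rightarrow> real \<Rightarrow> real" where
  "radial_cdf f r = (LINT s:{0<..r}|lborel. radial_pdf f s)"

text \<open>For positive \<open>f\<close>, the function \<open>radial_cdf f\<close> is strictly increasing from \<open>{0<..}\<close> onto
  \<open>{0<..<1}\<close>, and \<open>radial_quantile f\<close> is its inverse there.\<close>

definition radial_quantile :: "(real \<Rightarrow> real) \<Rightarrow> real \<Rightarrow> real" where
  "radial_quantile f = the_inv_into {0<..} (radial_cdf f)"

definition score :: "(real \<Rightarrow> real) \<Rightarrow> real \<Rightarrow> real" where
  "score f u =
     (let r = radial_quantile f u in - 2 * deriv (\<lambda>s. sqrt (f s)) r / sqrt (f r))"

definition score_second_moment :: "(real \<Rightarrow> real) \<Rightarrow> real" where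
  "score_second_moment f = (LINT u|uniform_measure lborel {0<..<1}. (score f u)\<^sup>2)"


section \<open>Pseudo-Mahalanobis ranks about the origin\<close>

text \<open>Tyler's equation determines the scatter matrix only up to a positive factor, which
  is fixed by the trace; the ranks below do not depend on this choice.\<close>

definition is_tyler_scatter :: "nat \<Rightarrow> (nat \<Rightarrow> real^2) \<Rightarrow> real^2^2 \<Rightarrow> bool" where
  "is_tyler_scatter m x S \<longleftrightarrow>
     transpose S = S \<and> (\<forall>v. v \<noteq> 0 \<longrightarrow> 0 < v \<bullet> (S *v v)) \<and> trace S = 2 \<and>
     (2 / real m) *\<^sub>R (\<Sum>i<m. (1 / (x i \<bullet> (matrix_inv S *v x i))) *\<^sub>R (\<chi> a b. x i $ a * x i $ b)) = S"

text \<open>For \<open>m \<ge> 3\<close> a sample from a density has almost surely exactly one Tyler scatter matrix. The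
  identity matrix is used on the remaining null set, since an undetermined description there
  could destroy the measurability of the test statistic.\<close>

definition tyler_scatter :: "nat \<Rightarrow> (nat \<Rightarrow> real^2) \<Rightarrow> real^2^2" where
  "tyler_scatter m x =
     (if \<exists>!S. is_tyler_scatter m x S then THE S. is_tyler_scatter m x S else mat 1)"

definition pseudo_mahalanobis :: "nat \<Rightarrow> (nat \<Rightarrow> real^2) \<Rightarrow> nat \<Rightarrow> real" where
  "pseudo_mahalanobis m x i = sqrt (x i \<bullet> (matrix_inv (tyler_scatter m x) *v x i))"

definition pm_rank :: "nat \<Rightarrow> (nat \<Rightarrow> real^2) \<Rightarrow> nat \<Rightarrow> nat" where
  "pm_rank m x i = card {j. j < m \<and> pseudo_mahalanobis m x j \<le> pseudo_mahalanobis m x i}"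


section \<open>Randles' interdirections about the origin\<close>

text \<open>The vector \<open>n\<close> is a normal of the line through the origin and \<open>l\<close>.\<close>

definition line_separates :: "real^2 \<Rightarrow> real^2 \<Rightarrow> real^2 \<Rightarrow> bool" where
  "line_separates l y z \<longleftrightarrow> l \<noteq> 0 \<and> (\<exists>n. n \<bullet> l = 0 \<and> n \<bullet> y < 0 \<and> 0 < n \<bullet> z)"

definition interdirection_count :: "nat \<Rightarrow> (nat \<Rightarrow> real^2) \<Rightarrow> nat \<Rightarrow> nat \<Rightarrow> nat" where
  "interdirection_count m x i j =
     card {l. l < m \<and> l \<notin> {i, j} \<and> line_separates (x l) (x i) (x j)}"

definition interdirection :: "nat \<Rightarrow> (nat \<Rightarrow> real^2) \<Rightarrow> nat \<Rightarrow> nat \<Rightarrow> real" where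
  "interdirection m x i j =
     (if i = j then 0 else (real (interdirection_count m x i j) + 1) / real m)"


section \<open>The rank tests\<close>

definition Q_stat :: "(real \<Rightarrow> real) \<Rightarrow> nat \<Rightarrow> (nat \<Rightarrow> real^2) \<Rightarrow> real" where
  "Q_stat f m x =
     2 / (real m * score_second_moment f) *
     (\<Sum>i<m. \<Sum>j<m. score f (real (pm_rank m x i) / (real m + 1)) *
                    score f (real (pm_rank m x j) / (real m + 1)) *
                    cos (pi * interdirection m x i j))"

definition chi_square_density :: "nat \<Rightarrow> real \<Rightarrow> real" where
  "chi_square_density k t =
     (if 0 < t then t powr (real k / 2 - 1) * exp (- t / 2) / (2 powr (real k / 2) * Gamma (real k / 2))
      else 0)"

definition chi_square_quantile :: "nat \<Rightarrow> real \<Rightarrow> real" where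
  "chi_square_quantile k p =
     Inf {t. p \<le> cdf (density lborel (\<lambda>t. ennreal (chi_square_density k t))) t}"

definition Q_test_power :: "(real \<Rightarrow> real) \<Rightarrow> real \<Rightarrow> nat \<Rightarrow> real^2 \<Rightarrow> real" where
  "Q_test_power f \<beta> m \<mu> =
     measure (pole_sample m \<mu>)
       {x \<in> space (pole_sample m \<mu>). chi_square_quantile 2 (1 - \<beta>) < Q_stat f m x}"


section \<open>Asymptotic Pitman relative efficiency\<close>

text \<open>A family of test sequences is given by its power \<open>\<phi> \<beta> N \<mu>\<close>, where \<open>\<beta>\<close> is the asymptotic level,
  \<open>N\<close> the sample size and \<open>\<mu>\<close> the true parameter (\<open>0\<close> under the null hypothesis).\<close>

type_synonym test_power = "real \<Rightarrow> nat \<Rightarrow> real^2 \<Rightarrow> real"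

text \<open>The power is required to stay at or above \<open>\<gamma>\<close> for all larger sample sizes as well: the exact
  size of an asymptotic test at a few very small sample sizes may exceed \<open>\<gamma>\<close> by accident (with one
  observation the statistics above are constant), and such sizes do not count.\<close>

definition size_suffices :: "test_power \<Rightarrow> real \<Rightarrow> real \<Rightarrow> real^2 \<Rightarrow> nat \<Rightarrow> bool" where
  "size_suffices \<phi> \<beta> \<gamma> \<mu> N \<longleftrightarrow> (\<forall>n\<ge>N. \<gamma> \<le> \<phi> \<beta> n \<mu>)"

definition sample_size_needed :: "test_power \<Rightarrow> real \<Rightarrow> real \<Rightarrow> real^2 \<Rightarrow> nat" where
  "sample_size_needed \<phi> \<beta> \<gamma> \<mu> = (LEAST N. size_suffices \<phi> \<beta> \<gamma> \<mu> N)"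

definition has_asymptotic_level :: "test_power \<Rightarrow> real \<Rightarrow> bool" where
  "has_asymptotic_level \<phi> \<beta> \<longleftrightarrow> (\<lambda>m. \<phi> \<beta> m 0) \<longlonglongrightarrow> \<beta>"

text \<open>The efficiency of \<open>\<phi>\<close> with respect to \<open>\<psi>\<close> is \<open>e\<close>. The same \<open>e\<close> has to serve for every level
  \<open>\<beta>\<close>, every power \<open>\<gamma>\<close> strictly between \<open>\<beta>\<close> and \<open>1\<close>, and every direction \<open>\<tau>\<close>.\<close>

definition has_pitman_ARE :: "test_power \<Rightarrow> test_power \<Rightarrow> real \<Rightarrow> bool" where
  "has_pitman_ARE \<phi> \<psi> e \<longleftrightarrow>
     (\<forall>\<beta>. 0 < \<beta> \<and> \<beta> < 1 \<longrightarrow>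
        has_asymptotic_level \<phi> \<beta> \<and> has_asymptotic_level \<psi> \<beta> \<and>
        (\<forall>\<gamma> \<tau>. \<beta> < \<gamma> \<and> \<gamma> < 1 \<and> \<tau> \<noteq> 0 \<longrightarrow>
           (let \<mu> = (\<lambda>m. (1 / sqrt (real m)) *\<^sub>R \<tau>) in
              (\<forall>\<^sub>F m in sequentially.
                 (\<exists>N. size_suffices \<phi> \<beta> \<gamma> (\<mu> m) N) \<and> (\<exists>N. size_suffices \<psi> \<beta> \<gamma> (\<mu> m) N)) \<and>
              (\<lambda>m. real (sample_size_needed \<psi> \<beta> \<gamma> (\<mu> m)) /
                   real (sample_size_needed \<phi> \<beta> \<gamma> (\<mu> m))) \<longlonglongrightarrow> e)))"

end

theory Submission
  imports Defs "HOL-Real_Asymp.Real_Asymp"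
begin

text \<open>In the plane both ingredients of the statistic become explicit. The lines through the origin and the
  sample points are ordered by their slopes, so the interdirections are differences of slope ranks, and the
  double sum in the statistic is the squared modulus of a complex sum of signed scores
  \<open>sgn (x i $ 1) * J (R i / (m + 1)) * cis \<theta> i\<close> with \<open>\<theta> i\<close> read off from the slope rank of \<open>x i\<close>. Tyler's matrix
  is a point of the unit disc which is close to \<open>0\<close> as soon as four trigonometric sums are small, and then the
  pseudo-Mahalanobis ranks are close to the ranks of the norms. Conditionally on \<open>\<plusminus>x i\<close> the signs are
  independent and nearly symmetric; hence the ranks in the complex sum may be replaced by their limits with an error
  of smaller order in mean square. What remains is a sum of independent terms. Its characteristic function gives the limit of
  the Laplace transform of the statistic under \<open>\<mu> = h / sqrt m\<close>: a noncentral chi-square law with two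
  degrees of freedom whose noncentrality is \<open>h\<^sup>2\<close> times a constant depending on the score. The efficiency is the quotient of the two
  constants, \<open>1 / (6 * I\<^sup>2)\<close> with \<open>I = \<integral> sqrt (u * (1 - u) * - ln (1 - u)) du\<close> over the unit interval, and the inequality of the means
  determines \<open>I\<close> accurately enough.\<close>

section \<open>The pole distribution in polar coordinates\<close>

text \<open>The needed sample size asks for power at least \<gamma> at all larger sizes too, so the
  power must be controlled for every sequence of sizes and shifts: where sqrt n times the shift
  converges, and where it diverges. Hence the rank approximation is proved along
  \<open>local_filter\<close>, jointly in size and centre with no relation between them, and a
  Chebyshev argument gives power tending to 1 in the divergent regime. Contiguity is avoided: the
  pole density has polynomial tails, so the ratio of two translates lies between constants that tend
  to 1 with the shift, and expectations at a shifted centre can be compared directly with those at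
  \<open>0\<close>. The Laplace transform of a squared modulus is obtained from characteristic
  functions because \<open>exp (- (t * (cmod w)\<^sup>2))\<close> is the average of characters of w
  over a planar Gaussian frequency; the characters factor over the sample. Both tests have the same
  limiting power function, evaluated at \<open>noncentrality\<close> times h squared. The constants
  are 2 / 3 for the pole score and \<open>4 * I\<^sup>2\<close> for the Gaussian score.\<close>

definition vec2 :: "real \<Rightarrow> real \<Rightarrow> real^2" where
  "vec2 a b = (\<chi> i. if i = 1 then a else b)"

lemma vec2_nth [simp]: "vec2 a b $ 1 = a" "vec2 a b $ 2 = b"
  by (simp_all add: vec2_def)

lemma vec2_eq_iff: "(x :: real^2) = y \<longleftrightarrow> x $ 1 = y $ 1 \<and> x $ 2 = y $ 2"
  by (simp add: vec_eq_iff forall_2)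

lemma inner_vec2: "(x :: real^2) \<bullet> y = x $ 1 * y $ 1 + x $ 2 * y $ 2"
  by (simp add: inner_vec_def sum_2)

lemma norm_vec2: "norm (x :: real^2) = sqrt ((x $ 1)\<^sup>2 + (x $ 2)\<^sup>2)"
  by (simp add: norm_eq_sqrt_inner inner_vec2 power2_eq_square)

lemma norm_vec2_sq: "(norm (x :: real^2))\<^sup>2 = (x $ 1)\<^sup>2 + (x $ 2)\<^sup>2"
  by (simp add: norm_vec2)

lemma Basis_vec2: "(Basis :: (real^2) set) = {axis 1 1, axis 2 1}"
  by (auto simp: Basis_vec_def UNIV_2)

lemma borel_measurable_nth2 [measurable]: "(\<lambda>x::real^2. x $ i) \<in> borel_measurable borel"
  by (intro borel_measurable_continuous_onI continuous_intros)

lemma borel_measurable_vec2 [measurable (raw)]: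
  assumes [measurable]: "f \<in> borel_measurable M" "g \<in> borel_measurable M"
  shows "(\<lambda>x. vec2 (f x) (g x)) \<in> borel_measurable M"
  by (subst borel_measurable_euclidean_space) (auto simp: Basis_vec2 inner_axis)

lemma prod_Basis_vec2: "(\<Prod>b\<in>Basis. (x :: real^2) \<bullet> b) = x $ 1 * x $ 2"
proof -
  have "axis 1 1 \<noteq> (axis 2 1 :: real^2)" by (simp add: axis_eq_axis)
  then show ?thesis by (simp add: Basis_vec2 inner_axis)
qed

lemma lborel_vec2: "lborel = distr (lborel \<Otimes>\<^sub>M lborel) borel (\<lambda>p. vec2 (fst p) (snd p))"
proof (rule lborel_eqI)
  fix l u :: "real^2"
  assume le: "\<And>b. b \<in> Basis \<Longrightarrow> l \<bullet> b \<le> u \<bullet> b"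
  have le1: "l $ 1 \<le> u $ 1" and le2: "l $ 2 \<le> u $ 2"
    using le[of "axis 1 1"] le[of "axis 2 1"] by (auto simp: Basis_vec2 inner_axis)
  have "(\<lambda>p. vec2 (fst p) (snd p)) -` box l u \<inter> space (lborel \<Otimes>\<^sub>M lborel)
      = {l $ 1<..<u $ 1} \<times> {l $ 2<..<u $ 2}"
    by (auto simp: space_pair_measure mem_box_cart forall_2)
  then show "emeasure (distr (lborel \<Otimes>\<^sub>M lborel) borel (\<lambda>p. vec2 (fst p) (snd p))) (box l u)
      = ennreal (prod ((\<bullet>) (u - l)) Basis)"
    using le1 le2 prod_Basis_vec2[of "u - l"]
    by (simp add: emeasure_distr lborel.emeasure_pair_measure_Times ennreal_mult)
qed simp

lemma nn_integral_vec2: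
  assumes [measurable]: "F \<in> borel_measurable borel"
  shows "(\<integral>\<^sup>+x. F x \<partial>(lborel :: (real^2) measure)) = (\<integral>\<^sup>+a. \<integral>\<^sup>+b. F (vec2 a b) \<partial>lborel \<partial>lborel)"
proof -
  have "(\<integral>\<^sup>+x. F x \<partial>(lborel :: (real^2) measure)) = (\<integral>\<^sup>+p. F (vec2 (fst p) (snd p)) \<partial>(lborel \<Otimes>\<^sub>M lborel))"
    by (subst lborel_vec2) (simp add: nn_integral_distr)
  also have "\<dots> = (\<integral>\<^sup>+a. \<integral>\<^sup>+b. F (vec2 a b) \<partial>lborel \<partial>lborel)"
    by (subst lborel.nn_integral_fst[symmetric]) simp_all
  finally show ?thesis .
qed

text \<open>Polar coordinates with a signed radius \<open>\<rho>\<close> and the line through the origin given by its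
  slope \<open>s\<close>; only affine substitutions in one variable are needed.\<close>

lemma nn_integral_polar:
  assumes [measurable]: "F \<in> borel_measurable borel"
  shows "(\<integral>\<^sup>+x. F x \<partial>(lborel :: (real^2) measure)) =
    (\<integral>\<^sup>+s. \<integral>\<^sup>+\<rho>. F (vec2 (\<rho> / sqrt (1 + s\<^sup>2)) (\<rho> * s / sqrt (1 + s\<^sup>2))) *
       ennreal (\<bar>\<rho>\<bar> / (1 + s\<^sup>2)) \<partial>lborel \<partial>lborel)"
proof -
  have "(\<integral>\<^sup>+x. F x \<partial>lborel) = (\<integral>\<^sup>+a. \<integral>\<^sup>+b. F (vec2 a b) \<partial>lborel \<partial>lborel)"
    by (rule nn_integral_vec2) simp
  \<comment> \<open>For fixed a the slope s = b / a replaces b; the line a = 0 is a null set. After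
    Fubini, a is rescaled to the signed radius for fixed s.\<close>
  also have "\<dots> = (\<integral>\<^sup>+a. \<integral>\<^sup>+s. F (vec2 a (a * s)) * ennreal \<bar>a\<bar> \<partial>lborel \<partial>lborel)"
  proof (rule nn_integral_cong_AE, rule AE_mp[OF AE_lborel_singleton[of 0]], rule AE_I2, rule impI)
    fix a :: real assume "a \<noteq> 0"
    have "(\<integral>\<^sup>+b. F (vec2 a b) \<partial>lborel) = ennreal \<bar>a\<bar> * (\<integral>\<^sup>+s. F (vec2 a (0 + a * s)) \<partial>lborel)"
      using \<open>a \<noteq> 0\<close> by (intro nn_integral_real_affine) simp_all
    then show "(\<integral>\<^sup>+b. F (vec2 a b) \<partial>lborel) = (\<integral>\<^sup>+s. F (vec2 a (a * s)) * ennreal \<bar>a\<bar> \<partial>lborel)"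
      by (simp add: nn_integral_multc mult.commute[of "ennreal \<bar>a\<bar>"])
  qed
  also have "\<dots> = (\<integral>\<^sup>+s. \<integral>\<^sup>+a. F (vec2 a (a * s)) * ennreal \<bar>a\<bar> \<partial>lborel \<partial>lborel)"
    by (rule lborel_pair.Fubini') simp
  also have "\<dots> = (\<integral>\<^sup>+s. \<integral>\<^sup>+\<rho>. F (vec2 (\<rho> / sqrt (1 + s\<^sup>2)) (\<rho> * s / sqrt (1 + s\<^sup>2))) *
       ennreal (\<bar>\<rho>\<bar> / (1 + s\<^sup>2)) \<partial>lborel \<partial>lborel)"
  proof (rule nn_integral_cong)
    fix s :: real
    define c where "c = 1 / sqrt (1 + s\<^sup>2)"
    have pos: "0 < 1 + s\<^sup>2" by (smt (verit) zero_le_power2)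
    then have c: "0 < c" "c * c = 1 / (1 + s\<^sup>2)" by (simp_all add: c_def)
    have "(\<integral>\<^sup>+a. F (vec2 a (a * s)) * ennreal \<bar>a\<bar> \<partial>lborel)
        = ennreal \<bar>c\<bar> * (\<integral>\<^sup>+\<rho>. F (vec2 (0 + c * \<rho>) ((0 + c * \<rho>) * s)) * ennreal \<bar>0 + c * \<rho>\<bar> \<partial>lborel)"
      using c by (intro nn_integral_real_affine) simp_all
    also have "\<dots> = (\<integral>\<^sup>+\<rho>. ennreal c * (F (vec2 (c * \<rho>) ((c * \<rho>) * s)) * ennreal \<bar>c * \<rho>\<bar>) \<partial>lborel)"
      using c by (simp add: nn_integral_cmult)
    also have "\<dots> = (\<integral>\<^sup>+\<rho>. F (vec2 (\<rho> / sqrt (1 + s\<^sup>2)) (\<rho> * s / sqrt (1 + s\<^sup>2))) *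
       ennreal (\<bar>\<rho>\<bar> / (1 + s\<^sup>2)) \<partial>lborel)"
    proof (rule nn_integral_cong)
      fix \<rho> :: real
      have "ennreal c * ennreal \<bar>c * \<rho>\<bar> = ennreal (\<bar>\<rho>\<bar> / (1 + s\<^sup>2))"
        using c by (simp add: ennreal_mult[symmetric] abs_mult mult.assoc[symmetric])
      moreover have "c * \<rho> = \<rho> / sqrt (1 + s\<^sup>2)" "(c * \<rho>) * s = \<rho> * s / sqrt (1 + s\<^sup>2)"
        by (simp_all add: c_def)
      ultimately show "ennreal c * (F (vec2 (c * \<rho>) ((c * \<rho>) * s)) * ennreal \<bar>c * \<rho>\<bar>)
        = F (vec2 (\<rho> / sqrt (1 + s\<^sup>2)) (\<rho> * s / sqrt (1 + s\<^sup>2))) * ennreal (\<bar>\<rho>\<bar> / (1 + s\<^sup>2))"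
        by (metis mult.left_commute)
    qed
    finally show "(\<integral>\<^sup>+a. F (vec2 a (a * s)) * ennreal \<bar>a\<bar> \<partial>lborel) = \<dots>" .
  qed
  finally show ?thesis .
qed

definition pole_law :: "real^2 \<Rightarrow> (real^2) measure" where
  "pole_law \<mu> = density lborel (\<lambda>z. ennreal (pole_density \<mu> z))"

definition slope :: "real^2 \<Rightarrow> real" where
  "slope x = x $ 2 / x $ 1"

text \<open>The density of the norm: the circumference 2 pi r times the planar density
  \<open>pole_radial r / pi\<close>.\<close>

definition radius_law :: "real measure" where
  "radius_law = density lborel (\<lambda>r. ennreal (2 * r / (1 + r\<^sup>2)\<^sup>2 * indicator {0<..} r))"

definition cauchy_law :: "real measure" where
  "cauchy_law = density lborel (\<lambda>s. ennreal (1 / (pi * (1 + s\<^sup>2))))"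

lemma pole_density_pos: "0 < pole_density \<mu> x"
proof -
  have "0 < 1 + (norm (x - \<mu>))\<^sup>2" by (smt (verit) zero_le_power2)
  then show ?thesis by (simp add: pole_density_def pole_radial_def)
qed

lemma borel_measurable_pole_density [measurable]: "pole_density \<mu> \<in> borel_measurable borel"
  unfolding pole_density_def[abs_def] pole_radial_def by measurable

lemma borel_measurable_slope [measurable]: "slope \<in> borel_measurable borel"
  unfolding slope_def[abs_def] by measurable

lemma sets_pole_law [simp, measurable_cong]: "sets (pole_law \<mu>) = sets borel"
  by (simp add: pole_law_def)

lemma space_pole_law [simp]: "space (pole_law \<mu>) = UNIV"
  by (simp add: pole_law_def)

lemma sets_radius_law [simp, measurable_cong]: "sets radius_law = sets borel"
  by (simp add: radius_law_def)

lemma sets_cauchy_law [simp, measurable_cong]: "sets cauchy_law = sets borel"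
  by (simp add: cauchy_law_def)

lemma emeasure_radius_law_atMost:
  assumes "0 \<le> t"
  shows "emeasure radius_law {..t} = ennreal (t\<^sup>2 / (1 + t\<^sup>2))"
proof -
  have pos: "0 < 1 + r\<^sup>2" for r :: real by (smt (verit) zero_le_power2)
  have "emeasure radius_law {..t} = (\<integral>\<^sup>+r. ennreal (2 * r / (1 + r\<^sup>2)\<^sup>2) * indicator {0..t} r \<partial>lborel)"
    unfolding radius_law_def
    by (subst emeasure_density) (auto intro!: nn_integral_cong simp: indicator_def)
  also have "\<dots> = ennreal (t\<^sup>2 / (1 + t\<^sup>2) - 0\<^sup>2 / (1 + 0\<^sup>2))"
  proof (rule nn_integral_FTC_Icc)
    fix r :: real assume "r \<in> {0..t}"
    show "((\<lambda>r. r\<^sup>2 / (1 + r\<^sup>2)) has_real_derivative 2 * r / (1 + r\<^sup>2)\<^sup>2) (at r)"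
      using pos[of r] by (auto intro!: derivative_eq_intros simp: power2_eq_square field_simps)
    show "0 \<le> 2 * r / (1 + r\<^sup>2)\<^sup>2" using \<open>r \<in> {0..t}\<close> by simp
  qed (use assms in auto)
  finally show ?thesis by simp
qed

lemma emeasure_cauchy_law_atMost:
  "emeasure cauchy_law {..t} = ennreal (arctan t / pi + 1 / 2)"
proof -
  have pos: "0 < 1 + r\<^sup>2" for r :: real by (smt (verit) zero_le_power2)
  have "emeasure cauchy_law {..t} = (\<integral>\<^sup>+s. ennreal (1 / (pi * (1 + s\<^sup>2))) * indicator {..t} s \<partial>lborel)"
    unfolding cauchy_law_def by (subst emeasure_density) auto
  also have "\<dots> = ennreal \<bar>-1\<bar> * (\<integral>\<^sup>+s. ennreal (1 / (pi * (1 + (0 + (-1) * s)\<^sup>2))) * indicator {..t} (0 + (-1) * s) \<partial>lborel)"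
    by (rule nn_integral_real_affine) simp_all
  also have "\<dots> = (\<integral>\<^sup>+s. ennreal (1 / (pi * (1 + s\<^sup>2))) * indicator {-t..} s \<partial>lborel)"
    by (simp, rule nn_integral_cong) (auto simp: indicator_def)
  also have "\<dots> = ennreal (1 / 2 - arctan (-t) / pi)"
  proof (rule nn_integral_FTC_atLeast)
    fix s :: real
    show "((\<lambda>s. arctan s / pi) has_real_derivative 1 / (pi * (1 + s\<^sup>2))) (at s)"
      by (rule DERIV_cong[OF DERIV_cdivide[OF DERIV_arctan]]) (simp add: divide_inverse mult.commute)
    show "0 \<le> 1 / (pi * (1 + s\<^sup>2))" using pos[of s] by simp
  next
    have "((\<lambda>s. arctan s / pi) \<longlongrightarrow> (pi / 2) / pi) at_top"
      by (intro tendsto_intros tendsto_arctan_at_top) simp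
    then show "((\<lambda>s. arctan s / pi) \<longlongrightarrow> 1 / 2) at_top" by simp
  qed simp
  finally show ?thesis by (simp add: arctan_minus add.commute)
qed

lemma emeasure_UNIV_limit:
  fixes M :: "real measure"
  assumes [simp]: "sets M = sets borel"
    and F: "\<And>t. 0 \<le> t \<Longrightarrow> emeasure M {..t} = ennreal (F t)" and lim: "(F \<longlongrightarrow> 1) at_top"
  shows "emeasure M UNIV = 1"
proof (rule LIMSEQ_unique)
  have "(\<Union>n::nat. {..real n}) = UNIV" by (auto intro: real_arch_simple)
  moreover have "(\<lambda>n. emeasure M {..real n}) \<longlonglongrightarrow> emeasure M (\<Union>n::nat. {..real n})"
    by (rule Lim_emeasure_incseq) (auto simp: incseq_def)
  ultimately show "(\<lambda>n. emeasure M {..real n}) \<longlonglongrightarrow> emeasure M UNIV" by simp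
  have "(\<lambda>n. ennreal (F (real n))) \<longlonglongrightarrow> ennreal 1"
    by (intro tendsto_ennrealI filterlim_compose[OF lim filterlim_real_sequentially])
  then show "(\<lambda>n. emeasure M {..real n}) \<longlonglongrightarrow> 1" by (simp add: F)
qed

lemma prob_space_radius_law: "prob_space radius_law"
proof (rule prob_spaceI)
  have "((\<lambda>t::real. t\<^sup>2 / (1 + t\<^sup>2)) \<longlongrightarrow> 1) at_top" by real_asymp
  then show "emeasure radius_law (space radius_law) = 1"
    using emeasure_UNIV_limit[OF sets_radius_law emeasure_radius_law_atMost]
    by (simp add: radius_law_def)
qed

lemma prob_space_cauchy_law: "prob_space cauchy_law"
proof (rule prob_spaceI)
  have "((\<lambda>t. arctan t / pi + 1 / 2) \<longlongrightarrow> (pi / 2) / pi + 1 / 2) at_top"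
    by (intro tendsto_intros tendsto_arctan_at_top) simp
  then have "((\<lambda>t. arctan t / pi + 1 / 2) \<longlongrightarrow> 1) at_top" by simp
  then show "emeasure cauchy_law (space cauchy_law) = 1"
    using emeasure_UNIV_limit[OF sets_cauchy_law emeasure_cauchy_law_atMost]
    by (simp add: cauchy_law_def)
qed

text \<open>In signed polar coordinates the density times the Jacobian splits into a factor in s and
  a factor in \<rho>. This product form yields both marginal laws and the independence of norm and
  slope.\<close>

lemma nn_integral_pole_law_radius_slope:
  assumes [measurable]: "g \<in> borel_measurable (borel \<Otimes>\<^sub>M borel)"
  shows "(\<integral>\<^sup>+x. g (norm x, slope x) \<partial>pole_law 0) = (\<integral>\<^sup>+s. \<integral>\<^sup>+r. g (r, s) \<partial>radius_law \<partial>cauchy_law)"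
proof -
  have "(\<integral>\<^sup>+x. g (norm x, slope x) \<partial>pole_law 0)
      = (\<integral>\<^sup>+x. ennreal (pole_density 0 x) * g (norm x, slope x) \<partial>lborel)"
    by (simp add: pole_law_def nn_integral_density)
  also have "\<dots> = (\<integral>\<^sup>+s. \<integral>\<^sup>+\<rho>. (ennreal (pole_density 0 (vec2 (\<rho> / sqrt (1 + s\<^sup>2)) (\<rho> * s / sqrt (1 + s\<^sup>2))))
        * g (norm (vec2 (\<rho> / sqrt (1 + s\<^sup>2)) (\<rho> * s / sqrt (1 + s\<^sup>2))),
           slope (vec2 (\<rho> / sqrt (1 + s\<^sup>2)) (\<rho> * s / sqrt (1 + s\<^sup>2))))) *
       ennreal (\<bar>\<rho>\<bar> / (1 + s\<^sup>2)) \<partial>lborel \<partial>lborel)"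
    by (rule nn_integral_polar) simp
  also have "\<dots> = (\<integral>\<^sup>+s. ennreal (1 / (pi * (1 + s\<^sup>2))) * (\<integral>\<^sup>+\<rho>. ennreal (\<bar>\<rho>\<bar> / (1 + \<rho>\<^sup>2)\<^sup>2) * g (\<bar>\<rho>\<bar>, s) \<partial>lborel) \<partial>lborel)"
  proof (rule nn_integral_cong)
    fix s :: real
    have pos: "0 < 1 + s\<^sup>2" by (smt (verit) zero_le_power2)
    have "(ennreal (pole_density 0 (vec2 (\<rho> / sqrt (1 + s\<^sup>2)) (\<rho> * s / sqrt (1 + s\<^sup>2))))
        * g (norm (vec2 (\<rho> / sqrt (1 + s\<^sup>2)) (\<rho> * s / sqrt (1 + s\<^sup>2))),
           slope (vec2 (\<rho> / sqrt (1 + s\<^sup>2)) (\<rho> * s / sqrt (1 + s\<^sup>2))))) * ennreal (\<bar>\<rho>\<bar> / (1 + s\<^sup>2))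
        = ennreal (1 / (pi * (1 + s\<^sup>2))) * (ennreal (\<bar>\<rho>\<bar> / (1 + \<rho>\<^sup>2)\<^sup>2) * g (\<bar>\<rho>\<bar>, s))"
      (is "?l \<rho> = ?r \<rho>") for \<rho>
    proof (cases "\<rho> = 0")
      case False
      have sq: "(\<rho> / sqrt (1 + s\<^sup>2))\<^sup>2 + (\<rho> * s / sqrt (1 + s\<^sup>2))\<^sup>2 = \<rho>\<^sup>2"
      proof -
        have "(\<rho> / sqrt (1 + s\<^sup>2))\<^sup>2 + (\<rho> * s / sqrt (1 + s\<^sup>2))\<^sup>2 = \<rho>\<^sup>2 * (1 + s\<^sup>2) / (1 + s\<^sup>2)"
          using pos by (simp add: power_divide power_mult_distrib add_divide_distrib distrib_left)
        also have "\<dots> = \<rho>\<^sup>2" using pos by simp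
        finally show ?thesis .
      qed
      have n: "norm (vec2 (\<rho> / sqrt (1 + s\<^sup>2)) (\<rho> * s / sqrt (1 + s\<^sup>2))) = \<bar>\<rho>\<bar>"
        unfolding norm_vec2 vec2_nth sq by simp
      have sl: "slope (vec2 (\<rho> / sqrt (1 + s\<^sup>2)) (\<rho> * s / sqrt (1 + s\<^sup>2))) = s"
        using False pos by (simp add: slope_def)
      have p: "pole_density 0 (vec2 (\<rho> / sqrt (1 + s\<^sup>2)) (\<rho> * s / sqrt (1 + s\<^sup>2))) = 1 / (1 + \<rho>\<^sup>2)\<^sup>2 / pi"
        by (simp add: pole_density_def n pole_radial_def)
      have prod: "ennreal (1 / (1 + \<rho>\<^sup>2)\<^sup>2 / pi) * ennreal (\<bar>\<rho>\<bar> / (1 + s\<^sup>2)) = ennreal (1 / (pi * (1 + s\<^sup>2))) * ennreal (\<bar>\<rho>\<bar> / (1 + \<rho>\<^sup>2)\<^sup>2)"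
        using pos by (simp add: ennreal_mult[symmetric] field_simps)
      have comm: "(a * b) * c = d * (e * b)" if "a * c = d * e" for a b c d e :: ennreal
      proof -
        have "(a * b) * c = (a * c) * b" by (metis mult.assoc mult.commute)
        also have "\<dots> = d * (e * b)" unfolding that by (rule mult.assoc)
        finally show ?thesis .
      qed
      show ?thesis unfolding n sl p by (rule comm[OF prod])
    qed simp
    then have "(\<integral>\<^sup>+\<rho>. ?l \<rho> \<partial>lborel) = (\<integral>\<^sup>+\<rho>. ?r \<rho> \<partial>lborel)" by simp
    also have "\<dots> = ennreal (1 / (pi * (1 + s\<^sup>2))) * (\<integral>\<^sup>+\<rho>. ennreal (\<bar>\<rho>\<bar> / (1 + \<rho>\<^sup>2)\<^sup>2) * g (\<bar>\<rho>\<bar>, s) \<partial>lborel)"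
      by (rule nn_integral_cmult) simp
    finally show "(\<integral>\<^sup>+\<rho>. ?l \<rho> \<partial>lborel) = \<dots>" .
  qed
  also have "\<dots> = (\<integral>\<^sup>+s. ennreal (1 / (pi * (1 + s\<^sup>2))) * (\<integral>\<^sup>+r. g (r, s) \<partial>radius_law) \<partial>lborel)"
  proof (rule nn_integral_cong, rule arg_cong[where f="(*) (ennreal _)"])
    fix s :: real
    let ?h = "\<lambda>\<rho>. ennreal (\<bar>\<rho>\<bar> / (1 + \<rho>\<^sup>2)\<^sup>2) * g (\<bar>\<rho>\<bar>, s)"
    have "(\<integral>\<^sup>+\<rho>. ?h \<rho> \<partial>lborel) = (\<integral>\<^sup>+\<rho>. ?h \<rho> * indicator {0<..} \<rho> + ?h \<rho> * indicator {..<0} \<rho> \<partial>lborel)"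
      by (rule nn_integral_cong) (auto simp: indicator_def)
    also have "\<dots> = (\<integral>\<^sup>+\<rho>. ?h \<rho> * indicator {0<..} \<rho> \<partial>lborel) + (\<integral>\<^sup>+\<rho>. ?h \<rho> * indicator {..<0} \<rho> \<partial>lborel)"
      by (rule nn_integral_add) simp_all
    \<comment> \<open>The two rays of a line contribute equally because the integrand depends on
      \<rho> only through its modulus. This is the factor 2 in \<open>radius_law\<close>.\<close>
    also have "(\<integral>\<^sup>+\<rho>. ?h \<rho> * indicator {..<0} \<rho> \<partial>lborel) = (\<integral>\<^sup>+\<rho>. ?h \<rho> * indicator {0<..} \<rho> \<partial>lborel)"
    proof -
      have "(\<integral>\<^sup>+\<rho>. ?h \<rho> * indicator {..<0} \<rho> \<partial>lborel)
          = ennreal \<bar>-1\<bar> * (\<integral>\<^sup>+\<rho>. ?h (0 + (-1) * \<rho>) * indicator {..<0} (0 + (-1) * \<rho>) \<partial>lborel)"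
        by (rule nn_integral_real_affine) simp_all
      also have "\<dots> = (\<integral>\<^sup>+\<rho>. ?h \<rho> * indicator {0<..} \<rho> \<partial>lborel)"
        by (simp, rule nn_integral_cong) (auto simp: indicator_def)
      finally show ?thesis .
    qed
    also have "(\<integral>\<^sup>+\<rho>. ?h \<rho> * indicator {0<..} \<rho> \<partial>lborel) + (\<integral>\<^sup>+\<rho>. ?h \<rho> * indicator {0<..} \<rho> \<partial>lborel)
       = (\<integral>\<^sup>+\<rho>. ?h \<rho> * indicator {0<..} \<rho> + ?h \<rho> * indicator {0<..} \<rho> \<partial>lborel)"
      by (rule nn_integral_add[symmetric]) simp_all
    also have "\<dots> = (\<integral>\<^sup>+\<rho>. ennreal (2 * \<rho> / (1 + \<rho>\<^sup>2)\<^sup>2 * indicator {0<..} \<rho>) * g (\<rho>, s) \<partial>lborel)"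
    proof (rule nn_integral_cong)
      fix \<rho> :: real
      show "?h \<rho> * indicator {0<..} \<rho> + ?h \<rho> * indicator {0<..} \<rho>
        = ennreal (2 * \<rho> / (1 + \<rho>\<^sup>2)\<^sup>2 * indicator {0<..} \<rho>) * g (\<rho>, s)"
      proof (cases "0 < \<rho>")
        case True
        then have "ennreal (2 * \<rho> / (1 + \<rho>\<^sup>2)\<^sup>2) = ennreal (\<rho> / (1 + \<rho>\<^sup>2)\<^sup>2) + ennreal (\<rho> / (1 + \<rho>\<^sup>2)\<^sup>2)"
          by (subst ennreal_plus[symmetric]) simp_all
        with True show ?thesis by (simp add: distrib_right)
      qed simp
    qed
    also have "\<dots> = (\<integral>\<^sup>+r. g (r, s) \<partial>radius_law)"
      by (simp add: radius_law_def nn_integral_density)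
    finally show "(\<integral>\<^sup>+\<rho>. ?h \<rho> \<partial>lborel) = (\<integral>\<^sup>+r. g (r, s) \<partial>radius_law)" .
  qed
  also have "\<dots> = (\<integral>\<^sup>+s. \<integral>\<^sup>+r. g (r, s) \<partial>radius_law \<partial>cauchy_law)"
  proof -
    interpret R: prob_space radius_law by (rule prob_space_radius_law)
    show ?thesis unfolding cauchy_law_def by (subst nn_integral_density) simp_all
  qed
  finally show ?thesis .
qed

interpretation R: prob_space radius_law by (rule prob_space_radius_law)
interpretation C: prob_space cauchy_law by (rule prob_space_cauchy_law)

lemma prob_space_pole_law: "prob_space (pole_law \<mu>)"
proof (rule prob_spaceI)
  have "emeasure (pole_law \<mu>) (space (pole_law \<mu>)) = (\<integral>\<^sup>+x. ennreal (pole_density \<mu> x) \<partial>lborel)"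
    by (simp add: pole_law_def emeasure_density)
  also have "\<dots> = (\<integral>\<^sup>+x. ennreal (pole_density \<mu> x) \<partial>(distr lborel borel ((+) \<mu>)))"
    by (simp only: lborel_distr_plus)
  also have "\<dots> = (\<integral>\<^sup>+x. ennreal (pole_density 0 x) \<partial>lborel)"
    by (subst nn_integral_distr, simp, simp) (simp add: pole_density_def)
  also have "\<dots> = (\<integral>\<^sup>+x. 1 \<partial>pole_law 0)"
    by (simp add: pole_law_def emeasure_density)
  also have "\<dots> = 1"
    using nn_integral_pole_law_radius_slope[of "\<lambda>_. 1"]
      R.emeasure_space_1 C.emeasure_space_1 by simp
  finally show "emeasure (pole_law \<mu>) (space (pole_law \<mu>)) = 1" .
qed

interpretation pole: prob_space "pole_law \<mu>" for \<mu> by (rule prob_space_pole_law)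

lemma distr_radius: "distr (pole_law 0) borel norm = radius_law" (is ?R)
  and distr_slope: "distr (pole_law 0) borel slope = cauchy_law" (is ?S)
  and indep_radius_slope: "pole.indep_var 0 borel norm borel slope" (is ?I)
proof -
  have g: "emeasure (pole_law 0) {x. norm x \<in> A \<and> slope x \<in> B} = emeasure radius_law A * emeasure cauchy_law B"
    if [measurable]: "A \<in> sets borel" "B \<in> sets borel" for A B
  proof -
    have "emeasure (pole_law 0) {x. norm x \<in> A \<and> slope x \<in> B}
       = (\<integral>\<^sup>+x. indicator {x. norm x \<in> A \<and> slope x \<in> B} x \<partial>pole_law 0)"
      by (rule nn_integral_indicator[symmetric]) measurable
    also have "\<dots> = (\<integral>\<^sup>+x. (\<lambda>(r, s). indicator A r * indicator B s) (norm x, slope x) \<partial>pole_law 0)"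
      by (rule nn_integral_cong) (auto split: split_indicator)
    also have "\<dots> = (\<integral>\<^sup>+s. \<integral>\<^sup>+r. indicator A r * indicator B s \<partial>radius_law \<partial>cauchy_law)"
      by (subst nn_integral_pole_law_radius_slope) simp_all
    also have "\<dots> = emeasure radius_law A * emeasure cauchy_law B"
      by (simp add: nn_integral_multc nn_integral_cmult)
    finally show ?thesis .
  qed
  show R: ?R
  proof (rule measure_eqI)
    fix A assume "A \<in> sets (distr (pole_law 0) borel norm)"
    then have [measurable]: "A \<in> sets borel" by simp
    show "emeasure (distr (pole_law 0) borel norm) A = emeasure radius_law A"
      using g[of A UNIV] C.emeasure_space_1 by (simp add: emeasure_distr vimage_def cauchy_law_def)
  qed simp
  show S: ?S
  proof (rule measure_eqI)
    fix A assume "A \<in> sets (distr (pole_law 0) borel slope)"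
    then have [measurable]: "A \<in> sets borel" by simp
    show "emeasure (distr (pole_law 0) borel slope) A = emeasure cauchy_law A"
      using g[of UNIV A] R.emeasure_space_1 by (simp add: emeasure_distr vimage_def radius_law_def)
  qed simp
  interpret RC: pair_prob_space radius_law cauchy_law ..
  have "radius_law \<Otimes>\<^sub>M cauchy_law = distr (pole_law 0) (borel \<Otimes>\<^sub>M borel) (\<lambda>x. (norm x, slope x))"
  proof (rule pair_measure_eqI)
    fix A B assume "A \<in> sets radius_law" "B \<in> sets cauchy_law"
    then have [measurable]: "A \<in> sets borel" "B \<in> sets borel" by simp_all
    have "(\<lambda>x::real^2. (norm x, slope x)) -` (A \<times> B) = {x. norm x \<in> A \<and> slope x \<in> B}" by auto
    then show "emeasure radius_law A * emeasure cauchy_law B =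
      emeasure (distr (pole_law 0) (borel \<Otimes>\<^sub>M borel) (\<lambda>x. (norm x, slope x))) (A \<times> B)"
      by (subst emeasure_distr) (simp_all add: g)
  next
    show "sets (radius_law \<Otimes>\<^sub>M cauchy_law) = sets (distr (pole_law 0) (borel \<Otimes>\<^sub>M borel) (\<lambda>x. (norm x, slope x)))"
      by (subst sets_distr) (intro sets_pair_measure_cong sets_radius_law sets_cauchy_law)
  qed (rule R.sigma_finite_measure_axioms C.sigma_finite_measure_axioms)+
  then show ?I unfolding pole.indep_var_distribution_eq R S by simp
qed

section \<open>Uniform variables obtained from the norm and the slope\<close>

abbreviation unif :: "real measure" where
  "unif \<equiv> uniform_measure lborel {0<..<1}"

lemma prob_space_unif: "prob_space unif"
  by (rule prob_space_uniform_measure) simp_all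

interpretation unif: prob_space unif by (rule prob_space_unif)

lemma uniform_distrI:
  assumes "prob_space M" and [measurable]: "X \<in> borel_measurable M"
    and range: "\<And>x. x \<in> space M \<Longrightarrow> 0 \<le> X x \<and> X x \<le> 1"
    and le: "\<And>t. 0 < t \<Longrightarrow> t < 1 \<Longrightarrow> emeasure M {x \<in> space M. X x \<le> t} = ennreal t"
  shows "distr M borel X = unif"
proof (rule cdf_unique)
  interpret M: prob_space M by fact
  interpret D: prob_space "distr M borel X" by (rule M.prob_space_distr) simp
  show "real_distribution (distr M borel X)" by (simp add: real_distribution_def real_distribution_axioms_def D.prob_space_axioms prob_space_unif)
  show "real_distribution unif" by (simp add: real_distribution_def real_distribution_axioms_def D.prob_space_axioms prob_space_unif)
  show "cdf (distr M borel X) = cdf unif"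
  proof
    fix t :: real
    have u: "cdf unif t = measure lborel ({0<..<1} \<inter> {..t})"
      by (simp add: cdf_def measure_def emeasure_uniform_measure divide_ennreal_def)
    have d: "cdf (distr M borel X) t = M.prob {x \<in> space M. X x \<le> t}"
      by (simp add: cdf_def measure_distr vimage_def Int_def conj_commute)
    consider "t < 0" | "0 < t" "t < 1" | "1 \<le> t" | "t = 0" by linarith
    then show "cdf (distr M borel X) t = cdf unif t"
    proof cases
      case 1
      then have e: "{x \<in> space M. X x \<le> t} = {}" "{0<..<1} \<inter> {..t} = {}" using range by (auto dest: order_trans simp: not_le[symmetric])
      show ?thesis unfolding u d e by simp
    next
      case 2
      then have e: "{0<..<1} \<inter> {..t} = {0<..t}" by auto
      show ?thesis using 2 le[OF 2] by (simp add: u d e measure_def)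
    next
      case 3
      then have e: "{x \<in> space M. X x \<le> t} = space M" "{0<..<1} \<inter> {..t} = {0<..<1}" using range by (auto intro: order_trans)
      show ?thesis unfolding u d e by (simp add: M.prob_space)
    next
      \<comment> \<open>Nothing is assumed at t = 0 itself; monotonicity and the values at small
        positive arguments force the probability to vanish.\<close>
      case 4
      have e: "{0<..<1} \<inter> {..t} = {}" using 4 by auto
      have "M.prob {x \<in> space M. X x \<le> t} \<le> \<epsilon>" if "0 < \<epsilon>" "\<epsilon> < 1" for \<epsilon>
      proof -
        have "M.prob {x \<in> space M. X x \<le> t} \<le> M.prob {x \<in> space M. X x \<le> \<epsilon>}"
          using that 4 by (intro M.finite_measure_mono) auto
        then show ?thesis using le[OF that] that by (simp add: measure_def)
      qed
      then have "M.prob {x \<in> space M. X x \<le> t} \<le> 0"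
        by (intro dense_ge_bounded[of 0 1]) auto
      then show ?thesis unfolding u d e using measure_nonneg[of M "{x \<in> space M. X x \<le> t}"] by simp
    qed
  qed
qed

text \<open>Probability integral transforms: \<open>radial_unif\<close> and \<open>line_unif\<close>
  apply the distribution functions of \<open>radius_law\<close> and \<open>cauchy_law\<close> to the
  norm and the slope. They are the limits of the normalized ranks.\<close>

definition radial_unif :: "real^2 \<Rightarrow> real" where
  "radial_unif x = (norm x)\<^sup>2 / (1 + (norm x)\<^sup>2)"

definition line_unif :: "real^2 \<Rightarrow> real" where
  "line_unif x = arctan (slope x) / pi + 1 / 2"

lemma borel_measurable_radial_unif [measurable]: "radial_unif \<in> borel_measurable borel"
  unfolding radial_unif_def[abs_def] by measurable

lemma borel_measurable_line_unif [measurable]: "line_unif \<in> borel_measurable borel"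
  unfolding line_unif_def[abs_def] by measurable

lemma one_plus_sq_pos: "0 < 1 + (r::real)\<^sup>2"
  by (smt (verit) zero_le_power2)

lemma radial_unif_bounds: "0 \<le> radial_unif x" "radial_unif x < 1"
  using one_plus_sq_pos[of "norm x"] by (simp_all add: radial_unif_def)

lemma radial_unif_pos: "x \<noteq> 0 \<Longrightarrow> 0 < radial_unif x"
  using one_plus_sq_pos[of "norm x"] by (simp add: radial_unif_def)

lemma line_unif_bounds: "0 < line_unif x" "line_unif x < 1"
  using arctan_bounded[of "slope x"] by (simp_all add: line_unif_def field_simps)

lemma radial_unif_le_iff:
  assumes "0 < t" "t < 1"
  shows "radial_unif x \<le> t \<longleftrightarrow> norm x \<le> sqrt (t / (1 - t))"
proof -
  have "radial_unif x \<le> t \<longleftrightarrow> (norm x)\<^sup>2 \<le> t / (1 - t)"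
    using one_plus_sq_pos[of "norm x"] assms by (simp add: radial_unif_def field_simps)
  also have "\<dots> \<longleftrightarrow> norm x \<le> sqrt (t / (1 - t))"
    by (metis abs_norm_cancel real_sqrt_abs real_sqrt_le_iff)
  finally show ?thesis .
qed

lemma distr_radial_unif: "distr (pole_law 0) borel radial_unif = unif"
proof (rule uniform_distrI)
  fix t :: real assume t: "0 < t" "t < 1"
  have "emeasure (pole_law 0) {x \<in> space (pole_law 0). radial_unif x \<le> t}
      = emeasure (distr (pole_law 0) borel norm) {..sqrt (t / (1 - t))}"
    by (subst emeasure_distr) (auto intro!: arg_cong[where f="emeasure _"] simp: radial_unif_le_iff[OF t])
  also have "\<dots> = ennreal t"
    unfolding distr_radius using t by (subst emeasure_radius_law_atMost) (simp_all add: field_simps)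
  finally show "emeasure (pole_law 0) {x \<in> space (pole_law 0). radial_unif x \<le> t} = ennreal t" .
qed (auto simp: prob_space_pole_law radial_unif_bounds less_imp_le)

lemma distr_line_unif: "distr (pole_law 0) borel line_unif = unif"
proof (rule uniform_distrI)
  fix t :: real assume t: "0 < t" "t < 1"
  define s where "s = tan (pi * (t - 1 / 2))"
  have "- (pi / 2) < pi * (t - 1 / 2)" "pi * (t - 1 / 2) < pi / 2"
    using t by (simp_all add: field_simps)
  then have s: "arctan s = pi * (t - 1 / 2)" unfolding s_def by (rule arctan_tan)
  have "line_unif x \<le> t \<longleftrightarrow> slope x \<le> s" for x
  proof -
    have "line_unif x \<le> t \<longleftrightarrow> arctan (slope x) \<le> arctan s"
      unfolding line_unif_def s by (simp add: field_simps)
    then show ?thesis by (simp add: arctan_le_iff)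
  qed
  then have "emeasure (pole_law 0) {x \<in> space (pole_law 0). line_unif x \<le> t}
      = emeasure (distr (pole_law 0) borel slope) {..s}"
    by (subst emeasure_distr) (auto intro!: arg_cong[where f="emeasure _"])
  also have "\<dots> = ennreal t"
    unfolding distr_slope emeasure_cauchy_law_atMost s by (simp add: field_simps)
  finally show "emeasure (pole_law 0) {x \<in> space (pole_law 0). line_unif x \<le> t} = ennreal t" .
qed (auto simp: prob_space_pole_law less_imp_le[OF line_unif_bounds(1)] less_imp_le[OF line_unif_bounds(2)])

lemma indep_radial_line: "pole.indep_var 0 borel radial_unif borel line_unif"
proof -
  have "pole.indep_var 0 borel ((\<lambda>r. r\<^sup>2 / (1 + r\<^sup>2)) \<circ> norm) borel ((\<lambda>s. arctan s / pi + 1 / 2) \<circ> slope)"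
    by (rule pole.indep_var_compose[OF indep_radius_slope]) measurable
  then show ?thesis by (simp add: comp_def radial_unif_def[abs_def] line_unif_def[abs_def])
qed

lemma integral_radial_unif:
  fixes \<phi> :: "real \<Rightarrow> real"
  assumes [measurable]: "\<phi> \<in> borel_measurable borel"
  shows "(\<integral>x. \<phi> (radial_unif x) \<partial>pole_law 0) = (\<integral>u. \<phi> u \<partial>unif)"
    "integrable (pole_law 0) (\<lambda>x. \<phi> (radial_unif x)) \<longleftrightarrow> integrable unif \<phi>"
  unfolding distr_radial_unif[symmetric] by (simp_all add: integral_distr integrable_distr_eq)

lemma integral_line_unif:
  fixes \<phi> :: "real \<Rightarrow> real"
  assumes [measurable]: "\<phi> \<in> borel_measurable borel"
  shows "(\<integral>x. \<phi> (line_unif x) \<partial>pole_law 0) = (\<integral>u. \<phi> u \<partial>unif)"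
    "integrable (pole_law 0) (\<lambda>x. \<phi> (line_unif x)) \<longleftrightarrow> integrable unif \<phi>"
  unfolding distr_line_unif[symmetric] by (simp_all add: integral_distr integrable_distr_eq)

lemma integral_radial_line:
  fixes \<phi> \<psi> :: "real \<Rightarrow> real"
  assumes [measurable]: "\<phi> \<in> borel_measurable borel" "\<psi> \<in> borel_measurable borel"
    and "integrable unif \<phi>" "integrable unif \<psi>"
  shows "integrable (pole_law 0) (\<lambda>x. \<phi> (radial_unif x) * \<psi> (line_unif x))"
    and "(\<integral>x. \<phi> (radial_unif x) * \<psi> (line_unif x) \<partial>pole_law 0) = (\<integral>u. \<phi> u \<partial>unif) * (\<integral>u. \<psi> u \<partial>unif)"
proof -
  have i: "pole.indep_var 0 borel (\<lambda>x. \<phi> (radial_unif x)) borel (\<lambda>x. \<psi> (line_unif x))"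
    using pole.indep_var_compose[OF indep_radial_line, of \<phi> borel \<psi> borel] by (simp add: comp_def)
  show "integrable (pole_law 0) (\<lambda>x. \<phi> (radial_unif x) * \<psi> (line_unif x))"
    using assms by (intro pole.indep_var_integrable i) (simp_all add: integral_radial_unif integral_line_unif)
  show "(\<integral>x. \<phi> (radial_unif x) * \<psi> (line_unif x) \<partial>pole_law 0) = (\<integral>u. \<phi> u \<partial>unif) * (\<integral>u. \<psi> u \<partial>unif)"
    using assms by (subst pole.indep_var_lebesgue_integral[OF i]) (simp_all add: integral_radial_unif integral_line_unif)
qed

lemma AE_pole_law_nth1: "AE x in pole_law \<mu>. x $ 1 \<noteq> 0"
proof -
  have "emeasure lborel {x :: real^2. x $ 1 = 0} = (\<integral>\<^sup>+x. indicator {x :: real^2. x $ 1 = 0} x \<partial>lborel)"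
    by (rule nn_integral_indicator[symmetric]) measurable
  also have "\<dots> = (\<integral>\<^sup>+(a::real). \<integral>\<^sup>+(b::real). indicator {0} a * (1::ennreal) \<partial>lborel \<partial>lborel)"
  proof -
    have e: "indicator {x :: real^2. x $ 1 = 0} (vec2 a b) = indicator {0} a * (1::ennreal)" for a b
      by (auto split: split_indicator)
    show ?thesis by (subst nn_integral_vec2, simp) (simp only: e)
  qed
  also have "\<dots> = (\<integral>\<^sup>+(a::real). 0 \<partial>lborel)"
    by (rule nn_integral_cong_AE, rule AE_mp[OF AE_lborel_singleton[of 0]]) simp
  finally have "AE x in lborel. (x :: real^2) $ 1 \<noteq> 0"
    by (intro AE_I[where N="{x :: real^2. x $ 1 = 0}"]) simp_all
  then show ?thesis unfolding pole_law_def by (subst AE_density) auto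
qed

definition line_angle :: "real^2 \<Rightarrow> real" where
  "line_angle x = arctan (slope x)"

lemma line_angle_eq: "line_angle x = pi * (line_unif x - 1 / 2)"
  by (simp add: line_angle_def line_unif_def)

lemma borel_measurable_line_angle [measurable]: "line_angle \<in> borel_measurable borel"
  unfolding line_angle_def[abs_def] by measurable

text \<open>The angle of the line lies strictly between - pi / 2 and pi / 2, where the cosine is
  positive, so the sign of the first coordinate selects the ray.\<close>

lemma vec2_line_angle:
  assumes "x $ 1 \<noteq> 0"
  shows "x $ 1 = sgn (x $ 1) * norm x * cos (line_angle x)"
    and "x $ 2 = sgn (x $ 1) * norm x * sin (line_angle x)"
proof -
  have n: "norm x = \<bar>x $ 1\<bar> * sqrt (1 + (slope x)\<^sup>2)"
  proof -
    have "(x $ 1)\<^sup>2 + (x $ 2)\<^sup>2 = (x $ 1)\<^sup>2 * (1 + (slope x)\<^sup>2)"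
      using assms by (simp add: slope_def power_divide distrib_left)
    then show ?thesis by (simp add: norm_vec2 real_sqrt_mult)
  qed
  have p: "0 < sqrt (1 + (slope x)\<^sup>2)" using one_plus_sq_pos by simp
  have s: "sgn (x $ 1) * \<bar>x $ 1\<bar> = x $ 1" by (simp add: sgn_mult_abs)
  show "x $ 1 = sgn (x $ 1) * norm x * cos (line_angle x)"
    unfolding n line_angle_def cos_arctan using p s by simp
  have "sgn (x $ 1) * norm x * sin (line_angle x) = (sgn (x $ 1) * \<bar>x $ 1\<bar>) * slope x"
    unfolding n line_angle_def sin_arctan using p by simp
  also have "\<dots> = x $ 2" unfolding s using assms by (simp add: slope_def)
  finally show "x $ 2 = sgn (x $ 1) * norm x * sin (line_angle x)" ..
qed

lemma integral_unif: "(\<integral>u. f u \<partial>unif) = (LBINT u. f u * indicator {0<..<1} u)"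
  if [measurable]: "f \<in> borel_measurable borel" for f :: "real \<Rightarrow> real"
proof -
  have "unif = density lborel (\<lambda>u. ennreal (indicator {0<..<1} u))"
    by (simp add: uniform_measure_def ennreal_indicator divide_ennreal_def)
  then show ?thesis by (simp add: integral_density mult.commute)
qed

lemma integral_unif_FTC:
  fixes f F :: "real \<Rightarrow> real"
  assumes "\<And>x. (F has_real_derivative f x) (at x)" "\<And>x. isCont f x"
  shows "(\<integral>u. f u \<partial>unif) = F 1 - F 0"
proof -
  have [measurable]: "f \<in> borel_measurable borel"
    using assms(2) by (intro borel_measurable_continuous_onI continuous_at_imp_continuous_on) auto
  have "(\<integral>u. f u \<partial>unif) = (LBINT u. f u * indicator {0<..<1} u)" by (rule integral_unif) simp
  also have "\<dots> = (LBINT u. f u * indicator {0..1} u)"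
  proof (rule integral_cong_AE)
    show "(\<lambda>u. f u * indicator {0<..<1} u) \<in> borel_measurable lborel"
         "(\<lambda>u. f u * indicator {0..1} u) \<in> borel_measurable lborel" by measurable
    show "AE u in lborel. f u * indicator {0<..<1} u = f u * indicator {0..1} u"
      using AE_lborel_singleton[of 0] AE_lborel_singleton[of 1]
      by eventually_elim (auto split: split_indicator)
  qed
  also have "\<dots> = F 1 - F 0"
    using assms by (intro integral_FTC_Icc_real) auto
  finally show ?thesis .
qed

lemma integrable_unif_bounded:
  fixes f :: "real \<Rightarrow> real"
  assumes [measurable]: "f \<in> borel_measurable borel" and "\<And>x. \<bar>f x\<bar> \<le> B"
  shows "integrable unif f"
  by (rule unif.integrable_const_bound[where B=B]) (use assms in auto)

text \<open>The doubled line angle is uniform on a full circle, so its nontrivial harmonics have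
  mean zero. The cases k = 1 and k = 2 give the four trigonometric sums that control Tyler's
  matrix.\<close>

lemma integral_line_angle_cos:
  assumes "k \<noteq> 0"
  shows "(\<integral>u. cos (2 * real k * (pi * (u - 1 / 2))) \<partial>unif) = 0"
proof -
  let ?c = "2 * real k * pi"
  have c: "?c \<noteq> 0" using assms by simp
  have "(\<integral>u. cos (2 * real k * (pi * (u - 1 / 2))) \<partial>unif)
     = sin (2 * real k * (pi * (1 - 1 / 2))) / ?c - sin (2 * real k * (pi * (0 - 1 / 2))) / ?c"
    using c by (intro integral_unif_FTC) (auto intro!: derivative_eq_intros continuous_intros simp: field_simps)
  also have "\<dots> = 0"
    by (simp add: sin_npi mult.commute)
  finally show ?thesis .
qed

lemma integral_line_angle_sin:
  assumes "k \<noteq> 0"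
  shows "(\<integral>u. sin (2 * real k * (pi * (u - 1 / 2))) \<partial>unif) = 0"
proof -
  let ?c = "2 * real k * pi"
  have c: "?c \<noteq> 0" using assms by simp
  have "(\<integral>u. sin (2 * real k * (pi * (u - 1 / 2))) \<partial>unif)
     = - cos (2 * real k * (pi * (1 - 1 / 2))) / ?c - - cos (2 * real k * (pi * (0 - 1 / 2))) / ?c"
    using c by (intro integral_unif_FTC) (auto intro!: derivative_eq_intros continuous_intros simp: field_simps)
  also have "\<dots> = 0"
    by (simp add: cos_npi mult.commute)
  finally show ?thesis .
qed

section \<open>Ratios of translated pole densities\<close>

definition ratio_bound :: "real \<Rightarrow> real" where
  "ratio_bound t = (1 + t + t\<^sup>2)\<^sup>2"

lemma ratio_bound_ge_1: "0 \<le> t \<Longrightarrow> 1 \<le> ratio_bound t"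
  by (simp add: ratio_bound_def one_le_power)

lemma ratio_bound_linear:
  assumes "0 \<le> t" "t \<le> 1"
  shows "ratio_bound t - 1 \<le> 8 * t"
proof -
  have "t\<^sup>2 \<le> t" using assms by (simp add: power2_eq_square mult_left_le)
  then have "ratio_bound t \<le> (1 + 2 * t)\<^sup>2" unfolding ratio_bound_def using assms by (intro power_mono) auto
  also have "\<dots> = 1 + 4 * t + 4 * t\<^sup>2" by (simp add: power2_eq_square algebra_simps)
  finally show ?thesis using \<open>t\<^sup>2 \<le> t\<close> by simp
qed

text \<open>If r is the distance to \<mu> and t the distance of the centres, then 2 r \<le> 1 + r^2
  gives 1 + (r + t)^2 \<le> (1 + t + t^2) (1 + r^2). The square of this is the claim.\<close>

lemma pole_density_ratio: "pole_density \<mu> x \<le> ratio_bound (norm (\<mu> - \<nu>)) * pole_density \<nu> x"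
proof -
  define t r where "t = norm (\<mu> - \<nu>)" and "r = norm (x - \<mu>)"
  have nn: "0 \<le> t" "0 \<le> r" by (simp_all add: t_def r_def)
  have "norm (x - \<nu>) \<le> r + t" unfolding t_def r_def using norm_triangle_ineq[of "x - \<mu>" "\<mu> - \<nu>"] by simp
  then have "1 + (norm (x - \<nu>))\<^sup>2 \<le> 1 + (r + t)\<^sup>2" by (simp add: power_mono)
  also have "\<dots> \<le> (1 + t + t\<^sup>2) * (1 + r\<^sup>2)"
  proof -
    have "2 * r \<le> 1 + r\<^sup>2" using sum_power2_ge_zero[of "r - 1" 0] by (simp add: power2_eq_square algebra_simps)
    then have "t * (2 * r) \<le> t * (1 + r\<^sup>2)" using nn by (intro mult_left_mono)
    moreover have "0 \<le> t\<^sup>2 * r\<^sup>2" by simp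
    ultimately show ?thesis by (simp add: power2_eq_square algebra_simps)
  qed
  finally have "(1 + (norm (x - \<nu>))\<^sup>2)\<^sup>2 \<le> ((1 + t + t\<^sup>2) * (1 + r\<^sup>2))\<^sup>2" by (intro power_mono) auto
  then have le: "(1 + (norm (x - \<nu>))\<^sup>2)\<^sup>2 \<le> ratio_bound t * (1 + r\<^sup>2)\<^sup>2"
    by (simp add: ratio_bound_def power_mult_distrib)
  have "0 < (1 + (norm (x - \<nu>))\<^sup>2)\<^sup>2" "0 < (1 + r\<^sup>2)\<^sup>2" by (intro zero_less_power one_plus_sq_pos)+
  then have "1 / (1 + r\<^sup>2)\<^sup>2 \<le> ratio_bound t * (1 / (1 + (norm (x - \<nu>))\<^sup>2)\<^sup>2)"
    using le by (simp add: field_simps)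
  then have "1 / (1 + r\<^sup>2)\<^sup>2 / pi \<le> ratio_bound t * (1 / (1 + (norm (x - \<nu>))\<^sup>2)\<^sup>2) / pi"
    by (intro divide_right_mono) auto
  then show ?thesis by (simp add: pole_density_def pole_radial_def t_def r_def)
qed

definition lratio :: "real^2 \<Rightarrow> real^2 \<Rightarrow> real" where
  "lratio \<mu> x = pole_density \<mu> x / pole_density 0 x"

lemma borel_measurable_lratio [measurable]: "lratio \<mu> \<in> borel_measurable borel"
  unfolding lratio_def[abs_def] by measurable

lemma lratio_pos: "0 < lratio \<mu> x"
  by (simp add: lratio_def pole_density_pos)

lemma lratio_le: "lratio \<mu> x \<le> ratio_bound (norm \<mu>)"
  using pole_density_ratio[of \<mu> x 0] pole_density_pos[of 0 x] by (simp add: lratio_def divide_simps mult.commute)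

lemma lratio_ge: "1 / ratio_bound (norm \<mu>) \<le> lratio \<mu> x"
  using pole_density_ratio[of 0 x \<mu>] pole_density_pos[of 0 x] ratio_bound_ge_1[of "norm \<mu>"]
  by (simp add: lratio_def divide_simps mult.commute)

lemma abs_lratio_minus_1: "\<bar>lratio \<mu> x - 1\<bar> \<le> ratio_bound (norm \<mu>) - 1"
proof -
  have 1: "1 \<le> ratio_bound (norm \<mu>)" by (simp add: ratio_bound_ge_1)
  then have "1 - (ratio_bound (norm \<mu>) - 1) \<le> 1 / ratio_bound (norm \<mu>)"
  proof -
    \<comment> \<open>This is (K - 1)^2 \<ge> 0 for the ratio bound K; so the lower bound 1 / K is
      as close to 1 as the upper bound K.\<close>
    have "(2 - ratio_bound (norm \<mu>)) * ratio_bound (norm \<mu>) \<le> 1"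
      using sum_power2_ge_zero[of "ratio_bound (norm \<mu>) - 1" 0] by (simp add: power2_eq_square algebra_simps)
    then show ?thesis using 1 by (simp add: field_simps)
  qed
  with lratio_ge[of \<mu> x] lratio_le[of \<mu> x] 1 show ?thesis by (auto simp: abs_le_iff)
qed

lemma pole_law_density: "pole_law \<mu> = density (pole_law 0) (\<lambda>x. ennreal (lratio \<mu> x))"
  unfolding pole_law_def
proof (subst density_density_eq)
  have "pole_density 0 x * lratio \<mu> x = pole_density \<mu> x" for x
    using pole_density_pos[of 0 x] by (simp add: lratio_def)
  then show "density lborel (\<lambda>x. ennreal (pole_density \<mu> x)) =
    density lborel (\<lambda>x. ennreal (pole_density 0 x) * ennreal (lratio \<mu> x))"
    by (simp add: ennreal_mult[symmetric] less_imp_le pole_density_pos lratio_pos)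
qed simp_all

context
  fixes \<phi> :: "real^2 \<Rightarrow> 'b :: {banach, second_countable_topology}" and \<mu> :: "real^2"
  assumes meas [measurable]: "\<phi> \<in> borel_measurable borel" and int: "integrable (pole_law 0) \<phi>"
begin

lemma integrable_lratio: "integrable (pole_law 0) (\<lambda>x. lratio \<mu> x *\<^sub>R \<phi> x)"
proof (rule Bochner_Integration.integrable_bound)
  show "integrable (pole_law 0) (\<lambda>x. ratio_bound (norm \<mu>) *\<^sub>R \<phi> x)" using int by simp
  show "AE x in pole_law 0. norm (lratio \<mu> x *\<^sub>R \<phi> x) \<le> norm (ratio_bound (norm \<mu>) *\<^sub>R \<phi> x)"
    using lratio_pos[of \<mu>] by (intro AE_I2) (auto intro!: mult_right_mono order_trans[OF lratio_le abs_ge_self] simp: abs_of_pos)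
qed simp

lemma integrable_pole_law: "integrable (pole_law \<mu>) \<phi>"
  unfolding pole_law_density[of \<mu>] using integrable_lratio
  by (subst integrable_density) (auto simp: less_imp_le lratio_pos)

lemma integral_pole_law: "(\<integral>x. \<phi> x \<partial>pole_law \<mu>) = (\<integral>x. lratio \<mu> x *\<^sub>R \<phi> x \<partial>pole_law 0)"
  unfolding pole_law_density[of \<mu>]
  by (subst integral_density) (auto simp: less_imp_le lratio_pos)

text \<open>The substitute for contiguity: moving the centre changes a mean by at most a fraction of
  the first absolute moment at \<open>0\<close>, and this fraction tends to 0 with the
  shift.\<close>

lemma integral_pole_law_diff:
  "norm ((\<integral>x. \<phi> x \<partial>pole_law \<mu>) - (\<integral>x. \<phi> x \<partial>pole_law 0)) \<le> (ratio_bound (norm \<mu>) - 1) * (\<integral>x. norm (\<phi> x) \<partial>pole_law 0)"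
proof -
  have "(\<integral>x. \<phi> x \<partial>pole_law \<mu>) - (\<integral>x. \<phi> x \<partial>pole_law 0) = (\<integral>x. lratio \<mu> x *\<^sub>R \<phi> x - \<phi> x \<partial>pole_law 0)"
    unfolding integral_pole_law by (subst Bochner_Integration.integral_diff) (use integrable_lratio int in auto)
  also have "norm \<dots> \<le> (\<integral>x. norm (lratio \<mu> x *\<^sub>R \<phi> x - \<phi> x) \<partial>pole_law 0)"
    by (rule integral_norm_bound)
  also have "\<dots> \<le> (\<integral>x. (ratio_bound (norm \<mu>) - 1) * norm (\<phi> x) \<partial>pole_law 0)"
  proof (rule integral_mono)
    show "integrable (pole_law 0) (\<lambda>x. norm (lratio \<mu> x *\<^sub>R \<phi> x - \<phi> x))"
      by (intro integrable_norm Bochner_Integration.integrable_diff integrable_lratio int)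
    show "integrable (pole_law 0) (\<lambda>x. (ratio_bound (norm \<mu>) - 1) * norm (\<phi> x))"
      using int by simp
    fix x
    have "lratio \<mu> x *\<^sub>R \<phi> x - \<phi> x = (lratio \<mu> x - 1) *\<^sub>R \<phi> x" by (simp add: scaleR_diff_left)
    then show "norm (lratio \<mu> x *\<^sub>R \<phi> x - \<phi> x) \<le> (ratio_bound (norm \<mu>) - 1) * norm (\<phi> x)"
      using abs_lratio_minus_1[of \<mu> x] by (simp add: mult_right_mono)
  qed
  finally show ?thesis by simp
qed

end

lemma integral_pole_law_le:
  fixes \<phi> :: "real^2 \<Rightarrow> real"
  assumes [measurable]: "\<phi> \<in> borel_measurable borel" and int: "integrable (pole_law 0) \<phi>" and nn: "\<And>x. 0 \<le> \<phi> x"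
  shows "(\<integral>x. \<phi> x \<partial>pole_law \<mu>) \<le> ratio_bound (norm \<mu>) * (\<integral>x. \<phi> x \<partial>pole_law 0)"
  using integral_pole_law_diff[OF assms(1) int, of \<mu>] nn by (simp add: algebra_simps abs_le_iff)

section \<open>Interdirections\<close>

lemma ex_scale_sign: "(\<exists>t::real. t * a < 0 \<and> 0 < t * b) \<longleftrightarrow> a * b < 0"
proof
  assume "\<exists>t. t * a < 0 \<and> 0 < t * b"
  then obtain t where t: "t * a < 0" "0 < t * b" by blast
  then have "(t * a) * (t * b) < 0" by (rule mult_neg_pos)
  then have "t\<^sup>2 * (a * b) < 0" by (simp add: power2_eq_square mult_ac)
  then show "a * b < 0" by (simp add: mult_less_0_iff)
next
  assume "a * b < 0"
  then have "b * a < 0 \<and> 0 < b * b" by (auto simp: mult.commute not_sum_squares_lt_zero zero_less_mult_iff mult_less_0_iff)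
  then show "\<exists>t. t * a < 0 \<and> 0 < t * b" by blast
qed

definition cross2 :: "real^2 \<Rightarrow> real^2 \<Rightarrow> real" where
  "cross2 l y = l $ 1 * y $ 2 - l $ 2 * y $ 1"

text \<open>The normals of the line through a nonzero l are the multiples of l turned by a right
  angle, and the inner product with such a multiple t is t times \<open>cross2 l\<close>. Only the
  signs of the two cross products matter.\<close>

lemma line_separates_iff: "line_separates l y z \<longleftrightarrow> l \<noteq> 0 \<and> cross2 l y * cross2 l z < 0"
proof (cases "l = 0")
  case False
  have "(\<exists>n. n \<bullet> l = 0 \<and> n \<bullet> y < 0 \<and> 0 < n \<bullet> z) \<longleftrightarrow> (\<exists>t. t * cross2 l y < 0 \<and> 0 < t * cross2 l z)"
  proof
    assume "\<exists>n. n \<bullet> l = 0 \<and> n \<bullet> y < 0 \<and> 0 < n \<bullet> z"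
    then obtain n where n: "n \<bullet> l = 0" "n \<bullet> y < 0" "0 < n \<bullet> z" by blast
    define d where "d = (norm l)\<^sup>2"
    have d: "d = l $ 1 * l $ 1 + l $ 2 * l $ 2" "0 < d"
      using False by (simp add: d_def norm_vec2_sq power2_eq_square[of "_ $ _"]) (simp add: d_def False)
    define t where "t = (l $ 1 * n $ 2 - l $ 2 * n $ 1) / d"
    have "t * cross2 l w = n \<bullet> w" for w
    proof -
      have nl: "n $ 1 * l $ 1 + n $ 2 * l $ 2 = 0" using n(1) by (simp add: inner_vec2)
      \<comment> \<open>The Binet-Cauchy identity for two cross products; the last product vanishes
        since n is orthogonal to l.\<close>
      have "(l $ 1 * n $ 2 - l $ 2 * n $ 1) * cross2 l w
          = d * (n \<bullet> w) - (n $ 1 * l $ 1 + n $ 2 * l $ 2) * (l $ 1 * w $ 1 + l $ 2 * w $ 2)"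
        by (simp add: d(1) cross2_def inner_vec2 algebra_simps)
      then show ?thesis unfolding t_def nl using d(2) by (simp add: field_simps)
    qed
    with n show "\<exists>t. t * cross2 l y < 0 \<and> 0 < t * cross2 l z" by metis
  next
    assume "\<exists>t. t * cross2 l y < 0 \<and> 0 < t * cross2 l z"
    then obtain t where t: "t * cross2 l y < 0" "0 < t * cross2 l z" by blast
    have "vec2 (- t * l $ 2) (t * l $ 1) \<bullet> w = t * cross2 l w" for w
      by (simp add: inner_vec2 cross2_def algebra_simps)
    moreover have "cross2 l l = 0" by (simp add: cross2_def)
    ultimately have "vec2 (- t * l $ 2) (t * l $ 1) \<bullet> l = 0 \<and> vec2 (- t * l $ 2) (t * l $ 1) \<bullet> y < 0
       \<and> 0 < vec2 (- t * l $ 2) (t * l $ 1) \<bullet> z" using t by simp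
    then show "\<exists>n. n \<bullet> l = 0 \<and> n \<bullet> y < 0 \<and> 0 < n \<bullet> z" by blast
  qed
  with False show ?thesis by (simp add: line_separates_def ex_scale_sign)
qed (simp add: line_separates_def)

lemma line_separates_slope:
  assumes "l $ 1 \<noteq> 0" "y $ 1 \<noteq> 0" "z $ 1 \<noteq> 0"
  shows "line_separates l y z \<longleftrightarrow> sgn (y $ 1) * sgn (z $ 1) * ((slope y - slope l) * (slope z - slope l)) < 0"
proof -
  have c: "cross2 l w = l $ 1 * w $ 1 * (slope w - slope l)" if "w $ 1 \<noteq> 0" for w
    using that assms by (simp add: cross2_def slope_def field_simps)
  have "cross2 l y * cross2 l z = ((l $ 1)\<^sup>2 * \<bar>y $ 1\<bar> * \<bar>z $ 1\<bar>) *
      (sgn (y $ 1) * sgn (z $ 1) * ((slope y - slope l) * (slope z - slope l)))"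
  proof -
    have r: "((l $ 1)\<^sup>2 * Y * Z) * (sy * sz * (p * q)) = (l $ 1 * (sy * Y) * p) * (l $ 1 * (sz * Z) * q)"
      for Y Z sy sz p q :: real by (simp add: power2_eq_square)
    show ?thesis unfolding r c[OF assms(2)] c[OF assms(3)] by (simp add: sgn_mult_abs)
  qed
  moreover have "0 < (l $ 1)\<^sup>2 * \<bar>y $ 1\<bar> * \<bar>z $ 1\<bar>" using assms by simp
  ultimately have "cross2 l y * cross2 l z < 0 \<longleftrightarrow> sgn (y $ 1) * sgn (z $ 1) * ((slope y - slope l) * (slope z - slope l)) < 0"
    by (metis mult_less_cancel_left_pos mult_zero_right)
  moreover have "l \<noteq> 0" using assms by auto
  ultimately show ?thesis by (simp add: line_separates_iff)
qed

definition slope_rank :: "nat \<Rightarrow> (nat \<Rightarrow> real^2) \<Rightarrow> nat \<Rightarrow> nat" where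
  "slope_rank m x i = card {l. l < m \<and> slope (x l) \<le> slope (x i)}"

lemma line_separates_sym: "line_separates l y z \<longleftrightarrow> line_separates l z y"
  by (simp add: line_separates_iff mult.commute)

lemma interdirection_sym: "interdirection m x i j = interdirection m x j i"
  unfolding interdirection_def interdirection_count_def
  by (subst line_separates_sym) (simp add: insert_commute)

text \<open>In the plane the interdirections measure differences of positions on a circle of
  \<open>2 m\<close> rays: the slope rank gives the line, the sign of the first coordinate the ray.\<close>

lemma cos_interdirection:
  assumes nz: "\<And>i. i < m \<Longrightarrow> x i $ 1 \<noteq> 0" and inj: "inj_on (\<lambda>i. slope (x i)) {..<m}"
    and i: "i < m" and j: "j < m"
  shows "cos (pi * interdirection m x i j) =
    sgn (x i $ 1) * sgn (x j $ 1) * cos (pi * (real (slope_rank m x i) - real (slope_rank m x j)) / real m)"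
proof -
  have main: "cos (pi * interdirection m x i j) =
    sgn (x i $ 1) * sgn (x j $ 1) * cos (pi * (real (slope_rank m x i) - real (slope_rank m x j)) / real m)"
    if i: "i < m" and j: "j < m" and less: "slope (x i) < slope (x j)" for i j
  proof -
    have m: "0 < m" using i by simp
    have ij: "i \<noteq> j" using less by auto
    \<comment> \<open>The sample lines strictly between those of i and j. The slope ranks differ by
      one more than their number, which the + 1 in the definition of the interdirections matches
      exactly.\<close>
    define B where "B = {l. l < m \<and> slope (x i) < slope (x l) \<and> slope (x l) < slope (x j)}"
    have [simp]: "finite B" by (simp add: B_def)
    have eq: "l = k" if "slope (x l) = slope (x k)" "l < m" "k < m" for l k
      using inj that by (auto simp: inj_on_def)
    have "{l. l < m \<and> slope (x l) \<le> slope (x j)} = {l. l < m \<and> slope (x l) \<le> slope (x i)} \<union> insert j B"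
      using less j eq by (auto simp: B_def not_le) (metis order_less_le)
    moreover have "{l. l < m \<and> slope (x l) \<le> slope (x i)} \<inter> insert j B = {}"
      using less by (auto simp: B_def)
    ultimately have r: "slope_rank m x j = slope_rank m x i + Suc (card B)"
      unfolding slope_rank_def by (simp add: card_Un_disjoint B_def)
    have B_ij: "i \<notin> B" "j \<notin> B" by (auto simp: B_def)
    have sub: "insert i (insert j B) \<subseteq> {..<m}" using i j by (auto simp: B_def)
    from card_mono[OF _ this] have cB: "card B + 2 \<le> m" using B_ij ij by simp
    define s where "s = sgn (x i $ 1) * sgn (x j $ 1)"
    have "s = 1 \<or> s = -1" using nz[OF i] nz[OF j] by (auto simp: s_def sgn_if)
    then show ?thesis
    proof
      \<comment> \<open>Both points lie in the same half-plane of first coordinates: exactly the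
        lines of B separate them.\<close>
      assume s: "s = 1"
      have "{l. l < m \<and> l \<notin> {i, j} \<and> line_separates (x l) (x i) (x j)} = B"
        using less i j by (auto simp: B_def line_separates_slope nz s_def[symmetric] s mult_less_0_iff)
      then have "interdirection m x i j = real (card B + 1) / real m"
        using ij by (simp add: interdirection_def interdirection_count_def)
      then have e: "interdirection m x i j = - ((real (slope_rank m x i) - real (slope_rank m x j)) / real m)"
        by (simp add: r minus_divide_left)
      have "pi * - ((real (slope_rank m x i) - real (slope_rank m x j)) / real m)
          = - (pi * (real (slope_rank m x i) - real (slope_rank m x j)) / real m)" by simp
      then show ?thesis unfolding s_def[symmetric] s e by (simp only: cos_minus mult_1)
    next
      \<comment> \<open>The points lie in opposite half-planes: the separating lines are the
        remaining ones, so the interdirection is 1 minus the rank distance over m, and the cosine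
        changes sign.\<close>
      assume s: "s = -1"
      have "{l. l < m \<and> l \<notin> {i, j} \<and> line_separates (x l) (x i) (x j)} = {..<m} - insert i (insert j B)"
      proof (rule set_eqI)
        fix l
        have "line_separates (x l) (x i) (x j) \<longleftrightarrow> l \<notin> B" if l: "l < m" "l \<noteq> i" "l \<noteq> j"
        proof -
          have ne: "slope (x l) \<noteq> slope (x i)" "slope (x l) \<noteq> slope (x j)" using eq l i j by blast+
          have "line_separates (x l) (x i) (x j) \<longleftrightarrow> 0 < (slope (x i) - slope (x l)) * (slope (x j) - slope (x l))"
            using line_separates_slope[OF nz[OF l(1)] nz[OF i] nz[OF j]] by (simp add: s_def[symmetric] s)
          also have "\<dots> \<longleftrightarrow> slope (x l) < slope (x i) \<or> slope (x j) < slope (x l)"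
            using less by (simp add: zero_less_mult_iff) linarith
          also have "\<dots> \<longleftrightarrow> l \<notin> B" using l ne by (auto simp: B_def)
          finally show ?thesis .
        qed
        moreover have "l \<notin> {i, j} \<and> l < m \<and> l \<notin> B \<longleftrightarrow> l \<in> {..<m} - insert i (insert j B)" by blast
        ultimately show "l \<in> {l. l < m \<and> l \<notin> {i, j} \<and> line_separates (x l) (x i) (x j)} \<longleftrightarrow> l \<in> {..<m} - insert i (insert j B)"
          by blast
      qed
      moreover have "card ({..<m} - insert i (insert j B)) = m - (card B + 2)"
        using sub B_ij ij by (subst card_Diff_subset) auto
      ultimately have "interdirection m x i j = (real (m - (card B + 2)) + 1) / real m"
        using ij by (simp add: interdirection_def interdirection_count_def)
      also have "\<dots> = 1 + (real (slope_rank m x i) - real (slope_rank m x j)) / real m"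
        using cB m by (simp add: r of_nat_diff field_simps)
      finally have e: "interdirection m x i j = 1 + (real (slope_rank m x i) - real (slope_rank m x j)) / real m" .
      show ?thesis unfolding s_def[symmetric] s e by (simp add: distrib_left cos_add)
    qed
  qed
  consider "slope (x i) < slope (x j)" | "slope (x j) < slope (x i)" | "slope (x i) = slope (x j)" by linarith
  then show ?thesis
  proof cases
    case 2
    have "pi * (real (slope_rank m x i) - real (slope_rank m x j)) / real m = - (pi * (real (slope_rank m x j) - real (slope_rank m x i)) / real m)"
      by (simp add: minus_divide_left algebra_simps)
    then show ?thesis using main[OF j i 2] by (simp add: interdirection_sym[of m x i j] mult.commute[of "sgn (x i $ 1)"])
  next
    case 3
    then have "i = j" using inj i j by (auto simp: inj_on_def)
    then show ?thesis using nz[OF i] by (simp add: interdirection_def sgn_if)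
  qed (use main[OF i j] in simp)
qed

lemma norm_sum_sq_complex:
  fixes w :: "'i \<Rightarrow> complex"
  shows "(cmod (\<Sum>i\<in>I. w i))\<^sup>2 = (\<Sum>i\<in>I. \<Sum>j\<in>I. Re (w i * cnj (w j)))"
proof -
  have "(cmod (\<Sum>i\<in>I. w i))\<^sup>2 = Re ((\<Sum>i\<in>I. w i) * cnj (\<Sum>j\<in>I. w j))"
    by (metis Re_complex_of_real complex_norm_square of_real_power)
  also have "\<dots> = (\<Sum>i\<in>I. \<Sum>j\<in>I. Re (w i * cnj (w j)))"
    by (simp add: sum_product)
  finally show ?thesis .
qed

text \<open>The offset 1 / 2 centres the empirical angle, so that it estimates
  \<open>line_angle\<close>; in the statistic it only turns the whole sum.\<close>

definition line_score :: "(real \<Rightarrow> real) \<Rightarrow> nat \<Rightarrow> (nat \<Rightarrow> real^2) \<Rightarrow> nat \<Rightarrow> complex" where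
  "line_score J m x i = complex_of_real (J (real (pm_rank m x i) / (real m + 1))) *
     cis (pi * (real (slope_rank m x i) / real m - 1 / 2))"

lemma Q_stat_eq:
  assumes nz: "\<And>i. i < m \<Longrightarrow> x i $ 1 \<noteq> 0" and inj: "inj_on (\<lambda>i. slope (x i)) {..<m}"
  shows "Q_stat f m x = 2 / (real m * score_second_moment f) *
    (cmod (\<Sum>i<m. complex_of_real (sgn (x i $ 1)) * line_score (score f) m x i))\<^sup>2"
proof -
  have "Re ((complex_of_real (sgn (x i $ 1)) * line_score (score f) m x i) *
      cnj (complex_of_real (sgn (x j $ 1)) * line_score (score f) m x j))
    = score f (real (pm_rank m x i) / (real m + 1)) * score f (real (pm_rank m x j) / (real m + 1)) *
        cos (pi * interdirection m x i j)" if "i < m" "j < m" for i j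
  proof -
    let ?a = "\<lambda>i. pi * (real (slope_rank m x i) / real m - 1 / 2)"
    have d: "?a i - ?a j = pi * (real (slope_rank m x i) - real (slope_rank m x j)) / real m"
      by (simp add: diff_divide_distrib algebra_simps)
    have cc: "cos (?a i) * cos (?a j) + sin (?a i) * sin (?a j) = cos (pi * (real (slope_rank m x i) - real (slope_rank m x j)) / real m)"
      unfolding d[symmetric] cos_diff ..
    have re: "Re ((complex_of_real a * (complex_of_real b * cis p)) * cnj (complex_of_real c * (complex_of_real d * cis q)))
      = b * d * (a * c * (cos p * cos q + sin p * sin q))" for a b c d p q
      by (simp add: algebra_simps)
    have ci: "cos (pi * interdirection m x i j) =
      sgn (x i $ 1) * sgn (x j $ 1) * cos (pi * (real (slope_rank m x i) - real (slope_rank m x j)) / real m)"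
      by (rule cos_interdirection) (use nz inj that in auto)
    show ?thesis
      unfolding line_score_def re cc ci by simp
  qed
  then show ?thesis unfolding Q_stat_def norm_sum_sq_complex by simp
qed

section \<open>Tyler's scatter matrix and the ranks\<close>

text \<open>Symmetric positive definite matrices of trace \<open>2\<close> correspond to the points of the open
  unit disc.\<close>

definition disc_mat :: "real \<times> real \<Rightarrow> real^2^2" where
  "disc_mat z = vector [vec2 (1 + fst z) (snd z), vec2 (snd z) (1 - fst z)]"

text \<open>The quadratic form of the adjugate of \<open>disc_mat z\<close>. Division by the
  determinant \<open>1 - (norm z)\<^sup>2\<close> gives the form of the inverse, and this common
  positive factor does not affect the ranks.\<close>

definition disc_form :: "real \<times> real \<Rightarrow> real^2 \<Rightarrow> real" where
  "disc_form z x = (1 - fst z) * (x $ 1)\<^sup>2 - 2 * snd z * (x $ 1 * x $ 2) + (1 + fst z) * (x $ 2)\<^sup>2"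

lemma disc_mat_nth [simp]:
  "disc_mat z $ 1 = vec2 (1 + fst z) (snd z)" "disc_mat z $ 2 = vec2 (snd z) (1 - fst z)"
  by (simp_all add: disc_mat_def)

lemma mat2_eq_iff: "(A :: real^2^2) = B \<longleftrightarrow>
    A $ 1 $ 1 = B $ 1 $ 1 \<and> A $ 1 $ 2 = B $ 1 $ 2 \<and> A $ 2 $ 1 = B $ 2 $ 1 \<and> A $ 2 $ 2 = B $ 2 $ 2"
  by (auto simp: vec_eq_iff forall_2)

lemma inj_disc_mat: "disc_mat z = disc_mat z' \<longleftrightarrow> z = z'"
  by (auto simp: mat2_eq_iff prod_eq_iff)

lemma disc_mat_0: "disc_mat 0 = mat 1"
  by (simp add: mat2_eq_iff mat_def)

lemma norm_pair_sq: "(norm (z :: real \<times> real))\<^sup>2 = (fst z)\<^sup>2 + (snd z)\<^sup>2"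
  by (cases z) (simp add: norm_Pair)

lemma norm_less_1_iff: "norm (z :: real \<times> real) < 1 \<longleftrightarrow> (fst z)\<^sup>2 + (snd z)\<^sup>2 < 1"
  unfolding norm_pair_sq[symmetric] by (simp add: abs_square_less_1[of "norm z", simplified])

text \<open>The determinant is 1 minus the squared norm of z. Completing the square gives one
  direction, two test vectors give the other.\<close>

lemma pos_def_disc_mat: "(\<forall>v. v \<noteq> 0 \<longrightarrow> 0 < v \<bullet> (disc_mat z *v v)) \<longleftrightarrow> norm z < 1"
proof -
  obtain p q where z: "z = (p, q)" by (cases z)
  have f: "v \<bullet> (disc_mat z *v v) = (1 + p) * (v $ 1)\<^sup>2 + 2 * q * (v $ 1 * v $ 2) + (1 - p) * (v $ 2)\<^sup>2" for v
    by (simp add: inner_vec2 matrix_vector_mult_def sum_2 z power2_eq_square algebra_simps)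
  show ?thesis unfolding f norm_less_1_iff unfolding z fst_conv snd_conv
  proof
    assume a: "\<forall>v::real^2. v \<noteq> 0 \<longrightarrow> 0 < (1 + p) * (v $ 1)\<^sup>2 + 2 * q * (v $ 1 * v $ 2) + (1 - p) * (v $ 2)\<^sup>2"
    have "0 < 1 + p" using a[rule_format, of "vec2 1 0"] by (simp add: vec2_eq_iff)
    moreover have "0 < (1 + p) * (1 - p\<^sup>2 - q\<^sup>2)"
    proof -
      \<comment> \<open>This vector annihilates the completed square, so the form takes the value (1
        + p) times the determinant there.\<close>
      have "vec2 (-q) (1 + p) \<noteq> 0" using \<open>0 < 1 + p\<close> by (simp add: vec2_eq_iff)
      from a[rule_format, OF this] show ?thesis by (simp add: power2_eq_square algebra_simps)
    qed
    ultimately show "p\<^sup>2 + q\<^sup>2 < 1" by (simp add: zero_less_mult_iff)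
  next
    assume a: "p\<^sup>2 + q\<^sup>2 < 1"
    then have "p\<^sup>2 < 1" using zero_le_power2[of q] by linarith
    then have p: "0 < 1 + p" by (simp add: abs_square_less_1)
    show "\<forall>v::real^2. v \<noteq> 0 \<longrightarrow> 0 < (1 + p) * (v $ 1)\<^sup>2 + 2 * q * (v $ 1 * v $ 2) + (1 - p) * (v $ 2)\<^sup>2"
    proof (intro allI impI)
      fix v :: "real^2" assume v: "v \<noteq> 0"
      have "0 < ((1 + p) * v $ 1 + q * v $ 2)\<^sup>2 + (1 - p\<^sup>2 - q\<^sup>2) * (v $ 2)\<^sup>2"
      proof (cases "v $ 2 = 0")
        case True
        then show ?thesis using v p by (simp add: vec2_eq_iff)
      next
        case False
        then have "0 < (1 - p\<^sup>2 - q\<^sup>2) * (v $ 2)\<^sup>2" using a by simp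
        then show ?thesis by (simp add: add_nonneg_pos)
      qed
      also have "\<dots> = (1 + p) * ((1 + p) * (v $ 1)\<^sup>2 + 2 * q * (v $ 1 * v $ 2) + (1 - p) * (v $ 2)\<^sup>2)"
        by (simp add: power2_eq_square algebra_simps)
      finally show "0 < (1 + p) * (v $ 1)\<^sup>2 + 2 * q * (v $ 1 * v $ 2) + (1 - p) * (v $ 2)\<^sup>2"
        using p by (simp add: zero_less_mult_iff)
    qed
  qed
qed

lemma disc_matI:
  fixes S :: "real^2^2"
  assumes "transpose S = S" "trace S = 2"
  shows "S = disc_mat (S $ 1 $ 1 - 1, S $ 1 $ 2)"
proof -
  have "S $ 2 $ 1 = S $ 1 $ 2" using arg_cong[OF assms(1), of "\<lambda>A. A $ 2 $ 1"] by (simp add: transpose_def)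
  moreover have "S $ 1 $ 1 + S $ 2 $ 2 = 2" using assms(2) by (simp add: trace_def sum_2)
  ultimately show ?thesis by (simp add: mat2_eq_iff)
qed

lemma transpose_disc_mat: "transpose (disc_mat z) = disc_mat z"
  by (simp add: mat2_eq_iff transpose_def)

lemma trace_disc_mat: "trace (disc_mat z) = 2"
  by (simp add: trace_def sum_2)

lemma matrix_inv_disc_mat:
  assumes "norm z < 1"
  shows "x \<bullet> (matrix_inv (disc_mat z) *v x) = disc_form z x / (1 - (norm z)\<^sup>2)"
proof -
  obtain p q where z: "z = (p, q)" by (cases z)
  have d: "0 < 1 - (p\<^sup>2 + q\<^sup>2)" using assms by (simp add: norm_less_1_iff z)
  define c where "c = 1 / (1 - (p\<^sup>2 + q\<^sup>2))"
  have c: "c = 1 + (c * (p * p) + c * (q * q))"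
  proof -
    have "c * (1 - (p\<^sup>2 + q\<^sup>2)) = 1" using d by (simp add: c_def)
    then show ?thesis by (simp add: power2_eq_square algebra_simps)
  qed
  define T :: "real^2^2" where "T = vector [vec2 ((1 - p) * c) (- q * c), vec2 (- q * c) ((1 + p) * c)]"
  have T: "T $ 1 = vec2 ((1 - p) * c) (- q * c)" "T $ 2 = vec2 (- q * c) ((1 + p) * c)"
    by (simp_all add: T_def)
  have 1: "disc_mat z ** T = mat 1"
    using c by (simp add: mat2_eq_iff matrix_matrix_mult_def mat_def sum_2 z T algebra_simps)
  have 2: "T ** disc_mat z = mat 1"
    using 1 matrix_left_right_inverse by blast
  have "disc_mat z ** matrix_inv (disc_mat z) = mat 1 \<and> matrix_inv (disc_mat z) ** disc_mat z = mat 1"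
    unfolding matrix_inv_def by (rule someI[of _ T]) (use 1 2 in simp)
  then have "matrix_inv (disc_mat z) ** (disc_mat z ** T) = T" by (simp add: matrix_mul_assoc)
  then have "matrix_inv (disc_mat z) = T" by (simp add: 1)
  then have "x \<bullet> (matrix_inv (disc_mat z) *v x) = x \<bullet> (T *v x)" by simp
  also have "\<dots> = ((1 - p) * (x $ 1)\<^sup>2 - 2 * q * (x $ 1 * x $ 2) + (1 + p) * (x $ 2)\<^sup>2) / (1 - (p\<^sup>2 + q\<^sup>2))"
    by (simp add: inner_vec2 matrix_vector_mult_def sum_2 T c_def power2_eq_square diff_divide_distrib add_divide_distrib algebra_simps)
  finally show ?thesis unfolding norm_pair_sq disc_form_def z by simp
qed

text \<open>The form is the squared norm of x minus the inner product of z with the vector of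
  doubled direction and length (norm x)^2; Cauchy-Schwarz bounds the latter.\<close>

lemma disc_form_bounds:
  shows "(1 - norm z) * (norm x)\<^sup>2 \<le> disc_form z x" and "disc_form z x \<le> (1 + norm z) * (norm x)\<^sup>2"
proof -
  obtain p q where z: "z = (p, q)" by (cases z)
  define w where "w = ((x $ 1)\<^sup>2 - (x $ 2)\<^sup>2, 2 * (x $ 1 * x $ 2))"
  have w: "norm w = (norm x)\<^sup>2"
  proof -
    have "(norm w)\<^sup>2 = ((norm x)\<^sup>2)\<^sup>2"
      unfolding norm_pair_sq norm_vec2_sq w_def by (simp add: power2_eq_square algebra_simps)
    then show ?thesis by (metis abs_norm_cancel norm_ge_zero power2_eq_iff_nonneg zero_le_power2)
  qed
  have "disc_form z x = (norm x)\<^sup>2 - z \<bullet> w"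
    unfolding disc_form_def norm_vec2_sq w_def z by (simp add: algebra_simps)
  moreover have "\<bar>z \<bullet> w\<bar> \<le> norm z * (norm x)\<^sup>2" using Cauchy_Schwarz_ineq2[of z w] w by simp
  ultimately show "(1 - norm z) * (norm x)\<^sup>2 \<le> disc_form z x" "disc_form z x \<le> (1 + norm z) * (norm x)\<^sup>2"
    by (auto simp: algebra_simps abs_le_iff)
qed

lemma disc_form_pos: "norm z < 1 \<Longrightarrow> x \<noteq> 0 \<Longrightarrow> 0 < disc_form z x"
  by (rule less_le_trans[OF _ disc_form_bounds(1)]) simp

text \<open>The direction enters only through its doubled angle, which is why Tyler's equation is
  governed by even harmonics of the line angle.\<close>

lemma disc_form_polar:
  assumes "x $ 1 \<noteq> 0"
  shows "disc_form z x = (norm x)\<^sup>2 * (1 - (fst z * cos (2 * line_angle x) + snd z * sin (2 * line_angle x)))"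
proof -
  have s: "(sgn (x $ 1))\<^sup>2 = 1" using assms by (simp add: sgn_if)
  let ?c = "cos (line_angle x)" and ?s = "sin (line_angle x)"
  have e: "(x $ 1)\<^sup>2 = (norm x)\<^sup>2 * ?c\<^sup>2" "(x $ 2)\<^sup>2 = (norm x)\<^sup>2 * ?s\<^sup>2" "x $ 1 * x $ 2 = (norm x)\<^sup>2 * (?c * ?s)"
  proof -
    note v = vec2_line_angle[OF assms]
    show "(x $ 1)\<^sup>2 = (norm x)\<^sup>2 * ?c\<^sup>2" by (subst v(1)) (simp only: power_mult_distrib s mult_1)
    show "(x $ 2)\<^sup>2 = (norm x)\<^sup>2 * ?s\<^sup>2" by (subst v(2)) (simp only: power_mult_distrib s mult_1)
    have "x $ 1 * x $ 2 = (sgn (x $ 1))\<^sup>2 * (norm x)\<^sup>2 * (?c * ?s)"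
      by (subst v(2), subst (1) v(1)) (simp only: power2_eq_square mult_ac)
    then show "x $ 1 * x $ 2 = (norm x)\<^sup>2 * (?c * ?s)" by (simp only: s mult_1)
  qed
  have "(norm x)\<^sup>2 * ?c\<^sup>2 + (norm x)\<^sup>2 * ?s\<^sup>2 = (norm x)\<^sup>2"
    unfolding distrib_left[symmetric] by simp
  then show ?thesis unfolding disc_form_def e sin_double cos_double by (simp add: algebra_simps)
qed

text \<open>Tyler's equation as a zero problem for a map on the disc, continuous on smaller closed
  discs. This form serves the measurability proof.\<close>

definition tyler_res :: "nat \<Rightarrow> (nat \<Rightarrow> real^2) \<Rightarrow> real \<times> real \<Rightarrow> real^2^2" where
  "tyler_res m x z = (2 / real m) *\<^sub>R (\<Sum>i<m. ((1 - (norm z)\<^sup>2) / disc_form z (x i)) *\<^sub>R (\<chi> a b. x i $ a * x i $ b)) - disc_mat z"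

lemma is_tyler_disc_mat: "is_tyler_scatter m x (disc_mat z) \<longleftrightarrow> norm z < 1 \<and> tyler_res m x z = 0"
  unfolding is_tyler_scatter_def pos_def_disc_mat
  by (auto simp: transpose_disc_mat trace_disc_mat matrix_inv_disc_mat tyler_res_def)

lemma is_tyler_scatter_iff: "is_tyler_scatter m x S \<longleftrightarrow> (\<exists>z. norm z < 1 \<and> tyler_res m x z = 0 \<and> S = disc_mat z)"
proof
  assume a: "is_tyler_scatter m x S"
  then have "S = disc_mat (S $ 1 $ 1 - 1, S $ 1 $ 2)" by (intro disc_matI) (auto simp: is_tyler_scatter_def)
  with a show "\<exists>z. norm z < 1 \<and> tyler_res m x z = 0 \<and> S = disc_mat z" by (metis is_tyler_disc_mat)
qed (auto simp: is_tyler_disc_mat)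

text \<open>The default \<open>0\<close> is the point of the identity matrix, in agreement with the
  default of \<open>tyler_scatter\<close>.\<close>

definition tyler_disc :: "nat \<Rightarrow> (nat \<Rightarrow> real^2) \<Rightarrow> real \<times> real" where
  "tyler_disc m x = (if \<exists>!z. norm z < 1 \<and> tyler_res m x z = 0 then THE z. norm z < 1 \<and> tyler_res m x z = 0 else 0)"

lemma ex1_tyler: "(\<exists>!S. is_tyler_scatter m x S) \<longleftrightarrow> (\<exists>!z. norm z < 1 \<and> tyler_res m x z = 0)"
proof
  assume "\<exists>!S. is_tyler_scatter m x S"
  then obtain S where S: "is_tyler_scatter m x S" and u: "\<And>S'. is_tyler_scatter m x S' \<Longrightarrow> S' = S" by auto
  from S obtain z where z: "norm z < 1" "tyler_res m x z = 0" "S = disc_mat z" by (auto simp only: is_tyler_scatter_iff)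
  show "\<exists>!z. norm z < 1 \<and> tyler_res m x z = 0"
  proof (rule ex1I[of _ z])
    fix y assume "norm y < 1 \<and> tyler_res m x y = 0"
    then have "disc_mat y = disc_mat z" using u[of "disc_mat y"] z(3) by (simp add: is_tyler_disc_mat)
    then show "y = z" by (simp only: inj_disc_mat)
  qed (use z in simp)
next
  assume "\<exists>!z. norm z < 1 \<and> tyler_res m x z = 0"
  then obtain z where z: "norm z < 1" "tyler_res m x z = 0" and u: "\<And>y. norm y < 1 \<Longrightarrow> tyler_res m x y = 0 \<Longrightarrow> y = z"
    by auto
  show "\<exists>!S. is_tyler_scatter m x S"
  proof (rule ex1I[of _ "disc_mat z"])
    show "is_tyler_scatter m x (disc_mat z)" using z by (simp only: is_tyler_disc_mat)
    fix S assume "is_tyler_scatter m x S"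
    then obtain y where "norm y < 1" "tyler_res m x y = 0" "S = disc_mat y" by (auto simp only: is_tyler_scatter_iff)
    with u show "S = disc_mat z" by blast
  qed
qed

lemma tyler_disc_cases: "tyler_disc m x = 0 \<or> norm (tyler_disc m x) < 1 \<and> tyler_res m x (tyler_disc m x) = 0"
proof (cases "\<exists>!z. norm z < 1 \<and> tyler_res m x z = 0")
  case True
  from theI'[OF this] True show ?thesis by (simp add: tyler_disc_def)
qed (simp add: tyler_disc_def)

lemma norm_tyler_disc: "norm (tyler_disc m x) < 1"
  using tyler_disc_cases[of m x] by auto

lemma tyler_scatter_eq: "tyler_scatter m x = disc_mat (tyler_disc m x)"
proof (cases "\<exists>!z. norm z < 1 \<and> tyler_res m x z = 0")
  case True
  from theI'[OF this] have "is_tyler_scatter m x (disc_mat (tyler_disc m x))"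
    using True by (simp add: tyler_disc_def is_tyler_disc_mat)
  with True show ?thesis unfolding tyler_scatter_def ex1_tyler
    by (simp only: if_True) (metis (no_types, lifting) ex1_tyler the1_equality True)
next
  case False
  then show ?thesis unfolding tyler_scatter_def ex1_tyler tyler_disc_def by (simp add: disc_mat_0)
qed

lemma pseudo_mahalanobis_eq:
  "pseudo_mahalanobis m x i = sqrt (disc_form (tyler_disc m x) (x i) / (1 - (norm (tyler_disc m x))\<^sup>2))"
  unfolding pseudo_mahalanobis_def tyler_scatter_eq matrix_inv_disc_mat[OF norm_tyler_disc] ..

lemma pseudo_mahalanobis_le_iff:
  "pseudo_mahalanobis m x j \<le> pseudo_mahalanobis m x i \<longleftrightarrow>
     disc_form (tyler_disc m x) (x j) \<le> disc_form (tyler_disc m x) (x i)"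
proof -
  have "(norm (tyler_disc m x))\<^sup>2 < 1" using norm_tyler_disc[of m x] by (simp add: abs_square_less_1)
  then show ?thesis unfolding pseudo_mahalanobis_eq by (simp add: divide_le_cancel)
qed

lemma pm_rank_eq: "pm_rank m x i =
    card {j. j < m \<and> disc_form (tyler_disc m x) (x j) \<le> disc_form (tyler_disc m x) (x i)}"
  unfolding pm_rank_def pseudo_mahalanobis_le_iff ..

text \<open>The left-hand side decreases in \<open>a\<close>, so a lower bound for \<open>a\<close> is enough.\<close>

lemma moebius_upper:
  fixes a c \<delta> :: real
  assumes "0 < \<delta>" "\<delta> \<le> 1 / 2" "\<delta> \<le> a" "a < 1" "\<bar>c\<bar> \<le> 1"
  shows "(c - a) / (1 - a * c) \<le> c - \<delta> + \<delta> * c\<^sup>2 + 4 * \<delta>\<^sup>2"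
proof -
  have ac: "a * c \<le> a * 1" using assms by (intro mult_left_mono) auto
  then have pa: "0 < 1 - a * c" using assms by linarith
  have dc: "\<delta> * c \<le> \<delta> * 1" using assms by (intro mult_left_mono) auto
  then have pd: "0 < 1 - \<delta> * c" using assms by linarith
  have c2: "c\<^sup>2 \<le> 1" using assms by (simp add: abs_square_le_1)
  \<comment> \<open>Cross-multiplied, monotonicity in a is the inequality (a - \<delta>) (1 - c^2)
    \<ge> 0.\<close>
  have "(a - \<delta>) * c\<^sup>2 \<le> (a - \<delta>) * 1" using c2 assms by (intro mult_left_mono) auto
  then have "(c - a) * (1 - \<delta> * c) \<le> (c - \<delta>) * (1 - a * c)" by (simp add: power2_eq_square algebra_simps)
  then have "(c - a) / (1 - a * c) \<le> (c - \<delta>) / (1 - \<delta> * c)" using pa pd by (simp add: frac_le_eq divide_le_0_iff)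
  also have "\<dots> \<le> c - \<delta> + \<delta> * c\<^sup>2 + 4 * \<delta>\<^sup>2"
  proof -
    have "\<bar>c * c\<^sup>2\<bar> \<le> 1 * 1" unfolding abs_mult using assms c2 by (intro mult_mono) auto
    moreover have "\<bar>\<delta> * c\<bar> \<le> 1 / 2 * 1" unfolding abs_mult using assms by (intro mult_mono) auto
    \<comment> \<open>The bracket is what remains of the second-order expansion in \<delta> after
      multiplication by 1 - \<delta> c. The constant 4 outweighs the other three terms, which are at
      least -1, -1 and -2.\<close>
    ultimately have "0 \<le> \<delta>\<^sup>2 * (4 + c - c * c\<^sup>2 - 4 * (\<delta> * c))" using assms by (intro mult_nonneg_nonneg) auto
    then have "c - \<delta> \<le> (c - \<delta> + \<delta> * c\<^sup>2 + 4 * \<delta>\<^sup>2) * (1 - \<delta> * c)" by (simp add: power2_eq_square algebra_simps)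
    then show ?thesis using pd by (simp add: pos_divide_le_eq)
  qed
  finally show ?thesis .
qed

text \<open>The trace of Tyler's equation at a point of the disc with modulus \<open>a\<close> is \<open>(\<Sum>i<m. (c i - a) / (1 - a * c i)) = 0\<close>, where \<open>c i\<close> is the
  cosine of the angle between this point and the doubled direction of \<open>x i\<close>.\<close>

lemma tyler_disc_small:
  assumes m: "0 < m" and nz: "\<And>i. i < m \<Longrightarrow> x i $ 1 \<noteq> 0" and d: "0 < \<delta>" "\<delta> \<le> 1 / 16"
    and C1: "\<bar>\<Sum>i<m. cos (2 * line_angle (x i))\<bar> \<le> \<delta> / 16 * m"
    and S1: "\<bar>\<Sum>i<m. sin (2 * line_angle (x i))\<bar> \<le> \<delta> / 16 * m"
    and C2: "\<bar>\<Sum>i<m. cos (4 * line_angle (x i))\<bar> \<le> \<delta> / 16 * m"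
    and S2: "\<bar>\<Sum>i<m. sin (4 * line_angle (x i))\<bar> \<le> \<delta> / 16 * m"
  shows "norm (tyler_disc m x) < \<delta>"
proof (rule ccontr)
  assume not: "\<not> norm (tyler_disc m x) < \<delta>"
  define a where "a = norm (tyler_disc m x)"
  obtain p q where z: "tyler_disc m x = (p, q)" by (cases "tyler_disc m x")
  have a: "\<delta> \<le> a" "a < 1" "0 < a" "a \<noteq> 0" using not norm_tyler_disc[of m x] d by (auto simp: a_def)
  have a2: "a\<^sup>2 = p\<^sup>2 + q\<^sup>2" unfolding a_def norm_pair_sq z by simp
  \<comment> \<open>The modulus is at least \<delta> > 0, so the default value is excluded and
    Tyler's equation does hold.\<close>
  have res: "tyler_res m x (p, q) = 0" using tyler_disc_cases[of m x] a(3) unfolding a_def z by auto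
  define D where "D i = p * cos (2 * line_angle (x i)) + q * sin (2 * line_angle (x i))" for i
  define c where "c i = D i / a" for i
  have D: "D i = a * c i" for i using a by (simp add: c_def)
  have Dle: "(D i)\<^sup>2 + (q * cos (2 * line_angle (x i)) - p * sin (2 * line_angle (x i)))\<^sup>2 = a\<^sup>2" for i
  proof -
    let ?C = "cos (2 * line_angle (x i))" and ?S = "sin (2 * line_angle (x i))"
    have "(D i)\<^sup>2 + (q * ?C - p * ?S)\<^sup>2 = (p\<^sup>2 + q\<^sup>2) * (?S\<^sup>2 + ?C\<^sup>2)"
    proof -
      have "(p * C + q * S)\<^sup>2 + (q * C - p * S)\<^sup>2 = (p\<^sup>2 + q\<^sup>2) * (S\<^sup>2 + C\<^sup>2)" for C S
        by (simp add: power2_eq_square algebra_simps)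
      then show ?thesis unfolding D_def .
    qed
    then show ?thesis by (simp add: a2)
  qed
  have c1: "\<bar>c i\<bar> \<le> 1" for i
  proof -
    have "(D i)\<^sup>2 \<le> a\<^sup>2" using Dle[of i] zero_le_power2 by (metis le_add_same_cancel1)
    then have "\<bar>D i\<bar> \<le> a" using a by (simp add: abs_le_square_iff[symmetric])
    then show ?thesis using a by (simp add: c_def)
  qed
  have "tyler_res m x (p, q) $ 1 $ 1 + tyler_res m x (p, q) $ 2 $ 2 = 0" by (simp add: res)
  then have "(2 / m) * (\<Sum>i<m. (1 - a\<^sup>2) / disc_form (p, q) (x i) * (norm (x i))\<^sup>2) = 2"
    by (simp add: tyler_res_def a_def[symmetric] z[symmetric] norm_vec2_sq sum_distrib_left distrib_left sum.distrib power2_eq_square[of "_ $ _"])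
  also have "(\<Sum>i<m. (1 - a\<^sup>2) / disc_form (p, q) (x i) * (norm (x i))\<^sup>2) = (\<Sum>i<m. 1 + a * ((c i - a) / (1 - a * c i)))"
  proof (rule sum.cong[OF refl])
    fix i assume "i \<in> {..<m}"
    then have nzi: "x i $ 1 \<noteq> 0" using nz by simp
    then have n: "0 < (norm (x i))\<^sup>2" by auto
    have f: "disc_form (p, q) (x i) = (norm (x i))\<^sup>2 * (1 - a * c i)"
      unfolding disc_form_polar[OF nzi] D[symmetric] D_def by simp
    have "a * c i \<le> a * 1" using c1[of i] a by (intro mult_left_mono) auto
    then have p: "0 < 1 - a * c i" using a by linarith
    have "1 + a * ((c i - a) / (1 - a * c i)) = ((1 - a * c i) + a * (c i - a)) / (1 - a * c i)"
      using p by (simp add: add_divide_distrib)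
    also have "(1 - a * c i) + a * (c i - a) = 1 - a\<^sup>2" by (simp add: power2_eq_square algebra_simps)
    finally show "(1 - a\<^sup>2) / disc_form (p, q) (x i) * (norm (x i))\<^sup>2 = 1 + a * ((c i - a) / (1 - a * c i))"
      unfolding f using n p by simp
  qed
  finally have "(\<Sum>i<m. 1 + a * ((c i - a) / (1 - a * c i))) = m" using m by (simp add: field_simps)
  then have "a * (\<Sum>i<m. (c i - a) / (1 - a * c i)) = 0" by (simp add: sum.distrib sum_distrib_left)
  then have "0 = (\<Sum>i<m. (c i - a) / (1 - a * c i))" using a by simp
  also have "\<dots> \<le> (\<Sum>i<m. c i - \<delta> + \<delta> * (c i)\<^sup>2 + 4 * \<delta>\<^sup>2)"
    using a d c1 by (intro sum_mono moebius_upper) auto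
  also have "\<dots> = (\<Sum>i<m. c i) + \<delta> * (\<Sum>i<m. (c i)\<^sup>2) + m * (4 * \<delta>\<^sup>2 - \<delta>)"
    by (simp add: sum.distrib sum_distrib_left sum_subtractf algebra_simps)
  finally have main: "0 \<le> (\<Sum>i<m. c i) + \<delta> * (\<Sum>i<m. (c i)\<^sup>2) + m * (4 * \<delta>\<^sup>2 - \<delta>)" .
  have pq: "\<bar>p\<bar> \<le> a" "\<bar>q\<bar> \<le> a" using a abs_le_square_iff[of p a] abs_le_square_iff[of q a] by (simp_all add: a2)
  have "a * (\<Sum>i<m. c i) = p * (\<Sum>i<m. cos (2 * line_angle (x i))) + q * (\<Sum>i<m. sin (2 * line_angle (x i)))"
    by (simp add: sum_distrib_left D[symmetric] D_def sum.distrib)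
  also have "\<dots> \<le> \<bar>p\<bar> * \<bar>\<Sum>i<m. cos (2 * line_angle (x i))\<bar> + \<bar>q\<bar> * \<bar>\<Sum>i<m. sin (2 * line_angle (x i))\<bar>"
    by (intro add_mono) (metis abs_ge_self abs_mult)+
  also have "\<dots> \<le> a * (\<delta> / 16 * m) + a * (\<delta> / 16 * m)"
    using pq C1 S1 a by (intro add_mono mult_mono) auto
  finally have "a * (\<Sum>i<m. c i) \<le> a * (\<delta> / 8 * m)" by (simp add: algebra_simps)
  then have sc: "(\<Sum>i<m. c i) \<le> \<delta> / 8 * m" using a by simp
  \<comment> \<open>\<open>2 * (c i)\<^sup>2 - 1\<close> is the cosine of the doubled angle
    difference, hence a combination of harmonics of frequency 4. So the mean of
    \<open>(c i)\<^sup>2\<close> cannot exceed 1 / 2 by much.\<close>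
  have "a\<^sup>2 * (\<Sum>i<m. 2 * (c i)\<^sup>2 - 1) = (p\<^sup>2 - q\<^sup>2) * (\<Sum>i<m. cos (4 * line_angle (x i))) + (2 * p * q) * (\<Sum>i<m. sin (4 * line_angle (x i)))"
    unfolding sum_distrib_left sum.distrib[symmetric]
  proof (rule sum.cong[OF refl])
    fix i
    let ?C = "cos (2 * line_angle (x i))" and ?S = "sin (2 * line_angle (x i))"
    have e: "cos (4 * line_angle (x i)) = ?C\<^sup>2 - ?S\<^sup>2" "sin (4 * line_angle (x i)) = 2 * ?S * ?C"
      using cos_double[of "2 * line_angle (x i)"] sin_double[of "2 * line_angle (x i)"] by simp_all
    have "a\<^sup>2 * (2 * (c i)\<^sup>2 - 1) = 2 * (D i)\<^sup>2 - (p\<^sup>2 + q\<^sup>2) * (?S\<^sup>2 + ?C\<^sup>2)"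
      by (simp add: D power_mult_distrib a2[symmetric] algebra_simps)
    also have "\<dots> = (p\<^sup>2 - q\<^sup>2) * (?C\<^sup>2 - ?S\<^sup>2) + 2 * p * q * (2 * ?S * ?C)"
    proof -
      have "2 * (p * C + q * S)\<^sup>2 - (p\<^sup>2 + q\<^sup>2) * (S\<^sup>2 + C\<^sup>2) = (p\<^sup>2 - q\<^sup>2) * (C\<^sup>2 - S\<^sup>2) + 2 * p * q * (2 * S * C)" for C S
        by (simp add: power2_eq_square algebra_simps)
      then show ?thesis unfolding D_def .
    qed
    finally show "a\<^sup>2 * (2 * (c i)\<^sup>2 - 1) = (p\<^sup>2 - q\<^sup>2) * cos (4 * line_angle (x i)) + 2 * p * q * sin (4 * line_angle (x i))"
      unfolding e .
  qed
  also have "\<dots> \<le> \<bar>p\<^sup>2 - q\<^sup>2\<bar> * \<bar>\<Sum>i<m. cos (4 * line_angle (x i))\<bar> + \<bar>2 * p * q\<bar> * \<bar>\<Sum>i<m. sin (4 * line_angle (x i))\<bar>"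
    by (intro add_mono) (metis abs_ge_self abs_mult)+
  also have "\<dots> \<le> a\<^sup>2 * (\<delta> / 16 * m) + a\<^sup>2 * (\<delta> / 16 * m)"
  proof (intro add_mono mult_mono C2 S2)
    show "\<bar>p\<^sup>2 - q\<^sup>2\<bar> \<le> a\<^sup>2" unfolding a2 by (simp add: abs_le_iff)
    have "0 \<le> (p - q)\<^sup>2" "0 \<le> (p + q)\<^sup>2" by simp_all
    then show "\<bar>2 * p * q\<bar> \<le> a\<^sup>2" unfolding a2 by (simp add: abs_le_iff power2_diff power2_sum)
  qed (use a in auto)
  finally have "a\<^sup>2 * (\<Sum>i<m. 2 * (c i)\<^sup>2 - 1) \<le> a\<^sup>2 * (\<delta> / 8 * m)" by (simp add: algebra_simps)
  then have "(\<Sum>i<m. 2 * (c i)\<^sup>2 - 1) \<le> \<delta> / 8 * m" using a by (simp only: mult_le_cancel_left_pos zero_less_power)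
  then have sc2: "(\<Sum>i<m. (c i)\<^sup>2) \<le> m / 2 + \<delta> / 16 * m" by (simp add: sum_subtractf sum_distrib_left[symmetric])
  have "0 \<le> \<delta> / 8 * m + \<delta> * (m / 2 + \<delta> / 16 * m) + m * (4 * \<delta>\<^sup>2 - \<delta>)"
    using main sc mult_left_mono[OF sc2, of \<delta>] d by linarith
  \<comment> \<open>For \<delta> \<le> 1 / 16 the bracket is at most 1 / 8 - 1 / 2 + 1 / 256 + 1 /
    4, which is negative; this is the contradiction.\<close>
  also have "\<dots> = m * \<delta> * (1 / 8 - 1 / 2 + \<delta> / 16 + 4 * \<delta>)" by (simp add: power2_eq_square algebra_simps)
  finally have "0 \<le> m * \<delta> * (1 / 8 - 1 / 2 + \<delta> / 16 + 4 * \<delta>)" .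
  moreover have "0 < m * \<delta>" using m d by simp
  ultimately have "0 \<le> 1 / 8 - 1 / 2 + \<delta> / 16 + 4 * \<delta>" by (meson linorder_not_less mult_pos_neg)
  with d show False by simp
qed

text \<open>The argument behind the Glivenko-Cantelli theorem: both distribution functions are
  monotone, so closeness on a grid of mesh 1 / K extends to the interval at the cost of one mesh
  width.\<close>

lemma empirical_grid:
  fixes u :: "nat \<Rightarrow> real"
  assumes m: "0 < m" and K: "0 < K" and t: "0 \<le> t" "t \<le> 1"
    and grid: "\<And>k. k \<le> K \<Longrightarrow> \<bar>real (card {j. j < m \<and> u j \<le> real k / real K}) / real m - real k / real K\<bar> \<le> \<eta>"
  shows "\<bar>real (card {j. j < m \<and> u j \<le> t}) / real m - t\<bar> \<le> \<eta> + 1 / real K"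
proof -
  define F where "F s = real (card {j. j < m \<and> u j \<le> s}) / real m" for s
  have mono: "F s \<le> F s'" if "s \<le> s'" for s s'
    unfolding F_def using that by (intro divide_right_mono) (auto intro!: card_mono)
  define k where "k = nat \<lfloor>t * real K\<rfloor>"
  have k: "real k \<le> t * real K" "t * real K < real k + 1" using t by (simp_all add: k_def of_nat_floor)
  have tK: "t * real K \<le> real K" using t mult_right_mono[of t 1 "real K"] by simp
  then have kK: "k \<le> K" using k by linarith
  have lo: "real k / real K \<le> t" using k K by (simp add: divide_le_eq)
  have "t - (\<eta> + 1 / real K) \<le> F t"
  proof -
    have "t < (real k + 1) / real K" using k K by (simp add: less_divide_eq)
    then show ?thesis using mono[OF lo] grid[OF kK] by (simp add: F_def[symmetric] add_divide_distrib abs_le_iff)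
  qed
  moreover have "F t \<le> t + (\<eta> + 1 / real K)"
  \<comment> \<open>At the right end there is no next grid point; there t = 1.\<close>
  proof (cases "k = K")
    case True
    have "F t \<le> F (real K / real K)" using t K by (intro mono) simp
    then have "F t \<le> 1 + \<eta>" using grid[of K] K by (simp add: F_def[symmetric] abs_le_iff)
    moreover have "1 \<le> t" using lo True K by simp
    moreover have "0 \<le> 1 / real K" by simp
    ultimately show ?thesis by linarith
  next
    case False
    then have Sk: "Suc k \<le> K" using kK by simp
    have "t \<le> real (Suc k) / real K" using k K by (simp add: le_divide_eq)
    then show ?thesis using mono[of t "real (Suc k) / real K"] grid[OF Sk] lo by (simp add: F_def[symmetric] add_divide_distrib abs_le_iff)
  qed
  ultimately show ?thesis by (simp add: F_def abs_le_iff)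
qed

lemma slope_rank_eq: "slope_rank m x i = card {l. l < m \<and> line_unif (x l) \<le> line_unif (x i)}"
  by (simp add: slope_rank_def line_unif_def arctan_le_iff divide_le_cancel)

text \<open>The function s / (1 + s) grows at most in proportion to s, so relative closeness of
  squared norms passes to the uniform variables.\<close>

lemma radial_unif_scale:
  assumes "1 \<le> \<kappa>" "(norm x)\<^sup>2 \<le> \<kappa> * (norm y)\<^sup>2"
  shows "radial_unif x \<le> \<kappa> * radial_unif y"
proof -
  define a b where "a = (norm x)\<^sup>2" and "b = (norm y)\<^sup>2"
  have ab: "0 \<le> a" "0 \<le> b" "a \<le> \<kappa> * b" using assms by (simp_all add: a_def b_def)
  have "1 * b \<le> \<kappa> * b" using assms ab by (intro mult_right_mono) auto
  moreover have "0 \<le> a * b * (\<kappa> - 1)" using ab assms by simp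
  ultimately have "a * (1 + b) \<le> \<kappa> * b * (1 + a)" using ab by (simp add: algebra_simps)
  then show ?thesis unfolding radial_unif_def a_def[symmetric] b_def[symmetric] using ab by (simp add: field_simps)
qed

text \<open>By \<open>disc_form_bounds\<close> the order of the forms agrees with that of
  \<open>radial_unif\<close> up to the factor (1 + \<delta>) / (1 - \<delta>) < 1 + 3 \<delta>. So
  the rank lies between the empirical counts at U / (1 + 3 \<delta>) and at (1 + 3 \<delta>)
  U.\<close>

lemma pm_rank_approx:
  assumes m: "0 < m" and nz: "\<And>i. i < m \<Longrightarrow> x i \<noteq> 0" and d: "0 < \<delta>" "\<delta> \<le> 1 / 16" and z: "norm (tyler_disc m x) < \<delta>"
    and emp: "\<And>t. 0 \<le> t \<Longrightarrow> t \<le> 1 \<Longrightarrow> \<bar>real (card {j. j < m \<and> radial_unif (x j) \<le> t}) / real m - t\<bar> \<le> \<epsilon>"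
    and i: "i < m"
  shows "\<bar>real (pm_rank m x i) / real m - radial_unif (x i)\<bar> \<le> \<epsilon> + 3 * \<delta>"
proof -
  define \<kappa> where "\<kappa> = (1 + \<delta>) / (1 - \<delta>)"
  have k1: "1 \<le> \<kappa>" using d by (simp add: \<kappa>_def)
  have "0 < \<delta> * (1 - 3 * \<delta>)" using d by simp
  then have "1 + \<delta> < (1 + 3 * \<delta>) * (1 - \<delta>)" by (simp add: algebra_simps)
  then have k2: "\<kappa> < 1 + 3 * \<delta>" using d by (simp add: \<kappa>_def divide_less_eq)
  let ?z = "tyler_disc m x"
  let ?U = "\<lambda>i. radial_unif (x i)"
  have key: "?U j \<le> \<kappa> * ?U k" if "disc_form ?z (x j) \<le> disc_form ?z (x k)" for j k
  proof (rule radial_unif_scale[OF k1])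
    have "(1 - \<delta>) * (norm (x j))\<^sup>2 \<le> (1 - norm ?z) * (norm (x j))\<^sup>2" using z by (intro mult_right_mono) auto
    also have "\<dots> \<le> (1 + norm ?z) * (norm (x k))\<^sup>2" using disc_form_bounds that by (meson order_trans)
    also have "\<dots> \<le> (1 + \<delta>) * (norm (x k))\<^sup>2" using z by (intro mult_right_mono) auto
    finally show "(norm (x j))\<^sup>2 \<le> \<kappa> * (norm (x k))\<^sup>2" using d by (simp add: \<kappa>_def field_simps)
  qed
  have Ui: "0 \<le> ?U i" "?U i \<le> 1" using radial_unif_bounds[of "x i"] by auto
  have up: "real (pm_rank m x i) / m \<le> ?U i + (\<epsilon> + 3 * \<delta>)"
  proof -
    define t where "t = min 1 ((1 + 3 * \<delta>) * ?U i)"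
    have t: "0 \<le> t" "t \<le> 1" using Ui d by (auto simp: t_def)
    have "{j. j < m \<and> disc_form ?z (x j) \<le> disc_form ?z (x i)} \<subseteq> {j. j < m \<and> ?U j \<le> t}"
    proof clarify
      fix j assume "disc_form ?z (x j) \<le> disc_form ?z (x i)"
      from key[OF this] mult_right_mono[OF less_imp_le[OF k2] Ui(1)] radial_unif_bounds(2)[of "x j"]
      show "?U j \<le> t" by (simp add: t_def)
    qed
    then have "pm_rank m x i \<le> card {j. j < m \<and> ?U j \<le> t}" unfolding pm_rank_eq by (intro card_mono) auto
    then have "real (pm_rank m x i) / m \<le> real (card {j. j < m \<and> ?U j \<le> t}) / m" by (intro divide_right_mono) auto
    also have "\<dots> \<le> t + \<epsilon>" using emp[OF t] by (simp add: abs_le_iff)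
    also have "t \<le> ?U i + 3 * \<delta>"
    proof -
      have "\<delta> * ?U i \<le> \<delta> * 1" using Ui d by (intro mult_left_mono) auto
      then show ?thesis by (simp add: t_def min_def algebra_simps)
    qed
    finally show ?thesis by simp
  qed
  have low: "?U i - (\<epsilon> + 3 * \<delta>) \<le> real (pm_rank m x i) / m"
  proof -
    define t where "t = ?U i / (1 + 3 * \<delta>)"
    have "?U i \<le> 1 * (1 + 3 * \<delta>)" using Ui d by simp
    then have t: "0 \<le> t" "t \<le> 1" using Ui d by (simp_all add: t_def)
    have "{j. j < m \<and> ?U j \<le> t} \<subseteq> {j. j < m \<and> disc_form ?z (x j) \<le> disc_form ?z (x i)}"
    proof (clarify, rule ccontr)
      fix j assume j: "j < m" "?U j \<le> t" "\<not> disc_form ?z (x j) \<le> disc_form ?z (x i)"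
      have "?U i \<le> \<kappa> * ?U j" using j(3) by (intro key) simp
      also have "\<dots> < (1 + 3 * \<delta>) * ?U j" using k2 radial_unif_pos[OF nz[OF j(1)]] by (intro mult_strict_right_mono)
      also have "\<dots> \<le> ?U i" using j(2) d by (simp add: t_def field_simps)
      finally show False by simp
    qed
    then have "card {j. j < m \<and> ?U j \<le> t} \<le> pm_rank m x i" unfolding pm_rank_eq by (intro card_mono) auto
    then have "real (card {j. j < m \<and> ?U j \<le> t}) / m \<le> real (pm_rank m x i) / m" by (intro divide_right_mono) auto
    moreover have "t - \<epsilon> \<le> real (card {j. j < m \<and> ?U j \<le> t}) / m" using emp[OF t] by (simp add: abs_le_iff)
    moreover have "?U i - 3 * \<delta> \<le> t"
    proof -
      have "(1 - 3 * \<delta>) * (1 + 3 * \<delta>) \<le> 1" using zero_le_power2[of "3 * \<delta>"] by (simp add: power2_eq_square algebra_simps)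
      then have "?U i * ((1 - 3 * \<delta>) * (1 + 3 * \<delta>)) \<le> ?U i * 1" using Ui by (intro mult_left_mono) auto
      then have "?U i * (1 - 3 * \<delta>) \<le> t" using d by (simp add: t_def le_divide_eq mult.assoc)
      moreover have "\<delta> * ?U i \<le> \<delta> * 1" using Ui d by (intro mult_left_mono) auto
      ultimately show ?thesis by (simp add: algebra_simps)
    qed
    ultimately show ?thesis by simp
  qed
  show ?thesis using up low by (simp add: abs_le_iff)
qed

section \<open>Measurability and absence of ties\<close>

text \<open>On a compact set a zero exists iff the infimum over a countable dense subset vanishes.\<close>

lemma sets_ex_zero_compact:
  fixes H :: "'a \<Rightarrow> 'b :: {metric_space, second_countable_topology} \<Rightarrow> 'c :: {real_normed_vector, second_countable_topology}"
  assumes K: "compact K" and cont: "\<And>x. x \<in> space M \<Longrightarrow> continuous_on K (H x)"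
    and [measurable]: "\<And>z. z \<in> K \<Longrightarrow> (\<lambda>x. H x z) \<in> borel_measurable M"
  shows "{x \<in> space M. \<exists>z\<in>K. H x z = 0} \<in> sets M"
proof (cases "K = {}")
  case False
  obtain D where D: "countable D" "D \<subseteq> K" "K \<subseteq> closure D" using separable by blast
  have "{x \<in> space M. \<exists>z\<in>K. H x z = 0} = (\<Inter>n. \<Union>z\<in>D. {x \<in> space M. norm (H x z) < 1 / real (Suc n)})"
  proof (intro set_eqI iffI)
    fix x assume "x \<in> {x \<in> space M. \<exists>z\<in>K. H x z = 0}"
    then obtain z where x: "x \<in> space M" and z: "z \<in> K" "H x z = 0" by auto
    show "x \<in> (\<Inter>n. \<Union>z\<in>D. {x \<in> space M. norm (H x z) < 1 / real (Suc n)})"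
    proof
      fix n
      have "0 < 1 / real (Suc n)" by simp
      then obtain d where d: "0 < d" "\<And>y. y \<in> K \<Longrightarrow> dist y z < d \<Longrightarrow> dist (H x y) (H x z) < 1 / real (Suc n)"
        using cont[OF x] z(1) unfolding continuous_on_iff by blast
      obtain y where "y \<in> D" "dist y z < d" using z(1) D(3) d(1) closure_approachable by blast
      then show "x \<in> (\<Union>z\<in>D. {x \<in> space M. norm (H x z) < 1 / real (Suc n)})"
        using d(2)[of y] D(2) x z(2) by auto
    qed
  next
    fix x assume x: "x \<in> (\<Inter>n. \<Union>z\<in>D. {x \<in> space M. norm (H x z) < 1 / real (Suc n)})"
    then have xM: "x \<in> space M" by auto
    have "continuous_on K (\<lambda>z. norm (H x z))" using cont[OF xM] by (intro continuous_intros)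
    from continuous_attains_inf[OF K False this]
    obtain z where z: "z \<in> K" "\<And>y. y \<in> K \<Longrightarrow> norm (H x z) \<le> norm (H x y)" by blast
    have "norm (H x z) \<le> 1 / real (Suc n)" for n
    proof -
      obtain y where "y \<in> D" "norm (H x y) < 1 / real (Suc n)" using x by blast
      then show ?thesis using z(2)[of y] D(2) by auto
    qed
    then have "norm (H x z) \<le> 0" by (intro LIMSEQ_le_const[OF LIMSEQ_Suc[OF lim_1_over_n]]) (auto simp del: of_nat_Suc)
    then show "x \<in> {x \<in> space M. \<exists>z\<in>K. H x z = 0}" using z(1) xM by auto
  qed
  moreover have "(\<Inter>n. \<Union>z\<in>D. {x \<in> space M. norm (H x z) < 1 / real (Suc n)}) \<in> sets M"
  proof (intro sets.countable_INT' sets.countable_UN' image_subsetI)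
    fix n z assume "z \<in> D"
    then have "z \<in> K" using D by auto
    then show "{x \<in> space M. norm (H x z) < 1 / real (Suc n)} \<in> sets M" by measurable
  qed (use D in auto)
  ultimately show ?thesis by simp
qed simp

lemma continuous_on_tyler_res:
  assumes "r < 1"
  shows "continuous_on (cball 0 r) (tyler_res m x)"
proof -
  have t: "continuous_on (cball 0 r) (\<lambda>z. (1 - (norm z)\<^sup>2) / disc_form z (x i))" for i
  proof (cases "x i = 0")
    case True
    then show ?thesis by (simp add: disc_form_def)
  next
    case False
    have "disc_form z (x i) \<noteq> 0" if "z \<in> cball 0 r" for z
      using disc_form_pos[of z "x i"] False that assms by force
    then show ?thesis unfolding disc_form_def by (intro continuous_intros) auto
  qed
  have d: "continuous_on (cball 0 r) disc_mat"
  proof -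
    have "disc_mat = (\<lambda>z. \<chi> a b. if a = 1 then (if b = 1 then 1 + fst z else snd z) else (if b = 1 then snd z else 1 - fst z))"
      by (rule ext) (simp add: mat2_eq_iff)
    moreover have "continuous_on S (\<lambda>z::real\<times>real. (\<chi> a b. if a = 1 then (if b = 1 then 1 + fst z else snd z) else (if b = 1 then snd z else 1 - fst z)) :: real^2^2)" for S
    proof (intro continuous_on_vec_lambda)
      fix a b :: 2
      show "continuous_on S (\<lambda>z::real\<times>real. if a = 1 then (if b = 1 then 1 + fst z else snd z) else (if b = 1 then snd z else 1 - fst z))"
        by (cases "a = 1"; cases "b = 1") (auto intro!: continuous_intros)
    qed
    ultimately show ?thesis by metis
  qed
  show ?thesis unfolding tyler_res_def[abs_def] by (intro continuous_intros t d)
qed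

section \<open>Measurability of Tyler's point, of the ranks and of the statistic\<close>

context
  fixes M :: "(nat \<Rightarrow> real^2) measure" and m :: nat
  assumes comp: "\<And>i. i < m \<Longrightarrow> (\<lambda>x. x i) \<in> borel_measurable M"
begin

lemma comp_nth: "i < m \<Longrightarrow> (\<lambda>x. x i $ k) \<in> borel_measurable M"
  by (rule measurable_compose[OF comp borel_measurable_nth2])

lemma measurable_tyler_res: "(\<lambda>x. tyler_res m x z) \<in> borel_measurable M"
proof -
  have e: "tyler_res m x z = (2 / real m) *\<^sub>R (\<Sum>i<m. ((1 - (norm z)\<^sup>2) / disc_form z (x i)) *\<^sub>R (\<chi> a b. x i $ a * x i $ b)) + (- disc_mat z)" for x
    by (simp add: tyler_res_def)
  have o: "(\<lambda>x. (\<chi> a b. x i $ a * x i $ b) :: real^2^2) \<in> borel_measurable M" if "i < m" for i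
  proof -
    have "continuous_on UNIV (\<lambda>v. (\<chi> a b. v $ a * v $ b) :: real^2^2)"
      by (intro continuous_intros)
    then have "(\<lambda>v. (\<chi> a b. v $ a * v $ b) :: real^2^2) \<in> borel_measurable borel"
      by (rule borel_measurable_continuous_onI)
    from measurable_compose[OF comp[OF that] this] show ?thesis by simp
  qed
  have f: "(\<lambda>x. (1 - (norm z)\<^sup>2) / disc_form z (x i)) \<in> borel_measurable M" if "i < m" for i
    unfolding disc_form_def
    by (intro borel_measurable_divide borel_measurable_add borel_measurable_diff borel_measurable_times borel_measurable_power comp_nth that borel_measurable_const)
  show ?thesis unfolding e
    by (intro borel_measurable_add borel_measurable_scaleR borel_measurable_sum borel_measurable_const o f) auto
qed

lemma sets_tyler_ex:
  assumes "r < 1" "closed C"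
  shows "{x \<in> space M. \<exists>z\<in>cball 0 r \<inter> C. tyler_res m x z = 0} \<in> sets M"
proof (rule sets_ex_zero_compact)
  show "compact (cball (0::real\<times>real) r \<inter> C)" using assms by (intro compact_Int_closed) auto
  show "continuous_on (cball 0 r \<inter> C) (tyler_res m x)" for x
    by (rule continuous_on_subset[OF continuous_on_tyler_res[OF assms(1)]]) auto
qed (rule measurable_tyler_res)

text \<open>Failure of uniqueness is a countable union over separations d of events of this kind; a
  fixed d keeps the set of pairs compact.\<close>

lemma sets_tyler_ex2:
  assumes "r < 1" "0 < d"
  shows "{x \<in> space M. \<exists>p\<in>(cball 0 r \<times> cball 0 r) \<inter> {p. d \<le> dist (fst p) (snd p)}. (tyler_res m x (fst p), tyler_res m x (snd p)) = 0} \<in> sets M"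
proof (rule sets_ex_zero_compact)
  have "closed {p :: (real \<times> real) \<times> (real \<times> real). d \<le> dist (fst p) (snd p)}"
    by (intro closed_Collect_le continuous_intros)
  then show "compact ((cball (0::real\<times>real) r \<times> cball (0::real\<times>real) r) \<inter> {p. d \<le> dist (fst p) (snd p)})"
    by (intro compact_Int_closed compact_Times compact_cball)
  show "continuous_on ((cball 0 r \<times> cball 0 r) \<inter> {p. d \<le> dist (fst p) (snd p)}) (\<lambda>p. (tyler_res m x (fst p), tyler_res m x (snd p)))" for x
    by (intro continuous_on_Pair continuous_on_compose2[OF continuous_on_tyler_res[OF assms(1)]] continuous_on_fst continuous_on_snd continuous_on_id) auto
  show "(\<lambda>x. (tyler_res m x (fst p), tyler_res m x (snd p))) \<in> borel_measurable M" for p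
    using measurable_tyler_res by (intro borel_measurable_Pair)
qed

text \<open>Radii of closed discs that exhaust the open unit disc.\<close>

definition disc_radius :: "nat \<Rightarrow> real" where "disc_radius n = 1 - 1 / real (Suc n)"

lemma disc_radius: "disc_radius n < 1" "norm (z :: real \<times> real) < 1 \<Longrightarrow> \<forall>\<^sub>F n in sequentially. norm z \<le> disc_radius n"
proof -
  show "disc_radius n < 1" by (simp add: disc_radius_def)
  assume "norm z < 1"
  have "disc_radius \<longlonglongrightarrow> 1 - 0" unfolding disc_radius_def
    by (intro tendsto_intros LIMSEQ_Suc[OF lim_1_over_n])
  then have "disc_radius \<longlonglongrightarrow> 1" by simp
  from order_tendstoD(1)[OF this \<open>norm z < 1\<close>] show "\<forall>\<^sub>F n in sequentially. norm z \<le> disc_radius n"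
    by (rule eventually_mono) simp
qed

lemma sets_tyler_disc_in:
  assumes "closed C"
  shows "{x \<in> space M. \<exists>z. norm z < 1 \<and> z \<in> C \<and> tyler_res m x z = 0} \<in> sets M"
proof -
  have "{x \<in> space M. \<exists>z. norm z < 1 \<and> z \<in> C \<and> tyler_res m x z = 0}
      = (\<Union>n. {x \<in> space M. \<exists>z\<in>cball 0 (disc_radius n) \<inter> C. tyler_res m x z = 0})" (is "?L = ?R")
  proof
    show "?L \<subseteq> ?R"
    proof clarify
      fix x a b assume "x \<in> space M" "norm (a, b) < 1" "(a, b) \<in> C" "tyler_res m x (a, b) = 0"
      moreover obtain n where "norm (a, b) \<le> disc_radius n"
        using eventually_happens[OF disc_radius(2)[OF \<open>norm (a, b) < 1\<close>]] by auto
      ultimately have "\<exists>z\<in>cball 0 (disc_radius n) \<inter> C. tyler_res m x z = 0" by (intro bexI[of _ "(a, b)"]) auto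
      with \<open>x \<in> space M\<close> show "x \<in> ?R" by blast
    qed
    show "?R \<subseteq> ?L" using disc_radius(1) by (fastforce intro: le_less_trans)
  qed
  then show ?thesis using sets_tyler_ex[OF disc_radius(1) assms] by auto
qed

lemma sets_tyler_ex1: "{x \<in> space M. \<exists>!z. norm z < 1 \<and> tyler_res m x z = 0} \<in> sets M"
proof -
  define B where "B = {x \<in> space M. \<exists>z z'. norm z < 1 \<and> norm z' < 1 \<and> z \<noteq> z' \<and> tyler_res m x z = 0 \<and> tyler_res m x z' = 0}"
  have "B = (\<Union>n. {x \<in> space M. \<exists>p\<in>(cball 0 (disc_radius n) \<times> cball 0 (disc_radius n)) \<inter> {p. 1 / real (Suc n) \<le> dist (fst p) (snd p)}.
     (tyler_res m x (fst p), tyler_res m x (snd p)) = 0})" (is "_ = (\<Union>n. ?R n)")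
  proof
    show "B \<subseteq> (\<Union>n. ?R n)"
    proof
      fix x assume "x \<in> B"
      then obtain z z' where xM: "x \<in> space M" and z: "norm z < 1" "norm z' < 1" "z \<noteq> z'" "tyler_res m x z = 0" "tyler_res m x z' = 0"
        by (auto simp only: B_def mem_Collect_eq)
      have "0 < dist z z'" using z by simp
      from order_tendstoD(2)[OF LIMSEQ_Suc[OF lim_1_over_n] this]
      have "\<forall>\<^sub>F n in sequentially. 1 / real (Suc n) \<le> dist z z'" by (rule eventually_mono) simp
      from eventually_happens[OF eventually_conj[OF this eventually_conj[OF disc_radius(2)[OF z(1)] disc_radius(2)[OF z(2)]]]]
      obtain n where "1 / real (Suc n) \<le> dist z z'" "norm z \<le> disc_radius n" "norm z' \<le> disc_radius n" by auto
      then have "x \<in> ?R n" using z xM by (intro CollectI conjI bexI[of _ "(z, z')"]) (auto simp flip: zero_prod_def)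
      then show "x \<in> (\<Union>n. ?R n)" by blast
    qed
    show "(\<Union>n. ?R n) \<subseteq> B"
    proof
      fix x assume "x \<in> (\<Union>n. ?R n)"
      then obtain n p where xM: "x \<in> space M" and p: "p \<in> (cball 0 (disc_radius n) \<times> cball 0 (disc_radius n)) \<inter> {p. 1 / real (Suc n) \<le> dist (fst p) (snd p)}"
        "(tyler_res m x (fst p), tyler_res m x (snd p)) = 0" by blast
      have "0 < 1 / real (Suc n)" by simp
      also have "\<dots> \<le> dist (fst p) (snd p)" using p(1) by auto
      finally have "fst p \<noteq> snd p" by auto
      moreover have "norm (fst p) < 1" "norm (snd p) < 1" using p(1) disc_radius(1)[of n] by (auto simp: mem_Times_iff)
      moreover have "tyler_res m x (fst p) = 0" "tyler_res m x (snd p) = 0" using p(2) by (auto simp: zero_prod_def)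
      ultimately show "x \<in> B" unfolding B_def using xM by blast
    qed
  qed
  then have "B \<in> sets M" using sets_tyler_ex2[OF disc_radius(1)] by auto
  moreover have "{x \<in> space M. \<exists>!z. norm z < 1 \<and> tyler_res m x z = 0} = {x \<in> space M. \<exists>z. norm z < 1 \<and> z \<in> UNIV \<and> tyler_res m x z = 0} - B"
    unfolding B_def by blast
  ultimately show ?thesis using sets_tyler_disc_in[of UNIV] by auto
qed

text \<open>For closed C the preimage consists of the samples whose unique zero lies in C, together
  with the samples without a unique zero if C contains the default.\<close>

lemma measurable_tyler_disc: "tyler_disc m \<in> borel_measurable M"
  unfolding borel_eq_closed
proof (rule measurable_measure_of)
  fix C :: "(real \<times> real) set" assume "C \<in> Collect closed"
  then have C: "closed C" by simp
  let ?E = "{x \<in> space M. \<exists>!z. norm z < 1 \<and> tyler_res m x z = 0}"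
  have "tyler_disc m -` C \<inter> space M = (?E \<inter> {x \<in> space M. \<exists>z. norm z < 1 \<and> z \<in> C \<and> tyler_res m x z = 0}) \<union> ((space M - ?E) \<inter> (if 0 \<in> C then space M else {}))"
  proof (rule set_eqI)
    fix x
    show "x \<in> tyler_disc m -` C \<inter> space M \<longleftrightarrow> x \<in> (?E \<inter> {x \<in> space M. \<exists>z. norm z < 1 \<and> z \<in> C \<and> tyler_res m x z = 0}) \<union> ((space M - ?E) \<inter> (if 0 \<in> C then space M else {}))"
    proof (cases "\<exists>!z. norm z < 1 \<and> tyler_res m x z = 0")
      case True
      have "norm (tyler_disc m x) < 1 \<and> tyler_res m x (tyler_disc m x) = 0"
        using theI'[OF True] True by (simp add: tyler_disc_def)
      then have "tyler_disc m x \<in> C \<longleftrightarrow> (\<exists>z. norm z < 1 \<and> z \<in> C \<and> tyler_res m x z = 0)"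
        using True by blast
      then show ?thesis using True by auto
    qed (simp add: tyler_disc_def)
  qed
  also have "\<dots> \<in> sets M" using sets_tyler_ex1 sets_tyler_disc_in[OF C] by auto
  finally show "tyler_disc m -` C \<inter> space M \<in> sets M" .
qed auto

lemma measurable_disc_form:
  assumes "i < m"
  shows "(\<lambda>x. disc_form (tyler_disc m x) (x i)) \<in> borel_measurable M"
proof -
  have "(\<lambda>x. fst (tyler_disc m x)) \<in> borel_measurable M" "(\<lambda>x. snd (tyler_disc m x)) \<in> borel_measurable M"
    by (auto intro!: measurable_compose[OF measurable_tyler_disc] borel_measurable_continuous_onI continuous_intros)
  then show ?thesis unfolding disc_form_def
    by (intro borel_measurable_add borel_measurable_diff borel_measurable_times borel_measurable_power comp_nth assms borel_measurable_const)
qed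

lemma measurable_pm_rank:
  assumes i: "i < m"
  shows "(\<lambda>x. pm_rank m x i) \<in> measurable M (count_space UNIV)"
  unfolding pm_rank_eq
proof (rule measurable_card)
  fix j
  show "{x \<in> space M. j \<in> {j. j < m \<and> disc_form (tyler_disc m x) (x j) \<le> disc_form (tyler_disc m x) (x i)}} \<in> sets M"
  proof (cases "j < m")
    case True
    note [measurable] = measurable_disc_form[OF True] measurable_disc_form[OF i]
    show ?thesis using True by simp
  qed simp
qed

lemma measurable_slope_rank:
  assumes i: "i < m"
  shows "(\<lambda>x. slope_rank m x i) \<in> measurable M (count_space UNIV)"
  unfolding slope_rank_def
proof (rule measurable_card)
  fix j
  show "{x \<in> space M. j \<in> {j. j < m \<and> slope (x j) \<le> slope (x i)}} \<in> sets M"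
  proof (cases "j < m")
    case True
    note [measurable] = comp[OF True] comp[OF i]
    show ?thesis using True by simp
  qed simp
qed

lemma measurable_interdirection:
  assumes i: "i < m" and j: "j < m"
  shows "(\<lambda>x. interdirection m x i j) \<in> borel_measurable M"
proof -
  have "(\<lambda>x. interdirection_count m x i j) \<in> measurable M (count_space UNIV)"
    unfolding interdirection_count_def
  proof (rule measurable_card)
    fix l
    show "{x \<in> space M. l \<in> {l. l < m \<and> l \<notin> {i, j} \<and> line_separates (x l) (x i) (x j)}} \<in> sets M"
    proof (cases "l < m")
      case True
      note [measurable] = comp[OF True] comp_nth[OF True] comp_nth[OF i] comp_nth[OF j]
      have "{x \<in> space M. x l \<noteq> 0 \<and> cross2 (x l) (x i) * cross2 (x l) (x j) < 0} \<in> sets M"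
        unfolding cross2_def by measurable
      then show ?thesis using True by (cases "l \<in> {i, j}") (auto simp: line_separates_iff)
    qed simp
  qed
  then have "(\<lambda>x. real (interdirection_count m x i j)) \<in> borel_measurable M"
    by (rule measurable_compose) simp
  then show ?thesis unfolding interdirection_def by simp
qed

lemma measurable_rank_score:
  assumes i: "i < m"
  shows "(\<lambda>x. J (real (pm_rank m x i) / (real m + 1)) :: real) \<in> borel_measurable M"
  by (rule measurable_compose[OF measurable_pm_rank[OF i]]) simp

lemma measurable_Q_stat: "Q_stat f m \<in> borel_measurable M"
  unfolding Q_stat_def[abs_def]
  by (intro borel_measurable_times borel_measurable_const borel_measurable_sum measurable_rank_score
      measurable_compose[OF _ borel_measurable_cos] measurable_interdirection) auto

lemma measurable_line_score:
  assumes i: "i < m"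
  shows "(\<lambda>x. line_score J m x i) \<in> borel_measurable M"
proof -
  have "(\<lambda>x. cis (pi * (real (slope_rank m x i) / real m - 1 / 2))) \<in> borel_measurable M"
    by (rule measurable_compose[OF measurable_slope_rank[OF i]]) simp
  moreover have "(\<lambda>x. complex_of_real (J (real (pm_rank m x i) / (real m + 1)))) \<in> borel_measurable M"
    by (rule measurable_compose[OF measurable_pm_rank[OF i]]) simp
  ultimately show ?thesis unfolding line_score_def by (rule borel_measurable_times[rotated])
qed

end

text \<open>Fubini with the coordinate i innermost: it is enough that each section of the
  exceptional set in this coordinate is null.\<close>

lemma AE_PiM_coordinate:
  fixes N :: "'b measure"
  assumes N: "prob_space N" and I: "finite I" "i \<in> I"
    and meas: "{x \<in> space (PiM I (\<lambda>_. N)). P x} \<in> sets (PiM I (\<lambda>_. N))"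
    and AE: "\<And>x. x \<in> space (PiM (I - {i}) (\<lambda>_. N)) \<Longrightarrow> AE y in N. P (x(i := y))"
  shows "AE x in PiM I (\<lambda>_. N). P x"
proof -
  interpret N: prob_space N by fact
  interpret product_sigma_finite "\<lambda>_. N" ..
  let ?M = "PiM I (\<lambda>_. N)"
  define A where "A = {x \<in> space ?M. \<not> P x}"
  have "A = space ?M - {x \<in> space ?M. P x}" by (auto simp: A_def)
  then have A [measurable]: "A \<in> sets ?M" using meas by auto
  have I': "insert i (I - {i}) = I" using I by auto
  have "emeasure ?M A = (\<integral>\<^sup>+x. indicator A x \<partial>?M)" by simp
  also have "\<dots> = (\<integral>\<^sup>+x. \<integral>\<^sup>+y. indicator A (x(i := y)) \<partial>N \<partial>PiM (I - {i}) (\<lambda>_. N))"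
    using product_nn_integral_insert[of "I - {i}" i "indicator A"] I I' by simp
  also have "\<dots> = (\<integral>\<^sup>+x. 0 \<partial>PiM (I - {i}) (\<lambda>_. N))"
  proof (rule nn_integral_cong)
    fix x assume x: "x \<in> space (PiM (I - {i}) (\<lambda>_. N))"
    have "AE y in N. indicator A (x(i := y)) = (0::ennreal)"
      using AE[OF x] by eventually_elim (simp add: A_def)
    then have "(\<integral>\<^sup>+y. indicator A (x(i := y)) \<partial>N) = (\<integral>\<^sup>+y. 0 \<partial>N)" by (rule nn_integral_cong_AE)
    then show "(\<integral>\<^sup>+y. indicator A (x(i := y)) \<partial>N) = 0" by simp
  qed
  finally have "emeasure ?M A = 0" by simp
  then show ?thesis using A by (intro AE_I[where N=A]) (simp_all add: A_def)
qed

section \<open>The law of the sample and the null events of ties\<close>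

lemma pole_sample_eq: "pole_sample m \<mu> = PiM {..<m} (\<lambda>_. pole_law \<mu>)"
  by (simp add: pole_sample_def pole_law_def)

lemma pole_sample_component: "i < m \<Longrightarrow> (\<lambda>x. x i) \<in> borel_measurable (pole_sample m \<mu>)"
proof -
  assume "i < m"
  then have "(\<lambda>x. x i) \<in> measurable (PiM {..<m} (\<lambda>_. pole_law \<mu>)) (pole_law \<mu>)"
    by (intro measurable_component_singleton) auto
  then show ?thesis unfolding pole_sample_eq by (simp cong: measurable_cong_sets)
qed

interpretation pole_sample: prob_space "pole_sample m \<mu>" for m \<mu>
  unfolding pole_sample_eq by (rule prob_space_PiM) (rule prob_space_pole_law)

lemma distr_pole_sample_component:
  assumes "i < m"
  shows "distr (pole_sample m \<mu>) (pole_law \<mu>) (\<lambda>x. x i) = pole_law \<mu>"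
  unfolding pole_sample_eq using assms by (intro distr_PiM_component) (auto simp: prob_space_pole_law)

lemma AE_pole_sample_component:
  assumes "i < m" and "AE y in pole_law \<mu>. P y"
  shows "AE x in pole_sample m \<mu>. P (x i)"
proof -
  have m: "(\<lambda>x. x i) \<in> measurable (pole_sample m \<mu>) (pole_law \<mu>)"
    using pole_sample_component[OF assms(1)] by (simp cong: measurable_cong_sets)
  have "AE y in distr (pole_sample m \<mu>) (pole_law \<mu>) (\<lambda>x. x i). P y"
    unfolding distr_pole_sample_component[OF assms(1)] by (rule assms(2))
  from AE_distrD[OF m this] show ?thesis .
qed

lemma AE_pole_lawI: "AE x in lborel. P x \<Longrightarrow> AE x in pole_law \<mu>. P x"
  unfolding pole_law_def by (subst AE_density) auto

text \<open>In polar coordinates the inner integral runs over a finite set. This suits ties of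
  pseudo-Mahalanobis distances, since Tyler's matrix does not change while one observation moves
  along its line.\<close>

lemma AE_lborel_polar:
  fixes A :: "(real^2) set"
  assumes [measurable]: "A \<in> sets borel"
    and fin: "\<And>s. finite {\<rho>. vec2 (\<rho> / sqrt (1 + s\<^sup>2)) (\<rho> * s / sqrt (1 + s\<^sup>2)) \<in> A}"
  shows "AE x in lborel. x \<notin> A"
proof -
  have "emeasure lborel A = (\<integral>\<^sup>+x. indicator A x \<partial>lborel)" by simp
  also have "\<dots> = (\<integral>\<^sup>+s. \<integral>\<^sup>+\<rho>. indicator A (vec2 (\<rho> / sqrt (1 + s\<^sup>2)) (\<rho> * s / sqrt (1 + s\<^sup>2))) *
       ennreal (\<bar>\<rho>\<bar> / (1 + s\<^sup>2)) \<partial>lborel \<partial>lborel)" by (rule nn_integral_polar) simp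
  also have "\<dots> = (\<integral>\<^sup>+(s::real). 0 \<partial>lborel)"
  proof (rule nn_integral_cong)
    fix s :: real
    define F where "F = {\<rho>. vec2 (\<rho> / sqrt (1 + s\<^sup>2)) (\<rho> * s / sqrt (1 + s\<^sup>2)) \<in> A}"
    have "F \<in> null_sets lborel" using fin[of s] by (intro finite_imp_null_set_lborel) (simp add: F_def)
    then have "AE \<rho> in lborel. \<rho> \<notin> F" by (rule AE_not_in)
    then have "AE \<rho> in lborel. indicator A (vec2 (\<rho> / sqrt (1 + s\<^sup>2)) (\<rho> * s / sqrt (1 + s\<^sup>2))) * ennreal (\<bar>\<rho>\<bar> / (1 + s\<^sup>2)) = 0"
      by eventually_elim (simp add: F_def)
    then have "(\<integral>\<^sup>+\<rho>. indicator A (vec2 (\<rho> / sqrt (1 + s\<^sup>2)) (\<rho> * s / sqrt (1 + s\<^sup>2))) *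
       ennreal (\<bar>\<rho>\<bar> / (1 + s\<^sup>2)) \<partial>lborel) = (\<integral>\<^sup>+(\<rho>::real). 0 \<partial>lborel)" by (rule nn_integral_cong_AE)
    then show "(\<integral>\<^sup>+\<rho>. indicator A (vec2 (\<rho> / sqrt (1 + s\<^sup>2)) (\<rho> * s / sqrt (1 + s\<^sup>2))) *
       ennreal (\<bar>\<rho>\<bar> / (1 + s\<^sup>2)) \<partial>lborel) = 0" by simp
  qed
  finally have "A \<in> null_sets lborel" by (auto simp: null_sets_def)
  then show ?thesis by (rule AE_not_in)
qed

lemma disc_form_scale: "disc_form z (c *\<^sub>R x) = c\<^sup>2 * disc_form z x"
  by (simp add: disc_form_def power2_eq_square algebra_simps)

text \<open>The square of the scale cancels between the form and the outer product: Tyler's equation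
  sees only the line through each observation.\<close>

lemma tyler_res_scale:
  assumes "c \<noteq> 0"
  shows "tyler_res m (x(i := c *\<^sub>R y)) = tyler_res m (x(i := y))"
proof (rule ext)
  fix z
  have "((1 - (norm z)\<^sup>2) / disc_form z ((x(i := c *\<^sub>R y)) j)) *\<^sub>R ((\<chi> a b. (x(i := c *\<^sub>R y)) j $ a * (x(i := c *\<^sub>R y)) j $ b) :: real^2^2)
    = ((1 - (norm z)\<^sup>2) / disc_form z ((x(i := y)) j)) *\<^sub>R (\<chi> a b. (x(i := y)) j $ a * (x(i := y)) j $ b)" for j
    using assms by (simp add: disc_form_scale mat2_eq_iff power2_eq_square)
  then show "tyler_res m (x(i := c *\<^sub>R y)) z = tyler_res m (x(i := y)) z"
    unfolding tyler_res_def by simp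
qed

lemma tyler_disc_scale: "c \<noteq> 0 \<Longrightarrow> tyler_disc m (x(i := c *\<^sub>R y)) = tyler_disc m (x(i := y))"
  unfolding tyler_disc_def tyler_res_scale ..

text \<open>For slopes, the law of one slope has a density. For the forms, Tyler's point is fixed
  while an observation moves along its line, so a tie is a quadratic equation in the signed radius
  with at most two solutions.\<close>

lemma AE_no_ties:
  "AE x in pole_sample m \<mu>. (\<forall>i<m. x i $ 1 \<noteq> 0) \<and> inj_on (\<lambda>i. slope (x i)) {..<m} \<and>
     inj_on (\<lambda>i. disc_form (tyler_disc m x) (x i)) {..<m}"
proof -
  have 1: "AE x in pole_sample m \<mu>. x i $ 1 \<noteq> 0" if "i < m" for i
    by (rule AE_pole_sample_component[OF that AE_pole_law_nth1])
  have 2: "AE x in pole_sample m \<mu>. slope (x i) \<noteq> slope (x j)" if i: "i < m" and j: "j < m" and ij: "i \<noteq> j" for i j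
    unfolding pole_sample_eq
  proof (rule AE_PiM_coordinate[where i=i])
    have "{x \<in> space (pole_sample m \<mu>). slope (x i) \<noteq> slope (x j)} \<in> sets (pole_sample m \<mu>)"
      by (intro borel_measurable_neq measurable_compose[OF pole_sample_component borel_measurable_slope] i j)
    then show "{x \<in> space (Pi\<^sub>M {..<m} (\<lambda>_. pole_law \<mu>)). slope (x i) \<noteq> slope (x j)} \<in> sets (Pi\<^sub>M {..<m} (\<lambda>_. pole_law \<mu>))"
      by (simp only: pole_sample_eq)
    fix x :: "nat \<Rightarrow> real^2"
    have "AE s in cauchy_law. s \<noteq> slope (x j)"
      unfolding cauchy_law_def using AE_lborel_singleton[of "slope (x j)"] by (subst AE_density) auto
    then have "AE y in pole_law 0. slope y \<noteq> slope (x j)"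
      unfolding distr_slope[symmetric] by (subst (asm) AE_distr_iff) auto
    then have "AE y in pole_law \<mu>. slope y \<noteq> slope (x j)"
      unfolding pole_law_density[of \<mu>] by (subst AE_density) auto
    then show "AE y in pole_law \<mu>. slope ((x(i := y)) i) \<noteq> slope ((x(i := y)) j)"
      using ij by simp
  qed (use i prob_space_pole_law in auto)
  have 3: "AE x in pole_sample m \<mu>. disc_form (tyler_disc m x) (x i) \<noteq> disc_form (tyler_disc m x) (x j)"
    if i: "i < m" and j: "j < m" and ij: "i \<noteq> j" for i j
    unfolding pole_sample_eq
  proof (rule AE_PiM_coordinate[where i=i])
    have "{x \<in> space (pole_sample m \<mu>). disc_form (tyler_disc m x) (x i) \<noteq> disc_form (tyler_disc m x) (x j)} \<in> sets (pole_sample m \<mu>)"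
      by (intro borel_measurable_neq measurable_disc_form pole_sample_component i j)
    then show "{x \<in> space (Pi\<^sub>M {..<m} (\<lambda>_. pole_law \<mu>)). disc_form (tyler_disc m x) (x i) \<noteq> disc_form (tyler_disc m x) (x j)} \<in> sets (Pi\<^sub>M {..<m} (\<lambda>_. pole_law \<mu>))"
      by (simp only: pole_sample_eq)
    fix x :: "nat \<Rightarrow> real^2"
    define T where "T y = tyler_disc m (x(i := y))" for y
    \<comment> \<open>The condition on the first coordinate excludes the origin, where the scaling
      invariance of Tyler's point breaks down.\<close>
    define A where "A = {y. y $ 1 \<noteq> 0 \<and> disc_form (T y) y = disc_form (T y) (x j)}"
    have T: "T \<in> borel_measurable borel"
    proof -
      have c: "(\<lambda>f. f k) \<in> borel_measurable (PiM UNIV (\<lambda>_. borel :: (real^2) measure))" if "k < m" for k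
        by (rule measurable_component_singleton) simp
      have "(\<lambda>y. x(i := y)) \<in> measurable borel (PiM UNIV (\<lambda>_. borel :: (real^2) measure))"
        by (rule measurable_PiM_single') auto
      from measurable_compose[OF this measurable_tyler_disc[OF c]] show ?thesis by (simp add: T_def[abs_def])
    qed
    have fs: "(\<lambda>y. fst (T y)) \<in> borel_measurable borel" "(\<lambda>y. snd (T y)) \<in> borel_measurable borel"
      using measurable_compose[OF T borel_measurable_continuous_onI[OF continuous_on_fst[OF continuous_on_id]]]
        measurable_compose[OF T borel_measurable_continuous_onI[OF continuous_on_snd[OF continuous_on_id]]] by simp_all
    have "(\<lambda>y. disc_form (T y) y) \<in> borel_measurable borel" "(\<lambda>y. disc_form (T y) (x j)) \<in> borel_measurable borel"
      unfolding disc_form_def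
      by (intro borel_measurable_add borel_measurable_diff borel_measurable_times borel_measurable_power
          borel_measurable_const fs borel_measurable_nth2)+
    from sets.Int[OF borel_measurable_neq[OF borel_measurable_nth2 borel_measurable_const] borel_measurable_eq[OF this]]
    have A: "A \<in> sets borel" by (simp add: A_def Collect_conj_eq)
    have "AE y in lborel. y \<notin> A"
    proof (rule AE_lborel_polar)
      fix s :: real
      define e where "e = vec2 (1 / sqrt (1 + s\<^sup>2)) (s / sqrt (1 + s\<^sup>2))"
      have e0: "e \<noteq> 0" using one_plus_sq_pos[of s] by (simp add: e_def vec2_eq_iff)
      have n: "norm (T e) < 1" unfolding T_def by (rule norm_tyler_disc)
      define D where "D = disc_form (T e) e"
      have D: "0 < D" unfolding D_def by (rule disc_form_pos[OF n e0])
      have v: "vec2 (\<rho> / sqrt (1 + s\<^sup>2)) (\<rho> * s / sqrt (1 + s\<^sup>2)) = \<rho> *\<^sub>R e" for \<rho>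
        by (simp add: e_def vec2_eq_iff)
      have "{\<rho>. \<rho> *\<^sub>R e \<in> A} \<subseteq> {\<rho>. \<rho>\<^sup>2 = disc_form (T e) (x j) / D}"
      proof clarify
        fix \<rho> assume a: "\<rho> *\<^sub>R e \<in> A"
        then have "\<rho> \<noteq> 0" by (auto simp: A_def)
        then have "T (\<rho> *\<^sub>R e) = T e" unfolding T_def by (rule tyler_disc_scale)
        with a have "\<rho>\<^sup>2 * D = disc_form (T e) (x j)" by (simp add: A_def disc_form_scale D_def)
        then show "\<rho>\<^sup>2 = disc_form (T e) (x j) / D" using D by (simp add: field_simps)
      qed
      also have "\<dots> \<subseteq> {sqrt (disc_form (T e) (x j) / D), - sqrt (disc_form (T e) (x j) / D)}"
      proof clarify
        fix \<rho> assume "\<rho>\<^sup>2 = disc_form (T e) (x j) / D" "\<rho> \<noteq> sqrt (disc_form (T e) (x j) / D)"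
        then show "\<rho> = - sqrt (disc_form (T e) (x j) / D)" by (metis abs_if minus_minus real_sqrt_abs)
      qed
      finally show "finite {\<rho>. vec2 (\<rho> / sqrt (1 + s\<^sup>2)) (\<rho> * s / sqrt (1 + s\<^sup>2)) \<in> A}"
        unfolding v by (rule finite_subset) simp
    qed (rule A)
    then have "AE y in pole_law \<mu>. y \<notin> A" by (rule AE_pole_lawI)
    then show "AE y in pole_law \<mu>. disc_form (tyler_disc m (x(i := y))) ((x(i := y)) i) \<noteq> disc_form (tyler_disc m (x(i := y))) ((x(i := y)) j)"
      using AE_pole_law_nth1[of \<mu>] by eventually_elim (use ij in \<open>auto simp: A_def T_def\<close>)
  qed (use i prob_space_pole_law in auto)
  have "AE x in pole_sample m \<mu>. \<forall>i\<in>{..<m}. x i $ 1 \<noteq> 0" using 1 by (intro AE_finite_allI) auto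
  moreover have "AE x in pole_sample m \<mu>. \<forall>p\<in>{p\<in>{..<m} \<times> {..<m}. fst p \<noteq> snd p}. slope (x (fst p)) \<noteq> slope (x (snd p))"
    using 2 by (intro AE_finite_allI) auto
  moreover have "AE x in pole_sample m \<mu>. \<forall>p\<in>{p\<in>{..<m} \<times> {..<m}. fst p \<noteq> snd p}.
      disc_form (tyler_disc m x) (x (fst p)) \<noteq> disc_form (tyler_disc m x) (x (snd p))"
    using 3 by (intro AE_finite_allI) auto
  ultimately show ?thesis by eventually_elim (auto simp: inj_on_def)
qed

text \<open>Without ties the ranks are a permutation of 1, ..., m, so sums over ranks are
  deterministic. This evaluates the fourth moments of the rank scores.\<close>

lemma sum_rank:
  fixes d :: "nat \<Rightarrow> real" and \<phi> :: "nat \<Rightarrow> real"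
  assumes inj: "inj_on d {..<m}"
  shows "(\<Sum>i<m. \<phi> (card {j. j < m \<and> d j \<le> d i})) = (\<Sum>k=1..m. \<phi> k)"
proof -
  define r where "r i = card {j. j < m \<and> d j \<le> d i}" for i
  have mono: "r i < r k" if "i < m" "k < m" "d i < d k" for i k
  proof -
    have "k \<in> {j. j < m \<and> d j \<le> d k}" "k \<notin> {j. j < m \<and> d j \<le> d i}" using that by auto
    moreover have "{j. j < m \<and> d j \<le> d i} \<subseteq> {j. j < m \<and> d j \<le> d k}" using that by auto
    ultimately show ?thesis unfolding r_def by (intro psubset_card_mono) auto
  qed
  have rinj: "inj_on r {..<m}"
  proof (rule inj_onI)
    fix i k assume "i \<in> {..<m}" "k \<in> {..<m}" "r i = r k"
    then have "\<not> d i < d k" "\<not> d k < d i" using mono[of i k] mono[of k i] by auto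
    then have "d i = d k" by simp
    then show "i = k" using inj \<open>i \<in> {..<m}\<close> \<open>k \<in> {..<m}\<close> by (simp add: inj_on_def)
  qed
  have sub: "r ` {..<m} \<subseteq> {1..m}"
  proof
    fix y assume "y \<in> r ` {..<m}"
    then obtain i where i: "i < m" "y = r i" by auto
    have "card {i} \<le> r i" unfolding r_def using i by (intro card_mono) auto
    moreover have "r i \<le> card {..<m}" unfolding r_def by (intro card_mono) auto
    ultimately show "y \<in> {1..m}" using i by simp
  qed
  have "r ` {..<m} = {1..m}"
    by (rule card_subset_eq[OF _ sub]) (simp_all add: card_image[OF rinj])
  then show ?thesis using sum.reindex[OF rinj, of \<phi>] by (simp add: r_def)
qed

section \<open>Changing signs\<close>

lemma integral_lborel_odd:
  fixes g :: "real^2 \<Rightarrow> real"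
  assumes [measurable]: "g \<in> borel_measurable borel" and odd: "\<And>y. g (- y) = - g y"
  shows "(\<integral>y. g y \<partial>lborel) = 0"
proof -
  have e: "lborel = distr lborel borel (\<lambda>x::real^2. - x)"
    using lborel_affine[of "-1" "0 :: real^2"] by (simp add: density_1)
  have "(\<integral>y. g y \<partial>lborel) = (\<integral>y. g (- y) \<partial>lborel)"
    by (subst e, subst integral_distr) simp_all
  also have "\<dots> = - (\<integral>y. g y \<partial>lborel)" by (simp add: odd)
  finally show ?thesis by simp
qed

text \<open>Averaging over \<open>y\<close> and \<open>- y\<close> turns the integral of \<open>sgn (y $ 1) * h y\<close>, for even \<open>h\<close>, into that of \<open>flip_score \<mu> y * h y\<close>,
  which is small together with \<open>\<mu>\<close>.\<close>

definition flip_score :: "real^2 \<Rightarrow> real^2 \<Rightarrow> real" where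
  "flip_score \<mu> y = sgn (y $ 1) * ((1 - pole_density \<mu> (- y) / pole_density \<mu> y) / 2)"

definition flip_bound :: "real^2 \<Rightarrow> real" where
  "flip_bound \<mu> = (ratio_bound (2 * norm \<mu>) - 1) / 2"

lemma borel_measurable_flip_score [measurable]: "flip_score \<mu> \<in> borel_measurable borel"
  unfolding flip_score_def[abs_def] by measurable

lemma pole_density_flip: "pole_density \<mu> (- y) = pole_density (- \<mu>) y"
proof -
  have "norm (- y - \<mu>) = norm (y - (- \<mu>))" by (metis minus_add_distrib norm_minus_cancel diff_conv_add_uminus minus_minus)
  then show ?thesis by (simp add: pole_density_def)
qed

lemma flip_bound_nonneg: "0 \<le> flip_bound \<mu>"
  using ratio_bound_ge_1[of "2 * norm \<mu>"] by (simp add: flip_bound_def)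

lemma pole_density_flip_ratio:
  "pole_density \<mu> (- y) / pole_density \<mu> y \<le> ratio_bound (2 * norm \<mu>)"
  "1 / ratio_bound (2 * norm \<mu>) \<le> pole_density \<mu> (- y) / pole_density \<mu> y"
proof -
  have n: "norm (- \<mu> - \<mu>) = 2 * norm \<mu>" "norm (\<mu> - - \<mu>) = 2 * norm \<mu>"
    using norm_scaleR[of 2 \<mu>] norm_minus_cancel[of "\<mu> + \<mu>"] by (simp_all add: scaleR_2)
  have p: "0 < pole_density \<mu> y" "0 < pole_density (- \<mu>) y" by (simp_all add: pole_density_pos)
  show "pole_density \<mu> (- y) / pole_density \<mu> y \<le> ratio_bound (2 * norm \<mu>)"
    using pole_density_ratio[of "- \<mu>" y \<mu>, unfolded n] p by (simp add: pole_density_flip pos_divide_le_eq)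
  have "1 \<le> ratio_bound (2 * norm \<mu>)" by (simp add: ratio_bound_ge_1)
  then show "1 / ratio_bound (2 * norm \<mu>) \<le> pole_density \<mu> (- y) / pole_density \<mu> y"
    using pole_density_ratio[of \<mu> y "- \<mu>", unfolded n] p by (simp add: pole_density_flip field_simps)
qed

lemma abs_flip_score_le: "\<bar>flip_score \<mu> y\<bar> \<le> flip_bound \<mu>"
proof -
  let ?r = "pole_density \<mu> (- y) / pole_density \<mu> y" and ?K = "ratio_bound (2 * norm \<mu>)"
  have K: "1 \<le> ?K" by (simp add: ratio_bound_ge_1)
  have "1 - (?K - 1) \<le> 1 / ?K"
  proof -
    have "(2 - ?K) * ?K \<le> 1"
      using sum_power2_ge_zero[of "?K - 1" 0] by (simp add: power2_eq_square algebra_simps)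
    then show ?thesis using K by (simp add: field_simps)
  qed
  then have "\<bar>1 - ?r\<bar> \<le> ?K - 1" using pole_density_flip_ratio[of \<mu> y] K by (auto simp: abs_le_iff)
  then have "\<bar>(1 - ?r) / 2\<bar> \<le> flip_bound \<mu>" by (simp add: flip_bound_def abs_le_iff)
  moreover have "\<bar>sgn (y $ 1) * ((1 - ?r) / 2)\<bar> \<le> 1 * \<bar>(1 - ?r) / 2\<bar>"
    unfolding abs_mult by (intro mult_right_mono) (auto simp: abs_sgn_eq)
  ultimately show ?thesis unfolding flip_score_def by linarith
qed

text \<open>Multiplied by the density, \<open>sgn (y $ 1) - flip_score \<mu> y\<close> becomes the
  sign times the average of the densities at y and - y, which is an odd function.\<close>

lemma integral_flip_pole_law:
  fixes H :: "real^2 \<Rightarrow> real"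
  assumes [measurable]: "H \<in> borel_measurable borel" and even: "\<And>y. H (- y) = H y"
  shows "(\<integral>y. (sgn (y $ 1) - flip_score \<mu> y) * H y \<partial>pole_law \<mu>) = 0"
proof -
  have "(\<integral>y. (sgn (y $ 1) - flip_score \<mu> y) * H y \<partial>pole_law \<mu>)
      = (\<integral>y. pole_density \<mu> y * ((sgn (y $ 1) - flip_score \<mu> y) * H y) \<partial>lborel)"
    unfolding pole_law_def by (subst integral_density) (auto simp: less_imp_le pole_density_pos)
  also have "\<dots> = 0"
  proof (rule integral_lborel_odd)
    fix y
    have e: "pole_density \<mu> y * ((sgn (y $ 1) - flip_score \<mu> y) * H y)
        = sgn (y $ 1) * (pole_density \<mu> y + pole_density \<mu> (- y)) / 2 * H y" for y
      using pole_density_pos[of \<mu> y] by (simp add: flip_score_def field_simps)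
    show "pole_density \<mu> (- y) * ((sgn ((- y) $ 1) - flip_score \<mu> (- y)) * H (- y))
        = - (pole_density \<mu> y * ((sgn (y $ 1) - flip_score \<mu> y) * H y))"
      unfolding e by (simp add: even sgn_minus add.commute)
  qed measurable
  finally show ?thesis .
qed

definition even_at :: "nat \<Rightarrow> ((nat \<Rightarrow> real^2) \<Rightarrow> 'b) \<Rightarrow> bool" where
  "even_at i h \<longleftrightarrow> (\<forall>x. h (x(i := - x i)) = h x)"

text \<open>Fubini with the coordinate i innermost, where \<open>integral_flip_pole_law\<close>
  applies because h is even in it.\<close>

lemma integral_flip:
  fixes h :: "(nat \<Rightarrow> real^2) \<Rightarrow> real"
  assumes i: "i < m" and int: "integrable (pole_sample m \<mu>) h" and even: "even_at i h"
  shows "(\<integral>x. sgn (x i $ 1) * h x \<partial>pole_sample m \<mu>) = (\<integral>x. flip_score \<mu> (x i) * h x \<partial>pole_sample m \<mu>)"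
    and "integrable (pole_sample m \<mu>) (\<lambda>x. sgn (x i $ 1) * h x)"
    and "integrable (pole_sample m \<mu>) (\<lambda>x. flip_score \<mu> (x i) * h x)"
proof -
  note c = pole_sample_component[OF i, of \<mu>]
  have [measurable]: "h \<in> borel_measurable (pole_sample m \<mu>)" using int by simp
  have [measurable]: "(\<lambda>x. sgn (x i $ 1)) \<in> borel_measurable (pole_sample m \<mu>)"
    "(\<lambda>x. flip_score \<mu> (x i)) \<in> borel_measurable (pole_sample m \<mu>)"
    by (rule measurable_compose[OF c]; measurable)+
  show i1: "integrable (pole_sample m \<mu>) (\<lambda>x. sgn (x i $ 1) * h x)"
    by (rule Bochner_Integration.integrable_bound[OF int]) (auto intro!: AE_I2 simp: abs_mult abs_sgn_eq)
  show i2: "integrable (pole_sample m \<mu>) (\<lambda>x. flip_score \<mu> (x i) * h x)"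
  proof (rule Bochner_Integration.integrable_bound)
    show "integrable (pole_sample m \<mu>) (\<lambda>x. flip_bound \<mu> * h x)" using int by simp
    show "AE x in pole_sample m \<mu>. norm (flip_score \<mu> (x i) * h x) \<le> norm (flip_bound \<mu> * h x)"
      using abs_flip_score_le flip_bound_nonneg by (intro AE_I2) (auto simp: abs_mult intro!: mult_right_mono)
  qed simp
  define F where "F x = (sgn (x i $ 1) - flip_score \<mu> (x i)) * h x" for x
  have iF: "integrable (pole_sample m \<mu>) F"
    using Bochner_Integration.integrable_diff[OF i1 i2] by (simp add: F_def[abs_def] left_diff_distrib)
  interpret product_sigma_finite "\<lambda>_. pole_law \<mu>"
    by standard
  have I: "insert i ({..<m} - {i}) = {..<m}" using i by auto
  have "(\<integral>x. F x \<partial>pole_sample m \<mu>) = (\<integral>x. \<integral>y. F (x(i := y)) \<partial>pole_law \<mu> \<partial>PiM ({..<m} - {i}) (\<lambda>_. pole_law \<mu>))"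
    using product_integral_insert[of "{..<m} - {i}" i F] iF unfolding I pole_sample_eq by simp
  also have "\<dots> = (\<integral>x. 0 \<partial>PiM ({..<m} - {i}) (\<lambda>_. pole_law \<mu>))"
  proof (rule Bochner_Integration.integral_cong[OF refl])
    fix x assume x: "x \<in> space (PiM ({..<m} - {i}) (\<lambda>_. pole_law \<mu>))"
    have "(\<lambda>y. x(i := y)) \<in> measurable borel (PiM (insert i ({..<m} - {i})) (\<lambda>_. pole_law \<mu>))"
      using measurable_component_update[OF x, of i] by (simp cong: measurable_cong_sets)
    then have "(\<lambda>y. h (x(i := y))) \<in> borel_measurable borel"
      by (rule measurable_compose) (use \<open>h \<in> _\<close> in \<open>simp only: I pole_sample_eq\<close>)
    moreover have "h (x(i := - y)) = h (x(i := y))" for y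
      using even[unfolded even_at_def, rule_format, of "x(i := y)"] by simp
    ultimately show "(\<integral>y. F (x(i := y)) \<partial>pole_law \<mu>) = 0"
      unfolding F_def fun_upd_same by (rule integral_flip_pole_law)
  qed
  finally have "(\<integral>x. F x \<partial>pole_sample m \<mu>) = 0" by simp
  then show "(\<integral>x. sgn (x i $ 1) * h x \<partial>pole_sample m \<mu>) = (\<integral>x. flip_score \<mu> (x i) * h x \<partial>pole_sample m \<mu>)"
    unfolding F_def left_diff_distrib using Bochner_Integration.integral_diff[OF i1 i2] by simp
qed

text \<open>The two signs are exchanged for \<open>flip_score\<close> one after the other; the
  remaining factor stays even in the coordinate concerned. The squared bound keeps all off-diagonal
  terms together within m times the squared shift of the diagonal ones.\<close>

lemma integral_flip2:
  fixes h :: "(nat \<Rightarrow> real^2) \<Rightarrow> real"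
  assumes i: "i < m" and j: "j < m" and ij: "i \<noteq> j" and int: "integrable (pole_sample m \<mu>) h"
    and ei: "even_at i h" and ej: "even_at j h"
  shows "\<bar>\<integral>x. sgn (x i $ 1) * sgn (x j $ 1) * h x \<partial>pole_sample m \<mu>\<bar> \<le> (flip_bound \<mu>)\<^sup>2 * (\<integral>x. \<bar>h x\<bar> \<partial>pole_sample m \<mu>)"
    and "integrable (pole_sample m \<mu>) (\<lambda>x. sgn (x i $ 1) * sgn (x j $ 1) * h x)"
proof -
  let ?M = "pole_sample m \<mu>"
  have int_j: "integrable ?M (\<lambda>x. sgn (x j $ 1) * h x)" by (rule integral_flip(2)[OF j int ej])
  have ej_i: "even_at i (\<lambda>x. sgn (x j $ 1) * h x)" using ei ij by (simp add: even_at_def)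
  have int_i: "integrable ?M (\<lambda>x. flip_score \<mu> (x i) * h x)" by (rule integral_flip(3)[OF i int ei])
  have ei_j: "even_at j (\<lambda>x. flip_score \<mu> (x i) * h x)" using ej ij by (simp add: even_at_def)
  show "integrable ?M (\<lambda>x. sgn (x i $ 1) * sgn (x j $ 1) * h x)"
    using integral_flip(2)[OF i int_j ej_i] by (simp add: mult.assoc)
  have "(\<integral>x. sgn (x i $ 1) * sgn (x j $ 1) * h x \<partial>?M) = (\<integral>x. flip_score \<mu> (x i) * (sgn (x j $ 1) * h x) \<partial>?M)"
    using integral_flip(1)[OF i int_j ej_i] by (simp add: mult.assoc)
  also have "\<dots> = (\<integral>x. sgn (x j $ 1) * (flip_score \<mu> (x i) * h x) \<partial>?M)" by (simp add: mult.left_commute)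
  also have "\<dots> = (\<integral>x. flip_score \<mu> (x j) * (flip_score \<mu> (x i) * h x) \<partial>?M)"
    by (rule integral_flip(1)[OF j int_i ei_j])
  also have "\<bar>\<dots>\<bar> \<le> (\<integral>x. \<bar>flip_score \<mu> (x j) * (flip_score \<mu> (x i) * h x)\<bar> \<partial>?M)"
    by (rule integral_abs_bound)
  also have "\<dots> \<le> (\<integral>x. (flip_bound \<mu>)\<^sup>2 * \<bar>h x\<bar> \<partial>?M)"
  proof (rule integral_mono)
    show "integrable ?M (\<lambda>x. \<bar>flip_score \<mu> (x j) * (flip_score \<mu> (x i) * h x)\<bar>)"
      by (intro integrable_abs integral_flip(3)[OF j int_i ei_j])
    show "integrable ?M (\<lambda>x. (flip_bound \<mu>)\<^sup>2 * \<bar>h x\<bar>)" using int by simp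
    fix x
    have "\<bar>flip_score \<mu> (x j)\<bar> * (\<bar>flip_score \<mu> (x i)\<bar> * \<bar>h x\<bar>) \<le> flip_bound \<mu> * (flip_bound \<mu> * \<bar>h x\<bar>)"
      by (intro mult_mono abs_flip_score_le) (auto simp: flip_bound_nonneg)
    then show "\<bar>flip_score \<mu> (x j) * (flip_score \<mu> (x i) * h x)\<bar> \<le> (flip_bound \<mu>)\<^sup>2 * \<bar>h x\<bar>"
      by (simp add: abs_mult power2_eq_square mult.assoc)
  qed
  finally show "\<bar>\<integral>x. sgn (x i $ 1) * sgn (x j $ 1) * h x \<partial>?M\<bar> \<le> (flip_bound \<mu>)\<^sup>2 * (\<integral>x. \<bar>h x\<bar> \<partial>?M)" by simp
qed

text \<open>Conditionally on the pairs \<open>\<plusminus>x i\<close> the signs are independent and nearly symmetric, whence the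
  sum of the signed terms has a variance of the order of the diagonal terms.\<close>

lemma signed_sum_second_moment:
  fixes d :: "nat \<Rightarrow> (nat \<Rightarrow> real^2) \<Rightarrow> complex"
  assumes meas: "\<And>i. i < m \<Longrightarrow> d i \<in> borel_measurable (pole_sample m \<mu>)"
    and int: "\<And>i. i < m \<Longrightarrow> integrable (pole_sample m \<mu>) (\<lambda>x. (cmod (d i x))\<^sup>2)"
    and even: "\<And>i j. i < m \<Longrightarrow> j < m \<Longrightarrow> even_at j (d i)"
  shows "(\<integral>x. (cmod (\<Sum>i<m. complex_of_real (sgn (x i $ 1)) * d i x))\<^sup>2 \<partial>pole_sample m \<mu>)
      \<le> (1 + real m * (flip_bound \<mu>)\<^sup>2) * (\<Sum>i<m. \<integral>x. (cmod (d i x))\<^sup>2 \<partial>pole_sample m \<mu>)"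
    and "integrable (pole_sample m \<mu>) (\<lambda>x. (cmod (\<Sum>i<m. complex_of_real (sgn (x i $ 1)) * d i x))\<^sup>2)"
proof -
  let ?M = "pole_sample m \<mu>"
  define D where "D i j x = Re (d i x * cnj (d j x))" for i j x
  define E where "E i = (\<integral>x. (cmod (d i x))\<^sup>2 \<partial>?M)" for i
  have Dle: "\<bar>D i j x\<bar> \<le> ((cmod (d i x))\<^sup>2 + (cmod (d j x))\<^sup>2) / 2" for i j x
  proof -
    have "\<bar>D i j x\<bar> \<le> cmod (d i x) * cmod (d j x)"
      unfolding D_def using abs_Re_le_cmod[of "d i x * cnj (d j x)"] by (simp add: norm_mult)
    also have "\<dots> \<le> ((cmod (d i x))\<^sup>2 + (cmod (d j x))\<^sup>2) / 2"
      using sum_squares_bound[of "cmod (d i x)" "cmod (d j x)"] by simp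
    finally show ?thesis .
  qed
  have Dm: "D i j \<in> borel_measurable ?M" if "i < m" "j < m" for i j
  proof -
    have "D i j = (\<lambda>x. Re (d i x) * Re (d j x) + Im (d i x) * Im (d j x))"
      by (rule ext) (simp add: D_def)
    then show ?thesis using meas[OF that(1)] meas[OF that(2)] by simp
  qed
  have ib: "integrable ?M (\<lambda>x. ((cmod (d i x))\<^sup>2 + (cmod (d j x))\<^sup>2) / 2)" if "i < m" "j < m" for i j
    using int[OF that(1)] int[OF that(2)] by simp
  have Di: "integrable ?M (D i j)" if "i < m" "j < m" for i j
    by (rule Bochner_Integration.integrable_bound[OF ib[OF that] Dm[OF that]])
       (use Dle in \<open>auto intro!: AE_I2 order_trans[OF Dle]\<close>)
  have Dabs: "(\<integral>x. \<bar>D i j x\<bar> \<partial>?M) \<le> (E i + E j) / 2" if "i < m" "j < m" for i j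
  proof -
    have "(\<integral>x. \<bar>D i j x\<bar> \<partial>?M) \<le> (\<integral>x. ((cmod (d i x))\<^sup>2 + (cmod (d j x))\<^sup>2) / 2 \<partial>?M)"
      by (intro integral_mono integrable_abs Di that ib Dle)
    also have "\<dots> = (E i + E j) / 2" using int[OF that(1)] int[OF that(2)] by (simp add: E_def)
    finally show ?thesis .
  qed
  have ev: "even_at k (D i j)" if "i < m" "j < m" "k < m" for i j k
    using even[OF that(1,3)] even[OF that(2,3)] by (simp add: even_at_def D_def)
  define T where "T i j x = sgn (x i $ 1) * sgn (x j $ 1) * D i j x" for i j x
  have nn: "0 \<le> E i" for i by (simp add: E_def)
  have T: "integrable ?M (T i j) \<and> (\<integral>x. T i j x \<partial>?M) \<le> (if i = j then E i else 0) + (flip_bound \<mu>)\<^sup>2 * ((E i + E j) / 2)"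
    if "i < m" "j < m" for i j
  proof (cases "i = j")
    case True
    have Tle: "\<bar>T i i x\<bar> \<le> \<bar>D i i x\<bar>" for x
      by (auto simp: T_def abs_mult sgn_if)
    have [measurable]: "(\<lambda>x. sgn (x i $ 1)) \<in> borel_measurable ?M"
      by (rule measurable_compose[OF pole_sample_component[OF that(1)]]) measurable
    have m: "T i i \<in> borel_measurable ?M" unfolding T_def[abs_def] using Dm[OF that(1) that(1)] by measurable
    have i: "integrable ?M (T i i)"
      by (rule Bochner_Integration.integrable_bound[OF integrable_abs[OF Di[OF that(1) that(1)]] m]) (use Tle in \<open>auto intro!: AE_I2\<close>)
    have "(\<integral>x. T i i x \<partial>?M) \<le> (\<integral>x. \<bar>D i i x\<bar> \<partial>?M)"
      by (intro integral_mono i integrable_abs Di that(1) order_trans[OF abs_ge_self Tle])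
    also have "\<dots> \<le> E i" using Dabs[OF that(1) that(1)] by simp
    finally show ?thesis using True i nn by (auto intro!: add_increasing2 mult_nonneg_nonneg)
  next
    case False
    have "(\<integral>x. T i j x \<partial>?M) \<le> (flip_bound \<mu>)\<^sup>2 * (\<integral>x. \<bar>D i j x\<bar> \<partial>?M)"
      using integral_flip2(1)[OF that False Di[OF that] ev[OF that that(1)] ev[OF that that(2)]] by (simp add: T_def abs_le_iff)
    also have "\<dots> \<le> (flip_bound \<mu>)\<^sup>2 * ((E i + E j) / 2)" by (intro mult_left_mono Dabs that) simp
    finally show ?thesis using False integral_flip2(2)[OF that False Di[OF that] ev[OF that that(1)] ev[OF that that(2)]]
      by (simp add: T_def[abs_def])
  qed
  have e: "(cmod (\<Sum>i<m. complex_of_real (sgn (x i $ 1)) * d i x))\<^sup>2 = (\<Sum>i<m. \<Sum>j<m. T i j x)" for x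
    unfolding norm_sum_sq_complex T_def D_def by (intro sum.cong refl) (simp add: algebra_simps)
  show "integrable ?M (\<lambda>x. (cmod (\<Sum>i<m. complex_of_real (sgn (x i $ 1)) * d i x))\<^sup>2)"
    unfolding e using T by (intro Bochner_Integration.integrable_sum) auto
  have "(\<integral>x. (cmod (\<Sum>i<m. complex_of_real (sgn (x i $ 1)) * d i x))\<^sup>2 \<partial>?M) = (\<Sum>i<m. \<Sum>j<m. \<integral>x. T i j x \<partial>?M)"
  proof -
    have Ti: "integrable ?M (T i j)" if "i < m" "j < m" for i j using T[OF that] by blast
    have "(\<integral>x. (\<Sum>i<m. \<Sum>j<m. T i j x) \<partial>?M) = (\<Sum>i<m. \<integral>x. (\<Sum>j<m. T i j x) \<partial>?M)"
      by (intro Bochner_Integration.integral_sum Bochner_Integration.integrable_sum Ti) auto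
    also have "\<dots> = (\<Sum>i<m. \<Sum>j<m. \<integral>x. T i j x \<partial>?M)"
      by (intro sum.cong refl Bochner_Integration.integral_sum Ti) auto
    finally show ?thesis unfolding e .
  qed
  also have "\<dots> \<le> (\<Sum>i<m. \<Sum>j<m. (if i = j then E i else 0) + (flip_bound \<mu>)\<^sup>2 * ((E i + E j) / 2))"
    using T by (intro sum_mono) auto
  also have "\<dots> = (\<Sum>i<m. E i) + (flip_bound \<mu>)\<^sup>2 * (\<Sum>i<m. \<Sum>j<m. (E i + E j) / 2)"
    by (simp add: sum.distrib sum_distrib_left)
  also have "(\<Sum>i<m. \<Sum>j<m. (E i + E j) / 2) = real m * (\<Sum>i<m. E i)"
    by (simp add: sum.distrib sum_divide_distrib[symmetric] sum_distrib_left[symmetric])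
  also have "(\<Sum>i<m. E i) + (flip_bound \<mu>)\<^sup>2 * (real m * (\<Sum>i<m. E i)) = (1 + real m * (flip_bound \<mu>)\<^sup>2) * (\<Sum>i<m. E i)"
    by (simp add: algebra_simps)
  finally show "(\<integral>x. (cmod (\<Sum>i<m. complex_of_real (sgn (x i $ 1)) * d i x))\<^sup>2 \<partial>?M)
      \<le> (1 + real m * (flip_bound \<mu>)\<^sup>2) * (\<Sum>i<m. \<integral>x. (cmod (d i x))\<^sup>2 \<partial>?M)" by (simp add: E_def)
qed

lemma tyler_disc_flip: "tyler_disc m (x(j := - x j)) = tyler_disc m x"
  using tyler_disc_scale[of "-1" m x j "x j"] by simp

lemma disc_form_uminus: "disc_form z (- x) = disc_form z x"
  using disc_form_scale[of z "-1" x] by simp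

lemma slope_uminus: "slope (- x) = slope x"
  by (simp add: slope_def)

text \<open>Tyler's point, the forms and the slopes are unchanged when an observation is replaced by
  its negative, and so are both kinds of ranks.\<close>

lemma even_at_line_score: "even_at j (\<lambda>x. line_score J m x i)"
proof -
  have "disc_form z ((x(j := - x j)) k) = disc_form z (x k)" "slope ((x(j := - x j)) k) = slope (x k)"
    for x :: "nat \<Rightarrow> real^2" and z k
    by (simp_all add: disc_form_uminus slope_uminus)
  then show ?thesis
    unfolding even_at_def line_score_def pm_rank_eq slope_rank_def tyler_disc_flip by (simp only: simp_thms)
qed

section \<open>Empirical distributions\<close>

lemma pole_sample_indep:
  fixes h :: "real^2 \<Rightarrow> 'b :: topological_space"
  assumes [measurable]: "h \<in> borel_measurable borel"
  assumes "0 < m"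
  shows "pole_sample.indep_vars m \<mu> (\<lambda>_. borel) (\<lambda>i x. h (x i)) {..<m}"
proof -
  have "pole_sample.indep_vars m \<mu> (\<lambda>_. pole_law \<mu>) (\<lambda>i f. f i) {..<m}"
  proof (subst pole_sample.indep_vars_iff_distr_eq_PiM')
    show "(\<lambda>f. f i) \<in> measurable (pole_sample m \<mu>) (pole_law \<mu>)" if "i \<in> {..<m}" for i
      using pole_sample_component[of i m \<mu>] that by (simp cong: measurable_cong_sets)
    have "distr (pole_sample m \<mu>) (PiM {..<m} (\<lambda>_. pole_law \<mu>)) (\<lambda>x. \<lambda>i\<in>{..<m}. x i) = distr (pole_sample m \<mu>) (pole_sample m \<mu>) (\<lambda>x. x)"
      by (rule distr_cong) (auto simp: pole_sample_eq space_PiM PiE_restrict)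
    also have "\<dots> = PiM {..<m} (\<lambda>i. distr (pole_sample m \<mu>) (pole_law \<mu>) (\<lambda>f. f i))"
      by (simp add: distr_id pole_sample_eq[of m \<mu>, symmetric])
         (auto simp: pole_sample_eq intro!: PiM_cong distr_pole_sample_component[symmetric, unfolded pole_sample_eq])
    finally show "distr (pole_sample m \<mu>) (PiM {..<m} (\<lambda>_. pole_law \<mu>)) (\<lambda>x. \<lambda>i\<in>{..<m}. x i) =
      PiM {..<m} (\<lambda>i. distr (pole_sample m \<mu>) (pole_law \<mu>) (\<lambda>f. f i))" .
  qed (use assms in auto)
  from pole_sample.indep_vars_compose2[OF this, of "\<lambda>_. h" "\<lambda>_. borel"] show ?thesis
    by (simp cong: measurable_cong_sets)
qed

lemma pole_sample_integral_component:
  fixes h :: "real^2 \<Rightarrow> 'b :: {banach, second_countable_topology}"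
  assumes i: "i < m" and [measurable]: "h \<in> borel_measurable borel"
  shows "(\<integral>x. h (x i) \<partial>pole_sample m \<mu>) = (\<integral>y. h y \<partial>pole_law \<mu>)"
    and "integrable (pole_sample m \<mu>) (\<lambda>x. h (x i)) \<longleftrightarrow> integrable (pole_law \<mu>) h"
proof -
  have m: "(\<lambda>x. x i) \<in> measurable (pole_sample m \<mu>) (pole_law \<mu>)"
    using pole_sample_component[OF i] by (simp cong: measurable_cong_sets)
  have h: "h \<in> borel_measurable (pole_law \<mu>)" by (simp cong: measurable_cong_sets)
  show "(\<integral>x. h (x i) \<partial>pole_sample m \<mu>) = (\<integral>y. h y \<partial>pole_law \<mu>)"
    using integral_distr[OF m h] unfolding distr_pole_sample_component[OF i] by simp
  show "integrable (pole_sample m \<mu>) (\<lambda>x. h (x i)) \<longleftrightarrow> integrable (pole_law \<mu>) h"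
    using integrable_distr_eq[OF m h] unfolding distr_pole_sample_component[OF i] by simp
qed

text \<open>Half of \<eta> pays for the bias between the centres \<mu> and \<open>0\<close>; the
  other half is Hoeffding's inequality for variables with values in [-1, 1].\<close>

lemma empirical_mean_deviation:
  fixes h :: "real^2 \<Rightarrow> real"
  assumes [measurable]: "h \<in> borel_measurable borel" and bdd: "\<And>y. \<bar>h y\<bar> \<le> 1" and m: "0 < m"
    and \<eta>: "0 < \<eta>" and near: "ratio_bound (norm \<mu>) - 1 \<le> \<eta> / 2"
  shows "measure (pole_sample m \<mu>) {x \<in> space (pole_sample m \<mu>). \<eta> * m < \<bar>(\<Sum>i<m. h (x i)) - m * (\<integral>y. h y \<partial>pole_law 0)\<bar>}
     \<le> 2 * exp (- (real m * \<eta>\<^sup>2 / 8))"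
proof -
  let ?M = "pole_sample m \<mu>"
  interpret H: Hoeffding_ineq ?M "{..<m}" "\<lambda>i x. h (x i)" "\<lambda>_. -1" "\<lambda>_. 1" "\<Sum>i<m. pole_sample.expectation m \<mu> (\<lambda>x. h (x i))"
  proof unfold_locales
    show "pole_sample.indep_vars m \<mu> (\<lambda>_. borel) (\<lambda>i x. h (x i)) {..<m}" by (rule pole_sample_indep) (simp_all add: m)
    show "AE x in ?M. h (x i) \<in> {-1..1}" for i using bdd by (intro AE_I2) (auto simp: abs_le_iff minus_le_iff)
  qed (simp_all add: atLeast0LessThan)
  have int: "integrable (pole_law \<nu>) h" for \<nu>
    by (rule pole.integrable_const_bound[where B=1]) (use bdd in auto)
  have mean: "(\<Sum>i<m. pole_sample.expectation m \<mu> (\<lambda>x. h (x i))) = m * (\<integral>y. h y \<partial>pole_law \<mu>)"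
    by (simp add: pole_sample_integral_component)
  have "\<bar>(\<integral>y. h y \<partial>pole_law \<mu>) - (\<integral>y. h y \<partial>pole_law 0)\<bar> \<le> (ratio_bound (norm \<mu>) - 1) * (\<integral>y. \<bar>h y\<bar> \<partial>pole_law 0)"
    using integral_pole_law_diff[OF _ int[of 0], of \<mu>] by simp
  also have "\<dots> \<le> (ratio_bound (norm \<mu>) - 1) * 1"
  proof (intro mult_left_mono)
    have "(\<integral>y. \<bar>h y\<bar> \<partial>pole_law 0) \<le> (\<integral>y. 1 \<partial>pole_law 0)"
      by (intro integral_mono integrable_abs int) (use bdd in auto)
    then show "(\<integral>y. \<bar>h y\<bar> \<partial>pole_law 0) \<le> 1" using pole.prob_space[of 0] by simp
  qed (use ratio_bound_ge_1[of "norm \<mu>"] in simp)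
  finally have d: "\<bar>(\<integral>y. h y \<partial>pole_law \<mu>) - (\<integral>y. h y \<partial>pole_law 0)\<bar> \<le> \<eta> / 2" using near by simp
  have "{x \<in> space ?M. \<eta> * m < \<bar>(\<Sum>i<m. h (x i)) - m * (\<integral>y. h y \<partial>pole_law 0)\<bar>}
      \<subseteq> {x \<in> space ?M. \<eta> / 2 * m \<le> \<bar>(\<Sum>i<m. h (x i)) - m * (\<integral>y. h y \<partial>pole_law \<mu>)\<bar>}"
  proof clarify
    fix x assume a: "\<eta> * m < \<bar>(\<Sum>i<m. h (x i)) - m * (\<integral>y. h y \<partial>pole_law 0)\<bar>"
    have "\<bar>m * (\<integral>y. h y \<partial>pole_law \<mu>) - m * (\<integral>y. h y \<partial>pole_law 0)\<bar> \<le> m * (\<eta> / 2)"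
      unfolding right_diff_distrib[symmetric] abs_mult using mult_left_mono[OF d, of "real m"] by simp
    then have "\<bar>m * (\<integral>y. h y \<partial>pole_law \<mu>) - m * (\<integral>y. h y \<partial>pole_law 0)\<bar> \<le> (\<eta> * m) / 2" by (simp add: mult.commute)
    with a have "(\<eta> * m) / 2 \<le> \<bar>(\<Sum>i<m. h (x i)) - m * (\<integral>y. h y \<partial>pole_law \<mu>)\<bar>" by linarith
    then show "\<eta> / 2 * m \<le> \<bar>(\<Sum>i<m. h (x i)) - m * (\<integral>y. h y \<partial>pole_law \<mu>)\<bar>" by simp
  qed
  then have "measure ?M {x \<in> space ?M. \<eta> * m < \<bar>(\<Sum>i<m. h (x i)) - m * (\<integral>y. h y \<partial>pole_law 0)\<bar>}
      \<le> measure ?M {x \<in> space ?M. \<eta> / 2 * m \<le> \<bar>(\<Sum>i<m. h (x i)) - m * (\<integral>y. h y \<partial>pole_law \<mu>)\<bar>}"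
  proof (rule pole_sample.finite_measure_mono)
    have "(\<lambda>x. h (x i)) \<in> borel_measurable ?M" if "i < m" for i
      by (rule measurable_compose[OF pole_sample_component[OF that]]) simp
    then have [measurable]: "(\<lambda>x. \<Sum>i<m. h (x i)) \<in> borel_measurable ?M" by simp
    show "{x \<in> space ?M. \<eta> / 2 * m \<le> \<bar>(\<Sum>i<m. h (x i)) - m * (\<integral>y. h y \<partial>pole_law \<mu>)\<bar>} \<in> sets ?M" by measurable
  qed
  also have "\<dots> \<le> 2 * exp (- 2 * (\<eta> / 2 * m)\<^sup>2 / (\<Sum>i<m. (1 - - 1)\<^sup>2))"
    using H.Hoeffding_ineq_abs_ge[of "\<eta> / 2 * m"] \<eta> m unfolding mean by simp
  also have "- 2 * (\<eta> / 2 * m)\<^sup>2 / (\<Sum>i<m. (1 - - 1)\<^sup>2) = - (real m * \<eta>\<^sup>2 / 8)"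
    using m by (simp add: power2_eq_square field_simps)
  finally show ?thesis .
qed

text \<open>Sample size to infinity and centre to \<open>0\<close> independently of each other, so
  that a limit along this filter covers sqrt m times the shift both bounded and unbounded.\<close>

abbreviation local_filter :: "(nat \<times> (real^2)) filter" where
  "local_filter \<equiv> sequentially \<times>\<^sub>F nhds 0"

lemma tendsto_ratio_bound: "((\<lambda>\<mu>::real^2. ratio_bound (norm \<mu>)) \<longlongrightarrow> 1) (nhds 0)"
proof -
  have "((\<lambda>\<mu>::real^2. ratio_bound (norm \<mu>)) \<longlongrightarrow> ratio_bound (norm (0::real^2))) (nhds 0)"
    unfolding ratio_bound_def by (intro tendsto_intros filterlim_ident)
  then show ?thesis by (simp add: ratio_bound_def)
qed

lemma eventually_near: "0 < \<eta> \<Longrightarrow> \<forall>\<^sub>F (m, \<mu>) in local_filter. 0 < m \<and> ratio_bound (norm \<mu>) - 1 \<le> \<eta>"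
proof -
  assume "0 < \<eta>"
  then have "\<forall>\<^sub>F \<mu> :: real^2 in nhds 0. ratio_bound (norm \<mu>) < 1 + \<eta>"
    by (intro order_tendstoD(2)[OF tendsto_ratio_bound]) simp
  from eventually_prodI[OF eventually_gt_at_top[of 0] this] show ?thesis
    by (rule eventually_mono) auto
qed

text \<open>The sample has centre \<mu>, but the means are those at the centre \<open>0\<close>: the
  rank limits are defined by the null law.\<close>

definition deviation_set :: "(real^2 \<Rightarrow> real) set \<Rightarrow> real \<Rightarrow> nat \<Rightarrow> real^2 \<Rightarrow> (nat \<Rightarrow> real^2) set" where
  "deviation_set H \<eta> m \<mu> = (\<Union>h\<in>H. {x \<in> space (pole_sample m \<mu>). \<eta> * m < \<bar>(\<Sum>i<m. h (x i)) - m * (\<integral>y. h y \<partial>pole_law 0)\<bar>})"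

lemma sets_deviation:
  fixes h :: "real^2 \<Rightarrow> real"
  assumes [measurable]: "h \<in> borel_measurable borel"
  shows "{x \<in> space (pole_sample m \<mu>). \<eta> * m < \<bar>(\<Sum>i<m. h (x i)) - m * (\<integral>y. h y \<partial>pole_law 0)\<bar>} \<in> sets (pole_sample m \<mu>)"
proof -
  have "(\<lambda>x. h (x i)) \<in> borel_measurable (pole_sample m \<mu>)" if "i < m" for i
    by (rule measurable_compose[OF pole_sample_component[OF that]]) simp
  then have [measurable]: "(\<lambda>x. \<Sum>i<m. h (x i)) \<in> borel_measurable (pole_sample m \<mu>)" by simp
  show ?thesis by measurable
qed

lemma sets_deviation_set:
  assumes "finite H" "\<And>h. h \<in> H \<Longrightarrow> h \<in> borel_measurable borel"
  shows "deviation_set H \<eta> m \<mu> \<in> sets (pole_sample m \<mu>)"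
  unfolding deviation_set_def using assms by (intro sets.finite_UN sets_deviation) auto

lemma deviation_set_null:
  assumes H: "finite H" and meas: "\<And>h. h \<in> H \<Longrightarrow> h \<in> borel_measurable borel" and bdd: "\<And>h y. h \<in> H \<Longrightarrow> \<bar>h y\<bar> \<le> 1" and \<eta>: "0 < \<eta>"
  shows "((\<lambda>(m, \<mu>). measure (pole_sample m \<mu>) (deviation_set H \<eta> m \<mu>)) \<longlongrightarrow> 0) local_filter"
proof (rule tendsto_sandwich)
  show "\<forall>\<^sub>F p in local_filter. 0 \<le> (case p of (m, \<mu>) \<Rightarrow> measure (pole_sample m \<mu>) (deviation_set H \<eta> m \<mu>))"
    by (rule always_eventually) (simp split: prod.split)
  show "\<forall>\<^sub>F p in local_filter. (case p of (m, \<mu>) \<Rightarrow> measure (pole_sample m \<mu>) (deviation_set H \<eta> m \<mu>)) \<le> card H * (2 * exp (- (real (fst p) * \<eta>\<^sup>2 / 8)))"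
  proof (rule eventually_mono[OF eventually_near[of "\<eta> / 2"]])
    fix p :: "nat \<times> (real^2)" assume "case p of (m, \<mu>) \<Rightarrow> 0 < m \<and> ratio_bound (norm \<mu>) - 1 \<le> \<eta> / 2"
    then obtain m \<mu> where p: "p = (m, \<mu>)" "0 < m" "ratio_bound (norm \<mu>) - 1 \<le> \<eta> / 2" by (cases p) auto
    have "measure (pole_sample m \<mu>) (deviation_set H \<eta> m \<mu>)
       \<le> (\<Sum>h\<in>H. measure (pole_sample m \<mu>) {x \<in> space (pole_sample m \<mu>). \<eta> * m < \<bar>(\<Sum>i<m. h (x i)) - m * (\<integral>y. h y \<partial>pole_law 0)\<bar>})"
      unfolding deviation_set_def by (intro measure_UNION_le H sets_deviation meas)
    also have "\<dots> \<le> (\<Sum>h\<in>H. 2 * exp (- (real m * \<eta>\<^sup>2 / 8)))"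
      by (intro sum_mono empirical_mean_deviation meas bdd p \<eta>)
    finally show "(case p of (m, \<mu>) \<Rightarrow> measure (pole_sample m \<mu>) (deviation_set H \<eta> m \<mu>)) \<le> card H * (2 * exp (- (real (fst p) * \<eta>\<^sup>2 / 8)))"
      by (simp add: p)
  qed (use \<eta> in simp)
  have "(\<lambda>m. card H * (2 * exp (- (real m * \<eta>\<^sup>2 / 8)))) \<longlonglongrightarrow> 0"
    using \<eta> by real_asymp
  then show "((\<lambda>p. card H * (2 * exp (- (real (fst p) * \<eta>\<^sup>2 / 8)))) \<longlongrightarrow> 0) local_filter"
    by (rule filterlim_compose[OF _ filterlim_fst])
qed simp

text \<open>The test functions for Tyler's estimator and for the empirical distribution functions.\<close>

definition test_functions :: "nat \<Rightarrow> (real^2 \<Rightarrow> real) set" where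
  "test_functions K = {\<lambda>x. cos (2 * line_angle x), \<lambda>x. sin (2 * line_angle x), \<lambda>x. cos (4 * line_angle x), \<lambda>x. sin (4 * line_angle x)}
     \<union> (\<lambda>k x. indicator {..real k / real K} (radial_unif x)) ` {..K}
     \<union> (\<lambda>k x. indicator {..real k / real K} (line_unif x)) ` {..K}"

lemma test_functions:
  "finite (test_functions K)"
  "h \<in> test_functions K \<Longrightarrow> h \<in> borel_measurable borel"
  "h \<in> test_functions K \<Longrightarrow> \<bar>h y\<bar> \<le> 1"
  by (auto simp: test_functions_def indicator_def)

lemma integral_unif_atMost:
  assumes "0 \<le> t" "t \<le> 1"
  shows "(\<integral>u. indicator {..t} u \<partial>unif) = (t::real)"
proof -
  have "(\<integral>u. indicator {..t} u \<partial>unif) = (LBINT u. indicator {..t} u * indicator {0<..<1} u :: real)"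
    by (rule integral_unif[of "indicator {..t}"]) simp
  also have "\<dots> = (LBINT u. indicator {0<..t} u)"
    by (rule integral_cong_AE) (use AE_lborel_singleton[of 1] assms in \<open>auto split: split_indicator elim!: eventually_mono\<close>)
  also have "\<dots> = t" using assms by simp
  finally show ?thesis .
qed

lemma test_function_means:
  "(\<integral>x. cos (2 * line_angle x) \<partial>pole_law 0) = 0" "(\<integral>x. sin (2 * line_angle x) \<partial>pole_law 0) = 0"
  "(\<integral>x. cos (4 * line_angle x) \<partial>pole_law 0) = 0" "(\<integral>x. sin (4 * line_angle x) \<partial>pole_law 0) = 0"
  "0 \<le> t \<Longrightarrow> t \<le> 1 \<Longrightarrow> (\<integral>x. indicator {..t} (radial_unif x) \<partial>pole_law 0) = (t::real)"
  "0 \<le> t \<Longrightarrow> t \<le> 1 \<Longrightarrow> (\<integral>x. indicator {..t} (line_unif x) \<partial>pole_law 0) = (t::real)"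
  using integral_line_unif(1)[of "\<lambda>u. cos (2 * (pi * (u - 1 / 2)))"] integral_line_angle_cos[of 1]
    integral_line_unif(1)[of "\<lambda>u. sin (2 * (pi * (u - 1 / 2)))"] integral_line_angle_sin[of 1]
    integral_line_unif(1)[of "\<lambda>u. cos (4 * (pi * (u - 1 / 2)))"] integral_line_angle_cos[of 2]
    integral_line_unif(1)[of "\<lambda>u. sin (4 * (pi * (u - 1 / 2)))"] integral_line_angle_sin[of 2]
    integral_line_unif(1)[of "indicator {..t}"] integral_radial_unif(1)[of "indicator {..t}"] integral_unif_atMost[of t]
  by (simp_all add: line_angle_eq)

lemma sum_indicator_eq_card:
  fixes m :: nat
  shows "(\<Sum>i<m. indicator S (f i)) = real (card {i. i < m \<and> f i \<in> S})"
proof -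
  have "(\<Sum>i<m. indicator S (f i)) = (\<Sum>i\<in>{i\<in>{..<m}. f i \<in> S}. 1::real)"
    by (rule sum.mono_neutral_cong_right) (auto simp: indicator_def)
  then show ?thesis by simp
qed

text \<open>K and \<eta> depend on \<delta> alone, so one event, of vanishing probability by
  \<open>deviation_set_null\<close>, controls all ranks at once. Outside it the estimate is
  deterministic.\<close>

lemma ranks_near:
  fixes \<delta> :: real
  assumes \<delta>: "0 < \<delta>"
  obtains K \<eta> where "0 < \<eta>" "\<And>m \<mu> x i. 0 < m \<Longrightarrow> 4 \<le> \<delta> * m \<Longrightarrow> \<forall>i<m. x i $ 1 \<noteq> 0 \<Longrightarrow> x \<in> space (pole_sample m \<mu>) \<Longrightarrow>
     x \<notin> deviation_set (test_functions K) \<eta> m \<mu> \<Longrightarrow> i < m \<Longrightarrow>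
     \<bar>real (pm_rank m x i) / (real m + 1) - radial_unif (x i)\<bar> \<le> \<delta> \<and> \<bar>real (slope_rank m x i) / real m - line_unif (x i)\<bar> \<le> \<delta>"
proof -
  \<comment> \<open>The tolerance \<delta> is shared in quarters by \<eta>, the mesh 1 / K, the term
    3 d from Tyler's point, and the passage from the denominator m to m + 1. The caps 1 / 16 and
    \<eta> = d / 16 are what \<open>tyler_disc_small\<close> asks for.\<close>
  define d where "d = min (1 / 16) (\<delta> / 12)"
  have d: "0 < d" "d \<le> 1 / 16" "3 * d \<le> \<delta> / 4" using \<delta> by (auto simp: d_def)
  define \<eta> where "\<eta> = d / 16"
  have \<eta>: "0 < \<eta>" "\<eta> \<le> \<delta> / 4" using d by (auto simp: \<eta>_def)
  obtain k where "inverse (real (Suc k)) < \<delta> / 4"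
    using \<delta> reals_Archimedean[of "\<delta> / 4"] by auto
  then obtain K where K: "0 < K" "1 / real K < \<delta> / 4"
    by (intro that[of "Suc k"]) (simp_all add: inverse_eq_divide)
  show thesis
  proof (rule that[OF \<eta>(1), of K])
    fix m \<mu> x i
    assume m: "0 < m" "4 \<le> \<delta> * real m" and nz: "\<forall>i<m. x i $ 1 \<noteq> 0" and xs: "x \<in> space (pole_sample m \<mu>)"
      and dev: "x \<notin> deviation_set (test_functions K) \<eta> m \<mu>" and i: "i < m"
    have T: "\<bar>(\<Sum>i<m. h (x i)) - m * (\<integral>y. h y \<partial>pole_law 0)\<bar> \<le> \<eta> * m" if "h \<in> test_functions K" for h
      using dev that xs by (auto simp: deviation_set_def not_less)
    have z: "norm (tyler_disc m x) < d"
    proof (rule tyler_disc_small[OF m(1) _ d(1,2)])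
      show "\<bar>\<Sum>i<m. cos (2 * line_angle (x i))\<bar> \<le> d / 16 * real m"
        using T[of "\<lambda>x. cos (2 * line_angle x)"] by (simp add: test_functions_def test_function_means \<eta>_def)
      show "\<bar>\<Sum>i<m. sin (2 * line_angle (x i))\<bar> \<le> d / 16 * real m"
        using T[of "\<lambda>x. sin (2 * line_angle x)"] by (simp add: test_functions_def test_function_means \<eta>_def)
      show "\<bar>\<Sum>i<m. cos (4 * line_angle (x i))\<bar> \<le> d / 16 * real m"
        using T[of "\<lambda>x. cos (4 * line_angle x)"] by (simp add: test_functions_def test_function_means \<eta>_def)
      show "\<bar>\<Sum>i<m. sin (4 * line_angle (x i))\<bar> \<le> d / 16 * real m"
        using T[of "\<lambda>x. sin (4 * line_angle x)"] by (simp add: test_functions_def test_function_means \<eta>_def)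
    qed (use nz in auto)
    have div: "\<bar>c / m - t\<bar> \<le> \<eta>" if "\<bar>c - m * t\<bar> \<le> \<eta> * m" for c t :: real
    proof -
      have "c / m - t = (c - m * t) / m" using m(1) by (simp add: field_simps)
      then have "\<bar>c / m - t\<bar> = \<bar>c - m * t\<bar> / m" by (simp add: abs_divide)
      then show ?thesis using that m(1) by (simp add: divide_le_eq)
    qed
    have gr: "\<bar>real (card {j. j < m \<and> radial_unif (x j) \<le> real k / real K}) / real m - real k / real K\<bar> \<le> \<eta>"
      and gl: "\<bar>real (card {j. j < m \<and> line_unif (x j) \<le> real k / real K}) / real m - real k / real K\<bar> \<le> \<eta>" if k: "k \<le> K" for k
    proof -
      have t: "0 \<le> real k / real K" "real k / real K \<le> 1" using k K by simp_all
      show "\<bar>real (card {j. j < m \<and> radial_unif (x j) \<le> real k / real K}) / real m - real k / real K\<bar> \<le> \<eta>"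
        using T[of "\<lambda>x. indicator {..real k / real K} (radial_unif x)"] k
        by (intro div) (simp add: test_functions_def test_function_means(5)[OF t] sum_indicator_eq_card)
      show "\<bar>real (card {j. j < m \<and> line_unif (x j) \<le> real k / real K}) / real m - real k / real K\<bar> \<le> \<eta>"
        using T[of "\<lambda>x. indicator {..real k / real K} (line_unif x)"] k
        by (intro div) (simp add: test_functions_def test_function_means(6)[OF t] sum_indicator_eq_card)
    qed
    have "\<bar>real (slope_rank m x i) / real m - line_unif (x i)\<bar> \<le> \<eta> + 1 / real K"
      unfolding slope_rank_eq
      by (rule empirical_grid[OF m(1) K(1) _ _ gl]) (use line_unif_bounds[of "x i"] in auto)
    then have s: "\<bar>real (slope_rank m x i) / real m - line_unif (x i)\<bar> \<le> \<delta>" using \<eta> K \<delta> by simp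
    have r: "\<bar>real (pm_rank m x i) / real m - radial_unif (x i)\<bar> \<le> (\<eta> + 1 / real K) + 3 * d"
    proof (rule pm_rank_approx[OF m(1) _ d(1,2) z _ i])
      show "x j \<noteq> 0" if "j < m" for j using nz that by auto
      show "\<bar>real (card {j. j < m \<and> radial_unif (x j) \<le> t}) / real m - t\<bar> \<le> \<eta> + 1 / real K" if "0 \<le> t" "t \<le> 1" for t
        by (rule empirical_grid[OF m(1) K(1) that gr])
    qed
    have "pm_rank m x i \<le> card {..<m}" unfolding pm_rank_def by (intro card_mono) auto
    then have R: "real (pm_rank m x i) \<le> m" by simp
    have "real (pm_rank m x i) / real m - real (pm_rank m x i) / (real m + 1) = real (pm_rank m x i) / m * (1 / (real m + 1))"
      using m(1) by (simp add: field_simps)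
    also have "\<dots> \<le> 1 * (1 / (real m + 1))" using R m(1) by (intro mult_right_mono) auto
    also have "\<dots> \<le> \<delta> / 4" using m \<delta> by (simp add: divide_le_eq algebra_simps)
    finally have "real (pm_rank m x i) / real m - real (pm_rank m x i) / (real m + 1) \<le> \<delta> / 4" .
    moreover have "real (pm_rank m x i) / (real m + 1) \<le> real (pm_rank m x i) / real m"
      using m(1) by (intro divide_left_mono) auto
    ultimately have "\<bar>real (pm_rank m x i) / (real m + 1) - radial_unif (x i)\<bar> \<le> \<delta>"
      using r \<eta> K d unfolding abs_le_iff by linarith
    with s show "\<bar>real (pm_rank m x i) / (real m + 1) - radial_unif (x i)\<bar> \<le> \<delta> \<and> \<bar>real (slope_rank m x i) / real m - line_unif (x i)\<bar> \<le> \<delta>"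
      by simp
  qed
qed

section \<open>Replacing the ranks by their limits\<close>

lemma cmod_cis_diff_le: "cmod (cis s - cis t) \<le> \<bar>s - t\<bar>"
proof -
  have "cis s - cis t = cis t * (cis (s - t) - 1)" by (simp add: cis_mult right_diff_distrib)
  then have "cmod (cis s - cis t) = cmod (cis (s - t) - 1)" by (simp add: norm_mult)
  also have "\<dots> \<le> \<bar>s - t\<bar>" using iexp_approx1[of "s - t" 0] by (simp add: cis_conv_exp)
  finally show ?thesis .
qed

text \<open>The integral of (1 - u) to the power - 1 / 2 over the unit interval, the majorant of the
  fourth power of a score.\<close>

lemma nn_integral_radial_sqrt: "(\<integral>\<^sup>+x. ennreal (1 / sqrt (1 - radial_unif x)) \<partial>pole_law 0) = 2"
proof -
  have e: "1 / sqrt (1 - radial_unif x) = sqrt (1 + (norm x)\<^sup>2)" for x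
  proof -
    have "1 - radial_unif x = 1 / (1 + (norm x)\<^sup>2)"
      using one_plus_sq_pos[of "norm x"] by (simp add: radial_unif_def field_simps)
    then show ?thesis by (simp add: real_sqrt_divide)
  qed
  have "(\<integral>\<^sup>+x. ennreal (1 / sqrt (1 - radial_unif x)) \<partial>pole_law 0) = (\<integral>\<^sup>+x. (\<lambda>(r, s). ennreal (sqrt (1 + r\<^sup>2))) (norm x, slope x) \<partial>pole_law 0)"
    by (simp add: e)
  also have "\<dots> = (\<integral>\<^sup>+s. \<integral>\<^sup>+r. ennreal (sqrt (1 + r\<^sup>2)) \<partial>radius_law \<partial>cauchy_law)"
    by (subst nn_integral_pole_law_radius_slope) simp_all
  also have "\<dots> = (\<integral>\<^sup>+r. ennreal (sqrt (1 + r\<^sup>2)) \<partial>radius_law)"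
    using C.emeasure_space_1 by simp
  also have "\<dots> = (\<integral>\<^sup>+r. ennreal (2 * r / ((1 + r\<^sup>2) * sqrt (1 + r\<^sup>2))) * indicator {0..} r \<partial>lborel)"
    unfolding radius_law_def
  proof (subst nn_integral_density, simp, simp, rule nn_integral_cong)
    fix r :: real
    have p: "0 < 1 + r\<^sup>2" by (rule one_plus_sq_pos)
    have "2 * r / (1 + r\<^sup>2)\<^sup>2 * sqrt (1 + r\<^sup>2) = 2 * r / ((1 + r\<^sup>2) * sqrt (1 + r\<^sup>2))"
    proof -
      define q where "q = sqrt (1 + r\<^sup>2)"
      have q: "q \<noteq> 0" "(1 + r\<^sup>2)\<^sup>2 = (1 + r\<^sup>2) * q * q" using p by (simp_all add: q_def power2_eq_square)
      show ?thesis unfolding q_def[symmetric] q(2) using q(1) by simp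
    qed
    then show "ennreal (2 * r / (1 + r\<^sup>2)\<^sup>2 * indicat_real {0<..} r) * ennreal (sqrt (1 + r\<^sup>2)) =
        ennreal (2 * r / ((1 + r\<^sup>2) * sqrt (1 + r\<^sup>2))) * indicator {0..} r"
      using p by (cases "0 < r") (auto simp: ennreal_mult[symmetric] indicator_def)
  qed
  also have "\<dots> = ennreal (0 - (- 2 / sqrt (1 + 0\<^sup>2)))"
  proof (rule nn_integral_FTC_atLeast)
    fix r :: real assume r: "0 \<le> r"
    have p: "0 < 1 + r\<^sup>2" by (rule one_plus_sq_pos)
    show "((\<lambda>r. - 2 / sqrt (1 + r\<^sup>2)) has_real_derivative 2 * r / ((1 + r\<^sup>2) * sqrt (1 + r\<^sup>2))) (at r)"
      using p by (auto intro!: derivative_eq_intros simp: field_simps)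
    show "0 \<le> 2 * r / ((1 + r\<^sup>2) * sqrt (1 + r\<^sup>2))" using r p by simp
  next
    show "((\<lambda>r::real. - 2 / sqrt (1 + r\<^sup>2)) \<longlongrightarrow> 0) at_top" by real_asymp
  qed simp
  finally show ?thesis by simp
qed

lemma sum_inverse_sqrt_le: "(\<Sum>j=1..m. 1 / sqrt (real j)) \<le> 2 * sqrt (real m)"
proof (induction m)
  case (Suc m)
  \<comment> \<open>The summand is dominated by a telescoping difference of square roots.\<close>
  have "1 / sqrt (real (Suc m)) \<le> 2 * (sqrt (real (Suc m)) - sqrt (real m))"
  proof -
    let ?a = "sqrt (real (Suc m))" and ?b = "sqrt (real m)"
    have "2 * ?a * ?b \<le> ?a\<^sup>2 + ?b\<^sup>2" by (rule sum_squares_bound)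
    then have "1 \<le> 2 * (?a - ?b) * ?a" by (simp add: algebra_simps power2_eq_square)
    then show ?thesis by (simp add: divide_le_eq)
  qed
  with Suc show ?case by simp
qed simp

lemma pm_rank_le: "pm_rank m x i \<le> m"
proof -
  have "pm_rank m x i \<le> card {..<m}" unfolding pm_rank_def by (intro card_mono) auto
  then show ?thesis by simp
qed

lemma pm_rank_pos: "i < m \<Longrightarrow> 0 < pm_rank m x i"
  unfolding pm_rank_def by (subst card_gt_0_iff) auto

text \<open>The growth condition bounds the fourth moments of \<open>J\<close> under the uniform law and on the grid of the ranks,
  so truncating \<open>J\<close> at \<open>K\<close> costs only \<open>O(1 / K\<^sup>2)\<close> in mean square.\<close>

locale rank_score =
  fixes J :: "real \<Rightarrow> real" and A :: real
  assumes meas [measurable]: "J \<in> borel_measurable borel"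
    and nonneg: "0 \<le> J u"
    and growth: "0 \<le> u \<Longrightarrow> u < 1 \<Longrightarrow> J u ^ 4 * sqrt (1 - u) \<le> A"
    and trunc_uc: "uniformly_continuous_on {0..<1} (\<lambda>u. min K (J u))"
begin

lemma A_nonneg: "0 \<le> A"
  using growth[of 0] nonneg[of 0] by (simp add: order_trans[OF zero_le_power])

lemma growth': "0 \<le> u \<Longrightarrow> u < 1 \<Longrightarrow> J u ^ 4 \<le> A * (1 / sqrt (1 - u))"
  using growth[of u] by (simp add: field_simps)

lemma integrable_pow4: "integrable (pole_law 0) (\<lambda>x. J (radial_unif x) ^ 4)"
  and integral_pow4_le: "(\<integral>x. J (radial_unif x) ^ 4 \<partial>pole_law 0) \<le> 2 * A"
proof -
  have "(\<integral>\<^sup>+x. ennreal (J (radial_unif x) ^ 4) \<partial>pole_law 0) \<le> (\<integral>\<^sup>+x. ennreal A * ennreal (1 / sqrt (1 - radial_unif x)) \<partial>pole_law 0)"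
  proof (rule nn_integral_mono)
    fix x show "ennreal (J (radial_unif x) ^ 4) \<le> ennreal A * ennreal (1 / sqrt (1 - radial_unif x))"
      using growth'[OF radial_unif_bounds, of x] A_nonneg radial_unif_bounds[of x] by (simp add: ennreal_mult[symmetric] ennreal_leI)
  qed
  also have "\<dots> = ennreal A * 2" by (simp add: nn_integral_cmult nn_integral_radial_sqrt)
  also have "\<dots> = ennreal (2 * A)" using A_nonneg by (simp add: ennreal_mult mult.commute)
  finally have le: "(\<integral>\<^sup>+x. ennreal (J (radial_unif x) ^ 4) \<partial>pole_law 0) \<le> ennreal (2 * A)" .
  then show i: "integrable (pole_law 0) (\<lambda>x. J (radial_unif x) ^ 4)"
    by (intro integrableI_bounded) (auto simp: nonneg intro: le_less_trans)
  have "ennreal (\<integral>x. J (radial_unif x) ^ 4 \<partial>pole_law 0) \<le> ennreal (2 * A)"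
    using le nn_integral_eq_integral[OF i] by (simp add: nonneg)
  then show "(\<integral>x. J (radial_unif x) ^ 4 \<partial>pole_law 0) \<le> 2 * A" using A_nonneg by (simp add: ennreal_le_iff)
qed

lemma integrable_pow2: "integrable (pole_law 0) (\<lambda>x. (J (radial_unif x))\<^sup>2)"
proof (rule Bochner_Integration.integrable_bound)
  show "integrable (pole_law 0) (\<lambda>x. 1 + J (radial_unif x) ^ 4)" using integrable_pow4 by simp
  have "a\<^sup>2 \<le> 1 + a ^ 4" for a :: real
    using sum_power2_ge_zero[of "a\<^sup>2 - 1" 0] zero_le_power2[of "a\<^sup>2"] by (simp add: power2_eq_square power4_eq_xxxx algebra_simps)
  then show "AE x in pole_law 0. norm ((J (radial_unif x))\<^sup>2) \<le> norm (1 + J (radial_unif x) ^ 4)"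
    by (intro AE_I2) (simp add: nonneg)
qed simp

text \<open>The Riemann sum belonging to \<open>integral_pow4_le\<close>: at k / (m + 1) the growth
  condition gives A times the square root of (m + 1) / (m + 1 - k).\<close>

lemma sum_rank_pow4: "(\<Sum>k=1..m. J (real k / (real m + 1)) ^ 4) \<le> 4 * A * m"
proof (cases "m = 0")
  case False
  have "(\<Sum>k=1..m. J (real k / (real m + 1)) ^ 4) \<le> (\<Sum>k=1..m. A * sqrt (real m + 1) * (1 / sqrt (real (m + 1 - k))))"
  proof (rule sum_mono)
    fix k assume k: "k \<in> {1..m}"
    have "1 - real k / (real m + 1) = real (m + 1 - k) / (real m + 1)" using k by (simp add: field_simps of_nat_diff)
    then have "1 / sqrt (1 - real k / (real m + 1)) = sqrt (real m + 1) * (1 / sqrt (real (m + 1 - k)))"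
      by (simp add: real_sqrt_divide)
    then show "J (real k / (real m + 1)) ^ 4 \<le> A * sqrt (real m + 1) * (1 / sqrt (real (m + 1 - k)))"
      using growth'[of "real k / (real m + 1)"] k by (simp add: mult.assoc)
  qed
  also have "\<dots> = A * sqrt (real m + 1) * (\<Sum>k=1..m. 1 / sqrt (real (m + 1 - k)))"
    by (simp add: sum_distrib_left)
  also have "(\<Sum>k=1..m. 1 / sqrt (real (m + 1 - k))) = (\<Sum>j=1..m. 1 / sqrt (real j))"
    by (rule sum.reindex_bij_witness[of _ "\<lambda>j. m + 1 - j" "\<lambda>j. m + 1 - j"]) auto
  also have "A * sqrt (real m + 1) * (\<Sum>j=1..m. 1 / sqrt (real j)) \<le> A * sqrt (real m + 1) * (2 * sqrt (real m))"
    using A_nonneg by (intro mult_left_mono sum_inverse_sqrt_le) auto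
  also have "\<dots> \<le> A * (2 * m) * 2"
  proof -
    have "real m + 1 \<le> 4 * real m" using False by simp
    then have "sqrt (real m + 1) \<le> sqrt (4 * real m)" by (simp only: real_sqrt_le_iff)
    then have "sqrt (real m + 1) \<le> 2 * sqrt (real m)" by (simp add: real_sqrt_mult)
    then have "sqrt (real m + 1) * sqrt (real m) \<le> 2 * sqrt (real m) * sqrt (real m)"
      by (rule mult_right_mono) simp
    also have "2 * sqrt (real m) * sqrt (real m) = 2 * real m" by (simp only: mult.assoc real_sqrt_mult_self abs_of_nat)
    finally have "sqrt (real m + 1) * sqrt (real m) \<le> 2 * real m" .
    then have "2 * A * (sqrt (real m + 1) * sqrt (real m)) \<le> 2 * A * (2 * real m)" using A_nonneg by (intro mult_left_mono) auto
    then show ?thesis by (simp add: mult_ac)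
  qed
  finally show ?thesis by (simp add: mult_ac)
qed simp

text \<open>Where J exceeds K, the factor (J / K)^2 is at least 1 and may be inserted, as in
  Chebyshev's inequality.\<close>

lemma trunc_tail:
  assumes "0 < K"
  shows "(J u - min K (J u))\<^sup>2 \<le> J u ^ 4 / K\<^sup>2"
proof (cases "J u \<le> K")
  case False
  then have K: "K \<le> J u" by simp
  have "(J u - K)\<^sup>2 \<le> (J u)\<^sup>2" using K assms by (intro power_mono) auto
  also have "\<dots> \<le> (J u)\<^sup>2 * ((J u)\<^sup>2 / K\<^sup>2)"
  proof -
    have "K\<^sup>2 \<le> (J u)\<^sup>2" using K assms by (intro power_mono) auto
    then have "1 \<le> (J u)\<^sup>2 / K\<^sup>2" using assms by simp
    then have "(J u)\<^sup>2 * 1 \<le> (J u)\<^sup>2 * ((J u)\<^sup>2 / K\<^sup>2)" by (intro mult_left_mono) auto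
    then show ?thesis by simp
  qed
  also have "\<dots> = J u ^ 4 / K\<^sup>2" by (simp add: power2_eq_square power4_eq_xxxx)
  finally show ?thesis using K by (simp add: min_def)
qed (use assms in \<open>simp add: min_def\<close>)

definition limit_score :: "real^2 \<Rightarrow> complex" where
  "limit_score y = complex_of_real (J (radial_unif y)) * cis (line_angle y)"

text \<open>The difference is split into two truncation tails, the change of the truncated score,
  and the change of the angle. The factor 4 is Cauchy-Schwarz for four summands.\<close>

lemma score_difference:
  assumes K: "0 < K" and "cmod p = 1" "cmod q = 1"
  shows "(cmod (complex_of_real (J u) * p - complex_of_real (J v) * q))\<^sup>2
     \<le> 4 * (J u ^ 4 / K\<^sup>2 + J v ^ 4 / K\<^sup>2 + (min K (J u) - min K (J v))\<^sup>2 + K\<^sup>2 * (cmod (p - q))\<^sup>2)"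
proof -
  define a b aK bK where "a = J u" and "b = J v" and "aK = min K (J u)" and "bK = min K (J v)"
  have bK: "0 \<le> bK" "bK \<le> K" using K nonneg by (auto simp: bK_def)
  have "complex_of_real a * p - complex_of_real b * q
     = complex_of_real (a - aK) * p + complex_of_real (aK - bK) * p + complex_of_real bK * (p - q) - complex_of_real (b - bK) * q"
    by (simp add: algebra_simps)
  also have "cmod \<dots> \<le> cmod (complex_of_real (a - aK) * p) + cmod (complex_of_real (aK - bK) * p) + cmod (complex_of_real bK * (p - q)) + cmod (complex_of_real (b - bK) * q)"
    by (intro order_trans[OF norm_triangle_ineq4] add_right_mono order_trans[OF norm_triangle_ineq] order_refl)
  also have "\<dots> = \<bar>a - aK\<bar> + \<bar>aK - bK\<bar> + bK * cmod (p - q) + \<bar>b - bK\<bar>"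
    unfolding norm_mult norm_of_real using assms bK by simp
  also have "\<dots> \<le> \<bar>a - aK\<bar> + \<bar>aK - bK\<bar> + K * cmod (p - q) + \<bar>b - bK\<bar>"
    using bK by (intro add_mono mult_right_mono) auto
  finally have "(cmod (complex_of_real a * p - complex_of_real b * q))\<^sup>2 \<le> (\<bar>a - aK\<bar> + \<bar>aK - bK\<bar> + K * cmod (p - q) + \<bar>b - bK\<bar>)\<^sup>2"
    by (intro power_mono) auto
  also have "\<dots> \<le> 4 * (\<bar>a - aK\<bar>\<^sup>2 + \<bar>aK - bK\<bar>\<^sup>2 + (K * cmod (p - q))\<^sup>2 + \<bar>b - bK\<bar>\<^sup>2)"
  proof -
    have "(w + x + y + z)\<^sup>2 \<le> 4 * (w\<^sup>2 + x\<^sup>2 + y\<^sup>2 + z\<^sup>2)" for w x y z :: real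
    proof -
      have "0 \<le> (w - x)\<^sup>2 + (w - y)\<^sup>2 + (w - z)\<^sup>2 + (x - y)\<^sup>2 + (x - z)\<^sup>2 + (y - z)\<^sup>2" by simp
      then show ?thesis by (simp add: power2_eq_square algebra_simps)
    qed
    then show ?thesis .
  qed
  finally have "(cmod (complex_of_real a * p - complex_of_real b * q))\<^sup>2 \<le> 4 * ((a - aK)\<^sup>2 + (aK - bK)\<^sup>2 + K\<^sup>2 * (cmod (p - q))\<^sup>2 + (b - bK)\<^sup>2)"
    by (simp add: power_mult_distrib)
  moreover have "X \<le> 4 * (S + V + t + w)" if "X \<le> 4 * (s + t + w + v)" "s \<le> S" "v \<le> V" for X s t w v S V :: real
    using that by simp
  moreover have "(a - aK)\<^sup>2 \<le> J u ^ 4 / K\<^sup>2" "(b - bK)\<^sup>2 \<le> J v ^ 4 / K\<^sup>2"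
    using trunc_tail[OF K] by (simp_all add: a_def b_def aK_def bK_def)
  ultimately have "(cmod (complex_of_real a * p - complex_of_real b * q))\<^sup>2
     \<le> 4 * (J u ^ 4 / K\<^sup>2 + J v ^ 4 / K\<^sup>2 + (aK - bK)\<^sup>2 + K\<^sup>2 * (cmod (p - q))\<^sup>2)" by blast
  then show ?thesis unfolding a_def b_def aK_def bK_def .
qed

definition score_error :: "nat \<Rightarrow> real^2 \<Rightarrow> real" where
  "score_error m \<mu> = (\<Sum>i<m. \<integral>x. (cmod (line_score J m x i - limit_score (x i)))\<^sup>2 \<partial>pole_sample m \<mu>) / m"

lemma measurable_limit_score [measurable]: "limit_score \<in> borel_measurable borel"
  unfolding limit_score_def[abs_def] cis_conv_exp by measurable

lemma cmod_limit_score: "cmod (limit_score y) = J (radial_unif y)"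
  by (simp add: limit_score_def norm_mult nonneg)

lemma cmod_line_score_le: "cmod (line_score J m x i) \<le> (\<Sum>k\<le>m. J (real k / (real m + 1)))"
proof -
  have "cmod (line_score J m x i) = J (real (pm_rank m x i) / (real m + 1))"
    by (simp add: line_score_def norm_mult nonneg)
  also have "\<dots> \<le> (\<Sum>k\<le>m. J (real k / (real m + 1)))"
    using pm_rank_le[of m x i] nonneg by (intro member_le_sum) auto
  finally show ?thesis .
qed

lemma measurable_score_diff:
  assumes "i < m"
  shows "(\<lambda>x. line_score J m x i - limit_score (x i)) \<in> borel_measurable (pole_sample m \<mu>)"
  by (intro borel_measurable_diff measurable_line_score pole_sample_component assms
      measurable_compose[OF pole_sample_component measurable_limit_score])

lemma integrable_limit_score: "integrable (pole_law \<mu>) (\<lambda>y. (cmod (limit_score y))\<^sup>2)"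
  unfolding cmod_limit_score by (rule integrable_pole_law[OF _ integrable_pow2]) simp

lemma integrable_score_diff:
  assumes "i < m"
  shows "integrable (pole_sample m \<mu>) (\<lambda>x. (cmod (line_score J m x i - limit_score (x i)))\<^sup>2)"
proof (rule Bochner_Integration.integrable_bound)
  let ?B = "\<Sum>k\<le>m. J (real k / (real m + 1))"
  show "integrable (pole_sample m \<mu>) (\<lambda>x. 2 * ?B\<^sup>2 + 2 * (cmod (limit_score (x i)))\<^sup>2)"
    using integrable_limit_score[of \<mu>] pole_sample_integral_component(2)[OF assms, of "\<lambda>y. (cmod (limit_score y))\<^sup>2" \<mu>] by simp
  show "(\<lambda>x. (cmod (line_score J m x i - limit_score (x i)))\<^sup>2) \<in> borel_measurable (pole_sample m \<mu>)"
    using measurable_score_diff[OF assms] by simp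
  have "(cmod (line_score J m x i - limit_score (x i)))\<^sup>2 \<le> 2 * ?B\<^sup>2 + 2 * (cmod (limit_score (x i)))\<^sup>2" for x
  proof -
    have "(cmod (line_score J m x i - limit_score (x i)))\<^sup>2 \<le> (?B + cmod (limit_score (x i)))\<^sup>2"
      by (intro power_mono order_trans[OF norm_triangle_ineq4] add_right_mono cmod_line_score_le) auto
    also have "\<dots> \<le> 2 * ?B\<^sup>2 + 2 * (cmod (limit_score (x i)))\<^sup>2"
      using sum_squares_bound[of ?B "cmod (limit_score (x i))"] by (simp add: power2_sum)
    finally show ?thesis .
  qed
  then show "AE x in pole_sample m \<mu>. norm ((cmod (line_score J m x i - limit_score (x i)))\<^sup>2) \<le> norm (2 * ?B\<^sup>2 + 2 * (cmod (limit_score (x i)))\<^sup>2)"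
    by (intro AE_I2) (auto intro!: order_trans[OF _ abs_ge_self])
qed

text \<open>Of 8 A, one half comes from the grid of the ranks and one half from the law of
  \<open>radial_unif\<close> at the shifted centre. Off the event B the ranks are uniformly close to
  their limits; on B the truncated scores are bounded crudely.\<close>

lemma score_error_bound:
  assumes K: "0 < K" and \<epsilon>: "0 < \<epsilon>"
  obtains B where "((\<lambda>(m, \<mu>). measure (pole_sample m \<mu>) (B m \<mu>)) \<longlongrightarrow> 0) local_filter"
    "\<forall>\<^sub>F (m, \<mu>) in local_filter. score_error m \<mu> \<le> 4 * (8 * A / K\<^sup>2 + \<epsilon> + 5 * K\<^sup>2 * measure (pole_sample m \<mu>) (B m \<mu>))"
proof -
  define e where "e = sqrt (\<epsilon> / 2)"
  have e: "0 < e" "e\<^sup>2 = \<epsilon> / 2" using \<epsilon> by (simp_all add: e_def)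
  obtain d where d: "0 < d" "\<And>u v. u \<in> {0..<1} \<Longrightarrow> v \<in> {0..<1} \<Longrightarrow> dist v u < d \<Longrightarrow> dist (min K (J v)) (min K (J u)) < e"
    using trunc_uc[of K] e(1) unfolding uniformly_continuous_on_def by metis
  \<comment> \<open>One bound serves the uniform continuity of the truncated score, the other makes
    K times the angular error pi * \<delta> at most e.\<close>
  define \<delta> where "\<delta> = min (d / 2) (e / (K * pi))"
  have \<delta>: "0 < \<delta>" "\<delta> < d" "\<delta> \<le> e / (K * pi)" using d e K by (auto simp: \<delta>_def)
  obtain N \<eta> where \<eta>: "0 < \<eta>" and near: "\<And>m \<mu> x i. 0 < m \<Longrightarrow> 4 \<le> \<delta> * m \<Longrightarrow> \<forall>i<m. x i $ 1 \<noteq> 0 \<Longrightarrow> x \<in> space (pole_sample m \<mu>) \<Longrightarrow>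
     x \<notin> deviation_set (test_functions N) \<eta> m \<mu> \<Longrightarrow> i < m \<Longrightarrow>
     \<bar>real (pm_rank m x i) / (real m + 1) - radial_unif (x i)\<bar> \<le> \<delta> \<and> \<bar>real (slope_rank m x i) / real m - line_unif (x i)\<bar> \<le> \<delta>"
    using ranks_near[OF \<delta>(1)] by metis
  define B where "B m \<mu> = deviation_set (test_functions N) \<eta> m \<mu>" for m \<mu>
  have B0: "((\<lambda>(m, \<mu>). measure (pole_sample m \<mu>) (B m \<mu>)) \<longlongrightarrow> 0) local_filter"
    unfolding B_def by (rule deviation_set_null[OF test_functions(1) _ _ \<eta>]) (auto intro: test_functions)
  have "\<forall>\<^sub>F m in sequentially. 4 / \<delta> \<le> real m"
    using filterlim_real_sequentially unfolding filterlim_at_top by blast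
  then have "\<forall>\<^sub>F (m, \<mu>) in local_filter. 4 / \<delta> \<le> real m"
    using eventually_prod_same by (auto simp: eventually_prod1 case_prod_unfold intro: eventually_compose_filterlim[OF _ filterlim_fst])
  then have "\<forall>\<^sub>F (m, \<mu>) in local_filter. score_error m \<mu> \<le> 4 * (8 * A / K\<^sup>2 + \<epsilon> + 5 * K\<^sup>2 * measure (pole_sample m \<mu>) (B m \<mu>))"
    using eventually_near[OF zero_less_one]
  proof eventually_elim
    case (elim p)
    obtain m \<mu> where p: "p = (m, \<mu>)" by (cases p)
    have m: "0 < m" "4 \<le> \<delta> * m" "ratio_bound (norm \<mu>) \<le> 2" using elim \<delta> by (simp_all add: p field_simps)
    let ?M = "pole_sample m \<mu>"
    have setsB [measurable]: "B m \<mu> \<in> sets ?M" unfolding B_def by (rule sets_deviation_set) (auto intro: test_functions)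
    define E where "E i x = (cmod (line_score J m x i - limit_score (x i)))\<^sup>2" for i x
    define R where "R x = 4 * (4 * A * m / K\<^sup>2 + (\<Sum>i<m. J (radial_unif (x i)) ^ 4) / K\<^sup>2 + m * (\<epsilon> + 5 * K\<^sup>2 * indicator (B m \<mu>) x))" for x
    have pw: "E i x \<le> 4 * (J (real (pm_rank m x i) / (real m + 1)) ^ 4 / K\<^sup>2 + J (radial_unif (x i)) ^ 4 / K\<^sup>2 + (\<epsilon> + 5 * K\<^sup>2 * indicator (B m \<mu>) x))"
      if x: "x \<in> space ?M" "\<forall>i<m. x i $ 1 \<noteq> 0" and i: "i < m" for i x
    proof -
      let ?u = "real (pm_rank m x i) / (real m + 1)" and ?v = "radial_unif (x i)"
      let ?s = "pi * (real (slope_rank m x i) / real m - 1 / 2)"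
      have u: "?u \<in> {0..<1}" using pm_rank_le[of m x i] by simp
      have v: "?v \<in> {0..<1}" using radial_unif_bounds[of "x i"] by simp
      have "(min K (J ?u) - min K (J ?v))\<^sup>2 + K\<^sup>2 * (cmod (cis ?s - cis (line_angle (x i))))\<^sup>2 \<le> \<epsilon> + 5 * K\<^sup>2 * indicator (B m \<mu>) x"
      proof (cases "x \<in> B m \<mu>")
        case True
        have "\<bar>min K (J ?u) - min K (J ?v)\<bar> \<le> K" using nonneg[of ?u] nonneg[of ?v] K by (auto simp: min_def abs_le_iff)
        then have 1: "(min K (J ?u) - min K (J ?v))\<^sup>2 \<le> K\<^sup>2" using K by (simp add: abs_le_square_iff[symmetric])
        have "cmod (cis ?s - cis (line_angle (x i))) \<le> 2" using norm_triangle_ineq4[of "cis ?s" "cis (line_angle (x i))"] by simp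
        then have "(cmod (cis ?s - cis (line_angle (x i))))\<^sup>2 \<le> 2\<^sup>2" by (intro power_mono) auto
        then have "K\<^sup>2 * (cmod (cis ?s - cis (line_angle (x i))))\<^sup>2 \<le> K\<^sup>2 * 2\<^sup>2" by (intro mult_left_mono) auto
        with 1 True \<epsilon> show ?thesis by simp
      next
        case False
        have n: "\<bar>?u - ?v\<bar> \<le> \<delta>" "\<bar>real (slope_rank m x i) / real m - line_unif (x i)\<bar> \<le> \<delta>"
          using near[OF m(1,2) x(2,1) False[unfolded B_def] i] by auto
        have "dist ?u ?v < d" using n \<delta> by (simp add: dist_real_def)
        from d(2)[OF v u this] have "\<bar>min K (J ?u) - min K (J ?v)\<bar> \<le> e" by (simp add: dist_real_def)
        then have 1: "(min K (J ?u) - min K (J ?v))\<^sup>2 \<le> e\<^sup>2" using e by (simp add: abs_le_square_iff[symmetric])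
        have "cmod (cis ?s - cis (line_angle (x i))) \<le> \<bar>?s - line_angle (x i)\<bar>" by (rule cmod_cis_diff_le)
        also have "?s - line_angle (x i) = pi * (real (slope_rank m x i) / real m - line_unif (x i))"
          by (simp add: line_angle_eq algebra_simps)
        also have "\<bar>\<dots>\<bar> \<le> pi * \<delta>" unfolding abs_mult using n(2) by (simp add: mult_left_mono)
        also have "\<dots> \<le> pi * (e / (K * pi))" using \<delta> by (intro mult_left_mono) auto
        also have "\<dots> = e / K" by simp
        finally have "K * cmod (cis ?s - cis (line_angle (x i))) \<le> e" using K by (simp add: field_simps)
        then have "(K * cmod (cis ?s - cis (line_angle (x i))))\<^sup>2 \<le> e\<^sup>2" using K by (intro power_mono) auto
        with 1 False show ?thesis by (simp add: e(2) power_mult_distrib)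
      qed
      then have "4 * (a + b + (min K (J ?u) - min K (J ?v))\<^sup>2 + K\<^sup>2 * (cmod (cis ?s - cis (line_angle (x i))))\<^sup>2)
          \<le> 4 * (a + b + (\<epsilon> + 5 * K\<^sup>2 * indicator (B m \<mu>) x))" for a b
        unfolding add.assoc by (intro mult_left_mono add_left_mono) (simp_all add: add.assoc)
      moreover have "E i x \<le> 4 * (J ?u ^ 4 / K\<^sup>2 + J ?v ^ 4 / K\<^sup>2 + (min K (J ?u) - min K (J ?v))\<^sup>2 + K\<^sup>2 * (cmod (cis ?s - cis (line_angle (x i))))\<^sup>2)"
        unfolding E_def line_score_def limit_score_def by (rule score_difference[OF K]) auto
      ultimately show ?thesis by (rule order_trans[rotated])
    qed
    have int4: "integrable (pole_law \<mu>) (\<lambda>y. J (radial_unif y) ^ 4)"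
      by (rule integrable_pole_law[OF _ integrable_pow4]) simp
    have int4': "integrable ?M (\<lambda>x. J (radial_unif (x i)) ^ 4)" if "i < m" for i
      using int4 pole_sample_integral_component(2)[OF that, of "\<lambda>y. J (radial_unif y) ^ 4" \<mu>] by simp
    have int4s: "integrable ?M (\<lambda>x. \<Sum>i<m. J (radial_unif (x i)) ^ 4)"
      using int4' by (intro Bochner_Integration.integrable_sum) auto
    have intB: "integrable ?M (\<lambda>x. indicator (B m \<mu>) x :: real)"
      by (intro integrable_real_indicator setsB) (simp add: pole_sample.emeasure_eq_measure)
    have intR: "integrable ?M R" unfolding R_def[abs_def]
      using int4s intB by simp
    have intE: "integrable ?M (E i)" if "i < m" for i unfolding E_def[abs_def] by (rule integrable_score_diff[OF that])
    have "(\<Sum>i<m. \<integral>x. E i x \<partial>?M) = (\<integral>x. (\<Sum>i<m. E i x) \<partial>?M)"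
      by (rule Bochner_Integration.integral_sum[symmetric]) (use intE in auto)
    also have "\<dots> \<le> (\<integral>x. R x \<partial>?M)"
    proof (rule integral_mono_AE)
      show "integrable ?M (\<lambda>x. \<Sum>i<m. E i x)" using intE by (intro Bochner_Integration.integrable_sum) auto
      show "AE x in ?M. (\<Sum>i<m. E i x) \<le> R x"
        using AE_no_ties[of m \<mu>] AE_space
      proof eventually_elim
        case (elim x)
        then have nz: "\<forall>i<m. x i $ 1 \<noteq> 0" and inj: "inj_on (\<lambda>i. disc_form (tyler_disc m x) (x i)) {..<m}" and xs: "x \<in> space ?M" by auto
        have "(\<Sum>i<m. E i x) \<le> (\<Sum>i<m. 4 * (J (real (pm_rank m x i) / (real m + 1)) ^ 4 / K\<^sup>2 + J (radial_unif (x i)) ^ 4 / K\<^sup>2 + (\<epsilon> + 5 * K\<^sup>2 * indicator (B m \<mu>) x)))"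
          by (intro sum_mono pw[OF xs nz]) auto
        also have "\<dots> = 4 * ((\<Sum>i<m. J (real (pm_rank m x i) / (real m + 1)) ^ 4) / K\<^sup>2 + (\<Sum>i<m. J (radial_unif (x i)) ^ 4) / K\<^sup>2 + m * (\<epsilon> + 5 * K\<^sup>2 * indicator (B m \<mu>) x))"
          unfolding sum_distrib_left[symmetric] sum.distrib sum_divide_distrib by (simp add: algebra_simps)
        also have "(\<Sum>i<m. J (real (pm_rank m x i) / (real m + 1)) ^ 4) = (\<Sum>k=1..m. J (real k / (real m + 1)) ^ 4)"
          unfolding pm_rank_eq by (rule sum_rank[OF inj, of "\<lambda>k. J (real k / (real m + 1)) ^ 4"])
        also have "4 * ((\<Sum>k=1..m. J (real k / (real m + 1)) ^ 4) / K\<^sup>2 + (\<Sum>i<m. J (radial_unif (x i)) ^ 4) / K\<^sup>2 + m * (\<epsilon> + 5 * K\<^sup>2 * indicator (B m \<mu>) x)) \<le> R x"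
          unfolding R_def by (intro mult_left_mono add_right_mono divide_right_mono sum_rank_pow4) auto
        finally show ?case .
      qed
    qed (rule intR)
    also have "(\<integral>x. R x \<partial>?M) = 4 * (4 * A * m / K\<^sup>2 + (\<Sum>i<m. \<integral>y. J (radial_unif y) ^ 4 \<partial>pole_law \<mu>) / K\<^sup>2 + m * (\<epsilon> + 5 * K\<^sup>2 * measure ?M (B m \<mu>)))"
    proof -
      have "(\<integral>x. (\<Sum>i<m. J (radial_unif (x i)) ^ 4) \<partial>?M) = (\<Sum>i<m. \<integral>y. J (radial_unif y) ^ 4 \<partial>pole_law \<mu>)"
        using int4' pole_sample_integral_component(1)[of _ m "\<lambda>y. J (radial_unif y) ^ 4" \<mu>]
        by (subst Bochner_Integration.integral_sum) auto
      then show ?thesis unfolding R_def using int4s intB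
        by (simp add: pole_sample.prob_space)
    qed
    \<comment> \<open>The fourth moment is at most 2 A at the centre \<open>0\<close>, and the ratio
      bound is at most 2 eventually.\<close>
    also have "(\<integral>y. J (radial_unif y) ^ 4 \<partial>pole_law \<mu>) \<le> 4 * A"
    proof -
      have "(\<integral>y. J (radial_unif y) ^ 4 \<partial>pole_law \<mu>) \<le> ratio_bound (norm \<mu>) * (\<integral>y. J (radial_unif y) ^ 4 \<partial>pole_law 0)"
        by (rule integral_pole_law_le[OF _ integrable_pow4]) (auto simp: nonneg)
      also have "\<dots> \<le> 2 * (2 * A)"
        using m(3) integral_pow4_le nonneg by (intro mult_mono) (auto intro!: integral_nonneg_AE AE_I2)
      finally show ?thesis by simp
    qed
    then have "4 * (4 * A * m / K\<^sup>2 + (\<Sum>i<m. \<integral>y. J (radial_unif y) ^ 4 \<partial>pole_law \<mu>) / K\<^sup>2 + m * (\<epsilon> + 5 * K\<^sup>2 * measure ?M (B m \<mu>)))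
      \<le> 4 * (4 * A * m / K\<^sup>2 + (\<Sum>i<m. 4 * A) / K\<^sup>2 + m * (\<epsilon> + 5 * K\<^sup>2 * measure ?M (B m \<mu>)))"
      by (intro mult_left_mono add_right_mono add_left_mono divide_right_mono sum_mono) auto
    also have "\<dots> = m * (4 * (8 * A / K\<^sup>2 + \<epsilon> + 5 * K\<^sup>2 * measure ?M (B m \<mu>)))"
      by (simp add: field_simps)
    finally have "(\<Sum>i<m. \<integral>x. E i x \<partial>?M) \<le> m * (4 * (8 * A / K\<^sup>2 + \<epsilon> + 5 * K\<^sup>2 * measure ?M (B m \<mu>)))" .
    then have "score_error m \<mu> \<le> 4 * (8 * A / K\<^sup>2 + \<epsilon> + 5 * K\<^sup>2 * measure ?M (B m \<mu>))"
      using m(1) by (simp add: score_error_def E_def pos_divide_le_eq mult.commute)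
    then show ?case by (simp add: p)
  qed
  with B0 show thesis by (rule that)
qed

lemma score_error_nonneg: "0 \<le> score_error m \<mu>"
  by (simp add: score_error_def sum_nonneg)

text \<open>The order of limits matters: K is fixed first to make the truncation term small, and
  only then does the probability of the event B vanish, whose weight contains K^2.\<close>

lemma score_error_tendsto: "((\<lambda>(m, \<mu>). score_error m \<mu>) \<longlongrightarrow> 0) local_filter"
proof (rule tendstoI)
  fix \<epsilon> :: real assume \<epsilon>: "0 < \<epsilon>"
  obtain K where K: "0 < K" "4 * (8 * A / K\<^sup>2) \<le> \<epsilon> / 4"
  proof -
    have "((\<lambda>K. 4 * (8 * A / K\<^sup>2)) \<longlongrightarrow> 0) at_top" by real_asymp
    then have "\<forall>\<^sub>F K in at_top. 4 * (8 * A / K\<^sup>2) < \<epsilon> / 4" using \<epsilon> by (intro order_tendstoD(2)) auto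
    from eventually_happens[OF eventually_conj[OF this eventually_gt_at_top[of 0]]] show thesis using that by fastforce
  qed
  have "0 < \<epsilon> / 16" using \<epsilon> by simp
  from score_error_bound[OF K(1) this] obtain B where
    B: "((\<lambda>(m, \<mu>). measure (pole_sample m \<mu>) (B m \<mu>)) \<longlongrightarrow> 0) local_filter"
    and le: "\<forall>\<^sub>F (m, \<mu>) in local_filter. score_error m \<mu> \<le> 4 * (8 * A / K\<^sup>2 + \<epsilon> / 16 + 5 * K\<^sup>2 * measure (pole_sample m \<mu>) (B m \<mu>))"
    by blast
  have "0 < \<epsilon> / (80 * K\<^sup>2)" using \<epsilon> K by simp
  from order_tendstoD(2)[OF B this] le
  show "\<forall>\<^sub>F p in local_filter. dist (case p of (m, \<mu>) \<Rightarrow> score_error m \<mu>) 0 < \<epsilon>"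
  proof eventually_elim
    case (elim p)
    obtain m \<mu> where p: "p = (m, \<mu>)" by (cases p)
    have "measure (pole_sample m \<mu>) (B m \<mu>) * (20 * K\<^sup>2) < \<epsilon> / (80 * K\<^sup>2) * (20 * K\<^sup>2)"
      using elim K by (intro mult_strict_right_mono) (auto simp: p)
    also have "\<dots> = \<epsilon> / 4" using K by simp
    finally have "measure (pole_sample m \<mu>) (B m \<mu>) * (20 * K\<^sup>2) < \<epsilon> / 4" .
    moreover have "4 * (8 * A / K\<^sup>2 + \<epsilon> / 16 + 5 * K\<^sup>2 * measure (pole_sample m \<mu>) (B m \<mu>))
      = 4 * (8 * A / K\<^sup>2) + \<epsilon> / 4 + measure (pole_sample m \<mu>) (B m \<mu>) * (20 * K\<^sup>2)" by (simp add: algebra_simps)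
    ultimately have "score_error m \<mu> < \<epsilon>" using elim K(2) \<epsilon> by (simp only: p prod.case)
    then show ?case using score_error_nonneg[of m \<mu>] by (simp add: p)
  qed
qed

end

section \<open>Shifts of the center\<close>

text \<open>The difference quotient of the likelihood ratio in the direction e. At s = 0 it is given
  its limit, the location score of the pole density, so that it is continuous there.\<close>

definition shift_score :: "real^2 \<Rightarrow> real \<Rightarrow> real^2 \<Rightarrow> real" where
  "shift_score e s y = (if s = 0 then 4 * (y \<bullet> e) / (1 + (norm y)\<^sup>2) else (lratio (s *\<^sub>R e) y - 1) / s)"

lemma abs_le_1_plus_sq: "\<bar>a :: real\<bar> \<le> 1 + a\<^sup>2"
proof -
  have "2 * \<bar>a\<bar> \<le> 1 + a\<^sup>2" using sum_power2_ge_zero[of "\<bar>a\<bar> - 1" 0] by (simp add: power2_eq_square algebra_simps)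
  then show ?thesis using abs_ge_zero[of a] by linarith
qed

lemma borel_measurable_inner_cis [measurable]: "(\<lambda>y. \<xi> \<bullet> cis (line_angle y)) \<in> borel_measurable borel"
  unfolding inner_complex_def by simp

lemma borel_measurable_shift_score [measurable]: "shift_score e s \<in> borel_measurable borel"
  unfolding shift_score_def[abs_def] by (cases "s = 0") auto

text \<open>The bound, uniform in s, supplies the dominating function for the limit s to 0; its
  constant is that of \<open>ratio_bound_linear\<close>.\<close>

lemma abs_shift_score_le:
  assumes "norm e = 1" "0 \<le> s" "s \<le> 1"
  shows "\<bar>shift_score e s y\<bar> \<le> 8"
proof (cases "s = 0")
  case True
  have "\<bar>y \<bullet> e\<bar> \<le> norm y" using Cauchy_Schwarz_ineq2[of y e] assms by simp
  also have "\<dots> \<le> 1 + (norm y)\<^sup>2" using abs_le_1_plus_sq[of "norm y"] by simp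
  finally have "4 * \<bar>y \<bullet> e\<bar> \<le> 8 * (1 + (norm y)\<^sup>2)" by simp
  then show ?thesis using True one_plus_sq_pos[of "norm y"] by (simp add: shift_score_def abs_mult divide_le_eq)
next
  case False
  then have s: "0 < s" using assms by simp
  have "\<bar>lratio (s *\<^sub>R e) y - 1\<bar> \<le> ratio_bound s - 1" using abs_lratio_minus_1[of "s *\<^sub>R e" y] assms by simp
  also have "\<dots> \<le> 8 * s" using assms by (intro ratio_bound_linear)
  finally show ?thesis using s by (simp add: shift_score_def divide_le_eq)
qed

lemma shift_score_tendsto:
  assumes e: "norm e = 1" and s: "s \<longlonglongrightarrow> 0"
  shows "(\<lambda>k. shift_score e (s k) y) \<longlonglongrightarrow> shift_score e 0 y"
proof -
  define f where "f s = lratio (s *\<^sub>R e) y" for s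
  define r where "r = (norm y)\<^sup>2"
  have r: "0 \<le> r" by (simp add: r_def)
  have n: "(norm (y - s *\<^sub>R e))\<^sup>2 = r - 2 * s * (y \<bullet> e) + s\<^sup>2" for s
  proof -
    have "e \<bullet> e = 1" using e by (simp add: dot_square_norm)
    then show ?thesis unfolding r_def dot_square_norm[symmetric]
      by (simp add: inner_diff_left inner_diff_right inner_commute power2_eq_square algebra_simps)
  qed
  have f: "f s = ((1 + r) / (1 + (r - 2 * s * (y \<bullet> e) + s\<^sup>2)))\<^sup>2" for s
    unfolding f_def lratio_def pole_density_def pole_radial_def n by (simp add: power_divide r_def)
  have p: "1 + r \<noteq> 0" using r by simp
  have "DERIV (\<lambda>s. (1 + r) / (1 + (r - 2 * s * (y \<bullet> e) + s\<^sup>2))) 0 :> (1 + r) * (2 * (y \<bullet> e)) / ((1 + r) * (1 + r))"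
    using p by (auto intro!: derivative_eq_intros)
  then have "DERIV f 0 :> 2 * ((1 + r) / (1 + (r - 2 * 0 * (y \<bullet> e) + 0\<^sup>2))) * ((1 + r) * (2 * (y \<bullet> e)) / ((1 + r) * (1 + r)))"
    unfolding f[abs_def] by (auto intro!: derivative_eq_intros)
  then have "DERIV f 0 :> 4 * (y \<bullet> e) / (1 + r)" using p by simp
  moreover have "f 0 = 1" using r by (simp add: f)
  ultimately have "((\<lambda>h. (f h - 1) / h) \<longlongrightarrow> 4 * (y \<bullet> e) / (1 + r)) (at 0)"
    by (simp add: DERIV_def)
  then have "isCont (\<lambda>s. shift_score e s y) 0"
    unfolding isCont_def shift_score_def f_def r_def if_True simp_thms
    by (rule Lim_transform_eventually) (auto simp: eventually_at intro!: exI[of _ 1])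
  from isCont_tendsto_compose[OF this s] show ?thesis .
qed

context
  fixes f :: "real^2 \<Rightarrow> real" and e :: "real^2"
  assumes f_meas [measurable]: "f \<in> borel_measurable borel" and f_int: "integrable (pole_law 0) f"
    and f_mean: "(\<integral>y. f y \<partial>pole_law 0) = 0" and e_norm: "norm e = 1"
begin

text \<open>The mean of f at the centre \<open>0\<close> vanishes, so only the likelihood ratio
  minus 1 contributes, and this is s times the difference quotient.\<close>

lemma integral_shift: "(\<integral>y. f y \<partial>pole_law (s *\<^sub>R e)) = s * (\<integral>y. f y * shift_score e s y \<partial>pole_law 0)"
proof (cases "s = 0")
  case False
  have "(\<integral>y. f y \<partial>pole_law (s *\<^sub>R e)) = (\<integral>y. lratio (s *\<^sub>R e) y * f y \<partial>pole_law 0) - (\<integral>y. f y \<partial>pole_law 0)"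
    using integral_pole_law[OF f_meas f_int, of "s *\<^sub>R e"] f_mean by simp
  also have "\<dots> = (\<integral>y. lratio (s *\<^sub>R e) y * f y - f y \<partial>pole_law 0)"
    using integrable_lratio[OF f_meas f_int, of "s *\<^sub>R e"] f_int by simp
  also have "\<dots> = (\<integral>y. s * (f y * shift_score e s y) \<partial>pole_law 0)"
    using False by (intro Bochner_Integration.integral_cong) (simp_all add: shift_score_def, simp add: algebra_simps)
  finally show ?thesis by simp
qed (simp add: f_mean)

lemma integral_shift_tendsto:
  assumes s: "s \<longlonglongrightarrow> 0" and nn: "\<And>k. 0 \<le> s k"
  shows "(\<lambda>k. \<integral>y. f y * shift_score e (s k) y \<partial>pole_law 0) \<longlonglongrightarrow> (\<integral>y. f y * shift_score e 0 y \<partial>pole_law 0)"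
proof -
  have "\<forall>\<^sub>F k in sequentially. s k < 1" by (rule order_tendstoD(2)[OF s]) simp
  then obtain N where N: "\<And>k. N \<le> k \<Longrightarrow> s k < 1" unfolding eventually_sequentially by auto
  have "(\<lambda>k. \<integral>y. f y * shift_score e (s (k + N)) y \<partial>pole_law 0) \<longlonglongrightarrow> (\<integral>y. f y * shift_score e 0 y \<partial>pole_law 0)"
  proof (rule integral_dominated_convergence[where w="\<lambda>y. 8 * \<bar>f y\<bar>"])
    show "integrable (pole_law 0) (\<lambda>y. 8 * \<bar>f y\<bar>)" using f_int by simp
    show "AE y in pole_law 0. (\<lambda>k. f y * shift_score e (s (k + N)) y) \<longlonglongrightarrow> f y * shift_score e 0 y"
      by (intro AE_I2 tendsto_mult_left shift_score_tendsto[OF e_norm] LIMSEQ_ignore_initial_segment s)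
    show "AE y in pole_law 0. norm (f y * shift_score e (s (k + N)) y) \<le> 8 * \<bar>f y\<bar>" for k
    proof (rule AE_I2)
      fix y
      have "\<bar>f y\<bar> * \<bar>shift_score e (s (k + N)) y\<bar> \<le> \<bar>f y\<bar> * 8"
        using N[of "k + N"] nn by (intro mult_left_mono abs_shift_score_le e_norm) (auto intro: less_imp_le)
      then show "norm (f y * shift_score e (s (k + N)) y) \<le> 8 * \<bar>f y\<bar>" by (simp add: abs_mult)
    qed
  qed simp_all
  then show ?thesis by (rule LIMSEQ_offset)
qed

end

lemma tendsto_integral_pole_law:
  fixes f :: "real^2 \<Rightarrow> real"
  assumes [measurable]: "f \<in> borel_measurable borel" and int: "integrable (pole_law 0) f" and mu: "\<mu> \<longlonglongrightarrow> 0"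
  shows "(\<lambda>k. \<integral>y. f y \<partial>pole_law (\<mu> k)) \<longlonglongrightarrow> (\<integral>y. f y \<partial>pole_law 0)"
proof (rule LIM_zero_cancel, rule Lim_null_comparison)
  show "\<forall>\<^sub>F k in sequentially. norm ((\<integral>y. f y \<partial>pole_law (\<mu> k)) - (\<integral>y. f y \<partial>pole_law 0)) \<le> (ratio_bound (norm (\<mu> k)) - 1) * (\<integral>y. norm (f y) \<partial>pole_law 0)"
    using integral_pole_law_diff[OF _ int] by (intro always_eventually) auto
  have "(\<lambda>k. ratio_bound (norm (\<mu> k))) \<longlonglongrightarrow> 1" by (rule filterlim_compose[OF tendsto_ratio_bound mu])
  then have "(\<lambda>k. (ratio_bound (norm (\<mu> k)) - 1) * (\<integral>y. norm (f y) \<partial>pole_law 0)) \<longlonglongrightarrow> (1 - 1) * (\<integral>y. norm (f y) \<partial>pole_law 0)"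
    by (intro tendsto_intros)
  then show "(\<lambda>k. (ratio_bound (norm (\<mu> k)) - 1) * (\<integral>y. norm (f y) \<partial>pole_law 0)) \<longlonglongrightarrow> 0" by simp
qed

text \<open>The radial factor 4 r / (1 + r^2) of the location score, written in u = r^2 / (1 + r^2).
  It is also the score function of the pole test, see \<open>score_pole_radial\<close>.\<close>

definition pole_score :: "real \<Rightarrow> real" where
  "pole_score u = 4 * sqrt (u * (1 - u))"

lemma borel_measurable_pole_score [measurable]: "pole_score \<in> borel_measurable borel"
  unfolding pole_score_def[abs_def] by measurable

lemma abs_pole_score_le: "0 \<le> u \<Longrightarrow> u \<le> 1 \<Longrightarrow> \<bar>pole_score u\<bar> \<le> 4"
proof -
  assume u: "0 \<le> u" "u \<le> 1"
  then have "u * (1 - u) \<le> 1 * 1" by (intro mult_mono) auto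
  then show ?thesis using u by (simp add: pole_score_def)
qed

lemma pole_score_radial_unif: "pole_score (radial_unif y) = 4 * norm y / (1 + (norm y)\<^sup>2)"
proof -
  have p: "0 < 1 + (norm y)\<^sup>2" by (rule one_plus_sq_pos)
  have "1 - radial_unif y = 1 / (1 + (norm y)\<^sup>2)" using p by (simp add: radial_unif_def field_simps)
  then have "radial_unif y * (1 - radial_unif y) = (norm y / (1 + (norm y)\<^sup>2))\<^sup>2"
    by (simp add: radial_unif_def power_divide power2_eq_square)
  then show ?thesis using p by (simp add: pole_score_def)
qed

section \<open>Moments of the signed scores\<close>

lemma inner_cis_mult:
  "(\<xi> \<bullet> cis t) * (\<zeta> \<bullet> cis t) = (\<xi> \<bullet> \<zeta>) / 2 + (Re \<xi> * Re \<zeta> - Im \<xi> * Im \<zeta>) / 2 * cos (2 * t) + (Re \<xi> * Im \<zeta> + Im \<xi> * Re \<zeta>) / 2 * sin (2 * t)"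
proof -
  have c: "cos t * cos t = (1 + cos (2 * t)) / 2" "sin t * sin t = (1 - cos (2 * t)) / 2"
    using cos_squared_eq[of t] by (simp_all add: cos_double power2_eq_square[symmetric] sin_squared_eq)
  have s: "cos t * sin t = sin (2 * t) / 2" by (simp add: sin_double)
  have "(\<xi> \<bullet> cis t) * (\<zeta> \<bullet> cis t) = Re \<xi> * Re \<zeta> * (cos t * cos t) + (Re \<xi> * Im \<zeta> + Im \<xi> * Re \<zeta>) * (cos t * sin t) + Im \<xi> * Im \<zeta> * (sin t * sin t)"
    by (simp add: inner_complex_def algebra_simps)
  then show ?thesis unfolding c s by (simp add: inner_complex_def field_simps)
qed

text \<open>The product of two first harmonics is half the inner product of \<xi> and \<zeta> plus
  second harmonics, which have mean zero; the radius is independent of the line.\<close>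

lemma integral_radial_inner:
  fixes \<phi> :: "real \<Rightarrow> real"
  assumes [measurable]: "\<phi> \<in> borel_measurable borel" and int: "integrable unif \<phi>"
  shows "integrable (pole_law 0) (\<lambda>y. \<phi> (radial_unif y) * ((\<xi> \<bullet> cis (line_angle y)) * (\<zeta> \<bullet> cis (line_angle y))))"
    and "(\<integral>y. \<phi> (radial_unif y) * ((\<xi> \<bullet> cis (line_angle y)) * (\<zeta> \<bullet> cis (line_angle y))) \<partial>pole_law 0) = (\<integral>u. \<phi> u \<partial>unif) * ((\<xi> \<bullet> \<zeta>) / 2)"
proof -
  define a where "a = (Re \<xi> * Re \<zeta> - Im \<xi> * Im \<zeta>) / 2"
  define b where "b = (Re \<xi> * Im \<zeta> + Im \<xi> * Re \<zeta>) / 2"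
  define \<psi> where "\<psi> u = (\<xi> \<bullet> \<zeta>) / 2 + a * cos (2 * (pi * (u - 1 / 2))) + b * sin (2 * (pi * (u - 1 / 2)))" for u
  have ic: "integrable unif (\<lambda>u. cos (2 * (pi * (u - 1 / 2))))" "integrable unif (\<lambda>u. sin (2 * (pi * (u - 1 / 2))))"
    by (rule integrable_unif_bounded[where B=1]; simp)+
  have i\<psi>: "integrable unif \<psi>" unfolding \<psi>_def[abs_def] using ic by simp
  have m\<psi>: "(\<integral>u. \<psi> u \<partial>unif) = (\<xi> \<bullet> \<zeta>) / 2"
    unfolding \<psi>_def using ic integral_line_angle_cos[of 1] integral_line_angle_sin[of 1] by (simp add: unif.prob_space)
  have [measurable]: "\<psi> \<in> borel_measurable borel" unfolding \<psi>_def[abs_def] by measurable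
  have e: "\<phi> (radial_unif y) * ((\<xi> \<bullet> cis (line_angle y)) * (\<zeta> \<bullet> cis (line_angle y))) = \<phi> (radial_unif y) * \<psi> (line_unif y)" for y
    unfolding inner_cis_mult \<psi>_def line_angle_eq a_def b_def ..
  show "integrable (pole_law 0) (\<lambda>y. \<phi> (radial_unif y) * ((\<xi> \<bullet> cis (line_angle y)) * (\<zeta> \<bullet> cis (line_angle y))))"
    unfolding e by (rule integral_radial_line(1)) (use int i\<psi> in auto)
  show "(\<integral>y. \<phi> (radial_unif y) * ((\<xi> \<bullet> cis (line_angle y)) * (\<zeta> \<bullet> cis (line_angle y))) \<partial>pole_law 0) = (\<integral>u. \<phi> u \<partial>unif) * ((\<xi> \<bullet> \<zeta>) / 2)"
    unfolding e by (subst integral_radial_line(2)) (use int i\<psi> m\<psi> in auto)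
qed

lemma AE_unif: "AE u in unif. 0 < u \<and> u < 1"
  by (simp add: AE_uniform_measure)

lemma line_angle_uminus: "line_angle (- y) = line_angle y"
  by (simp add: line_angle_def slope_uminus)

lemma radial_unif_uminus: "radial_unif (- y) = radial_unif y"
  by (simp add: radial_unif_def)

definition complex_of_vec :: "real^2 \<Rightarrow> complex" where
  "complex_of_vec e = Complex (e $ 1) (e $ 2)"

lemma cmod_complex_of_vec: "cmod (complex_of_vec e) = norm e"
  by (simp add: complex_of_vec_def cmod_def norm_vec2)

context rank_score
begin

text \<open>The sign turns the angle of the line into that of the ray: off the axis of vanishing
  first coordinate this is the score times the unit vector in the direction of y.\<close>

definition signed_score :: "real^2 \<Rightarrow> complex" where
  "signed_score y = complex_of_real (sgn (y $ 1)) * limit_score y"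

definition second_moment :: real where "second_moment = (\<integral>u. (J u)\<^sup>2 \<partial>unif)"

text \<open>The pairing of the score with the location score of the sampling law; its square over
  \<open>second_moment\<close> measures the efficacy of the test.\<close>

definition cross_moment :: real where "cross_moment = (\<integral>u. J u * pole_score u \<partial>unif)"

lemma measurable_signed_score [measurable]: "signed_score \<in> borel_measurable borel"
  unfolding signed_score_def[abs_def] by measurable

lemma inner_signed_score: "\<xi> \<bullet> signed_score y = sgn (y $ 1) * (J (radial_unif y) * (\<xi> \<bullet> cis (line_angle y)))"
  by (simp add: signed_score_def limit_score_def inner_complex_def algebra_simps)

lemma integrable_unif_pow2: "integrable unif (\<lambda>u. (J u)\<^sup>2)"
  using integrable_pow2 integral_radial_unif(2)[of "\<lambda>u. (J u)\<^sup>2"] by simp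

lemma integrable_unif_J: "integrable unif J"
proof (rule Bochner_Integration.integrable_bound)
  show "integrable unif (\<lambda>u. 1 + (J u)\<^sup>2)" using integrable_unif_pow2 by simp
  show "AE u in unif. norm (J u) \<le> norm (1 + (J u)\<^sup>2)"
    using abs_le_1_plus_sq by (intro AE_I2) simp
qed simp

lemma integrable_unif_cross: "integrable unif (\<lambda>u. J u * pole_score u)"
proof (rule Bochner_Integration.integrable_bound)
  show "integrable unif (\<lambda>u. J u * 4)" using integrable_unif_J by simp
  show "AE u in unif. norm (J u * pole_score u) \<le> norm (J u * 4)"
    using AE_unif by eventually_elim (auto simp: abs_mult intro!: mult_left_mono abs_pole_score_le)
qed simp

lemma inner_signed_score_sq:
  "AE y in pole_law 0. (\<xi> \<bullet> signed_score y)\<^sup>2 = (J (radial_unif y))\<^sup>2 * ((\<xi> \<bullet> cis (line_angle y)) * (\<xi> \<bullet> cis (line_angle y)))"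
  using AE_pole_law_nth1[of 0]
  by eventually_elim (auto simp: inner_signed_score power2_eq_square sgn_if)

lemma integral_inner_sq:
  shows "integrable (pole_law 0) (\<lambda>y. (\<xi> \<bullet> signed_score y)\<^sup>2)"
    and "(\<integral>y. (\<xi> \<bullet> signed_score y)\<^sup>2 \<partial>pole_law 0) = second_moment / 2 * (cmod \<xi>)\<^sup>2"
proof -
  note r = integral_radial_inner[of "\<lambda>u. (J u)\<^sup>2" \<xi> \<xi>, OF _ integrable_unif_pow2]
  show "integrable (pole_law 0) (\<lambda>y. (\<xi> \<bullet> signed_score y)\<^sup>2)"
    using r(1) by (subst integrable_cong_AE[OF _ _ inner_signed_score_sq]) simp_all
  show "(\<integral>y. (\<xi> \<bullet> signed_score y)\<^sup>2 \<partial>pole_law 0) = second_moment / 2 * (cmod \<xi>)\<^sup>2"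
    using r(2) by (subst integral_cong_AE[OF _ _ inner_signed_score_sq]) (simp_all add: second_moment_def dot_square_norm)
qed

lemma integrable_inner: "integrable (pole_law 0) (\<lambda>y. \<xi> \<bullet> signed_score y)"
proof (rule Bochner_Integration.integrable_bound)
  show "integrable (pole_law 0) (\<lambda>y. 1 + (\<xi> \<bullet> signed_score y)\<^sup>2)" using integral_inner_sq(1) by simp
  show "AE y in pole_law 0. norm (\<xi> \<bullet> signed_score y) \<le> norm (1 + (\<xi> \<bullet> signed_score y)\<^sup>2)"
    using abs_le_1_plus_sq by (intro AE_I2) simp
qed simp

lemma limit_score_uminus: "limit_score (- y) = limit_score y"
  by (simp add: limit_score_def line_angle_uminus radial_unif_uminus)

lemma integral_inner_null: "(\<integral>y. \<xi> \<bullet> signed_score y \<partial>pole_law 0) = 0"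
proof -
  have f: "flip_score 0 y = 0" for y
    using pole_density_pos[of 0 y] by (simp add: flip_score_def pole_density_flip)
  have "(\<integral>y. (sgn (y $ 1) - flip_score 0 y) * (J (radial_unif y) * (\<xi> \<bullet> cis (line_angle y))) \<partial>pole_law 0) = 0"
    by (rule integral_flip_pole_law) (simp_all add: line_angle_uminus radial_unif_uminus inner_complex_def)
  then show ?thesis by (simp add: f inner_signed_score)
qed

text \<open>Both factors carry the sign of the first coordinate, which cancels; what remains is a
  radial factor times two first harmonics of the line angle.\<close>

lemma integral_inner_shift_score:
  assumes e: "norm e = 1"
  shows "(\<integral>y. (\<xi> \<bullet> signed_score y) * shift_score e 0 y \<partial>pole_law 0) = cross_moment / 2 * (\<xi> \<bullet> complex_of_vec e)"
proof -
  note r = integral_radial_inner(2)[of "\<lambda>u. J u * pole_score u" \<xi> "complex_of_vec e", OF _ integrable_unif_cross]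
  have "AE y in pole_law 0. (\<xi> \<bullet> signed_score y) * shift_score e 0 y
    = (J (radial_unif y) * pole_score (radial_unif y)) * ((\<xi> \<bullet> cis (line_angle y)) * (complex_of_vec e \<bullet> cis (line_angle y)))"
    using AE_pole_law_nth1[of 0]
  proof eventually_elim
    case (elim y)
    have s: "sgn (y $ 1) * sgn (y $ 1) = 1" using elim by (simp add: sgn_if)
    have ye: "y \<bullet> e = sgn (y $ 1) * norm y * (complex_of_vec e \<bullet> cis (line_angle y))"
      unfolding inner_vec2 inner_complex_def complex_of_vec_def
      by (subst vec2_line_angle(1)[OF elim], subst vec2_line_angle(2)[OF elim]) (simp add: algebra_simps)
    have "(\<xi> \<bullet> signed_score y) * shift_score e 0 y = (sgn (y $ 1) * sgn (y $ 1)) *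
        ((J (radial_unif y) * (4 * norm y / (1 + (norm y)\<^sup>2))) * ((\<xi> \<bullet> cis (line_angle y)) * (complex_of_vec e \<bullet> cis (line_angle y))))"
      unfolding inner_signed_score shift_score_def ye by simp
    then show ?case unfolding s pole_score_radial_unif by simp
  qed
  then show ?thesis using r by (subst integral_cong_AE) (simp_all add: cross_moment_def)
qed

end

section \<open>Noncentral chi-square laws\<close>

text \<open>Poisson mixture representation of the noncentral chi-square distribution with two degrees
  of freedom and noncentrality \<open>2 x\<close>.\<close>

definition poisson_weight :: "real \<Rightarrow> nat \<Rightarrow> real" where
  "poisson_weight x j = exp (- x) * (x ^ j / fact j)"

definition noncentral_chi2 :: "real \<Rightarrow> real measure" where
  "noncentral_chi2 x = density lborel (\<lambda>t. \<Sum>j. ennreal (poisson_weight x j * erlang_density j (1 / 2) t))"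

lemma poisson_weight_nonneg: "0 \<le> x \<Longrightarrow> 0 \<le> poisson_weight x j"
  by (simp add: poisson_weight_def)

lemma sums_exp_real: "(\<lambda>j. x ^ j / fact j) sums exp (x::real)"
  using exp_converges[of x] by (simp add: divide_inverse mult.commute)

lemma poisson_weight_power_sums: "(\<lambda>j. poisson_weight x j * q ^ j) sums exp (x * q - x)"
proof -
  have "(\<lambda>j. exp (- x) * ((x * q) ^ j / fact j)) sums (exp (- x) * exp (x * q))"
    by (intro sums_mult sums_exp_real)
  then show ?thesis by (simp add: poisson_weight_def power_mult_distrib exp_diff exp_minus divide_inverse mult_ac)
qed

lemma nn_integral_noncentral_chi2:
  assumes [measurable]: "f \<in> borel_measurable borel" and x: "0 \<le> x"
  shows "(\<integral>\<^sup>+t. f t \<partial>noncentral_chi2 x) = (\<Sum>j. ennreal (poisson_weight x j) * (\<integral>\<^sup>+t. ennreal (erlang_density j (1 / 2) t) * f t \<partial>lborel))"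
proof -
  have "(\<integral>\<^sup>+t. f t \<partial>noncentral_chi2 x) = (\<integral>\<^sup>+t. (\<Sum>j. ennreal (poisson_weight x j * erlang_density j (1 / 2) t)) * f t \<partial>lborel)"
    unfolding noncentral_chi2_def by (rule nn_integral_density) simp_all
  also have "\<dots> = (\<integral>\<^sup>+t. (\<Sum>j. ennreal (poisson_weight x j) * (ennreal (erlang_density j (1 / 2) t) * f t)) \<partial>lborel)"
    using x by (intro nn_integral_cong) (simp add: ennreal_suminf_multc[symmetric] ennreal_mult poisson_weight_nonneg erlang_density_nonneg mult.assoc)
  also have "\<dots> = (\<Sum>j. \<integral>\<^sup>+t. ennreal (poisson_weight x j) * (ennreal (erlang_density j (1 / 2) t) * f t) \<partial>lborel)"
    by (rule nn_integral_suminf) simp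
  also have "\<dots> = (\<Sum>j. ennreal (poisson_weight x j) * (\<integral>\<^sup>+t. ennreal (erlang_density j (1 / 2) t) * f t \<partial>lborel))"
    by (simp add: nn_integral_cmult)
  finally show ?thesis .
qed

lemma sets_noncentral_chi2 [simp, measurable_cong]: "sets (noncentral_chi2 x) = sets borel"
  by (simp add: noncentral_chi2_def)

lemma space_noncentral_chi2 [simp]: "space (noncentral_chi2 x) = UNIV"
  by (simp add: noncentral_chi2_def)

lemma nn_integral_erlang_total: "0 < l \<Longrightarrow> (\<integral>\<^sup>+t. ennreal (erlang_density j l t) \<partial>lborel) = 1"
  using prob_space.emeasure_space_1[OF prob_space_erlang_density[of l j]] by (simp add: emeasure_density)

text \<open>The exponential tilts the Erlang density of rate 1 / 2 into one of rate (1 + s) / 2 with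
  mass 1 / (1 + s) to the power j + 1. The Poisson weights then sum to an exponential.\<close>

lemma noncentral_chi2_laplace:
  assumes x: "0 \<le> x" and s: "0 \<le> s"
  shows "(\<integral>\<^sup>+t. ennreal (exp (- (s * t / 2))) \<partial>noncentral_chi2 x) = ennreal (exp (- (x * s / (1 + s))) / (1 + s))"
proof -
  have "(\<integral>\<^sup>+t. ennreal (erlang_density j (1 / 2) t) * ennreal (exp (- (s * t / 2))) \<partial>lborel) = ennreal ((1 / (1 + s)) ^ Suc j)" for j
  proof -
    have "erlang_density j (1 / 2) t * exp (- (s * t / 2)) = (1 / (1 + s)) ^ Suc j * erlang_density j ((1 + s) / 2) t" for t
    proof -
      have e: "exp (- (t / 2)) * exp (- (s * t / 2)) = exp (- ((1 + s) * t / 2))"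
        by (simp add: exp_add[symmetric] field_simps)
      have p: "(1 / 2) ^ Suc j = (1 / (1 + s)) ^ Suc j * ((1 + s) / 2) ^ Suc j"
        unfolding power_mult_distrib[symmetric] using s by simp
      show ?thesis unfolding erlang_density_def p using e by (simp add: field_simps del: power_Suc)
    qed
    then have "(\<integral>\<^sup>+t. ennreal (erlang_density j (1 / 2) t) * ennreal (exp (- (s * t / 2))) \<partial>lborel)
      = (\<integral>\<^sup>+t. ennreal ((1 / (1 + s)) ^ Suc j) * ennreal (erlang_density j ((1 + s) / 2) t) \<partial>lborel)"
      using s by (simp add: ennreal_mult[symmetric] erlang_density_nonneg del: power_Suc)
    also have "\<dots> = ennreal ((1 / (1 + s)) ^ Suc j)"
      using s by (simp add: nn_integral_cmult nn_integral_erlang_total del: power_Suc)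
    finally show ?thesis .
  qed
  then have "(\<integral>\<^sup>+t. ennreal (exp (- (s * t / 2))) \<partial>noncentral_chi2 x) = (\<Sum>j. ennreal (poisson_weight x j) * ennreal ((1 / (1 + s)) ^ Suc j))"
    using x by (subst nn_integral_noncentral_chi2) simp_all
  also have "\<dots> = (\<Sum>j. ennreal (poisson_weight x j * (1 / (1 + s)) ^ j * (1 / (1 + s))))"
    using x s by (intro suminf_cong) (simp add: ennreal_mult[symmetric] poisson_weight_nonneg mult_ac)
  also have "\<dots> = ennreal (exp (x * (1 / (1 + s)) - x) * (1 / (1 + s)))"
    using x s poisson_weight_nonneg[OF x]
    by (intro suminf_ennreal_eq sums_mult2 poisson_weight_power_sums) auto
  also have "x * (1 / (1 + s)) - x = - (x * s / (1 + s))" using s by (simp add: field_simps)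
  finally show ?thesis by simp
qed

lemma prob_space_noncentral_chi2: "0 \<le> x \<Longrightarrow> prob_space (noncentral_chi2 x)"
  using noncentral_chi2_laplace[of x 0] by (intro prob_spaceI) simp

section \<open>The tail of the noncentral law as a function of the noncentrality\<close>

definition chi2_tail :: "real \<Rightarrow> real \<Rightarrow> real" where
  "chi2_tail c x = 1 - cdf (noncentral_chi2 x) c"

text \<open>The survival function at c of the Erlang law of shape j + 1 and rate 1 / 2, as the
  probability that a Poisson variable of mean c / 2 is at most j.\<close>

definition gamma_tail :: "real \<Rightarrow> nat \<Rightarrow> real" where
  "gamma_tail c j = (\<Sum>i\<le>j. exp (- (c / 2)) * ((c / 2) ^ i / fact i))"

lemma gamma_tail_bounds:
  assumes "0 \<le> c"
  shows "0 \<le> gamma_tail c j" "gamma_tail c j \<le> 1"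
proof -
  show "0 \<le> gamma_tail c j" using assms by (auto simp: gamma_tail_def intro!: sum_nonneg)
  have s: "(\<lambda>i. exp (- (c / 2)) * ((c / 2) ^ i / fact i)) sums (exp (- (c / 2)) * exp (c / 2))"
    by (intro sums_mult sums_exp_real)
  have "gamma_tail c j \<le> (\<Sum>i. exp (- (c / 2)) * ((c / 2) ^ i / fact i))"
    unfolding gamma_tail_def using assms by (intro sum_le_suminf sums_summable[OF s]) auto
  also have "\<dots> = 1" using s by (simp add: sums_iff exp_add[symmetric])
  finally show "gamma_tail c j \<le> 1" .
qed

lemma chi2_tail_sums:
  assumes x: "0 \<le> x" and c: "0 \<le> c"
  shows "(\<lambda>j. poisson_weight x j * gamma_tail c j) sums chi2_tail c x"
proof -
  have w: "(\<lambda>j. poisson_weight x j) sums 1" using poisson_weight_power_sums[of x 1] by simp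
  have sm: "summable (\<lambda>j. poisson_weight x j * (1 - gamma_tail c j))"
    by (rule summable_comparison_test'[OF sums_summable[OF w], of 0])
       (use gamma_tail_bounds[OF c] poisson_weight_nonneg[OF x] in \<open>auto simp: abs_mult intro!: mult_left_le\<close>)
  have "emeasure (noncentral_chi2 x) {..c} = (\<integral>\<^sup>+t. indicator {..c} t \<partial>noncentral_chi2 x)" by simp
  also have "\<dots> = (\<Sum>j. ennreal (poisson_weight x j) * (\<integral>\<^sup>+t. ennreal (erlang_density j (1 / 2) t) * indicator {..c} t \<partial>lborel))"
    using x by (subst nn_integral_noncentral_chi2) simp_all
  also have "\<dots> = (\<Sum>j. ennreal (poisson_weight x j * (1 - gamma_tail c j)))"
  proof (rule suminf_cong)
    fix j
    have "(\<integral>\<^sup>+t. ennreal (erlang_density j (1 / 2) t) * indicator {..c} t \<partial>lborel) = emeasure (density lborel (\<lambda>t. ennreal (erlang_density j (1 / 2) t))) {..c}"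
      by (simp add: emeasure_density)
    also have "\<dots> = ennreal (erlang_CDF j (1 / 2) c)"
      using c by (subst emeasure_erlang_density) simp_all
    also have "erlang_CDF j (1 / 2) c = 1 - gamma_tail c j"
      using c by (simp add: erlang_CDF_def gamma_tail_def mult.commute)
    finally show "ennreal (poisson_weight x j) * (\<integral>\<^sup>+t. ennreal (erlang_density j (1 / 2) t) * indicator {..c} t \<partial>lborel) = ennreal (poisson_weight x j * (1 - gamma_tail c j))"
      using x gamma_tail_bounds[OF c, of j] by (simp add: ennreal_mult poisson_weight_nonneg)
  qed
  also have "\<dots> = ennreal (\<Sum>j. poisson_weight x j * (1 - gamma_tail c j))"
    using x gamma_tail_bounds[OF c] by (intro suminf_ennreal2 sm) (auto simp: poisson_weight_nonneg)
  finally have "cdf (noncentral_chi2 x) c = (\<Sum>j. poisson_weight x j * (1 - gamma_tail c j))"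
    using x gamma_tail_bounds[OF c] by (auto simp: cdf_def measure_def intro!: enn2real_ennreal suminf_nonneg sm mult_nonneg_nonneg poisson_weight_nonneg)
  then have "(\<lambda>j. poisson_weight x j * (1 - gamma_tail c j)) sums cdf (noncentral_chi2 x) c"
    using sm by (simp add: sums_iff)
  from sums_diff[OF w this] show ?thesis by (simp add: chi2_tail_def algebra_simps)
qed

lemma chi2_tail_0: "0 \<le> c \<Longrightarrow> chi2_tail c 0 = exp (- (c / 2))"
proof -
  assume c: "0 \<le> c"
  have "(\<lambda>j. poisson_weight 0 j * gamma_tail c j) sums (\<Sum>j\<in>{0}. poisson_weight 0 j * gamma_tail c j)"
    by (rule sums_finite) (auto simp: poisson_weight_def)
  then have "(\<lambda>j. poisson_weight 0 j * gamma_tail c j) sums exp (- (c / 2))"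
    by (simp add: poisson_weight_def gamma_tail_def)
  with chi2_tail_sums[OF order_refl c] show ?thesis by (rule sums_unique2)
qed

text \<open>The power series, in place of \<open>chi2_tail\<close>, has a two-sided derivative also
  at x = 0. Up to factorials and exp (- x), the coefficients of the derivative are the increments of
  \<open>gamma_tail\<close>, which are positive.\<close>

lemma chi2_tail_deriv:
  assumes c: "0 < c" and x: "0 \<le> x"
  shows "\<exists>d>0. ((\<lambda>x. exp (- x) * (\<Sum>j. gamma_tail c j / fact j * x ^ j)) has_real_derivative d) (at x)"
proof -
  define a where "a j = gamma_tail c j / fact j" for j
  have b: "0 \<le> gamma_tail c j" "gamma_tail c j \<le> 1" for j using gamma_tail_bounds[of c j] c by auto
  have sm: "summable (\<lambda>j. a j * y ^ j)" for y
  proof (rule summable_comparison_test'[of "\<lambda>j. \<bar>y\<bar> ^ j / fact j" 0])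
    show "summable (\<lambda>j. \<bar>y\<bar> ^ j / fact j)" using sums_exp_real by (rule sums_summable)
    show "norm (a j * y ^ j) \<le> \<bar>y\<bar> ^ j / fact j" for j
      using b[of j] mult_right_mono[of "gamma_tail c j" 1 "\<bar>y\<bar> ^ j"] by (simp add: a_def abs_mult power_abs divide_right_mono)
  qed
  have D: "((\<lambda>y. \<Sum>j. a j * y ^ j) has_real_derivative (\<Sum>j. diffs a j * x ^ j)) (at x)"
    by (rule termdiffs_strong_converges_everywhere[OF sm])
  have sd: "summable (\<lambda>j. diffs a j * x ^ j)" by (rule termdiff_converges_all[OF sm])
  have da: "diffs a j = gamma_tail c (Suc j) / fact j" for j
    unfolding diffs_def a_def fact_Suc of_nat_mult by (simp del: of_nat_Suc)
  define d where "d = exp (- x) * ((\<Sum>j. diffs a j * x ^ j) - (\<Sum>j. a j * x ^ j))"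
  have "((\<lambda>y. exp (- y) * (\<Sum>j. a j * y ^ j)) has_real_derivative d) (at x)"
    unfolding d_def by (auto intro!: derivative_eq_intros D simp: algebra_simps)
  moreover have "0 < d"
  proof -
    have diff: "diffs a j * x ^ j - a j * x ^ j = exp (- (c / 2)) * ((c / 2) ^ Suc j / fact (Suc j)) * (x ^ j / fact j)" for j
      unfolding da a_def by (simp add: gamma_tail_def field_simps del: fact_Suc power_Suc)
    have "0 < (\<Sum>j. diffs a j * x ^ j - a j * x ^ j)"
    proof (rule suminf_pos2[of _ 0])
      show "summable (\<lambda>j. diffs a j * x ^ j - a j * x ^ j)" by (rule summable_diff[OF sd sm])
      show "0 \<le> diffs a j * x ^ j - a j * x ^ j" for j unfolding diff using c x by simp
      show "0 < diffs a 0 * x ^ 0 - a 0 * x ^ 0" unfolding diff using c by simp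
    qed
    then show ?thesis unfolding d_def using suminf_diff[OF sd sm] by simp
  qed
  ultimately show ?thesis unfolding a_def by blast
qed

lemma chi2_tail_eq:
  assumes "0 \<le> x" "0 \<le> c"
  shows "chi2_tail c x = exp (- x) * (\<Sum>j. gamma_tail c j / fact j * x ^ j)"
proof -
  have "(\<lambda>j. gamma_tail c j / fact j * x ^ j) sums (exp x * chi2_tail c x)"
    using sums_mult[OF chi2_tail_sums[OF assms], of "exp x"]
    by (simp add: poisson_weight_def exp_minus field_simps)
  then show ?thesis by (simp add: sums_iff exp_minus field_simps)
qed

lemma chi2_tail_strict_mono:
  assumes "0 < c" "0 \<le> x" "x < y"
  shows "chi2_tail c x < chi2_tail c y"
proof -
  let ?f = "\<lambda>x. exp (- x) * (\<Sum>j. gamma_tail c j / fact j * x ^ j)"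
  have "?f x < ?f y"
  proof (rule DERIV_pos_imp_increasing[OF assms(3)])
    fix z assume "x \<le> z" "z \<le> y"
    then show "\<exists>d. (?f has_real_derivative d) (at z) \<and> 0 < d"
      using chi2_tail_deriv[OF assms(1), of z] assms by auto
  qed
  then show ?thesis using assms by (simp add: chi2_tail_eq)
qed

lemma continuous_on_chi2_tail:
  assumes "0 < c"
  shows "continuous_on {0..} (chi2_tail c)"
proof -
  have "continuous_on {0..} (\<lambda>x. exp (- x) * (\<Sum>j. gamma_tail c j / fact j * x ^ j))"
    using chi2_tail_deriv[OF assms] by (intro continuous_at_imp_continuous_on ballI) (auto dest: DERIV_isCont)
  moreover have "continuous_on {0..} (chi2_tail c) \<longleftrightarrow> continuous_on {0..} (\<lambda>x. exp (- x) * (\<Sum>j. gamma_tail c j / fact j * x ^ j))"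
    using assms by (intro continuous_on_cong refl chi2_tail_eq) auto
  ultimately show ?thesis by simp
qed

text \<open>A Chernoff bound: the indicator of t \<le> c is at most exp ((c - t) / 2), and the
  Laplace transform at s = 1 is known.\<close>

lemma chi2_tail_tendsto_1:
  assumes "0 \<le> c"
  shows "(chi2_tail c \<longlongrightarrow> 1) at_top"
proof (rule tendsto_sandwich)
  show "\<forall>\<^sub>F x in at_top. chi2_tail c x \<le> 1"
    by (intro always_eventually allI) (simp add: chi2_tail_def cdf_def)
  show "\<forall>\<^sub>F x in at_top. 1 - exp (c / 2) * (exp (- (x / 2)) / 2) \<le> chi2_tail c x"
    using eventually_ge_at_top[of 0]
  proof eventually_elim
    case (elim x)
    interpret prob_space "noncentral_chi2 x" by (rule prob_space_noncentral_chi2) fact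
    have "emeasure (noncentral_chi2 x) {..c} = (\<integral>\<^sup>+t. indicator {..c} t \<partial>noncentral_chi2 x)" by simp
    also have "\<dots> \<le> (\<integral>\<^sup>+t. ennreal (exp (c / 2)) * ennreal (exp (- (1 * t / 2))) \<partial>noncentral_chi2 x)"
      by (intro nn_integral_mono) (auto split: split_indicator simp: ennreal_mult[symmetric] exp_add[symmetric] simp flip: ennreal_1 intro!: ennreal_leI)
    also have "\<dots> = ennreal (exp (c / 2)) * ennreal (exp (- (x * 1 / (1 + 1))) / (1 + 1))"
      by (subst nn_integral_cmult) (use noncentral_chi2_laplace[OF elim, of 1] in auto)
    also have "\<dots> = ennreal (exp (c / 2) * (exp (- (x / 2)) / 2))" by (simp add: ennreal_mult[symmetric])
    finally have "cdf (noncentral_chi2 x) c \<le> exp (c / 2) * (exp (- (x / 2)) / 2)"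
      unfolding cdf_def emeasure_eq_measure by (simp add: ennreal_le_iff)
    then show ?case by (simp add: chi2_tail_def)
  qed
  show "((\<lambda>x. 1 - exp (c / 2) * (exp (- (x / 2)) / 2)) \<longlongrightarrow> 1) at_top"
    by real_asymp
qed simp

text \<open>The tail at 0 is the level and its limit at infinity is 1, so every power between them
  is attained.\<close>

lemma chi2_tail_surj:
  assumes c: "0 < c" and \<gamma>: "exp (- (c / 2)) < \<gamma>" "\<gamma> < 1"
  obtains x where "0 < x" "chi2_tail c x = \<gamma>"
proof -
  have "\<forall>\<^sub>F y in at_top. \<gamma> < chi2_tail c y" using c \<gamma> by (intro order_tendstoD(1)[OF chi2_tail_tendsto_1]) auto
  from eventually_happens[OF eventually_conj[OF this eventually_gt_at_top[of 0]]] obtain y where y: "\<gamma> < chi2_tail c y" "0 < y" by auto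
  have "\<exists>x\<ge>0. x \<le> y \<and> chi2_tail c x = \<gamma>"
    using y c \<gamma> by (intro IVT' continuous_on_subset[OF continuous_on_chi2_tail[OF c]]) (auto simp: chi2_tail_0)
  then obtain x where x: "0 \<le> x" "chi2_tail c x = \<gamma>" by auto
  then have "x \<noteq> 0" using c \<gamma> chi2_tail_0[of c] by auto
  with x show thesis by (intro that[of x]) auto
qed

text \<open>Convergence of all moments of \<open>exp (- X / 2)\<close> determines the limit law by Weierstrass.\<close>

lemma tendsto_prob_of_laplace:
  fixes X :: "nat \<Rightarrow> 'a \<Rightarrow> real" and M :: "nat \<Rightarrow> 'a measure"
  assumes prob: "\<And>k. prob_space (M k)" and meas: "\<And>k. X k \<in> borel_measurable (M k)"
    and nn: "\<And>k. AE \<omega> in M k. 0 \<le> X k \<omega>" and x: "0 \<le> x" and c: "0 \<le> c"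
    and laplace: "\<And>j. (\<lambda>k. \<integral>\<omega>. exp (- (real j * X k \<omega> / 2)) \<partial>M k) \<longlonglongrightarrow> exp (- (x * real j / (1 + real j))) / (1 + real j)"
  shows "(\<lambda>k. measure (M k) {\<omega> \<in> space (M k). c < X k \<omega>}) \<longlonglongrightarrow> chi2_tail c x"
proof -
  \<comment> \<open>An increasing map of the half-line into the unit interval under which the given
    Laplace values become moments of 1 - \<phi>. The maximum with 0 keeps \<phi> bounded at negative
    arguments too.\<close>
  define \<phi> where "\<phi> t = 1 - exp (- (max 0 t / 2))" for t :: real
  have \<phi>01: "0 \<le> \<phi> t" "\<phi> t \<le> 1" for t by (simp_all add: \<phi>_def)
  have [measurable]: "\<phi> \<in> borel_measurable borel" unfolding \<phi>_def[abs_def] by measurable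
  note [measurable] = meas
  define \<nu> where "\<nu> = distr (noncentral_chi2 x) borel \<phi>"
  define N where "N k = distr (M k) borel (\<lambda>\<omega>. \<phi> (X k \<omega>))" for k
  interpret nc: prob_space "noncentral_chi2 x" by (rule prob_space_noncentral_chi2[OF x])
  have N: "real_distribution (N k)" for k
    unfolding N_def real_distribution_def real_distribution_axioms_def by (auto intro!: prob_space.prob_space_distr[OF prob])
  have \<nu>: "real_distribution \<nu>"
    unfolding \<nu>_def real_distribution_def real_distribution_axioms_def by (auto intro!: nc.prob_space_distr)
  interpret \<nu>: real_distribution \<nu> by (rule \<nu>)
  interpret N: real_distribution "N k" for k by (rule N)
  have nn': "AE t in noncentral_chi2 x. 0 \<le> t"
    unfolding noncentral_chi2_def by (subst AE_density, simp) (intro AE_I2 impI, rule ccontr, simp add: erlang_density_def)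
  have pow_lap: "(\<integral>t. exp (- (real j * t / 2)) \<partial>noncentral_chi2 x) = exp (- (x * real j / (1 + real j))) / (1 + real j)" for j
    using noncentral_chi2_laplace[OF x, of "real j"] by (intro integral_eq_nn_integral[THEN trans]) auto
  have pw: "1 - \<phi> t = exp (- (t / 2))" "(1 - \<phi> t) ^ j = exp (- (real j * t / 2))" if "0 \<le> t" for t j
    using that by (simp_all add: \<phi>_def exp_of_nat_mult[symmetric])
  have moment: "(\<lambda>k. \<integral>\<omega>. (1 - \<phi> (X k \<omega>)) ^ j \<partial>M k) \<longlonglongrightarrow> (\<integral>t. (1 - \<phi> t) ^ j \<partial>noncentral_chi2 x)" for j
  proof -
    have "(\<integral>\<omega>. (1 - \<phi> (X k \<omega>)) ^ j \<partial>M k) = (\<integral>\<omega>. exp (- (real j * X k \<omega> / 2)) \<partial>M k)" for k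
      using nn[of k] by (intro integral_cong_AE) (auto elim!: eventually_mono simp: pw(2))
    moreover have "(\<integral>t. (1 - \<phi> t) ^ j \<partial>noncentral_chi2 x) = (\<integral>t. exp (- (real j * t / 2)) \<partial>noncentral_chi2 x)"
      using nn' by (intro integral_cong_AE) (auto elim!: eventually_mono simp: pw(2))
    ultimately show ?thesis using laplace[of j] by (simp add: pow_lap)
  qed
  have conv: "(\<lambda>k. \<integral>\<omega>. g (\<phi> (X k \<omega>)) \<partial>M k) \<longlonglongrightarrow> (\<integral>t. g (\<phi> t) \<partial>noncentral_chi2 x)"
    if cont: "continuous_on UNIV g" and bdd: "\<And>u. \<bar>g u\<bar> \<le> 1" for g :: "real \<Rightarrow> real"
  proof (rule LIMSEQ_I)
    have [measurable]: "g \<in> borel_measurable borel" by (rule borel_measurable_continuous_onI[OF cont])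
    fix \<epsilon> :: real assume \<epsilon>: "0 < \<epsilon>"
    \<comment> \<open>The argument is reflected because the known moments are those of 1 -
      \<phi>.\<close>
    have "continuous_on {0..1} (\<lambda>u. g (1 - u))"
      by (intro continuous_on_compose2[OF cont]) (auto intro!: continuous_intros)
    from Stone_Weierstrass_real_polynomial_function[OF compact_Icc this, of "\<epsilon> / 3"] \<epsilon>
    obtain p where "real_polynomial_function p" and p: "\<And>u. u \<in> {0..1} \<Longrightarrow> \<bar>g (1 - u) - p u\<bar> < \<epsilon> / 3" by auto
    then obtain a n where pa: "p = (\<lambda>u. \<Sum>i\<le>n. a i * u ^ i)" unfolding real_polynomial_function_iff_sum by auto
    have near: "\<bar>(\<integral>\<omega>. g (\<phi> (Y \<omega>)) \<partial>P) - (\<integral>\<omega>. p (1 - \<phi> (Y \<omega>)) \<partial>P)\<bar> \<le> \<epsilon> / 3"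
      and poly: "(\<integral>\<omega>. p (1 - \<phi> (Y \<omega>)) \<partial>P) = (\<Sum>i\<le>n. a i * (\<integral>\<omega>. (1 - \<phi> (Y \<omega>)) ^ i \<partial>P))"
      if P: "prob_space P" and [measurable]: "Y \<in> borel_measurable P" for P :: "'c measure" and Y
    proof -
      interpret P: prob_space P by (rule P)
      have im: "integrable P (\<lambda>\<omega>. (1 - \<phi> (Y \<omega>)) ^ i)" for i
        by (rule P.integrable_const_bound[where B=1]) (auto intro!: AE_I2 power_le_one simp: \<phi>01)
      have ig: "integrable P (\<lambda>\<omega>. g (\<phi> (Y \<omega>)))"
        by (rule P.integrable_const_bound[where B=1]) (auto intro!: AE_I2 simp: bdd)
      have ip: "integrable P (\<lambda>\<omega>. p (1 - \<phi> (Y \<omega>)))" unfolding pa using im by simp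
      show "(\<integral>\<omega>. p (1 - \<phi> (Y \<omega>)) \<partial>P) = (\<Sum>i\<le>n. a i * (\<integral>\<omega>. (1 - \<phi> (Y \<omega>)) ^ i \<partial>P))"
        unfolding pa using im by (simp add: Bochner_Integration.integral_sum)
      have "\<bar>(\<integral>\<omega>. g (\<phi> (Y \<omega>)) \<partial>P) - (\<integral>\<omega>. p (1 - \<phi> (Y \<omega>)) \<partial>P)\<bar> = \<bar>\<integral>\<omega>. g (\<phi> (Y \<omega>)) - p (1 - \<phi> (Y \<omega>)) \<partial>P\<bar>"
        using ig ip by simp
      also have "\<dots> \<le> (\<integral>\<omega>. \<bar>g (\<phi> (Y \<omega>)) - p (1 - \<phi> (Y \<omega>))\<bar> \<partial>P)" by (rule integral_abs_bound)
      also have "\<dots> \<le> (\<integral>\<omega>. \<epsilon> / 3 \<partial>P)"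
      proof (rule integral_mono)
        show "integrable P (\<lambda>\<omega>. \<bar>g (\<phi> (Y \<omega>)) - p (1 - \<phi> (Y \<omega>))\<bar>)" using ig ip by (intro integrable_abs Bochner_Integration.integrable_diff)
        show "\<bar>g (\<phi> (Y \<omega>)) - p (1 - \<phi> (Y \<omega>))\<bar> \<le> \<epsilon> / 3" for \<omega>
          using p[of "1 - \<phi> (Y \<omega>)"] \<phi>01[of "Y \<omega>"] by simp
      qed simp
      finally show "\<bar>(\<integral>\<omega>. g (\<phi> (Y \<omega>)) \<partial>P) - (\<integral>\<omega>. p (1 - \<phi> (Y \<omega>)) \<partial>P)\<bar> \<le> \<epsilon> / 3" by (simp add: P.prob_space)
    qed
    have "(\<lambda>k. \<integral>\<omega>. p (1 - \<phi> (X k \<omega>)) \<partial>M k) \<longlonglongrightarrow> (\<integral>t. p (1 - \<phi> t) \<partial>noncentral_chi2 x)"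
      unfolding poly[OF prob meas] using poly[OF nc.prob_space_axioms, of "\<lambda>t. t"]
      by (simp, intro tendsto_sum tendsto_mult_left moment)
    from LIMSEQ_D[OF this, of "\<epsilon> / 3"] \<epsilon> obtain K where
      K: "\<And>k. K \<le> k \<Longrightarrow> \<bar>(\<integral>\<omega>. p (1 - \<phi> (X k \<omega>)) \<partial>M k) - (\<integral>t. p (1 - \<phi> t) \<partial>noncentral_chi2 x)\<bar> < \<epsilon> / 3" by auto
    show "\<exists>no. \<forall>k\<ge>no. norm ((\<integral>\<omega>. g (\<phi> (X k \<omega>)) \<partial>M k) - (\<integral>t. g (\<phi> t) \<partial>noncentral_chi2 x)) < \<epsilon>"
    proof (intro exI allI impI)
      fix k assume "K \<le> k"
      have "(\<lambda>t. t) \<in> borel_measurable (noncentral_chi2 x)" by simp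
      from K[OF \<open>K \<le> k\<close>] near[OF prob meas, of k] near[OF nc.prob_space_axioms this]
      show "norm ((\<integral>\<omega>. g (\<phi> (X k \<omega>)) \<partial>M k) - (\<integral>t. g (\<phi> t) \<partial>noncentral_chi2 x)) < \<epsilon>"
        unfolding real_norm_def by linarith
    qed
  qed
  have "weak_conv_m N \<nu>"
  proof (rule integral_cts_step_conv_imp_weak_conv[OF N \<nu>])
    fix a b :: real assume "a < b"
    have "continuous_on UNIV (cts_step a b)"
      using cts_step_uniformly_continuous[OF \<open>a < b\<close>] by (rule uniformly_continuous_imp_continuous)
    moreover have "\<bar>cts_step a b u\<bar> \<le> 1" for u using \<open>a < b\<close> by (auto simp: cts_step_def divide_simps)
    ultimately have "(\<lambda>k. \<integral>\<omega>. cts_step a b (\<phi> (X k \<omega>)) \<partial>M k) \<longlonglongrightarrow> (\<integral>t. cts_step a b (\<phi> t) \<partial>noncentral_chi2 x)"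
      by (rule conv)
    moreover have [measurable]: "cts_step a b \<in> borel_measurable borel"
      by (rule borel_measurable_continuous_onI) fact
    ultimately show "(\<lambda>k. integral\<^sup>L (N k) (cts_step a b)) \<longlonglongrightarrow> integral\<^sup>L \<nu> (cts_step a b)"
      unfolding N_def \<nu>_def by (simp add: integral_distr)
  qed
  \<comment> \<open>\<phi> is injective on the half-line and the noncentral law has a density, so
    the image law has no atom at \<phi> c.\<close>
  moreover have "isCont (cdf \<nu>) (\<phi> c)"
  proof -
    have "AE t in noncentral_chi2 x. t \<noteq> c"
      using AE_lborel_singleton[of c] unfolding noncentral_chi2_def by (subst AE_density) auto
    then have "AE t in noncentral_chi2 x. \<phi> t \<noteq> \<phi> c"
      using nn' by eventually_elim (use c in \<open>auto simp: \<phi>_def\<close>)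
    then have "emeasure (noncentral_chi2 x) {t \<in> space (noncentral_chi2 x). \<not> \<phi> t \<noteq> \<phi> c} = 0"
      by (subst (asm) AE_iff_measurable[OF _ refl]) auto
    moreover have "\<phi> -` {\<phi> c} \<inter> space (noncentral_chi2 x) = {t \<in> space (noncentral_chi2 x). \<not> \<phi> t \<noteq> \<phi> c}" by auto
    ultimately have "measure \<nu> {\<phi> c} = 0" unfolding \<nu>_def by (subst measure_distr) (simp_all add: measure_def)
    then show ?thesis by (simp add: \<nu>.isCont_cdf)
  qed
  ultimately have lim: "(\<lambda>k. cdf (N k) (\<phi> c)) \<longlonglongrightarrow> cdf \<nu> (\<phi> c)"
    unfolding weak_conv_m_def weak_conv_def by blast
  have le: "\<phi> t \<le> \<phi> c \<longleftrightarrow> t \<le> c" for t using c by (auto simp: \<phi>_def max_def)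
  have "cdf \<nu> (\<phi> c) = cdf (noncentral_chi2 x) c"
    unfolding cdf_def \<nu>_def by (subst measure_distr) (auto simp: vimage_def le atMost_def)
  moreover have "cdf (N k) (\<phi> c) = 1 - measure (M k) {\<omega> \<in> space (M k). c < X k \<omega>}" for k
  proof -
    interpret Mk: prob_space "M k" by (rule prob)
    have "cdf (N k) (\<phi> c) = measure (M k) {\<omega> \<in> space (M k). X k \<omega> \<le> c}"
      unfolding cdf_def N_def by (subst measure_distr) (auto intro!: arg_cong[where f="measure _"] simp: le)
    also have "{\<omega> \<in> space (M k). X k \<omega> \<le> c} = space (M k) - {\<omega> \<in> space (M k). c < X k \<omega>}" by auto
    also have "measure (M k) \<dots> = 1 - measure (M k) {\<omega> \<in> space (M k). c < X k \<omega>}"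
      by (rule Mk.prob_compl) measurable
    finally show ?thesis .
  qed
  ultimately have "(\<lambda>k. 1 - measure (M k) {\<omega> \<in> space (M k). c < X k \<omega>}) \<longlonglongrightarrow> cdf (noncentral_chi2 x) c"
    using lim by simp
  from tendsto_diff[OF tendsto_const[of 1] this] show ?thesis by (simp add: chi2_tail_def)
qed

section \<open>Sample sizes along local alternatives\<close>

lemma sample_size_needed_le: "size_suffices \<phi> \<beta> \<gamma> \<mu> N \<Longrightarrow> sample_size_needed \<phi> \<beta> \<gamma> \<mu> \<le> N"
  unfolding sample_size_needed_def by (rule Least_le)

lemma less_sample_size_needed:
  assumes "size_suffices \<phi> \<beta> \<gamma> \<mu> N" "\<phi> \<beta> n \<mu> < \<gamma>"
  shows "n < sample_size_needed \<phi> \<beta> \<gamma> \<mu>"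
proof (rule ccontr)
  assume "\<not> n < sample_size_needed \<phi> \<beta> \<gamma> \<mu>"
  moreover have "size_suffices \<phi> \<beta> \<gamma> \<mu> (sample_size_needed \<phi> \<beta> \<gamma> \<mu>)"
    unfolding sample_size_needed_def using assms(1) by (rule LeastI)
  ultimately have "\<gamma> \<le> \<phi> \<beta> n \<mu>" by (simp add: size_suffices_def)
  with assms(2) show False by simp
qed

text \<open>A monotone subsequence that is bounded below either converges or increases to
  infinity.\<close>

lemma convergent_or_diverging_subsequence:
  fixes q :: "nat \<Rightarrow> real"
  assumes "\<And>k. a \<le> q k"
  obtains r where "strict_mono r" "filterlim (q \<circ> r) at_top sequentially"
  | r L where "strict_mono r" "a \<le> L" "(q \<circ> r) \<longlonglongrightarrow> L"
proof -
  note result = that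
  obtain r where r: "strict_mono r" "monoseq (\<lambda>n. q (r n))" using seq_monosub[of q] by auto
  have conv: thesis if "convergent (q \<circ> r)"
  proof -
    from that obtain L where L: "(q \<circ> r) \<longlonglongrightarrow> L" by (auto simp: convergent_def)
    have "a \<le> L" by (rule LIMSEQ_le_const[OF L]) (use assms in auto)
    with r(1) L show thesis using result(2) by blast
  qed
  from r(2) consider "incseq (q \<circ> r)" | "decseq (q \<circ> r)" by (auto simp: monoseq_iff comp_def)
  then show thesis
  proof cases
    case 1
    show thesis
    proof (cases "\<exists>B. \<forall>k. (q \<circ> r) k \<le> B")
      case True
      then obtain B where B: "\<forall>k. (q \<circ> r) k \<le> B" by auto
      obtain L where "(q \<circ> r) \<longlonglongrightarrow> L" by (rule incseq_convergent[OF 1 B])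
      then show thesis by (intro conv) (auto simp: convergent_def)
    next
      case False
      have "filterlim (q \<circ> r) at_top sequentially"
        unfolding filterlim_at_top
      proof
        fix Z
        from False obtain k where "Z \<le> (q \<circ> r) k" by (metis nle_le)
        then have "\<And>n. k \<le> n \<Longrightarrow> Z \<le> (q \<circ> r) n" using 1 by (meson incseq_def order_trans)
        then show "\<forall>\<^sub>F n in sequentially. Z \<le> (q \<circ> r) n" unfolding eventually_sequentially by blast
      qed
      with r(1) show thesis using result(1) by blast
    qed
  next
    case 2
    have a: "\<forall>k. a \<le> (q \<circ> r) k" using assms by simp
    obtain L where "(q \<circ> r) \<longlonglongrightarrow> L" by (rule decseq_convergent[OF 2 a])
    then show thesis by (intro conv) (auto simp: convergent_def)
  qed
qed

text \<open>The abstract situation: the power tends to P (\<kappa> h^2) when sqrt n times the shift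
  tends to h, and to 1 when it diverges; P reaches the power \<gamma> at \<open>x0\<close>. Two
  tests sharing P and \<open>x0\<close> differ only in \<kappa>.\<close>

locale local_power =
  fixes \<phi> :: test_power and \<beta> \<gamma> \<kappa> x0 :: real and P :: "real \<Rightarrow> real" and \<tau> :: "real^2"
  assumes \<tau>: "\<tau> \<noteq> 0" and \<kappa>: "0 < \<kappa>" and x0: "0 < x0" "P x0 = \<gamma>" and \<gamma>: "\<gamma> < 1"
    and mono: "\<And>x y. 0 \<le> x \<Longrightarrow> x < y \<Longrightarrow> P x < P y"
    and regular: "\<And>n s h. filterlim n at_top sequentially \<Longrightarrow> s \<longlonglongrightarrow> 0 \<Longrightarrow> (\<And>k. 0 \<le> s k) \<Longrightarrow>
       (\<lambda>k. sqrt (real (n k)) * s k) \<longlonglongrightarrow> h \<Longrightarrow> (\<lambda>k. \<phi> \<beta> (n k) (s k *\<^sub>R (\<tau> /\<^sub>R norm \<tau>))) \<longlonglongrightarrow> P (\<kappa> * h\<^sup>2)"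
    and diverging: "\<And>n s. filterlim n at_top sequentially \<Longrightarrow> s \<longlonglongrightarrow> 0 \<Longrightarrow> (\<And>k. 0 \<le> s k) \<Longrightarrow>
       filterlim (\<lambda>k. sqrt (real (n k)) * s k) at_top sequentially \<Longrightarrow> (\<lambda>k. \<phi> \<beta> (n k) (s k *\<^sub>R (\<tau> /\<^sub>R norm \<tau>))) \<longlonglongrightarrow> 1"
begin

definition alternative :: "nat \<Rightarrow> real^2" where "alternative m = (1 / sqrt (real m)) *\<^sub>R \<tau>"

text \<open>The number L that solves \<kappa> * L * (norm \<tau>)^2 = x0, that is, the limit of
  needed size over m.\<close>

definition size_ratio :: real where "size_ratio = x0 / (\<kappa> * (norm \<tau>)\<^sup>2)"

lemma size_ratio_pos: "0 < size_ratio"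
  using \<tau> \<kappa> x0 by (simp add: size_ratio_def)

lemma alternative_eq: "alternative m = (norm \<tau> / sqrt (real m)) *\<^sub>R (\<tau> /\<^sub>R norm \<tau>)"
  using \<tau> by (simp add: alternative_def)

lemma shift_tendsto: "(\<lambda>m. norm \<tau> / sqrt (real m)) \<longlonglongrightarrow> 0"
  by real_asymp

lemma regular_at:
  assumes r: "strict_mono r" and n: "filterlim n at_top sequentially" and q: "(\<lambda>k. real (n k) / real (r k)) \<longlonglongrightarrow> L" and L: "0 \<le> L"
  shows "(\<lambda>k. \<phi> \<beta> (n k) (alternative (r k))) \<longlonglongrightarrow> P (\<kappa> * (L * (norm \<tau>)\<^sup>2))"
proof -
  have s: "(\<lambda>k. norm \<tau> / sqrt (real (r k))) \<longlonglongrightarrow> 0"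
    using LIMSEQ_subseq_LIMSEQ[OF shift_tendsto r] by (simp add: comp_def)
  have "(\<lambda>k. sqrt (real (n k) / real (r k)) * norm \<tau>) \<longlonglongrightarrow> sqrt L * norm \<tau>"
    by (intro tendsto_intros q)
  moreover have "sqrt (real (n k)) * (norm \<tau> / sqrt (real (r k))) = sqrt (real (n k) / real (r k)) * norm \<tau>" for k
    by (simp add: real_sqrt_divide)
  ultimately have "(\<lambda>k. sqrt (real (n k)) * (norm \<tau> / sqrt (real (r k)))) \<longlonglongrightarrow> sqrt L * norm \<tau>" by simp
  from regular[OF n s _ this] show ?thesis unfolding alternative_eq using L by (simp add: power_mult_distrib)
qed

text \<open>At sizes about a m the limiting h^2 is a times (norm \<tau>)^2, so the argument of P
  stays below \<open>x0\<close>.\<close>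

lemma eventually_insufficient:
  assumes a: "0 < a" "a < size_ratio"
  shows "\<forall>\<^sub>F m in sequentially. \<phi> \<beta> (nat \<lfloor>a * real m\<rfloor>) (alternative m) < \<gamma>"
proof -
  have n: "filterlim (\<lambda>m. nat \<lfloor>a * real m\<rfloor>) at_top sequentially" using a by real_asymp
  have q: "(\<lambda>m. real (nat \<lfloor>a * real m\<rfloor>) / real m) \<longlonglongrightarrow> a" using a by real_asymp
  have "(\<lambda>m. \<phi> \<beta> (nat \<lfloor>a * real m\<rfloor>) (alternative m)) \<longlonglongrightarrow> P (\<kappa> * (a * (norm \<tau>)\<^sup>2))"
    using regular_at[OF strict_mono_id n] q a by (simp add: id_def)
  moreover have "P (\<kappa> * (a * (norm \<tau>)\<^sup>2)) < \<gamma>"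
    unfolding x0(2)[symmetric] using a \<tau> \<kappa> by (intro mono) (auto simp: size_ratio_def pos_less_divide_eq mult_ac)
  ultimately show ?thesis by (rule order_tendstoD(2))
qed

text \<open>Otherwise there are sample sizes \<open>n\<close> with too little power along a subsequence, on which \<open>n / m\<close> converges or diverges;
  both limits of the power are then larger than \<open>\<gamma>\<close>.\<close>

lemma eventually_suffices:
  assumes a: "size_ratio < a"
  shows "\<forall>\<^sub>F m in sequentially. \<forall>n. a * real m \<le> real n \<longrightarrow> \<gamma> \<le> \<phi> \<beta> n (alternative m)"
proof (rule ccontr)
  assume "\<not> ?thesis"
  then have "\<exists>\<^sub>F m in sequentially. \<not> (\<forall>n. a * real m \<le> real n \<longrightarrow> \<gamma> \<le> \<phi> \<beta> n (alternative m))"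
    by (simp only: not_eventually)
  then have freq: "\<And>N. \<exists>m\<ge>N. \<exists>n. a * real m \<le> real n \<and> \<phi> \<beta> n (alternative m) < \<gamma>"
    unfolding frequently_sequentially by (simp add: not_le)
  define S where "S = {m. 0 < m \<and> (\<exists>n. a * real m \<le> real n \<and> \<phi> \<beta> n (alternative m) < \<gamma>)}"
  have "infinite S" unfolding infinite_nat_iff_unbounded
  proof
    fix N
    from freq[of "Suc N"] show "\<exists>n>N. n \<in> S" by (force simp: S_def Suc_le_eq)
  qed
  define r where "r = enumerate S"
  have r: "strict_mono r" "\<And>k. 0 < r k \<and> (\<exists>n. a * real (r k) \<le> real n \<and> \<phi> \<beta> n (alternative (r k)) < \<gamma>)"
    using strict_mono_enumerate[OF \<open>infinite S\<close>] enumerate_in_set[OF \<open>infinite S\<close>] by (auto simp: r_def S_def)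
  then obtain n where n: "\<And>k. a * real (r k) \<le> real (n k)" "\<And>k. \<phi> \<beta> (n k) (alternative (r k)) < \<gamma>" by metis
  have a0: "0 < a" using a size_ratio_pos by simp
  define q where "q k = real (n k) / real (r k)" for k
  have aq: "a \<le> q k" for k using n(1)[of k] r(2)[of k] by (simp add: q_def le_divide_eq)
  have nlim: "filterlim n at_top sequentially"
  proof -
    have "filterlim (\<lambda>k. a * real (r k)) at_top sequentially"
      using a0 filterlim_subseq[OF r(1)] by (intro filterlim_tendsto_pos_mult_at_top[OF tendsto_const] filterlim_compose[OF filterlim_real_sequentially]) auto
    then have "filterlim (\<lambda>k. real (n k)) at_top sequentially" by (rule filterlim_at_top_mono) (use n in auto)
    then show ?thesis by (simp add: filterlim_sequentially_iff_filterlim_real)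
  qed
  have contra: False if s: "strict_mono s" and lim: "(\<lambda>k. \<phi> \<beta> (n (s k)) (alternative (r (s k)))) \<longlonglongrightarrow> L" and "\<gamma> < L" for s L
  proof -
    from order_tendstoD(1)[OF lim \<open>\<gamma> < L\<close>] obtain k where "\<gamma> < \<phi> \<beta> (n (s k)) (alternative (r (s k)))"
      by (auto simp: eventually_sequentially)
    with n(2)[of "s k"] show False by simp
  qed
  show False
  proof (rule convergent_or_diverging_subsequence[of a q, OF aq])
    fix s assume s: "strict_mono s" and q: "filterlim (q \<circ> s) at_top sequentially"
    have ns: "filterlim (\<lambda>k. n (s k)) at_top sequentially" by (rule filterlim_compose[OF nlim filterlim_subseq[OF s]])
    have sh: "(\<lambda>k. norm \<tau> / sqrt (real (r (s k)))) \<longlonglongrightarrow> 0"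
      using LIMSEQ_subseq_LIMSEQ[OF LIMSEQ_subseq_LIMSEQ[OF shift_tendsto r(1)] s] by (simp add: comp_def)
    have "filterlim (\<lambda>k. norm \<tau> * sqrt (q (s k))) at_top sequentially"
      using \<tau> q by (intro filterlim_tendsto_pos_mult_at_top[OF tendsto_const] filterlim_compose[OF sqrt_at_top]) (auto simp: comp_def)
    moreover have "sqrt (real (n (s k))) * (norm \<tau> / sqrt (real (r (s k)))) = norm \<tau> * sqrt (q (s k))" for k
      by (simp add: q_def real_sqrt_divide)
    ultimately have "filterlim (\<lambda>k. sqrt (real (n (s k))) * (norm \<tau> / sqrt (real (r (s k))))) at_top sequentially" by simp
    from diverging[OF ns sh _ this] have "(\<lambda>k. \<phi> \<beta> (n (s k)) (alternative (r (s k)))) \<longlonglongrightarrow> 1" by (simp add: alternative_eq)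
    then show False by (rule contra[OF s _ \<gamma>])
  next
    fix s L assume s: "strict_mono s" and L: "a \<le> L" and q: "(q \<circ> s) \<longlonglongrightarrow> L"
    have ns: "filterlim (\<lambda>k. n (s k)) at_top sequentially" by (rule filterlim_compose[OF nlim filterlim_subseq[OF s]])
    have "(\<lambda>k. \<phi> \<beta> (n (s k)) (alternative (r (s k)))) \<longlonglongrightarrow> P (\<kappa> * (L * (norm \<tau>)\<^sup>2))"
      using regular_at[OF strict_mono_compose[OF r(1) s] ns] q L a0 by (simp add: comp_def q_def)
    moreover have "\<gamma> < P (\<kappa> * (L * (norm \<tau>)\<^sup>2))"
    proof -
      have "size_ratio < L" using a L by simp
      then have "x0 < \<kappa> * (L * (norm \<tau>)\<^sup>2)" using \<tau> \<kappa> by (simp add: size_ratio_def pos_divide_less_eq mult_ac)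
      then show ?thesis unfolding x0(2)[symmetric] using x0(1) by (intro mono) auto
    qed
    ultimately show False by (rule contra[OF s])
  qed
qed

lemma eventually_ex_size: "\<forall>\<^sub>F m in sequentially. \<exists>N. size_suffices \<phi> \<beta> \<gamma> (alternative m) N"
proof -
  have "size_ratio < size_ratio + 1" by simp
  from eventually_suffices[OF this] show ?thesis
  proof eventually_elim
    case (elim m)
    have "size_suffices \<phi> \<beta> \<gamma> (alternative m) (nat \<lceil>(size_ratio + 1) * real m\<rceil>)"
      unfolding size_suffices_def using elim by (auto simp: nat_le_iff ceiling_le_iff)
    then show ?case ..
  qed
qed

text \<open>Sizes below the ratio fail at a single size, which bounds the least sufficient size from
  below; sizes above it suffice throughout. Rounding to integers costs at most one
  observation.\<close>

lemma size_tendsto: "(\<lambda>m. real (sample_size_needed \<phi> \<beta> \<gamma> (alternative m)) / real m) \<longlonglongrightarrow> size_ratio"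
proof (rule order_tendstoI)
  fix a assume "a < size_ratio"
  obtain b where b: "0 < b" "a < b" "b < size_ratio"
    using \<open>a < size_ratio\<close> size_ratio_pos dense[of "max 0 a" size_ratio] by auto
  show "\<forall>\<^sub>F m in sequentially. a < real (sample_size_needed \<phi> \<beta> \<gamma> (alternative m)) / real m"
    using eventually_insufficient[OF b(1,3)] eventually_ex_size eventually_gt_at_top[of 0]
  proof eventually_elim
    case (elim m)
    then obtain N where "size_suffices \<phi> \<beta> \<gamma> (alternative m) N" by auto
    from less_sample_size_needed[OF this elim(1)]
    have "b * real m < real (sample_size_needed \<phi> \<beta> \<gamma> (alternative m))" using b by linarith
    then have "b < real (sample_size_needed \<phi> \<beta> \<gamma> (alternative m)) / real m" using elim by (simp add: less_divide_eq)
    then show ?case using b by simp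
  qed
next
  fix a assume "size_ratio < a"
  obtain b where b: "size_ratio < b" "b < a" using \<open>size_ratio < a\<close> dense by blast
  have "filterlim (\<lambda>m. (a - b) * real m) at_top sequentially" using b by real_asymp
  then have "\<forall>\<^sub>F m in sequentially. 1 < (a - b) * real m" by (simp add: filterlim_at_top_dense)
  then show "\<forall>\<^sub>F m in sequentially. real (sample_size_needed \<phi> \<beta> \<gamma> (alternative m)) / real m < a"
    using eventually_suffices[OF b(1)] eventually_gt_at_top[of 0]
  proof eventually_elim
    case (elim m)
    have "size_suffices \<phi> \<beta> \<gamma> (alternative m) (nat \<lceil>b * real m\<rceil>)"
      unfolding size_suffices_def using elim by (auto simp: nat_le_iff ceiling_le_iff)
    from sample_size_needed_le[OF this]
    have "real (sample_size_needed \<phi> \<beta> \<gamma> (alternative m)) \<le> b * real m + 1"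
    proof -
      have "0 \<le> b * real m" using b size_ratio_pos by simp
      with \<open>sample_size_needed \<phi> \<beta> \<gamma> (alternative m) \<le> _\<close> show ?thesis by linarith
    qed
    also have "\<dots> < a * real m" using elim by (simp add: algebra_simps)
    finally show ?case using elim by (simp add: divide_less_eq)
  qed
qed

end

section \<open>The limit of the statistic\<close>

text \<open>g k and exp (z / n) are compared by means of |a^n - b^n| \<le> n |a - b| in the closed
  unit disc, where \<open>Re z \<le> 0\<close> keeps the exponential. Complex logarithms are avoided
  in this way.\<close>

lemma power_tendsto_exp:
  fixes g :: "nat \<Rightarrow> complex"
  assumes g: "\<And>k. cmod (g k) \<le> 1" and n: "filterlim n at_top sequentially"
    and lim: "(\<lambda>k. of_nat (n k) * (g k - 1)) \<longlonglongrightarrow> z" and z: "Re z \<le> 0"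
  shows "(\<lambda>k. g k ^ n k) \<longlonglongrightarrow> exp z"
proof -
  have n0: "\<forall>\<^sub>F k in sequentially. 0 < n k" by (rule eventually_compose_filterlim[OF eventually_gt_at_top n])
  have nr: "filterlim (\<lambda>k. real (n k)) at_top sequentially"
    by (rule filterlim_compose[OF filterlim_real_sequentially n])
  define w where "w k = z / of_nat (n k)" for k
  have w0: "w \<longlonglongrightarrow> 0"
  proof -
    have "(\<lambda>k. cmod z / real (n k)) \<longlonglongrightarrow> 0" by (rule real_tendsto_divide_at_top[OF tendsto_const nr])
    then have "(\<lambda>k. norm (w k)) \<longlonglongrightarrow> 0" by (simp add: w_def norm_divide)
    then show ?thesis by (simp add: tendsto_norm_zero_iff)
  qed
  have elim: "(\<lambda>k. of_nat (n k) * (exp (w k) - 1)) \<longlonglongrightarrow> z"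
  proof (cases "z = 0")
    case False
    have "((\<lambda>h. (exp h - 1) / h) \<longlongrightarrow> 1) (at (0::complex))"
      using DERIV_exp[of "0::complex"] by (simp add: DERIV_def)
    moreover have "filterlim w (at 0) sequentially"
      using w0 n0 False by (auto simp: filterlim_at w_def elim!: eventually_mono)
    ultimately have "(\<lambda>k. (exp (w k) - 1) / w k) \<longlonglongrightarrow> 1" by (rule filterlim_compose)
    then have "(\<lambda>k. z * ((exp (w k) - 1) / w k)) \<longlonglongrightarrow> z * 1" by (intro tendsto_intros)
    moreover have "\<forall>\<^sub>F k in sequentially. z * ((exp (w k) - 1) / w k) = of_nat (n k) * (exp (w k) - 1)"
      using n0 by eventually_elim (use False in \<open>simp add: w_def field_simps\<close>)
    ultimately have "(\<lambda>k. of_nat (n k) * (exp (w k) - 1)) \<longlonglongrightarrow> z * 1" by (rule Lim_transform_eventually)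
    then show ?thesis by simp
  qed (simp add: w_def)
  have "(\<lambda>k. g k ^ n k - exp (w k) ^ n k) \<longlonglongrightarrow> 0"
  proof (rule Lim_null_comparison)
    show "\<forall>\<^sub>F k in sequentially. norm (g k ^ n k - exp (w k) ^ n k) \<le> cmod (of_nat (n k) * (g k - 1) - of_nat (n k) * (exp (w k) - 1))"
    proof (rule always_eventually, rule allI)
      fix k
      have "Re (w k) \<le> 0" using z by (simp add: w_def divide_le_0_iff)
      then have "cmod (exp (w k)) \<le> 1" by simp
      from norm_power_diff[OF g[of k] this, of "n k"]
      have "norm (g k ^ n k - exp (w k) ^ n k) \<le> real (n k) * norm (g k - exp (w k))" .
      also have "\<dots> = cmod (of_nat (n k) * (g k - exp (w k)))" by (simp add: norm_mult)
      also have "of_nat (n k) * (g k - exp (w k)) = of_nat (n k) * (g k - 1) - of_nat (n k) * (exp (w k) - 1)"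
        by (simp add: algebra_simps)
      finally show "norm (g k ^ n k - exp (w k) ^ n k) \<le> cmod (of_nat (n k) * (g k - 1) - of_nat (n k) * (exp (w k) - 1))" .
    qed
    have "(\<lambda>k. of_nat (n k) * (g k - 1) - of_nat (n k) * (exp (w k) - 1)) \<longlonglongrightarrow> z - z"
      by (intro tendsto_diff lim elim)
    then show "(\<lambda>k. cmod (of_nat (n k) * (g k - 1) - of_nat (n k) * (exp (w k) - 1))) \<longlonglongrightarrow> 0"
      by (simp add: tendsto_norm_zero_iff)
  qed
  moreover have "(\<lambda>k. exp (w k) ^ n k) \<longlonglongrightarrow> exp z"
  proof (rule tendsto_eventually)
    show "\<forall>\<^sub>F k in sequentially. exp (w k) ^ n k = exp z"
      using n0 by eventually_elim (simp add: w_def exp_of_nat_mult[symmetric])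
  qed
  ultimately show ?thesis using tendsto_add[of "\<lambda>k. g k ^ n k - exp (w k) ^ n k" 0 _ "\<lambda>k. exp (w k) ^ n k" "exp z"] by simp
qed

text \<open>The extra quadratic factor shrinks the variance from 1 to 1 / (1 + b); rescaling by c
  leads back to the standard characteristic function.\<close>

lemma integral_gauss_iexp:
  assumes b: "0 \<le> b"
  shows "(\<integral>z. iexp (a * z) * exp (- complex_of_real (b * z\<^sup>2 / 2)) \<partial>std_normal_distribution)
     = complex_of_real (exp (- (a\<^sup>2 / (2 * (1 + b)))) / sqrt (1 + b))"
proof -
  define c where "c = 1 / sqrt (1 + b)"
  have c: "0 < c" "c\<^sup>2 = 1 / (1 + b)" using b by (simp_all add: c_def power_divide)
  define F where "F z = std_normal_density (z / c) *\<^sub>R iexp (a * z)" for z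
  have e: "std_normal_density z *\<^sub>R (iexp (a * z) * exp (- complex_of_real (b * z\<^sup>2 / 2))) = F z" for z
  proof -
    have "- z\<^sup>2 / 2 + - (b * z\<^sup>2 / 2) = - (z / c)\<^sup>2 / 2" using b by (simp add: power_divide c(2) field_simps)
    then have "exp (- z\<^sup>2 / 2) * exp (- (b * z\<^sup>2 / 2)) = exp (- (z / c)\<^sup>2 / 2)" by (simp only: exp_add[symmetric])
    then have s: "std_normal_density z * exp (- (b * z\<^sup>2 / 2)) = std_normal_density (z / c)"
      by (simp add: std_normal_density_def)
    have "exp (- complex_of_real (b * z\<^sup>2 / 2)) = complex_of_real (exp (- (b * z\<^sup>2 / 2)))" by (simp add: exp_of_real[symmetric])
    then show ?thesis unfolding F_def s[symmetric] by (simp add: scaleR_conv_of_real)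
  qed
  have "(\<integral>z. iexp (a * z) * exp (- complex_of_real (b * z\<^sup>2 / 2)) \<partial>std_normal_distribution)
     = (\<integral>z. std_normal_density z *\<^sub>R (iexp (a * z) * exp (- complex_of_real (b * z\<^sup>2 / 2))) \<partial>lborel)"
    by (rule integral_density) (auto simp: normal_density_nonneg)
  also have "\<dots> = (\<integral>z. F z \<partial>lborel)" by (simp only: e)
  also have "\<dots> = \<bar>c\<bar> *\<^sub>R (\<integral>z. F (0 + c * z) \<partial>lborel)"
    using c by (intro lborel_integral_real_affine) auto
  also have "(\<integral>z. F (0 + c * z) \<partial>lborel) = (\<integral>z. std_normal_density z *\<^sub>R iexp ((a * c) * z) \<partial>lborel)"
    using c by (simp add: F_def mult.assoc)
  also have "\<dots> = char std_normal_distribution (a * c)"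
    unfolding char_def by (rule integral_density[symmetric]) (auto simp: normal_density_nonneg)
  also have "\<dots> = complex_of_real (exp (- ((a * c)\<^sup>2) / 2))" by (simp add: char_std_normal_distribution)
  also have "\<bar>c\<bar> *\<^sub>R complex_of_real (exp (- ((a * c)\<^sup>2) / 2)) = complex_of_real (exp (- (a\<^sup>2 / (2 * (1 + b)))) / sqrt (1 + b))"
    using c by (simp add: scaleR_conv_of_real power_mult_distrib c_def field_simps)
  finally show ?thesis .
qed

section \<open>Planar Gaussian frequencies\<close>

abbreviation std_normal2 :: "(real \<times> real) measure" where
  "std_normal2 \<equiv> std_normal_distribution \<Otimes>\<^sub>M std_normal_distribution"

lemma prob_space_std_normal: "prob_space std_normal_distribution"
  using real_dist_normal_dist by (simp add: real_distribution_def)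

interpretation normal: prob_space std_normal_distribution by (rule prob_space_std_normal)
interpretation normal2: pair_prob_space std_normal_distribution std_normal_distribution ..

lemma sets_std_normal2 [measurable_cong]: "sets std_normal2 = sets (borel \<Otimes>\<^sub>M borel)"
  by (intro sets_pair_measure_cong) simp_all

lemma integral_std_normal2_product:
  fixes f g :: "real \<Rightarrow> complex"
  assumes [measurable]: "f \<in> borel_measurable borel" "g \<in> borel_measurable borel"
    and "\<And>z. cmod (f z) \<le> 1" "\<And>z. cmod (g z) \<le> 1"
  shows "(\<integral>p. f (fst p) * g (snd p) \<partial>std_normal2) = (\<integral>z. f z \<partial>std_normal_distribution) * (\<integral>z. g z \<partial>std_normal_distribution)"
proof -
  have "integrable std_normal2 (\<lambda>p. f (fst p) * g (snd p))"
    by (rule normal2.integrable_const_bound[where B=1]) (use assms in \<open>auto intro!: AE_I2 mult_le_one simp: norm_mult\<close>)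
  then have i: "integrable std_normal2 (\<lambda>(x, y). f x * g y)" by (simp add: case_prod_unfold)
  have "(\<integral>p. f (fst p) * g (snd p) \<partial>std_normal2) = (\<integral>(x, y). f x * g y \<partial>std_normal2)" by (simp add: case_prod_unfold)
  also have "\<dots> = (\<integral>x. (\<integral>y. f x * g y \<partial>std_normal_distribution) \<partial>std_normal_distribution)"
    using normal2.integral_fst[of "\<lambda>x y. f x * g y"] i by simp
  also have "\<dots> = (\<integral>z. f z \<partial>std_normal_distribution) * (\<integral>z. g z \<partial>std_normal_distribution)" by simp
  finally show ?thesis .
qed

definition complex_of_pair :: "real \<times> real \<Rightarrow> complex" where "complex_of_pair p = Complex (fst p) (snd p)"

lemma measurable_complex_of_pair [measurable]: "complex_of_pair \<in> borel_measurable (borel \<Otimes>\<^sub>M borel)"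
proof -
  have "complex_of_pair = (\<lambda>p. complex_of_real (fst p) + \<i> * complex_of_real (snd p))"
    by (rule ext) (simp add: complex_of_pair_def complex_eq_iff)
  moreover have "(\<lambda>p. complex_of_real (fst p) + \<i> * complex_of_real (snd p)) \<in> borel_measurable (borel \<Otimes>\<^sub>M borel)"
    by measurable
  ultimately show ?thesis by simp
qed

lemma inner_complex_of_pair: "complex_of_pair p \<bullet> w = fst p * Re w + snd p * Im w"
  by (simp add: complex_of_pair_def inner_complex_def)

text \<open>The characteristic function of the planar normal law read backwards: a functional
  quadratic in w becomes an average of functionals exponential in a linear form of w.\<close>

lemma exp_norm_sq_linearize:
  assumes t: "0 \<le> t"
  shows "complex_of_real (exp (- (t * (cmod w)\<^sup>2))) = (\<integral>p. iexp (sqrt (2 * t) * (complex_of_pair p \<bullet> w)) \<partial>std_normal2)"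
proof -
  have "(\<integral>p. iexp (sqrt (2 * t) * (complex_of_pair p \<bullet> w)) \<partial>std_normal2)
    = (\<integral>p. iexp ((sqrt (2 * t) * Re w) * fst p) * iexp ((sqrt (2 * t) * Im w) * snd p) \<partial>std_normal2)"
    by (simp add: inner_complex_of_pair exp_add[symmetric] algebra_simps)
  also have "\<dots> = char std_normal_distribution (sqrt (2 * t) * Re w) * char std_normal_distribution (sqrt (2 * t) * Im w)"
    unfolding char_def by (rule integral_std_normal2_product) simp_all
  also have "\<dots> = complex_of_real (exp (- (t * (cmod w)\<^sup>2)))"
    unfolding char_std_normal_distribution of_real_mult[symmetric] exp_add[symmetric] cmod_power2
    using t by (simp add: power_mult_distrib algebra_simps)
  finally show ?thesis ..
qed

text \<open>The right-hand side is the Laplace transform at t of the squared norm of a planar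
  Gaussian vector with mean c u and covariance s2 / 2 times the identity.\<close>

lemma integral_gauss2_limit:
  assumes t: "0 \<le> t" and s2: "0 \<le> s2" and u: "cmod u = 1"
  shows "(\<integral>p. exp (\<i> * complex_of_real (c * ((sqrt (2 * t) *\<^sub>R complex_of_pair p) \<bullet> u)) - complex_of_real (s2 / 4 * (cmod (sqrt (2 * t) *\<^sub>R complex_of_pair p))\<^sup>2)) \<partial>std_normal2)
    = complex_of_real (exp (- (t * c\<^sup>2 / (1 + t * s2))) / (1 + t * s2))"
proof -
  let ?b = "t * s2"
  have b: "0 \<le> ?b" using t s2 by simp
  let ?f = "\<lambda>a z. iexp (a * z) * exp (- complex_of_real (?b * z\<^sup>2 / 2))"
  have e: "exp (\<i> * complex_of_real (c * ((sqrt (2 * t) *\<^sub>R complex_of_pair p) \<bullet> u)) - complex_of_real (s2 / 4 * (cmod (sqrt (2 * t) *\<^sub>R complex_of_pair p))\<^sup>2))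
     = ?f (c * sqrt (2 * t) * Re u) (fst p) * ?f (c * sqrt (2 * t) * Im u) (snd p)" for p
  proof -
    have n: "(cmod (sqrt (2 * t) *\<^sub>R complex_of_pair p))\<^sup>2 = 2 * t * ((fst p)\<^sup>2 + (snd p)\<^sup>2)"
      using t by (simp add: power_mult_distrib cmod_power2 complex_of_pair_def)
    have "exp (\<i> * complex_of_real (c * sqrt (2 * t) * Re u * fst p)) * exp (- complex_of_real (?b * (fst p)\<^sup>2 / 2)) *
       (exp (\<i> * complex_of_real (c * sqrt (2 * t) * Im u * snd p)) * exp (- complex_of_real (?b * (snd p)\<^sup>2 / 2)))
     = exp (\<i> * complex_of_real (c * sqrt (2 * t) * Re u * fst p) + - complex_of_real (?b * (fst p)\<^sup>2 / 2) +
       (\<i> * complex_of_real (c * sqrt (2 * t) * Im u * snd p) + - complex_of_real (?b * (snd p)\<^sup>2 / 2)))"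
      by (simp only: exp_add)
    also have "\<i> * complex_of_real (c * sqrt (2 * t) * Re u * fst p) + - complex_of_real (?b * (fst p)\<^sup>2 / 2) +
       (\<i> * complex_of_real (c * sqrt (2 * t) * Im u * snd p) + - complex_of_real (?b * (snd p)\<^sup>2 / 2))
      = \<i> * complex_of_real (c * ((sqrt (2 * t) *\<^sub>R complex_of_pair p) \<bullet> u)) - complex_of_real (s2 / 4 * (cmod (sqrt (2 * t) *\<^sub>R complex_of_pair p))\<^sup>2)"
      unfolding n inner_scaleR_left inner_complex_of_pair by (simp add: field_simps)
    finally show ?thesis ..
  qed
  have bd: "cmod (?f a z) \<le> 1" for a z
    using b by (simp add: norm_mult exp_of_real[symmetric] flip: of_real_minus)
  have "(\<integral>p. ?f (c * sqrt (2 * t) * Re u) (fst p) * ?f (c * sqrt (2 * t) * Im u) (snd p) \<partial>std_normal2)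
    = complex_of_real (exp (- ((c * sqrt (2 * t) * Re u)\<^sup>2 / (2 * (1 + ?b)))) / sqrt (1 + ?b)) *
      complex_of_real (exp (- ((c * sqrt (2 * t) * Im u)\<^sup>2 / (2 * (1 + ?b)))) / sqrt (1 + ?b))"
    unfolding integral_gauss_iexp[OF b, symmetric]
    by (rule integral_std_normal2_product) (simp_all add: bd del: of_real_divide of_real_mult)
  also have "\<dots> = complex_of_real (exp (- (t * c\<^sup>2 / (1 + t * s2))) / (1 + t * s2))"
  proof -
    have "(Re u)\<^sup>2 + (Im u)\<^sup>2 = 1" using u by (simp add: cmod_power2[symmetric])
    then have "(c * sqrt (2 * t) * Re u)\<^sup>2 + (c * sqrt (2 * t) * Im u)\<^sup>2 = c\<^sup>2 * (2 * t)"
      using t by (simp add: power_mult_distrib distrib_left[symmetric])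
    moreover have "- (x / d) + - (y / d) = - ((x + y) / d)" for x y d :: real by (simp add: add_divide_distrib)
    moreover have "c\<^sup>2 * (2 * t) / (2 * (1 + ?b)) = t * c\<^sup>2 / (1 + t * s2)"
      using mult_divide_mult_cancel_left[of 2 "t * c\<^sup>2" "1 + ?b"] by (simp only: mult_ac)
    ultimately have "- ((c * sqrt (2 * t) * Re u)\<^sup>2 / (2 * (1 + ?b))) + - ((c * sqrt (2 * t) * Im u)\<^sup>2 / (2 * (1 + ?b))) = - (t * c\<^sup>2 / (1 + t * s2))"
      by (simp only:)
    then have "exp (- ((c * sqrt (2 * t) * Re u)\<^sup>2 / (2 * (1 + ?b)))) * exp (- ((c * sqrt (2 * t) * Im u)\<^sup>2 / (2 * (1 + ?b)))) = exp (- (t * c\<^sup>2 / (1 + t * s2)))"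
      by (simp only: exp_add[symmetric])
    moreover have "sqrt (1 + ?b) * sqrt (1 + ?b) = 1 + ?b" using b by simp
    ultimately show ?thesis unfolding of_real_mult[symmetric] times_divide_times_eq by simp
  qed
  finally show ?thesis by (simp only: e)
qed

text \<open>A substitute for uniform continuity in which the error enters through the square of a -
  b, so that a mean-square estimate is all it takes after integration.\<close>

lemma exp_neg_sq_diff:
  fixes a b t \<epsilon> :: real
  assumes t: "0 \<le> t" and \<epsilon>: "0 < \<epsilon>" and a: "0 \<le> a" and b: "0 \<le> b"
  shows "\<bar>exp (- (t * a\<^sup>2)) - exp (- (t * b\<^sup>2))\<bar> \<le> \<epsilon> + (t / \<epsilon> + t) * (a - b)\<^sup>2"
proof -
  have main: "exp (- (t * a\<^sup>2)) - exp (- (t * b\<^sup>2)) \<le> \<epsilon> + (t / \<epsilon> + t) * (a - b)\<^sup>2" if ab: "0 \<le> a" "a \<le> b" for a b :: real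
  proof -
    have "exp (- (t * a\<^sup>2)) - exp (- (t * b\<^sup>2)) = exp (- (t * a\<^sup>2)) * (1 - exp (- (t * (b\<^sup>2 - a\<^sup>2))))"
      by (simp add: right_diff_distrib exp_add[symmetric] algebra_simps)
    also have "\<dots> \<le> exp (- (t * a\<^sup>2)) * (t * (b\<^sup>2 - a\<^sup>2))"
      using exp_ge_add_one_self[of "- (t * (b\<^sup>2 - a\<^sup>2))"] by (intro mult_left_mono) auto
    also have "\<dots> = (exp (- (t * a\<^sup>2)) * (2 * t * a)) * (b - a) + exp (- (t * a\<^sup>2)) * (t * (b - a)\<^sup>2)"
      by (simp add: power2_eq_square algebra_simps)
    also have "exp (- (t * a\<^sup>2)) * (t * (b - a)\<^sup>2) \<le> 1 * (t * (b - a)\<^sup>2)"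
      using t by (intro mult_right_mono) auto
    also have "(exp (- (t * a\<^sup>2)) * (2 * t * a)) * (b - a) \<le> \<epsilon> + t / \<epsilon> * (b - a)\<^sup>2"
    proof -
      have u: "exp (- (t * a\<^sup>2)) * (1 + t * a\<^sup>2) \<le> 1"
      proof -
        have "exp (- (t * a\<^sup>2)) * (1 + t * a\<^sup>2) \<le> exp (- (t * a\<^sup>2)) * exp (t * a\<^sup>2)"
          using exp_ge_add_one_self[of "t * a\<^sup>2"] by (intro mult_left_mono) auto
        then show ?thesis by (simp add: exp_add[symmetric])
      qed
      define E where "E = exp (- (t * a\<^sup>2))"
      have E: "0 \<le> E" "E \<le> 1" "E * (t * a\<^sup>2) \<le> 1" using t u by (simp_all add: E_def algebra_simps) (smt (verit) exp_ge_zero)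
      have "(\<epsilon> * a - d)\<^sup>2 / \<epsilon> = \<epsilon> * a\<^sup>2 - 2 * a * d + d\<^sup>2 / \<epsilon>" for d
      proof -
        have "(\<epsilon> * a - d)\<^sup>2 = \<epsilon> * (\<epsilon> * a\<^sup>2 - 2 * a * d) + d\<^sup>2" by (simp add: power2_eq_square algebra_simps)
        then show ?thesis using \<epsilon> by (simp add: add_divide_distrib)
      qed
      moreover have "0 \<le> (\<epsilon> * a - (b - a))\<^sup>2 / \<epsilon>" using \<epsilon> by simp
      \<comment> \<open>Young's inequality, weighted so that the term with a^2 is absorbed by E * (t
        * a^2) \<le> 1 at the cost \<epsilon>.\<close>
      ultimately have "2 * a * (b - a) \<le> \<epsilon> * a\<^sup>2 + (b - a)\<^sup>2 / \<epsilon>" by simp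
      then have "(E * t) * (2 * a * (b - a)) \<le> (E * t) * (\<epsilon> * a\<^sup>2 + (b - a)\<^sup>2 / \<epsilon>)"
        using E t by (intro mult_left_mono) auto
      also have "\<dots> = \<epsilon> * (E * (t * a\<^sup>2)) + E * (t / \<epsilon> * (b - a)\<^sup>2)" by (simp add: algebra_simps)
      also have "\<dots> \<le> \<epsilon> * 1 + 1 * (t / \<epsilon> * (b - a)\<^sup>2)"
        using E t \<epsilon> by (intro add_mono mult_left_mono mult_right_mono) auto
      finally have "(E * t) * (2 * a * (b - a)) \<le> \<epsilon> + t / \<epsilon> * (b - a)\<^sup>2" by simp
      moreover have "(E * (2 * t * a)) * (b - a) = (E * t) * (2 * a * (b - a))" by (simp only: mult_ac)
      ultimately show ?thesis by (simp only: E_def)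
    qed
    finally show ?thesis by (simp add: algebra_simps power2_commute)
  qed
  show ?thesis
  proof (cases "a \<le> b")
    case True
    then have "exp (- (t * b\<^sup>2)) \<le> exp (- (t * a\<^sup>2))" using t a by (simp add: mult_left_mono power_mono)
    then show ?thesis using main[OF a True] by simp
  next
    case False
    then have "exp (- (t * a\<^sup>2)) \<le> exp (- (t * b\<^sup>2))" using t b by (simp add: mult_left_mono power_mono)
    then show ?thesis using main[OF b, of a] False by (simp add: power2_commute)
  qed
qed

section \<open>Characteristic functions of sums of signed scores\<close>

lemma pole_law_prob_UNIV [simp]: "measure (pole_law \<mu>) UNIV = 1"
  using pole.prob_space[of \<mu>] by simp

text \<open>The third-order bound gives smallness, the second-order one domination by x^2; together
  they need second moments only, as in Lindeberg's proof.\<close>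

lemma cmod_iexp_remainder: "cmod (iexp x - (1 + \<i> * complex_of_real x - complex_of_real (x\<^sup>2 / 2))) \<le> x\<^sup>2 * min 1 \<bar>x\<bar>"
proof -
  have e: "(\<Sum>k\<le>2. (\<i> * complex_of_real x) ^ k / fact k) = 1 + \<i> * complex_of_real x - complex_of_real (x\<^sup>2 / 2)"
  proof -
    have "sum f {..2} = f 0 + f 1 + f 2" for f :: "nat \<Rightarrow> complex" by (simp add: numeral_2_eq_2)
    then show ?thesis by (simp add: power_mult_distrib)
  qed
  have 1: "cmod (iexp x - (1 + \<i> * complex_of_real x - complex_of_real (x\<^sup>2 / 2))) \<le> \<bar>x\<bar> ^ 3 / fact 3"
    using iexp_approx1[of x 2] unfolding e by (simp add: numeral_3_eq_3)
  have "\<bar>x\<bar> ^ 3 = x\<^sup>2 * \<bar>x\<bar>" by (simp add: power3_eq_cube power2_eq_square)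
  then have "\<bar>x\<bar> ^ 3 / fact 3 \<le> x\<^sup>2 * \<bar>x\<bar>" by (simp add: fact_numeral)
  moreover have "cmod (iexp x - (1 + \<i> * complex_of_real x - complex_of_real (x\<^sup>2 / 2))) \<le> x\<^sup>2"
    using iexp_approx2[of x 2] unfolding e by simp
  ultimately show ?thesis using 1 by (simp add: min_def)
qed

lemma iexp_measurable: "f \<in> borel_measurable M \<Longrightarrow> (\<lambda>x. iexp (f x)) \<in> borel_measurable M"
  by measurable

context rank_score
begin

lemma char_sum:
  assumes m: "0 < m"
  shows "(\<integral>x. iexp (a * (\<xi> \<bullet> (\<Sum>i<m. signed_score (x i)))) \<partial>pole_sample m \<mu>)
     = (\<integral>y. iexp (a * (\<xi> \<bullet> signed_score y)) \<partial>pole_law \<mu>) ^ m"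
proof -
  have [measurable]: "(\<lambda>y. iexp (a * (\<xi> \<bullet> signed_score y))) \<in> borel_measurable borel" by measurable
  have int: "integrable (pole_law \<mu>) (\<lambda>y. iexp (a * (\<xi> \<bullet> signed_score y)))"
    by (rule pole.integrable_const_bound[where B=1]) auto
  have "(\<integral>x. iexp (a * (\<xi> \<bullet> (\<Sum>i<m. signed_score (x i)))) \<partial>pole_sample m \<mu>)
      = (\<integral>x. (\<Prod>i<m. iexp (a * (\<xi> \<bullet> signed_score (x i)))) \<partial>pole_sample m \<mu>)"
    by (simp add: exp_sum[symmetric] inner_sum_right sum_distrib_left)
  also have "\<dots> = (\<Prod>i<m. \<integral>x. iexp (a * (\<xi> \<bullet> signed_score (x i))) \<partial>pole_sample m \<mu>)"
  proof (rule pole_sample.indep_vars_lebesgue_integral)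
    show "pole_sample.indep_vars m \<mu> (\<lambda>_. borel) (\<lambda>i x. iexp (a * (\<xi> \<bullet> signed_score (x i)))) {..<m}"
      using pole_sample_indep[of "\<lambda>y. iexp (a * (\<xi> \<bullet> signed_score y))" m \<mu>] m by simp
    show "integrable (pole_sample m \<mu>) (\<lambda>x. iexp (a * (\<xi> \<bullet> signed_score (x i))))" if "i \<in> {..<m}" for i
      using that int by (subst pole_sample_integral_component(2)[of i m "\<lambda>y. iexp (a * (\<xi> \<bullet> signed_score y))"]) auto
  qed simp
  also have "\<dots> = (\<Prod>i<m. \<integral>y. iexp (a * (\<xi> \<bullet> signed_score y)) \<partial>pole_law \<mu>)"
    by (intro prod.cong refl pole_sample_integral_component(1)[of _ m "\<lambda>y. iexp (a * (\<xi> \<bullet> signed_score y))"]) auto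
  finally show ?thesis by simp
qed

definition rank_sum :: "nat \<Rightarrow> (nat \<Rightarrow> real^2) \<Rightarrow> complex" where
  "rank_sum m x = (\<Sum>i<m. complex_of_real (sgn (x i $ 1)) * line_score J m x i)"

lemma rank_sum_diff: "rank_sum m x - (\<Sum>i<m. signed_score (x i)) = (\<Sum>i<m. complex_of_real (sgn (x i $ 1)) * (line_score J m x i - limit_score (x i)))"
  unfolding rank_sum_def signed_score_def by (simp add: sum_subtractf right_diff_distrib)

lemma measurable_rank_sum: "rank_sum m \<in> borel_measurable (pole_sample m \<nu>)"
proof -
  have "(\<lambda>x. complex_of_real (sgn (x i $ 1))) \<in> borel_measurable (pole_sample m \<nu>)" if "i < m" for i
    by (rule measurable_compose[OF pole_sample_component[OF that]]) simp
  then show ?thesis unfolding rank_sum_def[abs_def]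
    by (intro borel_measurable_sum borel_measurable_times measurable_line_score pole_sample_component) auto
qed

lemma measurable_linear_sum: "(\<lambda>x. \<Sum>i<m. signed_score (x i)) \<in> borel_measurable (pole_sample m \<nu>)"
  by (intro borel_measurable_sum measurable_compose[OF pole_sample_component measurable_signed_score]) auto

text \<open>The differences of line and limit scores are even in every coordinate, so
  \<open>signed_sum_second_moment\<close> applies to them.\<close>

lemma rank_sum_approx:
  shows "integrable (pole_sample m \<nu>) (\<lambda>x. (cmod (rank_sum m x - (\<Sum>i<m. signed_score (x i))))\<^sup>2)"
    and "(\<integral>x. (cmod (rank_sum m x - (\<Sum>i<m. signed_score (x i))))\<^sup>2 \<partial>pole_sample m \<nu>)
       \<le> (1 + real m * (flip_bound \<nu>)\<^sup>2) * (real m * score_error m \<nu>)"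
proof -
  let ?d = "\<lambda>i x. line_score J m x i - limit_score (x i)"
  have ev: "even_at j (?d i)" for i j
  proof -
    have "limit_score ((x(j := - x j)) i) = limit_score (x i)" for x :: "nat \<Rightarrow> real^2"
      by (simp add: limit_score_uminus)
    then show ?thesis using even_at_line_score[of j J m i] by (simp add: even_at_def)
  qed
  note b = signed_sum_second_moment[of m ?d \<nu>, OF measurable_score_diff integrable_score_diff ev]
  show "integrable (pole_sample m \<nu>) (\<lambda>x. (cmod (rank_sum m x - (\<Sum>i<m. signed_score (x i))))\<^sup>2)"
    unfolding rank_sum_diff by (rule b(2))
  have "(\<Sum>i<m. \<integral>x. (cmod (?d i x))\<^sup>2 \<partial>pole_sample m \<nu>) = real m * score_error m \<nu>"
    by (cases "m = 0") (simp_all add: score_error_def)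
  then show "(\<integral>x. (cmod (rank_sum m x - (\<Sum>i<m. signed_score (x i))))\<^sup>2 \<partial>pole_sample m \<nu>)
       \<le> (1 + real m * (flip_bound \<nu>)\<^sup>2) * (real m * score_error m \<nu>)"
    unfolding rank_sum_diff using b(1) by simp
qed

end

locale local_shift = rank_score +
  fixes n :: "nat \<Rightarrow> nat" and s :: "nat \<Rightarrow> real" and e :: "real^2"
  assumes n: "filterlim n at_top sequentially" and s: "s \<longlonglongrightarrow> 0" and s_nonneg: "\<And>k. 0 \<le> s k" and e: "norm e = 1"
begin

abbreviation \<mu> :: "nat \<Rightarrow> real^2" where "\<mu> k \<equiv> s k *\<^sub>R e"

lemma mu_tendsto: "\<mu> \<longlonglongrightarrow> 0"
  using tendsto_scaleR[OF s tendsto_const[of e]] by simp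

lemma eventually_n_pos: "\<forall>\<^sub>F k in sequentially. 0 < n k"
  by (rule eventually_compose_filterlim[OF eventually_gt_at_top n])

lemma n_real: "filterlim (\<lambda>k. real (n k)) at_top sequentially"
  by (rule filterlim_compose[OF filterlim_real_sequentially n])

lemma mean_eq: "(\<integral>y. \<xi> \<bullet> signed_score y \<partial>pole_law (\<mu> k)) = s k * (\<integral>y. (\<xi> \<bullet> signed_score y) * shift_score e (s k) y \<partial>pole_law 0)"
  by (rule integral_shift[OF _ integrable_inner integral_inner_null e]) simp

lemma mean_tendsto: "(\<lambda>k. \<integral>y. (\<xi> \<bullet> signed_score y) * shift_score e (s k) y \<partial>pole_law 0) \<longlonglongrightarrow> cross_moment / 2 * (\<xi> \<bullet> complex_of_vec e)"
  using integral_shift_tendsto[OF _ integrable_inner integral_inner_null e s s_nonneg, of \<xi>]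
  by (simp add: integral_inner_shift_score[OF e])

lemma local_filterlim: "filterlim (\<lambda>k. (n k, \<mu> k)) local_filter sequentially"
  by (intro filterlim_Pair n mu_tendsto)

lemma error_tendsto: "(\<lambda>k. score_error (n k) (\<mu> k)) \<longlonglongrightarrow> 0"
  using filterlim_compose[OF score_error_tendsto local_filterlim] by simp

text \<open>\<open>ratio_bound_linear\<close> at 2 s gives 16 s, and \<open>flip_bound\<close> takes
  half of it.\<close>

lemma flip_bound_le: "\<forall>\<^sub>F k in sequentially. flip_bound (\<mu> k) \<le> 8 * s k"
proof -
  have "\<forall>\<^sub>F k in sequentially. s k < 1 / 2" by (rule order_tendstoD(2)[OF s]) simp
  then show ?thesis
  proof eventually_elim
    case (elim k)
    then show ?case using ratio_bound_linear[of "2 * s k"] s_nonneg[of k] e by (simp add: flip_bound_def)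
  qed
qed

text \<open>By a second-order expansion n (g - 1) tends to the exponent: the mean of the summand, of
  order of the shift, gives the drift term, and half its second moment gives the quadratic
  term.\<close>

lemma char_limit:
  assumes h: "(\<lambda>k. sqrt (real (n k)) * s k) \<longlonglongrightarrow> h"
  shows "(\<lambda>k. (\<integral>y. iexp (1 / sqrt (real (n k)) * (\<xi> \<bullet> signed_score y)) \<partial>pole_law (\<mu> k)) ^ n k)
     \<longlonglongrightarrow> exp (\<i> * complex_of_real (h * cross_moment / 2 * (\<xi> \<bullet> complex_of_vec e)) - complex_of_real (second_moment / 4 * (cmod \<xi>)\<^sup>2))"
proof (rule power_tendsto_exp[OF _ n])
  define W where "W y = \<xi> \<bullet> signed_score y" for y
  have [measurable]: "W \<in> borel_measurable borel" unfolding W_def[abs_def] by measurable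
  have iW: "integrable (pole_law 0) W" unfolding W_def[abs_def] by (rule integrable_inner)
  have iW2: "integrable (pole_law 0) (\<lambda>y. (W y)\<^sup>2)" unfolding W_def by (rule integral_inner_sq(1))
  have s2: "0 \<le> second_moment" unfolding second_moment_def by simp
  have int: "integrable (pole_law \<nu>) (\<lambda>y. iexp (a * W y))" for \<nu> a
    by (rule pole.integrable_const_bound[where B=1]) auto
  show "cmod (\<integral>y. iexp (1 / sqrt (real (n k)) * (\<xi> \<bullet> signed_score y)) \<partial>pole_law (\<mu> k)) \<le> 1" for k
  proof -
    have "cmod (\<integral>y. iexp (1 / sqrt (real (n k)) * W y) \<partial>pole_law (\<mu> k)) \<le> (\<integral>y. cmod (iexp (1 / sqrt (real (n k)) * W y)) \<partial>pole_law (\<mu> k))"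
      by (rule integral_norm_bound)
    then show ?thesis by (simp add: W_def pole.prob_space)
  qed
  show "Re (\<i> * complex_of_real (h * cross_moment / 2 * (\<xi> \<bullet> complex_of_vec e)) - complex_of_real (second_moment / 4 * (cmod \<xi>)\<^sup>2)) \<le> 0"
    using s2 by simp
  define a where "a k = 1 / sqrt (real (n k))" for k
  define R where "R k y = iexp (a k * W y) - (1 + \<i> * complex_of_real (a k * W y) - complex_of_real ((a k * W y)\<^sup>2 / 2))" for k y
  have [measurable]: "R k \<in> borel_measurable borel" for k unfolding R_def[abs_def] by measurable
  \<comment> \<open>This function bounds n times the modulus of the remainder, tends to 0 pointwise
    and is dominated by the integrable square of W.\<close>
  define \<rho> where "\<rho> k y = (W y)\<^sup>2 * min 1 (a k * \<bar>W y\<bar>)" for k y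
  have a0: "0 \<le> a k" for k by (simp add: a_def)
  have alim: "a \<longlonglongrightarrow> 0"
  proof -
    have "filterlim (\<lambda>k. sqrt (real (n k))) at_top sequentially" by (rule filterlim_compose[OF sqrt_at_top n_real])
    then show ?thesis unfolding a_def[abs_def] by (rule real_tendsto_divide_at_top[OF tendsto_const])
  qed
  have \<rho>_le: "0 \<le> \<rho> k y" "\<rho> k y \<le> (W y)\<^sup>2" for k y
    using a0[of k] by (auto simp: \<rho>_def intro!: mult_nonneg_nonneg mult_left_le)
  have [measurable]: "\<rho> k \<in> borel_measurable borel" for k unfolding \<rho>_def[abs_def] by measurable
  have i\<rho>: "integrable (pole_law 0) (\<rho> k)" for k
    by (rule Bochner_Integration.integrable_bound[OF iW2]) (use \<rho>_le in \<open>auto intro!: AE_I2\<close>)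
  have \<rho>lim: "(\<lambda>k. \<integral>y. \<rho> k y \<partial>pole_law 0) \<longlonglongrightarrow> (\<integral>y. 0 \<partial>pole_law 0)"
  proof (rule integral_dominated_convergence[OF _ _ iW2])
    show "AE y in pole_law 0. (\<lambda>k. \<rho> k y) \<longlonglongrightarrow> 0"
    proof (rule AE_I2)
      fix y
      have "(\<lambda>k. (W y)\<^sup>2 * min 1 (a k * \<bar>W y\<bar>)) \<longlonglongrightarrow> (W y)\<^sup>2 * min 1 (0 * \<bar>W y\<bar>)"
        by (intro tendsto_intros alim)
      then show "(\<lambda>k. \<rho> k y) \<longlonglongrightarrow> 0" by (simp add: \<rho>_def)
    qed
    show "AE y in pole_law 0. norm (\<rho> k y) \<le> (W y)\<^sup>2" for k using \<rho>_le by (intro AE_I2) auto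
  qed simp_all
  have Rle: "real (n k) * cmod (R k y) \<le> \<rho> k y" if "0 < n k" for k y
  proof -
    have "cmod (R k y) \<le> (a k * W y)\<^sup>2 * min 1 \<bar>a k * W y\<bar>" unfolding R_def by (rule cmod_iexp_remainder)
    then have "real (n k) * cmod (R k y) \<le> real (n k) * ((a k * W y)\<^sup>2 * min 1 \<bar>a k * W y\<bar>)" by (intro mult_left_mono) auto
    also have "\<dots> = \<rho> k y" using that by (simp add: \<rho>_def a_def power_mult_distrib power_divide abs_mult)
    finally show ?thesis .
  qed
  have rem: "(\<lambda>k. of_nat (n k) * (\<integral>y. R k y \<partial>pole_law (\<mu> k))) \<longlonglongrightarrow> 0"
  proof (rule Lim_null_comparison)
    show "\<forall>\<^sub>F k in sequentially. norm (of_nat (n k) * (\<integral>y. R k y \<partial>pole_law (\<mu> k))) \<le> ratio_bound (norm (\<mu> k)) * (\<integral>y. \<rho> k y \<partial>pole_law 0)"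
      using eventually_n_pos
    proof eventually_elim
      case (elim k)
      have i1: "integrable (pole_law (\<mu> k)) (\<rho> k)" by (rule integrable_pole_law[OF _ i\<rho>]) simp
      have i2: "integrable (pole_law (\<mu> k)) (\<lambda>y. real (n k) * cmod (R k y))"
        by (rule Bochner_Integration.integrable_bound[OF i1]) (use Rle[OF elim] \<rho>_le in \<open>auto intro!: AE_I2\<close>)
      have "norm (of_nat (n k) * (\<integral>y. R k y \<partial>pole_law (\<mu> k))) \<le> real (n k) * (\<integral>y. cmod (R k y) \<partial>pole_law (\<mu> k))"
        unfolding norm_mult norm_of_nat by (intro mult_left_mono integral_norm_bound) auto
      also have "\<dots> = (\<integral>y. real (n k) * cmod (R k y) \<partial>pole_law (\<mu> k))" by simp
      also have "\<dots> \<le> (\<integral>y. \<rho> k y \<partial>pole_law (\<mu> k))" by (intro integral_mono i1 i2 Rle elim)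
      also have "\<dots> \<le> ratio_bound (norm (\<mu> k)) * (\<integral>y. \<rho> k y \<partial>pole_law 0)"
        by (rule integral_pole_law_le[OF _ i\<rho>]) (use \<rho>_le in auto)
      finally show ?case .
    qed
    have "(\<lambda>k. ratio_bound (norm (\<mu> k)) * (\<integral>y. \<rho> k y \<partial>pole_law 0)) \<longlonglongrightarrow> 1 * (\<integral>y. 0 \<partial>pole_law 0)"
      by (intro tendsto_mult \<rho>lim filterlim_compose[OF tendsto_ratio_bound mu_tendsto])
    then show "(\<lambda>k. ratio_bound (norm (\<mu> k)) * (\<integral>y. \<rho> k y \<partial>pole_law 0)) \<longlonglongrightarrow> 0" by simp
  qed
  \<comment> \<open>The mean is s times a convergent factor, so sqrt n times the mean has a finite
    limit.\<close>
  have m1: "(\<lambda>k. sqrt (real (n k)) * (\<integral>y. W y \<partial>pole_law (\<mu> k))) \<longlonglongrightarrow> h * (cross_moment / 2 * (\<xi> \<bullet> complex_of_vec e))"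
    using tendsto_mult[OF h mean_tendsto[of \<xi>]] unfolding W_def mean_eq by (simp add: mult.assoc)
  have m2: "(\<lambda>k. \<integral>y. (W y)\<^sup>2 \<partial>pole_law (\<mu> k)) \<longlonglongrightarrow> second_moment / 2 * (cmod \<xi>)\<^sup>2"
    using tendsto_integral_pole_law[OF _ iW2 mu_tendsto] by (simp add: W_def integral_inner_sq(2))
  have "(\<lambda>k. of_nat (n k) * (\<integral>y. R k y \<partial>pole_law (\<mu> k)) + \<i> * complex_of_real (sqrt (real (n k)) * (\<integral>y. W y \<partial>pole_law (\<mu> k)))
      - complex_of_real ((\<integral>y. (W y)\<^sup>2 \<partial>pole_law (\<mu> k)) / 2)) \<longlonglongrightarrow>
      0 + \<i> * complex_of_real (h * (cross_moment / 2 * (\<xi> \<bullet> complex_of_vec e))) - complex_of_real ((second_moment / 2 * (cmod \<xi>)\<^sup>2) / 2)"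
    by (intro tendsto_intros rem m1 m2) auto
  then have lim: "(\<lambda>k. of_nat (n k) * (\<integral>y. R k y \<partial>pole_law (\<mu> k)) + \<i> * complex_of_real (sqrt (real (n k)) * (\<integral>y. W y \<partial>pole_law (\<mu> k)))
      - complex_of_real ((\<integral>y. (W y)\<^sup>2 \<partial>pole_law (\<mu> k)) / 2)) \<longlonglongrightarrow>
      \<i> * complex_of_real (h * cross_moment / 2 * (\<xi> \<bullet> complex_of_vec e)) - complex_of_real (second_moment / 4 * (cmod \<xi>)\<^sup>2)"
    by (simp only: add_0_left times_divide_eq_right times_divide_eq_left mult.assoc divide_divide_eq_left numeral_times_numeral semiring_norm)
  show "(\<lambda>k. of_nat (n k) * ((\<integral>y. iexp (1 / sqrt (real (n k)) * (\<xi> \<bullet> signed_score y)) \<partial>pole_law (\<mu> k)) - 1)) \<longlonglongrightarrow>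
     \<i> * complex_of_real (h * cross_moment / 2 * (\<xi> \<bullet> complex_of_vec e)) - complex_of_real (second_moment / 4 * (cmod \<xi>)\<^sup>2)"
  proof (rule Lim_transform_eventually[OF lim])
    show "\<forall>\<^sub>F k in sequentially. of_nat (n k) * (\<integral>y. R k y \<partial>pole_law (\<mu> k)) + \<i> * complex_of_real (sqrt (real (n k)) * (\<integral>y. W y \<partial>pole_law (\<mu> k)))
      - complex_of_real ((\<integral>y. (W y)\<^sup>2 \<partial>pole_law (\<mu> k)) / 2) = of_nat (n k) * ((\<integral>y. iexp (1 / sqrt (real (n k)) * (\<xi> \<bullet> signed_score y)) \<partial>pole_law (\<mu> k)) - 1)"
      using eventually_n_pos
    proof eventually_elim
      case (elim k)
      let ?P = "pole_law (\<mu> k)"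
      have jW: "integrable ?P W" by (rule integrable_pole_law[OF _ iW]) simp
      have jW2: "integrable ?P (\<lambda>y. (W y)\<^sup>2)" by (rule integrable_pole_law[OF _ iW2]) simp
      have j1: "integrable ?P (\<lambda>y. \<i> * complex_of_real (a k * W y))"
        using jW by (intro integrable_mult_right integrable_of_real)
      have j2: "integrable ?P (\<lambda>y. complex_of_real ((a k * W y)\<^sup>2 / 2))"
        using jW2 by (intro integrable_of_real) (simp add: power_mult_distrib)
      have R: "(\<integral>y. R k y \<partial>?P) = (\<integral>y. iexp (a k * W y) \<partial>?P) - (1 + \<i> * complex_of_real (a k * (\<integral>y. W y \<partial>?P)) - complex_of_real ((a k)\<^sup>2 * (\<integral>y. (W y)\<^sup>2 \<partial>?P) / 2))"
      proof -
        have "(\<integral>y. R k y \<partial>?P) = (\<integral>y. iexp (a k * W y) \<partial>?P) - (\<integral>y. (1 + \<i> * complex_of_real (a k * W y) - complex_of_real ((a k * W y)\<^sup>2 / 2)) \<partial>?P)"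
          unfolding R_def using j1 j2 by (intro Bochner_Integration.integral_diff int Bochner_Integration.integrable_diff Bochner_Integration.integrable_add) auto
        also have "(\<integral>y. (1 + \<i> * complex_of_real (a k * W y) - complex_of_real ((a k * W y)\<^sup>2 / 2)) \<partial>?P)
          = (\<integral>y. 1 + \<i> * complex_of_real (a k * W y) \<partial>?P) - (\<integral>y. complex_of_real ((a k * W y)\<^sup>2 / 2) \<partial>?P)"
          using j1 j2 by (intro Bochner_Integration.integral_diff Bochner_Integration.integrable_add) auto
        also have "(\<integral>y. 1 + \<i> * complex_of_real (a k * W y) \<partial>?P) = 1 + (\<integral>y. \<i> * complex_of_real (a k * W y) \<partial>?P)"
          using j1 by (subst Bochner_Integration.integral_add) (auto simp: pole.prob_space)
        also have "(\<integral>y. \<i> * complex_of_real (a k * W y) \<partial>?P) = \<i> * complex_of_real (a k * (\<integral>y. W y \<partial>?P))"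
          by (simp only: integral_mult_right_zero integral_complex_of_real)
        also have "(\<integral>y. complex_of_real ((a k * W y)\<^sup>2 / 2) \<partial>?P) = complex_of_real ((a k)\<^sup>2 * (\<integral>y. (W y)\<^sup>2 \<partial>?P) / 2)"
          unfolding integral_complex_of_real power_mult_distrib by simp
        finally show ?thesis .
      qed
      have f1: "of_nat (n k) * (complex_of_real (a k * w)) = complex_of_real (sqrt (real (n k)) * w)" for w
      proof -
        have "real (n k) / sqrt (real (n k)) = sqrt (real (n k))" by (rule real_div_sqrt) simp
        then have "real (n k) * (a k * w) = sqrt (real (n k)) * w"
          unfolding a_def by (metis mult.assoc times_divide_eq_right mult.right_neutral)
        then show ?thesis by (metis of_real_mult of_real_of_nat_eq)
      qed
      have f2: "of_nat (n k) * complex_of_real ((a k)\<^sup>2 * w / 2) = complex_of_real (w / 2)" for w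
        using elim by (simp add: a_def power_divide)
      have d: "N * (F - 1) = N * I + \<i> * (N * x) - N * y" if "I = F - (1 + \<i> * x - y)" for N F I x y :: complex
        unfolding that by (simp add: algebra_simps)
      show ?case unfolding W_def[symmetric] a_def[symmetric] d[OF R] f1 f2 ..
    qed
  qed
qed

text \<open>Fubini moves the Gaussian frequency outside. For each frequency the characteristic
  function converges by \<open>char_limit\<close>, and all of them are bounded by 1.\<close>

lemma laplace_linear:
  assumes h: "(\<lambda>k. sqrt (real (n k)) * s k) \<longlonglongrightarrow> h" and t: "0 \<le> t"
  shows "(\<lambda>k. \<integral>x. exp (- (t * (cmod (\<Sum>i<n k. signed_score (x i)) / sqrt (real (n k)))\<^sup>2)) \<partial>pole_sample (n k) (\<mu> k))
    \<longlonglongrightarrow> exp (- (t * (h * cross_moment / 2)\<^sup>2 / (1 + t * second_moment))) / (1 + t * second_moment)"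
proof -
  define c where "c = h * cross_moment / 2"
  define T where "T k x = (\<Sum>i<n k. signed_score (x i))" for k and x :: "nat \<Rightarrow> real^2"
  define b where "b = sqrt (2 * t)"
  define \<Phi> where "\<Phi> k p = (\<integral>y. iexp (1 / sqrt (real (n k)) * ((b *\<^sub>R complex_of_pair p) \<bullet> signed_score y)) \<partial>pole_law (\<mu> k)) ^ n k" for k p
  define \<Phi>' where "\<Phi>' p = exp (\<i> * complex_of_real (c * ((b *\<^sub>R complex_of_pair p) \<bullet> complex_of_vec e)) - complex_of_real (second_moment / 4 * (cmod (b *\<^sub>R complex_of_pair p))\<^sup>2))" for p
  have s2: "0 \<le> second_moment" unfolding second_moment_def by simp
  have Tm: "T k \<in> borel_measurable (pole_sample (n k) (\<mu> k))" for k
    unfolding T_def[abs_def] by (intro borel_measurable_sum measurable_compose[OF pole_sample_component measurable_signed_score]) auto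
  have eq: "complex_of_real (\<integral>x. exp (- (t * (cmod (T k x) / sqrt (real (n k)))\<^sup>2)) \<partial>pole_sample (n k) (\<mu> k)) = (\<integral>p. \<Phi> k p \<partial>std_normal2)"
    if nk: "0 < n k" for k
  proof -
    let ?M = "pole_sample (n k) (\<mu> k)"
    interpret pr: pair_prob_space ?M std_normal2 ..
    define G where "G x p = iexp (1 / sqrt (real (n k)) * ((b *\<^sub>R complex_of_pair p) \<bullet> T k x))" for x p
    have Gm: "case_prod G \<in> borel_measurable (?M \<Otimes>\<^sub>M std_normal2)"
    proof -
      have "(\<lambda>q. T k (fst q)) \<in> borel_measurable (?M \<Otimes>\<^sub>M std_normal2)"
        by (rule measurable_compose[OF measurable_fst Tm])
      moreover have "(\<lambda>q. complex_of_pair (snd q)) \<in> borel_measurable (?M \<Otimes>\<^sub>M std_normal2)"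
        by (rule measurable_compose[OF measurable_snd]) measurable
      ultimately have "(\<lambda>q. iexp (1 / sqrt (real (n k)) * ((b *\<^sub>R complex_of_pair (snd q)) \<bullet> T k (fst q)))) \<in> borel_measurable (?M \<Otimes>\<^sub>M std_normal2)"
        by (intro iexp_measurable borel_measurable_times borel_measurable_inner borel_measurable_scaleR borel_measurable_const)
      then show ?thesis by (simp add: G_def case_prod_unfold)
    qed
    have Gi: "integrable (?M \<Otimes>\<^sub>M std_normal2) (case_prod G)"
      by (rule pr.integrable_const_bound[where B=1]) (auto simp: G_def Gm)
    have "complex_of_real (\<integral>x. exp (- (t * (cmod (T k x) / sqrt (real (n k)))\<^sup>2)) \<partial>?M)
       = (\<integral>x. complex_of_real (exp (- (t * (cmod ((1 / sqrt (real (n k))) *\<^sub>R T k x))\<^sup>2))) \<partial>?M)"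
      unfolding integral_complex_of_real by (simp add: norm_divide)
    also have "\<dots> = (\<integral>x. (\<integral>p. G x p \<partial>std_normal2) \<partial>?M)"
      unfolding exp_norm_sq_linearize[OF t] G_def b_def inner_scaleR_right inner_scaleR_left by (simp only: mult.left_commute)
    also have "\<dots> = (\<integral>p. (\<integral>x. G x p \<partial>?M) \<partial>std_normal2)"
      by (rule pr.Fubini_integral[OF Gi, symmetric])
    also have "\<dots> = (\<integral>p. \<Phi> k p \<partial>std_normal2)"
      unfolding G_def \<Phi>_def T_def by (simp only: char_sum[OF nk])
    finally show ?thesis .
  qed
  have \<Phi>1: "cmod (\<Phi> k p) \<le> 1" for k p
  proof -
    let ?F = "\<lambda>y. iexp (1 / sqrt (real (n k)) * ((b *\<^sub>R complex_of_pair p) \<bullet> signed_score y))"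
    have "cmod (\<integral>y. ?F y \<partial>pole_law (\<mu> k)) \<le> (\<integral>y. cmod (?F y) \<partial>pole_law (\<mu> k))" by (rule integral_norm_bound)
    also have "\<dots> = 1" unfolding norm_exp_i_times by (simp add: pole.prob_space)
    finally show ?thesis unfolding \<Phi>_def norm_power by (intro power_le_one) auto
  qed
  have \<Phi>m: "\<Phi> k \<in> borel_measurable std_normal2" for k
  proof -
    have "(\<lambda>q. iexp (1 / sqrt (real (n k)) * ((b *\<^sub>R complex_of_pair (fst q)) \<bullet> signed_score (snd q)))) \<in> borel_measurable (std_normal2 \<Otimes>\<^sub>M pole_law (\<mu> k))"
    proof (intro iexp_measurable borel_measurable_times borel_measurable_inner borel_measurable_scaleR borel_measurable_const)
      show "(\<lambda>q. complex_of_pair (fst q)) \<in> borel_measurable (std_normal2 \<Otimes>\<^sub>M pole_law (\<mu> k))"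
        by (rule measurable_compose[OF measurable_fst]) measurable
      show "(\<lambda>q. signed_score (snd q)) \<in> borel_measurable (std_normal2 \<Otimes>\<^sub>M pole_law (\<mu> k))"
        by (rule measurable_compose[OF measurable_snd]) measurable
    qed
    then have "case_prod (\<lambda>p y. iexp (1 / sqrt (real (n k)) * ((b *\<^sub>R complex_of_pair p) \<bullet> signed_score y))) \<in> borel_measurable (std_normal2 \<Otimes>\<^sub>M pole_law (\<mu> k))"
      by (simp add: case_prod_unfold)
    then have "(\<lambda>p. \<integral>y. iexp (1 / sqrt (real (n k)) * ((b *\<^sub>R complex_of_pair p) \<bullet> signed_score y)) \<partial>pole_law (\<mu> k)) \<in> borel_measurable std_normal2"
      by (rule pole.borel_measurable_lebesgue_integral)
    then show ?thesis unfolding \<Phi>_def[abs_def] by (rule borel_measurable_power)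
  qed
  have \<Phi>'m: "\<Phi>' \<in> borel_measurable std_normal2"
    unfolding \<Phi>'_def[abs_def] inner_complex_def by measurable
  have "(\<lambda>k. \<integral>p. \<Phi> k p \<partial>std_normal2) \<longlonglongrightarrow> (\<integral>p. \<Phi>' p \<partial>std_normal2)"
  proof (rule integral_dominated_convergence[where w="\<lambda>_. 1", OF \<Phi>'m \<Phi>m])
    show "AE p in std_normal2. (\<lambda>k. \<Phi> k p) \<longlonglongrightarrow> \<Phi>' p"
      unfolding \<Phi>_def \<Phi>'_def c_def by (intro AE_I2 char_limit h)
    show "AE p in std_normal2. norm (\<Phi> k p) \<le> 1" for k using \<Phi>1 by (intro AE_I2)
  qed simp
  moreover have "\<forall>\<^sub>F k in sequentially. (\<integral>p. \<Phi> k p \<partial>std_normal2) = complex_of_real (\<integral>x. exp (- (t * (cmod (T k x) / sqrt (real (n k)))\<^sup>2)) \<partial>pole_sample (n k) (\<mu> k))"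
    using eventually_n_pos by eventually_elim (simp only: eq)
  ultimately have "(\<lambda>k. complex_of_real (\<integral>x. exp (- (t * (cmod (T k x) / sqrt (real (n k)))\<^sup>2)) \<partial>pole_sample (n k) (\<mu> k))) \<longlonglongrightarrow> (\<integral>p. \<Phi>' p \<partial>std_normal2)"
    by (rule Lim_transform_eventually)
  also have "(\<integral>p. \<Phi>' p \<partial>std_normal2) = complex_of_real (exp (- (t * c\<^sup>2 / (1 + t * second_moment))) / (1 + t * second_moment))"
    unfolding \<Phi>'_def b_def by (rule integral_gauss2_limit[OF t s2]) (simp add: cmod_complex_of_vec e)
  finally show ?thesis unfolding T_def c_def by (simp only: tendsto_of_real_iff)
qed

text \<open>By \<open>exp_neg_sq_diff\<close> the transforms of the rank sum and of the sum of
  independent terms differ by \<epsilon> plus a multiple of the mean-square error per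
  observation.\<close>

lemma laplace_rank:
  assumes h: "(\<lambda>k. sqrt (real (n k)) * s k) \<longlonglongrightarrow> h" and t: "0 \<le> t"
  shows "(\<lambda>k. \<integral>x. exp (- (t * (cmod (rank_sum (n k) x) / sqrt (real (n k)))\<^sup>2)) \<partial>pole_sample (n k) (\<mu> k))
    \<longlonglongrightarrow> exp (- (t * (h * cross_moment / 2)\<^sup>2 / (1 + t * second_moment))) / (1 + t * second_moment)" (is "?S \<longlonglongrightarrow> ?L")
proof -
  define T where "T k x = (\<Sum>i<n k. signed_score (x i))" for k and x :: "nat \<Rightarrow> real^2"
  let ?T = "\<lambda>k. \<integral>x. exp (- (t * (cmod (T k x) / sqrt (real (n k)))\<^sup>2)) \<partial>pole_sample (n k) (\<mu> k)"
  have T: "?T \<longlonglongrightarrow> ?L" unfolding T_def by (rule laplace_linear[OF h t])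
  \<comment> \<open>The constant 64 is the square of the 8 in \<open>flip_bound_le\<close>. The
    first factor is bounded because sqrt n times the shift converges.\<close>
  define r where "r k = (1 + 64 * (sqrt (real (n k)) * s k)\<^sup>2) * score_error (n k) (\<mu> k)" for k
  have r0: "r \<longlonglongrightarrow> 0"
  proof -
    have "r \<longlonglongrightarrow> (1 + 64 * h\<^sup>2) * 0" unfolding r_def[abs_def] by (intro tendsto_intros h error_tendsto)
    then show ?thesis by simp
  qed
  have diff: "\<forall>\<^sub>F k in sequentially. \<bar>?S k - ?T k\<bar> \<le> \<epsilon> + (t / \<epsilon> + t) * r k" if \<epsilon>: "0 < \<epsilon>" for \<epsilon>
    using eventually_n_pos flip_bound_le
  proof eventually_elim
    case (elim k)
    let ?M = "pole_sample (n k) (\<mu> k)"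
    note [measurable] = measurable_rank_sum[of "n k" "\<mu> k"]
    have [measurable]: "T k \<in> borel_measurable ?M" unfolding T_def[abs_def] by (rule measurable_linear_sum)
    have nk: "0 < sqrt (real (n k))" using elim by simp
    have iS: "integrable ?M (\<lambda>x. exp (- (t * (cmod (rank_sum (n k) x) / sqrt (real (n k)))\<^sup>2)))"
      and iT: "integrable ?M (\<lambda>x. exp (- (t * (cmod (T k x) / sqrt (real (n k)))\<^sup>2)))"
      by (rule pole_sample.integrable_const_bound[where B=1]; use t in simp)+
    have iD: "integrable ?M (\<lambda>x. (cmod (rank_sum (n k) x - T k x))\<^sup>2)" unfolding T_def by (rule rank_sum_approx(1))
    have "\<bar>?S k - ?T k\<bar> = \<bar>\<integral>x. exp (- (t * (cmod (rank_sum (n k) x) / sqrt (real (n k)))\<^sup>2)) - exp (- (t * (cmod (T k x) / sqrt (real (n k)))\<^sup>2)) \<partial>?M\<bar>"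
      using iS iT by simp
    also have "\<dots> \<le> (\<integral>x. \<bar>exp (- (t * (cmod (rank_sum (n k) x) / sqrt (real (n k)))\<^sup>2)) - exp (- (t * (cmod (T k x) / sqrt (real (n k)))\<^sup>2))\<bar> \<partial>?M)"
      by (rule integral_abs_bound)
    also have "\<dots> \<le> (\<integral>x. \<epsilon> + (t / \<epsilon> + t) * ((cmod (rank_sum (n k) x - T k x))\<^sup>2 / real (n k)) \<partial>?M)"
    proof (rule integral_mono)
      show "integrable ?M (\<lambda>x. \<bar>exp (- (t * (cmod (rank_sum (n k) x) / sqrt (real (n k)))\<^sup>2)) - exp (- (t * (cmod (T k x) / sqrt (real (n k)))\<^sup>2))\<bar>)"
        using iS iT by (intro integrable_abs Bochner_Integration.integrable_diff)
      show "integrable ?M (\<lambda>x. \<epsilon> + (t / \<epsilon> + t) * ((cmod (rank_sum (n k) x - T k x))\<^sup>2 / real (n k)))"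
        using iD by simp
      fix x
      have "(cmod (rank_sum (n k) x) / sqrt (real (n k)) - cmod (T k x) / sqrt (real (n k)))\<^sup>2 \<le> (cmod (rank_sum (n k) x - T k x))\<^sup>2 / real (n k)"
      proof -
        have "\<bar>cmod (rank_sum (n k) x) - cmod (T k x)\<bar> \<le> cmod (rank_sum (n k) x - T k x)" by (rule norm_triangle_ineq3)
        then have "\<bar>cmod (rank_sum (n k) x) - cmod (T k x)\<bar>\<^sup>2 \<le> (cmod (rank_sum (n k) x - T k x))\<^sup>2" by (intro power_mono) auto
        then have "(cmod (rank_sum (n k) x) - cmod (T k x))\<^sup>2 / real (n k) \<le> (cmod (rank_sum (n k) x - T k x))\<^sup>2 / real (n k)"
          by (intro divide_right_mono) auto
        then show ?thesis by (simp add: diff_divide_distrib[symmetric] power_divide)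
      qed
      then have "(t / \<epsilon> + t) * (cmod (rank_sum (n k) x) / sqrt (real (n k)) - cmod (T k x) / sqrt (real (n k)))\<^sup>2
          \<le> (t / \<epsilon> + t) * ((cmod (rank_sum (n k) x - T k x))\<^sup>2 / real (n k))"
        using t \<epsilon> by (intro mult_left_mono) auto
      then show "\<bar>exp (- (t * (cmod (rank_sum (n k) x) / sqrt (real (n k)))\<^sup>2)) - exp (- (t * (cmod (T k x) / sqrt (real (n k)))\<^sup>2))\<bar>
        \<le> \<epsilon> + (t / \<epsilon> + t) * ((cmod (rank_sum (n k) x - T k x))\<^sup>2 / real (n k))"
        using exp_neg_sq_diff[OF t \<epsilon>, of "cmod (rank_sum (n k) x) / sqrt (real (n k))" "cmod (T k x) / sqrt (real (n k))"] nk by simp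
    qed
    also have "\<dots> = \<epsilon> + (t / \<epsilon> + t) * ((\<integral>x. (cmod (rank_sum (n k) x - T k x))\<^sup>2 \<partial>?M) / real (n k))"
      using iD by (simp add: pole_sample.prob_space)
    also have "\<dots> \<le> \<epsilon> + (t / \<epsilon> + t) * r k"
    proof (intro add_left_mono mult_left_mono)
      have "(\<integral>x. (cmod (rank_sum (n k) x - T k x))\<^sup>2 \<partial>?M) / real (n k) \<le> (1 + real (n k) * (flip_bound (\<mu> k))\<^sup>2) * score_error (n k) (\<mu> k)"
        using rank_sum_approx(2)[of "n k" "\<mu> k"] elim(1) unfolding T_def by (simp add: divide_le_eq mult_ac)
      also have "\<dots> \<le> r k"
      proof -
        have "(flip_bound (\<mu> k))\<^sup>2 \<le> (8 * s k)\<^sup>2" using elim(2) flip_bound_nonneg by (intro power_mono) auto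
        then have "real (n k) * (flip_bound (\<mu> k))\<^sup>2 \<le> real (n k) * (8 * s k)\<^sup>2" by (intro mult_left_mono) auto
        then have "1 + real (n k) * (flip_bound (\<mu> k))\<^sup>2 \<le> 1 + 64 * (sqrt (real (n k)) * s k)\<^sup>2" by (simp add: power_mult_distrib)
        then show ?thesis unfolding r_def by (intro mult_right_mono score_error_nonneg)
      qed
      finally show "(\<integral>x. (cmod (rank_sum (n k) x - T k x))\<^sup>2 \<partial>?M) / real (n k) \<le> r k" .
    qed (use t \<epsilon> in auto)
    finally show ?case .
  qed
  have "(\<lambda>k. ?S k - ?T k) \<longlonglongrightarrow> 0"
  proof (rule tendstoI)
    fix \<epsilon> :: real assume \<epsilon>: "0 < \<epsilon>"
    have "(\<lambda>k. \<epsilon> / 2 + (t / (\<epsilon> / 2) + t) * r k) \<longlonglongrightarrow> \<epsilon> / 2 + (t / (\<epsilon> / 2) + t) * 0"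
      by (intro tendsto_intros r0)
    then have "(\<lambda>k. \<epsilon> / 2 + (t / (\<epsilon> / 2) + t) * r k) \<longlonglongrightarrow> \<epsilon> / 2" by simp
    from order_tendstoD(2)[OF this, of \<epsilon>] have "\<forall>\<^sub>F k in sequentially. \<epsilon> / 2 + (t / (\<epsilon> / 2) + t) * r k < \<epsilon>"
      using \<epsilon> by simp
    moreover have "0 < \<epsilon> / 2" using \<epsilon> by simp
    note diff[OF this]
    ultimately show "\<forall>\<^sub>F k in sequentially. dist (?S k - ?T k) 0 < \<epsilon>"
    proof eventually_elim
      case (elim k)
      show ?case unfolding dist_real_def diff_0_right by (rule le_less_trans[OF elim(2,1)])
    qed
  qed
  from tendsto_add[OF this T] show ?thesis by simp
qed

end

section \<open>The power of the tests\<close>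

text \<open>Centred terms are uncorrelated by independence, and a variance is at most the second
  moment, which is the quantity known to converge along the shifts.\<close>

lemma sum_variance_le:
  fixes W :: "real^2 \<Rightarrow> real"
  assumes [measurable]: "W \<in> borel_measurable borel" and i1: "integrable (pole_law \<mu>) W" and i2: "integrable (pole_law \<mu>) (\<lambda>y. (W y)\<^sup>2)" and m: "0 < m"
  shows "integrable (pole_sample m \<mu>) (\<lambda>x. ((\<Sum>i<m. W (x i)) - real m * (\<integral>y. W y \<partial>pole_law \<mu>))\<^sup>2)"
    and "(\<integral>x. ((\<Sum>i<m. W (x i)) - real m * (\<integral>y. W y \<partial>pole_law \<mu>))\<^sup>2 \<partial>pole_sample m \<mu>) \<le> real m * (\<integral>y. (W y)\<^sup>2 \<partial>pole_law \<mu>)"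
proof -
  let ?M = "pole_sample m \<mu>" and ?L = "pole_law \<mu>"
  define V where "V y = W y - (\<integral>y. W y \<partial>?L)" for y
  have Vm [measurable]: "V \<in> borel_measurable borel" unfolding V_def[abs_def] by measurable
  have iV: "integrable ?L V" unfolding V_def[abs_def] using i1 by simp
  have V0: "(\<integral>y. V y \<partial>?L) = 0" unfolding V_def using i1 by (simp add: pole.prob_space)
  have e: "(V y)\<^sup>2 = (W y)\<^sup>2 - 2 * (\<integral>y. W y \<partial>?L) * W y + (\<integral>y. W y \<partial>?L)\<^sup>2" for y
    by (simp add: V_def power2_diff)
  have iV2: "integrable ?L (\<lambda>y. (V y)\<^sup>2)" unfolding e using i1 i2 by simp
  have V2: "(\<integral>y. (V y)\<^sup>2 \<partial>?L) \<le> (\<integral>y. (W y)\<^sup>2 \<partial>?L)"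
    unfolding e using i1 i2 by (simp add: pole.prob_space power2_eq_square)
  have c: "integrable ?M (\<lambda>x. V (x i) * V (x j)) \<and> (\<integral>x. V (x i) * V (x j) \<partial>?M) = (if i = j then (\<integral>y. (V y)\<^sup>2 \<partial>?L) else 0)"
    if i: "i < m" and j: "j < m" for i j
  proof (cases "i = j")
    case True
    then show ?thesis using pole_sample_integral_component[OF i, of "\<lambda>y. (V y)\<^sup>2" \<mu>] iV2 by (simp add: power2_eq_square)
  next
    case False
    have ind: "pole_sample.indep_vars m \<mu> (\<lambda>_. borel) (\<lambda>i x. V (x i)) {i, j}"
      by (rule pole_sample.indep_vars_subset[OF pole_sample_indep[OF Vm m]]) (use i j in auto)
    have int: "integrable ?M (\<lambda>x. V (x l))" if "l \<in> {i, j}" for l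
      using that i j iV pole_sample_integral_component(2)[OF _ Vm, of _ m \<mu>] by auto
    have "integrable ?M (\<lambda>x. \<Prod>l\<in>{i, j}. V (x l))" "(\<integral>x. (\<Prod>l\<in>{i, j}. V (x l)) \<partial>?M) = (\<Prod>l\<in>{i, j}. \<integral>x. V (x l) \<partial>?M)"
      using pole_sample.indep_vars_integrable[OF _ ind int] pole_sample.indep_vars_lebesgue_integral[OF _ ind int] by auto
    with False i show ?thesis by (simp add: pole_sample_integral_component(1)[OF i Vm] V0)
  qed
  have s: "(\<Sum>i<m. W (x i)) - real m * (\<integral>y. W y \<partial>?L) = (\<Sum>i<m. V (x i))" for x
    by (simp add: V_def sum_subtractf)
  have q: "((\<Sum>i<m. W (x i)) - real m * (\<integral>y. W y \<partial>?L))\<^sup>2 = (\<Sum>i<m. \<Sum>j<m. V (x i) * V (x j))" for x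
    unfolding s power2_eq_square sum_product ..
  show "integrable ?M (\<lambda>x. ((\<Sum>i<m. W (x i)) - real m * (\<integral>y. W y \<partial>?L))\<^sup>2)"
    unfolding q using c by (intro Bochner_Integration.integrable_sum) auto
  have "(\<integral>x. ((\<Sum>i<m. W (x i)) - real m * (\<integral>y. W y \<partial>?L))\<^sup>2 \<partial>?M) = (\<Sum>i<m. \<Sum>j<m. if i = j then (\<integral>y. (V y)\<^sup>2 \<partial>?L) else 0)"
  proof -
    have "(\<integral>x. (\<Sum>i<m. \<Sum>j<m. V (x i) * V (x j)) \<partial>?M) = (\<Sum>i<m. \<integral>x. (\<Sum>j<m. V (x i) * V (x j)) \<partial>?M)"
      using c by (intro Bochner_Integration.integral_sum Bochner_Integration.integrable_sum) auto
    also have "\<dots> = (\<Sum>i<m. \<Sum>j<m. \<integral>x. V (x i) * V (x j) \<partial>?M)"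
      using c by (intro sum.cong refl Bochner_Integration.integral_sum) auto
    also have "\<dots> = (\<Sum>i<m. \<Sum>j<m. if i = j then (\<integral>y. (V y)\<^sup>2 \<partial>?L) else 0)"
      using c by (intro sum.cong refl) auto
    finally show ?thesis unfolding q .
  qed
  also have "\<dots> = real m * (\<integral>y. (V y)\<^sup>2 \<partial>?L)" by simp
  also have "\<dots> \<le> real m * (\<integral>y. (W y)\<^sup>2 \<partial>?L)" using V2 by (intro mult_left_mono) auto
  finally show "(\<integral>x. ((\<Sum>i<m. W (x i)) - real m * (\<integral>y. W y \<partial>?L))\<^sup>2 \<partial>?M) \<le> real m * (\<integral>y. (W y)\<^sup>2 \<partial>?L)" .
qed

text \<open>\<open>score f\<close> is meaningful only inside the unit interval, where the rank
  arguments lie and the uniform law lives. J is a version of it that is nonnegative everywhere and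
  satisfies the growth condition.\<close>

locale score_test = rank_score +
  fixes f :: "real \<Rightarrow> real"
  assumes measurable_score: "score f \<in> borel_measurable borel"
    and score_eq: "\<And>u. 0 < u \<Longrightarrow> u < 1 \<Longrightarrow> score f u = J u"
    and second_moment_pos: "0 < second_moment" and cross_moment_pos: "0 < cross_moment"
begin

lemma score_second_moment: "score_second_moment f = second_moment"
  unfolding score_second_moment_def second_moment_def
proof (rule integral_cong_AE)
  show "AE u in unif. (score f u)\<^sup>2 = (J u)\<^sup>2"
    using AE_unif by eventually_elim (simp add: score_eq)
  show "(\<lambda>u. (score f u)\<^sup>2) \<in> borel_measurable unif" using measurable_score by measurable
  show "(\<lambda>u. (J u)\<^sup>2) \<in> borel_measurable unif" by measurable
qed

lemma line_score_eq: "i < m \<Longrightarrow> line_score (score f) m x i = line_score J m x i"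
  using pm_rank_pos[of i m x] pm_rank_le[of m x i] by (simp add: line_score_def score_eq)

lemma AE_Q_stat: "AE x in pole_sample m \<nu>. Q_stat f m x = 2 / (real m * second_moment) * (cmod (rank_sum m x))\<^sup>2"
  using AE_no_ties[of m \<nu>]
proof eventually_elim
  case (elim x)
  then show ?case
    by (subst Q_stat_eq) (auto simp: score_second_moment rank_sum_def line_score_eq)
qed

lemma Q_test_power_eq:
  "Q_test_power f \<beta> m \<nu> = measure (pole_sample m \<nu>) {x \<in> space (pole_sample m \<nu>).
     chi_square_quantile 2 (1 - \<beta>) < 2 / (real m * second_moment) * (cmod (rank_sum m x))\<^sup>2}"
  unfolding Q_test_power_def
proof (rule measure_eq_AE)
  show "AE x in pole_sample m \<nu>. x \<in> {x \<in> space (pole_sample m \<nu>). chi_square_quantile 2 (1 - \<beta>) < Q_stat f m x} \<longleftrightarrow>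
     x \<in> {x \<in> space (pole_sample m \<nu>). chi_square_quantile 2 (1 - \<beta>) < 2 / (real m * second_moment) * (cmod (rank_sum m x))\<^sup>2}"
    using AE_Q_stat by eventually_elim simp
  have [measurable]: "Q_stat f m \<in> borel_measurable (pole_sample m \<nu>)" "rank_sum m \<in> borel_measurable (pole_sample m \<nu>)"
    by (intro measurable_Q_stat pole_sample_component measurable_rank_sum; assumption)+
  show "{x \<in> space (pole_sample m \<nu>). chi_square_quantile 2 (1 - \<beta>) < Q_stat f m x} \<in> sets (pole_sample m \<nu>)" by measurable
  show "{x \<in> space (pole_sample m \<nu>). chi_square_quantile 2 (1 - \<beta>) < 2 / (real m * second_moment) * (cmod (rank_sum m x))\<^sup>2} \<in> sets (pole_sample m \<nu>)" by measurable
qed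

text \<open>This is half of the usual noncentrality parameter per unit of \<open>h\<^sup>2\<close>, in accordance with \<^const>\<open>chi2_tail\<close>.\<close>

definition noncentrality :: real where "noncentrality = cross_moment\<^sup>2 / (4 * second_moment)"

lemma noncentrality_pos: "0 < noncentrality"
  using second_moment_pos cross_moment_pos by (simp add: noncentrality_def)

lemma power_regular:
  assumes n: "filterlim n at_top sequentially" and s: "s \<longlonglongrightarrow> 0" "\<And>k. 0 \<le> s k" and e: "norm e = 1"
    and h: "(\<lambda>k. sqrt (real (n k)) * s k) \<longlonglongrightarrow> h" and c: "0 \<le> chi_square_quantile 2 (1 - \<beta>)"
  shows "(\<lambda>k. Q_test_power f \<beta> (n k) (s k *\<^sub>R e)) \<longlonglongrightarrow> chi2_tail (chi_square_quantile 2 (1 - \<beta>)) (noncentrality * h\<^sup>2)"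
  unfolding Q_test_power_eq
proof (rule tendsto_prob_of_laplace)
  interpret local_shift J A n s e by unfold_locales (use n s e in auto)
  let ?M = "\<lambda>k. pole_sample (n k) (s k *\<^sub>R e)"
  show "prob_space (?M k)" for k by (rule pole_sample.prob_space_axioms)
  have [measurable]: "rank_sum m \<in> borel_measurable (pole_sample m \<nu>)" for m \<nu> by (rule measurable_rank_sum)
  show "(\<lambda>x. 2 / (real (n k) * second_moment) * (cmod (rank_sum (n k) x))\<^sup>2) \<in> borel_measurable (?M k)" for k by measurable
  show "AE x in ?M k. 0 \<le> 2 / (real (n k) * second_moment) * (cmod (rank_sum (n k) x))\<^sup>2" for k
    using second_moment_pos by (intro AE_I2) simp
  show "0 \<le> noncentrality * h\<^sup>2" using noncentrality_pos by simp
  show "(\<lambda>k. \<integral>x. exp (- (real j * (2 / (real (n k) * second_moment) * (cmod (rank_sum (n k) x))\<^sup>2) / 2)) \<partial>?M k)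
     \<longlonglongrightarrow> exp (- (noncentrality * h\<^sup>2 * real j / (1 + real j))) / (1 + real j)" for j
  proof -
    \<comment> \<open>This scaling makes t * second_moment = j, so the limit is the Laplace
      transform of the noncentral law at the integer j.\<close>
    let ?t = "real j / second_moment"
    have t: "0 \<le> ?t" using second_moment_pos by simp
    have 1: "real j * (2 / (real (n k) * second_moment) * (cmod (rank_sum (n k) x))\<^sup>2) / 2 = ?t * (cmod (rank_sum (n k) x) / sqrt (real (n k)))\<^sup>2" for k x
      by (simp add: power_divide)
    have 2: "?t * second_moment = real j" using second_moment_pos by simp
    have 3: "?t * (h * cross_moment / 2)\<^sup>2 = noncentrality * h\<^sup>2 * real j"
      by (simp add: noncentrality_def power_mult_distrib power_divide mult_ac)
    show ?thesis using laplace_rank[OF h t] unfolding 1 2 3 .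
  qed
qed (rule c)

text \<open>The sum is projected onto the direction u of the shift. The projected mean is sqrt n
  times \<open>a k\<close>, with \<open>a k\<close> diverging, whereas acceptance bounds the rank
  sum by half of it. Markov's inequality for the squared deviations does the rest.\<close>

lemma power_diverging:
  assumes n: "filterlim n at_top sequentially" and s: "s \<longlonglongrightarrow> 0" "\<And>k. 0 \<le> s k" and e: "norm e = 1"
    and h: "filterlim (\<lambda>k. sqrt (real (n k)) * s k) at_top sequentially" and c: "0 \<le> chi_square_quantile 2 (1 - \<beta>)"
  shows "(\<lambda>k. Q_test_power f \<beta> (n k) (s k *\<^sub>R e)) \<longlonglongrightarrow> 1"
proof -
  interpret local_shift J A n s e by unfold_locales (use n s e in auto)
  define c where "c = chi_square_quantile 2 (1 - \<beta>)"
  define u where "u = complex_of_vec e"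
  have u: "cmod u = 1" by (simp add: u_def cmod_complex_of_vec e)
  define W where "W y = u \<bullet> signed_score y" for y
  have [measurable]: "W \<in> borel_measurable borel" unfolding W_def[abs_def] by measurable
  have iW0: "integrable (pole_law 0) W" unfolding W_def[abs_def] by (rule integrable_inner)
  have iW20: "integrable (pole_law 0) (\<lambda>y. (W y)\<^sup>2)" unfolding W_def by (rule integral_inner_sq(1))
  have iW: "integrable (pole_law \<nu>) W" for \<nu> by (rule integrable_pole_law[OF _ iW0]) simp
  have iW2: "integrable (pole_law \<nu>) (\<lambda>y. (W y)\<^sup>2)" for \<nu> by (rule integrable_pole_law[OF _ iW20]) simp
  define g where "g k = (\<integral>y. (u \<bullet> signed_score y) * shift_score e (s k) y \<partial>pole_law 0)" for k
  have g: "g \<longlonglongrightarrow> cross_moment / 2"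
    using mean_tendsto[of u] u unfolding g_def[abs_def] u_def[symmetric] by (simp add: dot_square_norm)
  have mean: "(\<integral>y. W y \<partial>pole_law (\<mu> k)) = s k * g k" for k unfolding W_def g_def by (rule mean_eq)
  define v where "v k = (\<integral>y. (W y)\<^sup>2 \<partial>pole_law (\<mu> k))" for k
  have v: "v \<longlonglongrightarrow> second_moment / 2"
    using tendsto_integral_pole_law[OF _ iW20 mu_tendsto] u unfolding v_def W_def integral_inner_sq(2) by simp
  define a where "a k = sqrt (real (n k)) * s k * g k" for k
  have a: "filterlim a at_top sequentially" unfolding a_def[abs_def]
    by (rule filterlim_at_top_mult_tendsto_pos[OF g _ h]) (use cross_moment_pos in simp)
  define r where "r k = 8 * (v k + (1 + real (n k) * (flip_bound (\<mu> k))\<^sup>2) * score_error (n k) (\<mu> k)) / (a k)\<^sup>2" for k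
  \<comment> \<open>Once \<open>a k\<close> exceeds the threshold, acceptance forces the fluctuation
    |p| or the replacement error q to be large: sqrt n * a / 2 \<le> |p| + q, whose square yields n
    a^2 / 8 \<le> p^2 + q^2.\<close>
  have bound: "\<forall>\<^sub>F k in sequentially. 1 - Q_test_power f \<beta> (n k) (\<mu> k) \<le> r k"
    using eventually_n_pos a[unfolded filterlim_at_top, rule_format, of "2 * sqrt (c * second_moment / 2) + 1"]
  proof eventually_elim
    case (elim k)
    let ?M = "pole_sample (n k) (\<mu> k)" and ?m = "real (n k)"
    let ?T = "\<lambda>x. \<Sum>i<n k. signed_score (x i)"
    let ?Q = "\<lambda>x. 2 / (real (n k) * second_moment) * (cmod (rank_sum (n k) x))\<^sup>2"
    let ?Y = "\<lambda>x. ((\<Sum>i<n k. W (x i)) - ?m * (\<integral>y. W y \<partial>pole_law (\<mu> k)))\<^sup>2 + (cmod (rank_sum (n k) x - ?T x))\<^sup>2"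
    have [measurable]: "rank_sum (n k) \<in> borel_measurable ?M" by (rule measurable_rank_sum)
    have c0: "0 \<le> c" using c by (simp add: c_def)
    have sq0: "0 \<le> sqrt (c * second_moment / 2)" using c0 second_moment_pos by simp
    have a1: "0 < a k" "sqrt (c * second_moment / 2) \<le> a k / 2" using elim(2) sq0 by linarith+
    have iY1: "integrable ?M (\<lambda>x. ((\<Sum>i<n k. W (x i)) - ?m * (\<integral>y. W y \<partial>pole_law (\<mu> k)))\<^sup>2)"
      by (rule sum_variance_le(1)[OF _ iW iW2 elim(1)]) simp
    have iY2: "integrable ?M (\<lambda>x. (cmod (rank_sum (n k) x - ?T x))\<^sup>2)" by (rule rank_sum_approx(1))
    have iY: "integrable ?M ?Y" using iY1 iY2 by (rule Bochner_Integration.integrable_add)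
    have sub: "{x \<in> space ?M. \<not> c < ?Q x} \<subseteq> {x \<in> space ?M. ?m * (a k)\<^sup>2 / 8 \<le> ?Y x}"
    proof clarify
      fix x assume "\<not> c < ?Q x"
      then have "?Q x \<le> c" by simp
      then have "(cmod (rank_sum (n k) x))\<^sup>2 \<le> ?m * (c * second_moment / 2)"
        using elim(1) second_moment_pos by (simp add: field_simps)
      then have "cmod (rank_sum (n k) x) \<le> sqrt (?m * (c * second_moment / 2))" by (rule real_le_rsqrt)
      also have "\<dots> = sqrt ?m * sqrt (c * second_moment / 2)" by (rule real_sqrt_mult)
      also have "\<dots> \<le> sqrt ?m * (a k / 2)" using a1 by (intro mult_left_mono) auto
      finally have rs: "cmod (rank_sum (n k) x) \<le> sqrt ?m * a k / 2" by simp
      define p where "p = (\<Sum>i<n k. W (x i)) - ?m * (\<integral>y. W y \<partial>pole_law (\<mu> k))"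
      define q where "q = cmod (rank_sum (n k) x - ?T x)"
      have "?m * (\<integral>y. W y \<partial>pole_law (\<mu> k)) = sqrt ?m * a k"
        unfolding mean a_def by simp
      moreover have "(\<Sum>i<n k. W (x i)) = u \<bullet> rank_sum (n k) x - u \<bullet> (rank_sum (n k) x - ?T x)"
        by (simp add: W_def inner_sum_right inner_diff_right)
      moreover have "\<bar>u \<bullet> rank_sum (n k) x\<bar> \<le> cmod (rank_sum (n k) x)" "\<bar>u \<bullet> (rank_sum (n k) x - ?T x)\<bar> \<le> q"
        unfolding q_def using Cauchy_Schwarz_ineq2[of u] u by (metis mult_1)+
      ultimately have "sqrt ?m * a k / 2 \<le> \<bar>p\<bar> + q" unfolding p_def using rs by linarith
      then have "(sqrt ?m * a k / 2)\<^sup>2 \<le> (\<bar>p\<bar> + q)\<^sup>2" using a1 by (intro power_mono) auto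
      also have "\<dots> \<le> 2 * (p\<^sup>2 + q\<^sup>2)" using sum_squares_bound[of "\<bar>p\<bar>" q] by (simp add: power2_sum)
      finally show "?m * (a k)\<^sup>2 / 8 \<le> ?Y x" unfolding p_def[symmetric] q_def[symmetric]
        by (simp add: power_divide power_mult_distrib)
    qed
    have "1 - Q_test_power f \<beta> (n k) (\<mu> k) = measure ?M {x \<in> space ?M. \<not> c < ?Q x}"
      unfolding Q_test_power_eq c_def by (subst pole_sample.prob_neg) auto
    also have "\<dots> \<le> measure ?M {x \<in> space ?M. ?m * (a k)\<^sup>2 / 8 \<le> ?Y x}"
      by (intro pole_sample.finite_measure_mono sub borel_measurable_le borel_measurable_const borel_measurable_integrable[OF iY])
    also have "\<dots> \<le> (\<integral>x. ?Y x \<partial>?M) / (?m * (a k)\<^sup>2 / 8)"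
      using elim(1) a1 by (intro integral_Markov_inequality_measure[OF iY, of "{}"]) auto
    also have "(\<integral>x. ?Y x \<partial>?M) \<le> ?m * v k + (1 + ?m * (flip_bound (\<mu> k))\<^sup>2) * (?m * score_error (n k) (\<mu> k))"
      unfolding Bochner_Integration.integral_add[OF iY1 iY2] v_def
      by (intro add_mono rank_sum_approx(2) sum_variance_le(2)[OF _ iW iW2 elim(1)]) simp
    then have "(\<integral>x. ?Y x \<partial>?M) / (?m * (a k)\<^sup>2 / 8) \<le> (?m * v k + (1 + ?m * (flip_bound (\<mu> k))\<^sup>2) * (?m * score_error (n k) (\<mu> k))) / (?m * (a k)\<^sup>2 / 8)"
      by (intro divide_right_mono) auto
    also have "\<dots> = r k"
    proof -
      have "?m * v + X * (?m * E) = ?m * (v + X * E)" for v X E by (simp add: distrib_left mult_ac)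
      then show ?thesis using elim(1) by (simp add: r_def)
    qed
    finally show ?case .
  qed
  \<comment> \<open>The factor 1 + n flip_bound^2 may diverge here, but no faster than a^2. Their
    quotient is at most 64 / g^2 for the second part, and it is multiplied by the vanishing score
    error.\<close>
  have r_le: "\<forall>\<^sub>F k in sequentially. r k \<le> 8 * v k / (a k)\<^sup>2 + 8 * score_error (n k) (\<mu> k) / (a k)\<^sup>2 + 512 * score_error (n k) (\<mu> k) / (g k)\<^sup>2"
    using flip_bound_le a[unfolded filterlim_at_top, rule_format, of 1]
  proof eventually_elim
    case (elim k)
    let ?m = "real (n k)"
    have a: "(a k)\<^sup>2 = ?m * (s k)\<^sup>2 * (g k)\<^sup>2" by (simp add: a_def power_mult_distrib)
    have nz: "0 < ?m * (s k)\<^sup>2" "g k \<noteq> 0" using elim(2) by (auto simp: a_def zero_less_mult_iff intro!: Nat.gr0I)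
    have "(flip_bound (\<mu> k))\<^sup>2 \<le> (8 * s k)\<^sup>2" using elim(1) flip_bound_nonneg by (intro power_mono) auto
    then have "?m * (flip_bound (\<mu> k))\<^sup>2 \<le> ?m * (64 * (s k)\<^sup>2)" by (intro mult_left_mono) (auto simp: power_mult_distrib)
    then have "?m * (flip_bound (\<mu> k))\<^sup>2 / (a k)\<^sup>2 \<le> ?m * (64 * (s k)\<^sup>2) / (a k)\<^sup>2" by (intro divide_right_mono) auto
    also have "\<dots> = 64 * (?m * (s k)\<^sup>2) / (?m * (s k)\<^sup>2 * (g k)\<^sup>2)" unfolding a by (simp only: mult.left_commute)
    also have "\<dots> = 64 / (g k)\<^sup>2"
    proof -
      have c: "64 * p / (p * G) = 64 / G" if "p \<noteq> 0" for p G :: real using that by simp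
      show ?thesis by (rule c[OF less_imp_neq[OF nz(1), symmetric]])
    qed
    finally have "8 * score_error (n k) (\<mu> k) * (?m * (flip_bound (\<mu> k))\<^sup>2 / (a k)\<^sup>2) \<le> 8 * score_error (n k) (\<mu> k) * (64 / (g k)\<^sup>2)"
      using score_error_nonneg by (intro mult_left_mono) auto
    then show ?case unfolding r_def by (simp add: add_divide_distrib distrib_right distrib_left mult_ac)
  qed
  have lim: "(\<lambda>k. 8 * v k / (a k)\<^sup>2 + 8 * score_error (n k) (\<mu> k) / (a k)\<^sup>2 + 512 * score_error (n k) (\<mu> k) / (g k)\<^sup>2) \<longlonglongrightarrow> 0 + 0 + 512 * 0 / (cross_moment / 2)\<^sup>2"
  proof (intro tendsto_add tendsto_divide tendsto_mult tendsto_power tendsto_const g error_tendsto)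
    have a2: "filterlim (\<lambda>k. (a k)\<^sup>2) at_top sequentially" by (rule filterlim_pow_at_top[OF _ a]) simp
    show "(\<lambda>k. 8 * v k / (a k)\<^sup>2) \<longlonglongrightarrow> 0" by (rule real_tendsto_divide_at_top[OF tendsto_mult[OF tendsto_const v] a2])
    show "(\<lambda>k. 8 * score_error (n k) (\<mu> k) / (a k)\<^sup>2) \<longlonglongrightarrow> 0" by (rule real_tendsto_divide_at_top[OF tendsto_mult[OF tendsto_const error_tendsto] a2])
  qed (use cross_moment_pos in auto)
  have "(\<lambda>k. 1 - Q_test_power f \<beta> (n k) (\<mu> k)) \<longlonglongrightarrow> 0"
  proof (rule real_tendsto_sandwich[OF _ _ tendsto_const])
    show "\<forall>\<^sub>F k in sequentially. 0 \<le> 1 - Q_test_power f \<beta> (n k) (\<mu> k)"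
      unfolding Q_test_power_def by (simp add: pole_sample.prob_le_1)
    show "\<forall>\<^sub>F k in sequentially. 1 - Q_test_power f \<beta> (n k) (\<mu> k) \<le> 8 * v k / (a k)\<^sup>2 + 8 * score_error (n k) (\<mu> k) / (a k)\<^sup>2 + 512 * score_error (n k) (\<mu> k) / (g k)\<^sup>2"
      using bound r_le by eventually_elim simp
    show "(\<lambda>k. 8 * v k / (a k)\<^sup>2 + 8 * score_error (n k) (\<mu> k) / (a k)\<^sup>2 + 512 * score_error (n k) (\<mu> k) / (g k)\<^sup>2) \<longlonglongrightarrow> 0"
      using lim by simp
  qed
  from tendsto_diff[OF tendsto_const[of 1] this] show ?thesis by simp
qed

end

section \<open>Critical values and score functions\<close>

lemma cdf_chi_square_2:
  "cdf (density lborel (\<lambda>t. ennreal (chi_square_density 2 t))) t = (if t < 0 then 0 else 1 - exp (- (t / 2)))"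
proof -
  have [measurable]: "chi_square_density 2 \<in> borel_measurable borel"
    unfolding chi_square_density_def[abs_def] by measurable
  have d: "density lborel (\<lambda>t. ennreal (chi_square_density 2 t)) = density lborel (\<lambda>t. ennreal (exponential_density (1 / 2) t))"
  proof (rule density_cong)
    \<comment> \<open>The two densities differ at the single point 0.\<close>
    show "AE t in lborel. ennreal (chi_square_density 2 t) = ennreal (exponential_density (1 / 2) t)"
      using AE_lborel_singleton[of 0]
      by eventually_elim (auto simp: chi_square_density_def exponential_density_def)
  qed simp_all
  show ?thesis unfolding cdf_def d measure_def
    using emeasure_erlang_density[of "1 / 2" 0 t] by (auto simp: erlang_CDF_def)
qed

lemma chi_square_quantile_2:
  assumes "0 < \<beta>" "\<beta> < 1"
  shows "chi_square_quantile 2 (1 - \<beta>) = - 2 * ln \<beta>"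
  unfolding chi_square_quantile_def
proof (rule cInf_eq_minimum)
  have l: "ln \<beta> < 0" using assms by simp
  show "- 2 * ln \<beta> \<in> {t. 1 - \<beta> \<le> cdf (density lborel (\<lambda>t. ennreal (chi_square_density 2 t))) t}"
    using assms l by (simp add: cdf_chi_square_2)
  fix t assume "t \<in> {t. 1 - \<beta> \<le> cdf (density lborel (\<lambda>t. ennreal (chi_square_density 2 t))) t}"
  then have t: "0 \<le> t" "exp (- (t / 2)) \<le> \<beta>" using assms by (auto simp: cdf_chi_square_2 split: if_splits)
  then have "ln (exp (- (t / 2))) \<le> ln \<beta>" by (subst ln_le_cancel_iff) (use assms in auto)
  then show "- 2 * ln \<beta> \<le> t" by simp
qed

text \<open>F is the primitive of r f(r) that vanishes at 0, c the total mass and G the quantile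
  function. This data evaluates the description hidden in \<open>radial_quantile\<close>.\<close>

locale radial_family =
  fixes f F G :: "real \<Rightarrow> real" and c :: real
  assumes cont: "\<And>r. isCont f r" and f_nonneg: "\<And>r. 0 \<le> f r"
    and deriv: "\<And>r. (F has_real_derivative r * f r) (at r)" and F0: "F 0 = 0"
    and lim: "(F \<longlongrightarrow> c) at_top" and c_pos: "0 < c"
    and F_less: "\<And>r. F r < c" and F_pos: "\<And>r. 0 < r \<Longrightarrow> 0 < F r"
    and G_pos: "\<And>u. 0 < u \<Longrightarrow> u < 1 \<Longrightarrow> 0 < G u" and F_G: "\<And>u. 0 < u \<Longrightarrow> u < 1 \<Longrightarrow> F (G u) = c * u"
    and inj: "inj_on F {0<..}"
begin

lemma cont': "isCont (\<lambda>s. s * f s) r"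
  using cont by (intro continuous_intros)

lemma measurable_density: "(\<lambda>s. s * f s) \<in> borel_measurable borel"
  using cont' by (intro borel_measurable_continuous_onI continuous_at_imp_continuous_on) auto

lemma total: "(LINT s:{0<..}|lborel. s * f s) = c"
proof -
  note [measurable] = measurable_density
  have "(LINT s:{0<..}|lborel. s * f s) = (\<integral>s. s * f s * indicator {0..} s \<partial>lborel)"
    unfolding set_lebesgue_integral_def by (intro Bochner_Integration.integral_cong) (auto simp: indicator_def)
  also have "\<dots> = enn2real (\<integral>\<^sup>+s. ennreal (s * f s * indicator {0..} s) \<partial>lborel)"
    using f_nonneg by (intro integral_eq_nn_integral AE_I2) (auto simp: indicator_def)
  also have "(\<integral>\<^sup>+s. ennreal (s * f s * indicator {0..} s) \<partial>lborel) = (\<integral>\<^sup>+s. ennreal (s * f s) * indicator {0..} s \<partial>lborel)"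
    by (intro nn_integral_cong) (auto simp: indicator_def)
  also have "\<dots> = ennreal (c - F 0)"
    using f_nonneg by (intro nn_integral_FTC_atLeast lim deriv) auto
  finally show ?thesis using c_pos by (simp add: F0)
qed

lemma radial_cdf_eq: "0 < r \<Longrightarrow> radial_cdf f r = F r / c"
proof -
  assume r: "0 < r"
  have "radial_cdf f r = (LBINT s. (s * f s / c) * indicator {0..r} s)"
    unfolding radial_cdf_def radial_pdf_def total unfolding set_lebesgue_integral_def
    by (intro Bochner_Integration.integral_cong) (auto simp: indicator_def)
  also have "\<dots> = F r / c - F 0 / c"
  proof (rule integral_FTC_Icc_real)
    show "((\<lambda>s. F s / c) has_real_derivative s * f s / c) (at s)" for s
      using DERIV_cdivide[OF deriv] .
    show "isCont (\<lambda>s. s * f s / c) s" for s using cont' c_pos by (intro isCont_divide continuous_const) auto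
  qed (use r in auto)
  finally show ?thesis by (simp add: F0)
qed

lemma inj_radial_cdf: "inj_on (radial_cdf f) {0<..}"
  using inj c_pos by (auto simp: inj_on_def radial_cdf_eq)

lemma radial_quantile_eq: "0 < u \<Longrightarrow> u < 1 \<Longrightarrow> radial_quantile f u = G u"
  unfolding radial_quantile_def
  using the_inv_into_f_f[OF inj_radial_cdf, of "G u"] G_pos[of u] F_G[of u] c_pos by (simp add: radial_cdf_eq)

text \<open>Outside the unit interval the description in \<^const>\<open>the_inv_into\<close> is void, and hence the same for all arguments.\<close>

lemma radial_quantile_outside: "\<not> (0 < u \<and> u < 1) \<Longrightarrow> radial_quantile f u = radial_quantile f 0"
proof -
  have "radial_cdf f r \<noteq> v" if "\<not> (0 < v \<and> v < 1)" "0 < r" for r v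
    using that F_pos[of r] F_less[of r] c_pos by (auto simp: radial_cdf_eq)
  then have q: "(\<lambda>r. r \<in> {0<..} \<and> radial_cdf f r = v) = (\<lambda>r. False)" if "\<not> (0 < v \<and> v < 1)" for v
    using that by auto
  assume "\<not> (0 < u \<and> u < 1)"
  then have "(\<lambda>r. r \<in> {0<..} \<and> radial_cdf f r = u) = (\<lambda>r. r \<in> {0<..} \<and> radial_cdf f r = 0)"
    by (rule trans[OF q q[symmetric]]) simp
  from arg_cong[OF this, of The] show ?thesis unfolding radial_quantile_def the_inv_into_def .
qed

lemma measurable_score:
  assumes J: "J \<in> borel_measurable borel" and eq: "\<And>u. 0 < u \<Longrightarrow> u < 1 \<Longrightarrow> score f u = J u"
  shows "score f \<in> borel_measurable borel"
proof -
  note [measurable] = J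
  have "score f = (\<lambda>u. if 0 < u \<and> u < 1 then J u else score f 0)"
  proof (rule ext)
    fix u show "score f u = (if 0 < u \<and> u < 1 then J u else score f 0)"
      using eq[of u] radial_quantile_outside[of u] by (simp add: score_def)
  qed
  then show ?thesis by (rule ssubst) measurable
qed

lemma score_eq:
  assumes "0 < u" "u < 1" and "((\<lambda>s. sqrt (f s)) has_real_derivative d) (at (G u))"
  shows "score f u = - 2 * d / sqrt (f (G u))"
  using assms by (simp add: score_def radial_quantile_eq DERIV_imp_deriv)

end

interpretation pole_family: radial_family pole_radial "\<lambda>r. (1 - 1 / (1 + r\<^sup>2)) / 2" "\<lambda>u. sqrt (u / (1 - u))" "1 / 2"
proof
  have p: "0 < 1 + r\<^sup>2" for r :: real by (rule one_plus_sq_pos)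
  show "isCont pole_radial r" for r
    unfolding pole_radial_def[abs_def] using p[of r] by (intro continuous_intros) auto
  show "((\<lambda>r. (1 - 1 / (1 + r\<^sup>2)) / 2) has_real_derivative r * pole_radial r) (at r)" for r
    using p[of r] by (auto intro!: derivative_eq_intros simp: pole_radial_def power2_eq_square)
  show "((\<lambda>r::real. (1 - 1 / (1 + r\<^sup>2)) / 2) \<longlongrightarrow> 1 / 2) at_top" by real_asymp
  show "(1 - 1 / (1 + r\<^sup>2)) / 2 < 1 / 2" for r :: real using p[of r] by simp
  show "0 < (1 - 1 / (1 + r\<^sup>2)) / 2" if "0 < r" for r :: real using p[of r] that by simp
  show "(1 - 1 / (1 + (sqrt (u / (1 - u)))\<^sup>2)) / 2 = 1 / 2 * u" if "0 < u" "u < 1" for u :: real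
    using that by (simp add: field_simps)
  show "inj_on (\<lambda>r::real. (1 - 1 / (1 + r\<^sup>2)) / 2) {0<..}"
    using p by (auto simp: inj_on_def)
qed (auto simp: pole_radial_def)

interpretation gauss_family: radial_family gauss_radial "\<lambda>r. 1 - exp (- (r\<^sup>2) / 2)" "\<lambda>u. sqrt (- 2 * ln (1 - u))" 1
proof
  show "isCont gauss_radial r" for r
    unfolding gauss_radial_def[abs_def] by (intro continuous_intros) auto
  show "((\<lambda>r. 1 - exp (- (r\<^sup>2) / 2)) has_real_derivative r * gauss_radial r) (at r)" for r
    by (auto intro!: derivative_eq_intros simp: gauss_radial_def)
  show "((\<lambda>r::real. 1 - exp (- (r\<^sup>2) / 2)) \<longlongrightarrow> 1) at_top" by real_asymp
  show "0 < sqrt (- 2 * ln (1 - u))" if "0 < u" "u < 1" for u :: real using that by (simp add: mult_neg_neg)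
  show "1 - exp (- ((sqrt (- 2 * ln (1 - u)))\<^sup>2) / 2) = 1 * u" if "0 < u" "u < 1" for u :: real
  proof -
    have "ln (1 - u) \<le> 0" using that by simp
    then show ?thesis using that by simp
  qed
  show "inj_on (\<lambda>r::real. 1 - exp (- (r\<^sup>2) / 2)) {0<..}"
    by (auto simp: inj_on_def)
qed (auto simp: gauss_radial_def)

lemma score_pole_radial:
  assumes u: "0 < u" "u < 1"
  shows "score pole_radial u = pole_score u"
proof -
  let ?r = "sqrt (u / (1 - u))"
  have p: "0 < 1 + s\<^sup>2" for s :: real by (rule one_plus_sq_pos)
  have s: "sqrt (pole_radial s) = 1 / (1 + s\<^sup>2)" for s
    using p[of s] by (simp add: pole_radial_def real_sqrt_divide)
  have "((\<lambda>s. sqrt (pole_radial s)) has_real_derivative - (2 * ?r) / (1 + ?r\<^sup>2)\<^sup>2) (at ?r)"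
    unfolding s using p[of ?r] by (auto intro!: derivative_eq_intros simp: power2_eq_square)
  from pole_family.score_eq[OF u this] have "score pole_radial u = 4 * ?r / (1 + ?r\<^sup>2)"
    using p[of ?r] by (simp add: s power2_eq_square)
  also have "1 + ?r\<^sup>2 = 1 / (1 - u)" using u by (simp add: field_simps)
  also have "4 * ?r / (1 / (1 - u)) = 4 * (sqrt u * ((1 - u) / sqrt (1 - u)))" by (simp add: real_sqrt_divide)
  also have "(1 - u) / sqrt (1 - u) = sqrt (1 - u)" using u by (intro real_div_sqrt) simp
  finally show ?thesis by (simp add: pole_score_def real_sqrt_mult)
qed

definition gauss_score :: "real \<Rightarrow> real" where
  "gauss_score u = (if 0 \<le> u \<and> u < 1 then sqrt (- 2 * ln (1 - u)) else 0)"

lemma score_gauss_radial: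
  assumes u: "0 < u" "u < 1"
  shows "score gauss_radial u = gauss_score u"
proof -
  let ?r = "sqrt (- 2 * ln (1 - u))"
  have s: "sqrt (gauss_radial s) = exp (- (s\<^sup>2) / 4)" for s
  proof -
    have "gauss_radial s = (exp (- (s\<^sup>2) / 4))\<^sup>2" by (simp add: gauss_radial_def power2_eq_square exp_add[symmetric])
    then show ?thesis by simp
  qed
  have "((\<lambda>s. sqrt (gauss_radial s)) has_real_derivative - (?r / 2) * exp (- (?r\<^sup>2) / 4)) (at ?r)"
    unfolding s by (auto intro!: derivative_eq_intros)
  from gauss_family.score_eq[OF u this] show ?thesis using u by (simp add: s gauss_score_def)
qed

section \<open>Moments of the scores\<close>

lemma uniformly_continuous_on_eq_subset:
  fixes f g :: "real \<Rightarrow> real"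
  assumes "uniformly_continuous_on T f" "S \<subseteq> T" "\<And>x. x \<in> S \<Longrightarrow> f x = g x"
  shows "uniformly_continuous_on S g"
  unfolding uniformly_continuous_on_def
proof (intro allI impI)
  fix \<epsilon> :: real assume "0 < \<epsilon>"
  then obtain d where "0 < d" "\<forall>x\<in>T. \<forall>y\<in>T. dist y x < d \<longrightarrow> dist (f y) (f x) < \<epsilon>"
    using assms(1) unfolding uniformly_continuous_on_def by blast
  then have "0 < d \<and> (\<forall>x\<in>S. \<forall>y\<in>S. dist y x < d \<longrightarrow> dist (g y) (g x) < \<epsilon>)"
    using assms(2) by (auto simp: assms(3)[symmetric])
  then show "\<exists>d>0. \<forall>x\<in>S. \<forall>y\<in>S. dist y x < d \<longrightarrow> dist (g y) (g x) < \<epsilon>" ..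
qed

text \<open>The square root of a negative number is negative, so \<open>pole_score\<close> is
  negative outside the unit interval; the maximum with 0 repairs this. The constant is 4^4.\<close>

interpretation pole_rank: rank_score "\<lambda>u. max 0 (pole_score u)" 256
proof
  show "max 0 (pole_score u) ^ 4 * sqrt (1 - u) \<le> 256" if u: "0 \<le> u" "u < 1" for u
  proof -
    have "max 0 (pole_score u) ^ 4 \<le> 4 ^ 4" using abs_pole_score_le[of u] u by (intro power_mono) auto
    then have "max 0 (pole_score u) ^ 4 * sqrt (1 - u) \<le> 4 ^ 4 * 1" using u by (intro mult_mono) auto
    then show ?thesis by simp
  qed
  show "uniformly_continuous_on {0..<1} (\<lambda>u. min K (max 0 (pole_score u)))" for K
  proof (rule uniformly_continuous_on_eq_subset)
    show "uniformly_continuous_on {0..1} (\<lambda>u. min K (max 0 (pole_score u)))"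
      unfolding pole_score_def by (intro compact_uniformly_continuous continuous_intros compact_Icc)
  qed auto
qed auto

interpretation gauss_rank: rank_score gauss_score 64
proof
  show "gauss_score \<in> borel_measurable borel" unfolding gauss_score_def[abs_def] by measurable
  show nn: "0 \<le> gauss_score u" for u by (simp add: gauss_score_def)
  show "gauss_score u ^ 4 * sqrt (1 - u) \<le> 64" if u: "0 \<le> u" "u < 1" for u
  proof -
    \<comment> \<open>With 1 - u = exp (- 4 y) the fourth power of the score is 64 y^2 and the
      square root is exp (- 2 y); the constant 64 then follows from y \<le> exp y.\<close>
    define y where "y = - ln (1 - u) / 4"
    have y: "0 \<le> y" "ln (1 - u) = - 4 * y" using u by (simp_all add: y_def)
    have "1 - u = exp (- 4 * y)" unfolding y(2)[symmetric] using u by simp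
    then have s: "sqrt (1 - u) = exp (- 2 * y)" by (intro real_sqrt_unique) (simp_all add: power2_eq_square exp_add[symmetric])
    have "gauss_score u ^ 4 = ((gauss_score u)\<^sup>2)\<^sup>2" by simp
    also have "(gauss_score u)\<^sup>2 = 8 * y" using u y by (simp add: gauss_score_def)
    finally have g: "gauss_score u ^ 4 = 64 * y\<^sup>2" by (simp add: power2_eq_square)
    have "y \<le> exp y" using exp_ge_add_one_self[of y] by linarith
    then have "y\<^sup>2 \<le> (exp y)\<^sup>2" using y by (intro power_mono) auto
    also have "(exp y)\<^sup>2 = exp (2 * y)" by (simp add: power2_eq_square exp_add[symmetric])
    finally have "64 * y\<^sup>2 * exp (- 2 * y) \<le> 64 * exp (2 * y) * exp (- 2 * y)" by (intro mult_right_mono) auto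
    then show ?thesis unfolding g s by (simp add: mult.assoc exp_add[symmetric])
  qed
  show "uniformly_continuous_on {0..<1} (\<lambda>u. min K (gauss_score u))" for K
  proof (cases "0 \<le> K")
    case False
    then have "min K (gauss_score u) = K" for u using nn[of u] by simp
    then show ?thesis by (simp add: uniformly_continuous_on_const)
  next
    case True
    \<comment> \<open>At q the score equals K. Beyond it the truncated score is constant, so it
      extends continuously to the closed interval.\<close>
    define q where "q = 1 - exp (- (K\<^sup>2 / 2))"
    have q: "q < 1" by (simp add: q_def)
    let ?h = "\<lambda>u. min K (sqrt (- 2 * ln (1 - min u q)))"
    have eq: "?h u = min K (gauss_score u)" if u: "u \<in> {0..<1}" for u
    proof (cases "u \<le> q")
      case True
      then show ?thesis using u by (simp add: gauss_score_def)
    next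
      case False
      have k: "sqrt (- 2 * ln (1 - q)) = K" using \<open>0 \<le> K\<close> by (simp add: q_def)
      have "ln (1 - u) \<le> ln (1 - q)" using u False by (subst ln_le_cancel_iff) auto
      then have "sqrt (- 2 * ln (1 - q)) \<le> gauss_score u" using u by (simp add: gauss_score_def)
      then show ?thesis using False k by simp
    qed
    have "continuous_on {0..1} ?h"
      using q by (intro continuous_intros) auto
    then have "uniformly_continuous_on {0..1} ?h" by (rule compact_uniformly_continuous) simp
    then show ?thesis by (rule uniformly_continuous_on_eq_subset[OF _ _ eq]) auto
  qed
qed

section \<open>Closed integrals over the unit interval\<close>

lemma unif_FTC_nonneg:
  fixes f F :: "real \<Rightarrow> real"
  assumes [measurable]: "f \<in> borel_measurable borel"
    and F: "\<And>u. 0 < u \<Longrightarrow> u < 1 \<Longrightarrow> (F has_real_derivative f u) (at u)"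
    and f: "\<And>u. 0 < u \<Longrightarrow> u < 1 \<Longrightarrow> isCont f u" "\<And>u. 0 < u \<Longrightarrow> u < 1 \<Longrightarrow> 0 \<le> f u"
    and lim: "(F \<longlongrightarrow> a) (at_right 0)" "(F \<longlongrightarrow> b) (at_left 1)"
  shows "integrable unif f" "(\<integral>u. f u \<partial>unif) = b - a"
proof -
  have l: "((F \<circ> real_of_ereal) \<longlongrightarrow> a) (at_right (ereal 0))" "((F \<circ> real_of_ereal) \<longlongrightarrow> b) (at_left (ereal 1))"
    using lim by (simp_all only: ereal_tendsto_simps)
  have "set_integrable lborel (einterval (ereal 0) (ereal 1)) f \<and> (LBINT u=ereal 0..ereal 1. f u) = b - a"
    using interval_integral_FTC_nonneg[of "ereal 0" "ereal 1" F f, OF _ _ _ _ l] F f by auto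
  then have s: "set_integrable lborel {0<..<1} f" "(LBINT u:{0<..<1}. f u) = b - a"
    by (simp_all add: interval_lebesgue_integral_def einterval_eq_Icc)
  have d: "unif = density lborel (\<lambda>u. ennreal (indicator {0<..<1} u))"
    by (simp add: uniform_measure_def ennreal_indicator divide_ennreal_def)
  show "integrable unif f" unfolding d using s(1) by (subst integrable_density) (auto simp: set_integrable_def)
  show "(\<integral>u. f u \<partial>unif) = b - a" using s(2)
    by (subst integral_unif) (auto simp: set_lebesgue_integral_def mult.commute)
qed

lemma DERIV_sqrt_power:
  assumes u: "u < 1"
  shows "((\<lambda>u. sqrt (1 - u) ^ k) has_real_derivative - (real k / 2) * (sqrt (1 - u) ^ k / (1 - u))) (at u)"
proof -
  have "((\<lambda>u. sqrt (1 - u) ^ k) has_real_derivative real k * (sqrt (1 - u) ^ (k - 1) * (- (1 / sqrt (1 - u) / 2)))) (at u)"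
    using assms by (auto intro!: derivative_eq_intros simp: inverse_eq_divide)
  also have "real k * (sqrt (1 - u) ^ (k - 1) * (- (1 / sqrt (1 - u) / 2))) = - (real k / 2) * (sqrt (1 - u) ^ k / (1 - u))"
  proof (cases k)
    case (Suc j)
    define r where "r = sqrt (1 - u)"
    have r: "0 < r" "1 - u = r * r" using u by (simp_all add: r_def)
    show ?thesis unfolding Suc r_def[symmetric] r(2) using r(1) by simp
  qed simp
  finally show ?thesis .
qed

lemma unif_sqrt_power:
  shows "integrable unif (\<lambda>u. sqrt (1 - u) ^ k)" "(\<integral>u. sqrt (1 - u) ^ k \<partial>unif) = 2 / (real k + 2)"
proof -
  let ?F = "\<lambda>u::real. - (2 / (real k + 2)) * sqrt (1 - u) ^ (k + 2)"
  have c: "isCont ?F u" for u by (intro continuous_intros)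
  have d: "(?F has_real_derivative sqrt (1 - u) ^ k) (at u)" if "0 < u" "u < 1" for u
  proof -
    have e: "sqrt (1 - u) ^ (k + 2) = sqrt (1 - u) ^ k * (1 - u)" unfolding power_add using that by simp
    have "- (real (k + 2) / 2) * (sqrt (1 - u) ^ (k + 2) / (1 - u)) = - (real (k + 2) / 2) * sqrt (1 - u) ^ k"
      unfolding e using that by simp
    with DERIV_sqrt_power[OF that(2), of "k + 2"]
    have d: "((\<lambda>u. sqrt (1 - u) ^ (k + 2)) has_real_derivative - (real (k + 2) / 2) * sqrt (1 - u) ^ k) (at u)" by (simp only:)
    have c: "- (2 / (real k + 2)) * (- (real (k + 2) / 2) * p) = p" for p
    proof -
      have g: "- (2 / K) * (- (K / 2) * p) = p" if "K \<noteq> 0" for K :: real using that by simp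
      have "real k + 2 \<noteq> 0" by linarith
      then show ?thesis unfolding of_nat_add of_nat_numeral by (rule g)
    qed
    from DERIV_cmult[OF d, of "- (2 / (real k + 2))"] show ?thesis unfolding c .
  qed
  have l: "(?F \<longlongrightarrow> ?F 0) (at_right 0)" "(?F \<longlongrightarrow> ?F 1) (at_left 1)"
    using c unfolding isCont_def by (blast intro: tendsto_within_subset)+
  note r = unif_FTC_nonneg[OF _ d _ _ l]
  show "integrable unif (\<lambda>u. sqrt (1 - u) ^ k)" by (rule r(1)) (auto intro!: continuous_intros)
  show "(\<integral>u. sqrt (1 - u) ^ k \<partial>unif) = 2 / (real k + 2)" by (subst r(2)) (auto intro!: continuous_intros)
qed

lemma unif_sqrt_power_ln:
  shows "integrable unif (\<lambda>u. sqrt (1 - u) ^ k * - ln (1 - u))" "(\<integral>u. sqrt (1 - u) ^ k * - ln (1 - u) \<partial>unif) = 4 / (real k + 2)\<^sup>2"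
proof -
  define K where "K = real k + 2"
  have K: "0 < K" by (simp add: K_def)
  \<comment> \<open>Integration by parts for the product of - ln w with w to the power k / 2, where
    w = 1 - u; one factor w is kept apart so that w ln w has limits at both ends.\<close>
  let ?F = "\<lambda>u::real. sqrt (1 - u) ^ k * ((1 - u) * ln (1 - u) * (2 / K) - (1 - u) * (4 / K\<^sup>2))"
  have d: "(?F has_real_derivative sqrt (1 - u) ^ k * - ln (1 - u)) (at u)" if u: "0 < u" "u < 1" for u
  proof -
    have 3: "((\<lambda>u. (1 - u) * ln (1 - u) * a - (1 - u) * b) has_real_derivative (- ln (1 - u) - 1) * a + b) (at u)" for a b
      using u by (auto intro!: derivative_eq_intros)
    have D: "(?F has_real_derivative (- (real k / 2) * (sqrt (1 - u) ^ k / (1 - u))) * ((1 - u) * ln (1 - u) * (2 / K) - (1 - u) * (4 / K\<^sup>2))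
        + ((- ln (1 - u) - 1) * (2 / K) + 4 / K\<^sup>2) * sqrt (1 - u) ^ k) (at u)"
      by (rule DERIV_mult[OF DERIV_sqrt_power[OF u(2)] 3])
    have id: "(- (real k / 2) * (p / w)) * (w * l * (2 / K) - w * (4 / K\<^sup>2)) + ((- l - 1) * (2 / K) + 4 / K\<^sup>2) * p = p * - l"
      if w: "w \<noteq> 0" for p w l
    proof -
      have k: "real k = K - 2" by (simp add: K_def)
      show ?thesis unfolding k using w K by (simp add: field_simps power2_eq_square)
    qed
    have w: "1 - u \<noteq> 0" using u by simp
    from D show ?thesis unfolding id[OF w] .
  qed
  have s: "((\<lambda>u. sqrt (1 - u) ^ k) \<longlongrightarrow> sqrt (1 - x) ^ k) (at x within A)" for x :: real and A
    by (intro tendsto_intros)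
  have "(?F \<longlongrightarrow> sqrt (1 - 0) ^ k * (0 * (2 / K) - (1 - 0) * (4 / K\<^sup>2))) (at_right 0)"
  proof (intro tendsto_mult s tendsto_diff tendsto_const tendsto_ident_at)
    show "((\<lambda>u::real. (1 - u) * ln (1 - u)) \<longlongrightarrow> 0) (at_right 0)" by real_asymp
  qed
  then have l1: "(?F \<longlongrightarrow> - 4 / K\<^sup>2) (at_right 0)" by simp
  have "(?F \<longlongrightarrow> sqrt (1 - 1) ^ k * (0 * (2 / K) - (1 - 1) * (4 / K\<^sup>2))) (at_left 1)"
  proof (intro tendsto_mult s tendsto_diff tendsto_const tendsto_ident_at)
    show "((\<lambda>u::real. (1 - u) * ln (1 - u)) \<longlongrightarrow> 0) (at_left 1)" by real_asymp
  qed
  then have l2: "(?F \<longlongrightarrow> 0) (at_left 1)" by simp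
  have c: "isCont (\<lambda>u. sqrt (1 - u) ^ k * - ln (1 - u)) u" if "0 < u" "u < 1" for u :: real
    using that by (intro continuous_intros) auto
  have nn: "0 \<le> sqrt (1 - u) ^ k * - ln (1 - u)" if "0 < u" "u < 1" for u :: real
    using that by (intro mult_nonneg_nonneg) auto
  have m: "(\<lambda>u. sqrt (1 - u) ^ k * - ln (1 - u)) \<in> borel_measurable borel" by measurable
  note r = unif_FTC_nonneg[OF m d c nn l1 l2]
  show "integrable unif (\<lambda>u. sqrt (1 - u) ^ k * - ln (1 - u))" by (rule r(1))
  show "(\<integral>u. sqrt (1 - u) ^ k * - ln (1 - u) \<partial>unif) = 4 / (real k + 2)\<^sup>2" using r(2) by (simp add: K_def)
qed

text \<open>The pole test is scored by the location score of its own sampling law, so both moments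
  are 16 times the integral of u (1 - u).\<close>

lemma pole_rank_moments: "pole_rank.second_moment = 8 / 3" "pole_rank.cross_moment = 8 / 3"
proof -
  have "(\<integral>u. 16 * (u * (1 - u)) \<partial>unif) = (8 * 1\<^sup>2 - 16 / 3 * 1 ^ 3) - (8 * 0\<^sup>2 - 16 / 3 * 0 ^ 3)"
    by (rule integral_unif_FTC) (auto intro!: derivative_eq_intros continuous_intros simp: power2_eq_square algebra_simps)
  then have i: "(\<integral>u. 16 * (u * (1 - u)) \<partial>unif) = 8 / 3" by simp
  have p: "AE u in unif. 0 \<le> pole_score u \<and> (pole_score u)\<^sup>2 = 16 * (u * (1 - u))"
    using AE_unif by eventually_elim (simp add: pole_score_def power_mult_distrib)
  have "pole_rank.second_moment = (\<integral>u. 16 * (u * (1 - u)) \<partial>unif)" unfolding pole_rank.second_moment_def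
  proof (rule integral_cong_AE)
    show "AE u in unif. (max 0 (pole_score u))\<^sup>2 = 16 * (u * (1 - u))" using p by eventually_elim (simp add: max_def)
  qed (simp_all, measurable)
  with i show "pole_rank.second_moment = 8 / 3" by simp
  have "pole_rank.cross_moment = (\<integral>u. 16 * (u * (1 - u)) \<partial>unif)" unfolding pole_rank.cross_moment_def
  proof (rule integral_cong_AE)
    show "AE u in unif. max 0 (pole_score u) * pole_score u = 16 * (u * (1 - u))" using p by eventually_elim (simp add: max_def power2_eq_square)
  qed (simp_all, measurable)
  with i show "pole_rank.cross_moment = 8 / 3" by simp
qed

lemma gauss_rank_second_moment: "gauss_rank.second_moment = 2"
proof -
  have "gauss_rank.second_moment = (\<integral>u. 2 * (sqrt (1 - u) ^ 0 * - ln (1 - u)) \<partial>unif)" unfolding gauss_rank.second_moment_def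
  proof (rule integral_cong_AE)
    show "AE u in unif. (gauss_score u)\<^sup>2 = 2 * (sqrt (1 - u) ^ 0 * - ln (1 - u))"
      using AE_unif by eventually_elim (simp add: gauss_score_def)
  qed (simp_all, measurable)
  also have "\<dots> = 2 * (4 / (real 0 + 2)\<^sup>2)" unfolding integral_mult_right_zero unif_sqrt_power_ln(2) by simp
  finally show ?thesis by simp
qed

section \<open>The efficiency\<close>

text \<open>Equality holds at v = 1, and the difference has derivative - (1 - x)^2 / (x (1 +
  x)^2).\<close>

lemma neg_ln_ge: "2 * (1 - v) / (1 + v) \<le> - ln v" if "0 < v" "v \<le> 1" for v :: real
proof -
  let ?k = "\<lambda>v::real. - ln v - 2 * (1 - v) / (1 + v)"
  have "?k 1 \<le> ?k v"
  proof (rule DERIV_nonpos_imp_nonincreasing[OF that(2)])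
    fix x assume x: "v \<le> x" "x \<le> 1"
    then have p: "0 < x" using that by simp
    have "(?k has_real_derivative - ((1 - x)\<^sup>2 / (x * (1 + x)\<^sup>2))) (at x)"
    proof -
      have "(?k has_real_derivative - (1 / x) - (- 2 * (1 + x) - 2 * (1 - x)) / ((1 + x) * (1 + x))) (at x)"
        using p by (auto intro!: derivative_eq_intros simp: inverse_eq_divide)
      moreover have "- (1 / x) - (- 2 * (1 + x) - 2 * (1 - x)) / ((1 + x) * (1 + x)) = - ((1 - x)\<^sup>2 / (x * (1 + x)\<^sup>2))"
        using p by (simp add: divide_simps) (simp add: power2_eq_square algebra_simps)
      ultimately show ?thesis by simp
    qed
    moreover have "- ((1 - x)\<^sup>2 / (x * (1 + x)\<^sup>2)) \<le> 0" using p by simp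
    ultimately show "\<exists>y. (?k has_real_derivative y) (at x) \<and> y \<le> 0" by blast
  qed
  then show ?thesis by simp
qed

text \<open>Equality holds at v = 1 and the derivative is again nonpositive. The numerator satisfies
  1 + 6 v + v^2 = (1 - v)^2 + 8 v, which later turns into the cubic bound 8 v d \<le> t^3.\<close>

lemma neg_ln_le: "- ln v \<le> (1 - v) * (1 + 6 * v + v\<^sup>2) / (4 * (v + v\<^sup>2))" if "0 < v" "v \<le> 1" for v :: real
proof -
  let ?h = "\<lambda>v::real. (1 - v) * (1 + 6 * v + v\<^sup>2) / (4 * (v + v\<^sup>2)) + ln v"
  have "?h 1 \<le> ?h v"
  proof (rule DERIV_nonpos_imp_nonincreasing[OF that(2)])
    fix x assume x: "v \<le> x" "x \<le> 1"
    then have p: "0 < x" using that by simp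
    define q where "q = x + x\<^sup>2"
    have q: "0 < q" using p by (simp add: q_def add_pos_pos)
    define N where "N = (1 - x) * (1 + 6 * x + x\<^sup>2)"
    define N' where "N' = - (1 + 6 * x + x\<^sup>2) + (1 - x) * (6 + 2 * x)"
    have n: "((\<lambda>v. (1 - v) * (1 + 6 * v + v\<^sup>2)) has_real_derivative N') (at x)"
      unfolding N'_def by (auto intro!: derivative_eq_intros)
    have d: "((\<lambda>v::real. 4 * (v + v\<^sup>2)) has_real_derivative 4 * (1 + 2 * x)) (at x)"
      by (auto intro!: derivative_eq_intros)
    have A: "(?h has_real_derivative (N' * (4 * q) - N * (4 * (1 + 2 * x))) / (4 * q * (4 * q)) + 1 / x) (at x)"
      using DERIV_add[OF DERIV_divide[OF n d] DERIV_ln_divide[OF p]] q by (simp add: N_def q_def)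
    have E: "(N' * (4 * q) - N * (4 * (1 + 2 * x))) / (4 * q * (4 * q)) + 1 / x = - ((1 - x)\<^sup>2 * (1 + x\<^sup>2) / (4 * q\<^sup>2))"
    proof -
      have "x * (N' * q - N * (1 + 2 * x)) + 4 * q\<^sup>2 = - (x * ((1 - x)\<^sup>2 * (1 + x\<^sup>2)))"
        unfolding N_def N'_def q_def by (simp add: power2_eq_square algebra_simps)
      then have "(x * (N' * q - N * (1 + 2 * x)) + 4 * q\<^sup>2) / (4 * q\<^sup>2 * x) = - (x * ((1 - x)\<^sup>2 * (1 + x\<^sup>2))) / (4 * q\<^sup>2 * x)" by simp
      moreover have "(N' * (4 * q) - N * (4 * (1 + 2 * x))) / (4 * q * (4 * q)) + 1 / x = (x * (N' * q - N * (1 + 2 * x)) + 4 * q\<^sup>2) / (4 * q\<^sup>2 * x)"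
      proof -
        have "(4 * P) / (4 * q * (4 * q)) + 1 / x = (x * P + 4 * q\<^sup>2) / (4 * q\<^sup>2 * x)" for P
          using p q add_frac_eq[of "4 * q\<^sup>2" x P 1] by (simp add: power2_eq_square mult_ac)
        from this[of "N' * q - N * (1 + 2 * x)"] show ?thesis by (simp add: algebra_simps)
      qed
      ultimately show ?thesis using p by simp
    qed
    have "- ((1 - x)\<^sup>2 * (1 + x\<^sup>2) / (4 * q\<^sup>2)) \<le> 0" by simp
    with A[unfolded E] show "\<exists>y. (?h has_real_derivative y) (at x) \<and> y \<le> 0" by blast
  qed
  then show ?thesis by simp
qed

definition cross_integrand :: "real \<Rightarrow> real" where
  "cross_integrand u = sqrt (u * (1 - u) * - ln (1 - u))"

text \<open>With \<open>v = sqrt (1 - u)\<close>, \<open>t = 1 - v\<close> and \<open>q = (1 + v) * L / 4\<close>, where \<open>L = - ln (1 - u)\<close>, the integrand is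
  \<open>2 * v * sqrt (t * q)\<close>, and \<open>q\<close> is so close to \<open>t\<close> that the geometric mean can be replaced by the arithmetic one.\<close>

lemma cross_integrand_bounds:
  assumes u: "0 < u" "u < 1"
  defines "v \<equiv> sqrt (1 - u)" and "L \<equiv> - ln (1 - u)"
  shows "cross_integrand u \<le> v - v ^ 2 + (v + v ^ 2) * L / 4"
    and "v - v ^ 2 + (v + v ^ 2) * L / 4 - ((1 - v - v ^ 2 + v ^ 3) * L / 4 - (1 - 3 * v + 3 * v ^ 2 - v ^ 3)) / 32 \<le> cross_integrand u"
proof -
  have v: "0 < v" "v < 1" "v\<^sup>2 = 1 - u" using u by (simp_all add: v_def)
  have L: "L = - 2 * ln v" using u by (simp add: L_def v_def ln_sqrt)
  define t where "t = 1 - v"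
  define q where "q = (1 + v) * L / 4"
  define a where "a = t + q"
  define d where "d = q - t"
  have t: "0 < t" using v by (simp add: t_def)
  have "(1 + v) * (2 * (1 - v) / (1 + v)) \<le> (1 + v) * - ln v"
    using v by (intro mult_left_mono neg_ln_ge) auto
  then have "2 * (1 - v) \<le> (1 + v) * - ln v" using v by simp
  then have d0: "0 \<le> d" by (simp add: d_def q_def t_def L field_simps)
  have "(1 + v) * - ln v \<le> (1 + v) * ((1 - v) * (1 + 6 * v + v\<^sup>2) / (4 * (v + v\<^sup>2)))"
    using v by (intro mult_left_mono neg_ln_le) auto
  also have "v + v\<^sup>2 = v * (1 + v)" by (simp add: power2_eq_square algebra_simps)
  also have "(1 + v) * ((1 - v) * (1 + 6 * v + v\<^sup>2) / (4 * (v * (1 + v)))) = t * (t\<^sup>2 + 8 * v) / (4 * v)"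
  proof -
    have c: "c * (b / (4 * (v * c))) = b / (4 * v)" if "c \<noteq> 0" for b c :: real using that by simp
    have w: "1 + 6 * v + v\<^sup>2 = t\<^sup>2 + 8 * v" by (simp add: t_def power2_eq_square algebra_simps)
    have "1 + v \<noteq> 0" using v by simp
    from c[OF this] show ?thesis unfolding w t_def[symmetric] .
  qed
  finally have "(1 + v) * - ln v / 2 \<le> t * (t\<^sup>2 + 8 * v) / (4 * v) / 2" by (rule divide_right_mono) simp
  then have "(1 + v) * - ln v / 2 \<le> t * (t\<^sup>2 + 8 * v) / (8 * v)" by (simp add: divide_divide_eq_left mult.commute)
  moreover have "q = (1 + v) * - ln v / 2" by (simp add: q_def L)
  ultimately have q_le: "q \<le> t * (t\<^sup>2 + 8 * v) / (8 * v)" by simp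
  have d_le: "8 * v * d \<le> t ^ 3"
  proof -
    have "8 * v * q \<le> t * (t\<^sup>2 + 8 * v)" using q_le v by (simp add: le_divide_eq mult.commute)
    then show ?thesis by (simp add: d_def right_diff_distrib power2_eq_square power3_eq_cube algebra_simps)
  qed
  \<comment> \<open>With a = t + q and d = q - t, the difference of squares is 4 t q, so this is the
    geometric mean 2 v sqrt (t q).\<close>
  have S: "cross_integrand u = v * sqrt (a\<^sup>2 - d\<^sup>2)"
  proof -
    have "u * (1 - u) * - ln (1 - u) = v\<^sup>2 * (a\<^sup>2 - d\<^sup>2)"
    proof -
      have "u * (1 - u) * L = (1 - v\<^sup>2) * v\<^sup>2 * L" using v(3) by simp
      also have "\<dots> = v\<^sup>2 * (a\<^sup>2 - d\<^sup>2)"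
        unfolding a_def d_def q_def t_def by (simp add: power2_eq_square algebra_simps)
      finally show ?thesis unfolding L_def .
    qed
    from arg_cong[OF this, of sqrt] show ?thesis unfolding cross_integrand_def[symmetric] using v(1) by (simp add: real_sqrt_mult)
  qed
  have ad: "0 \<le> a" "d \<le> a" using t d0 by (simp_all add: a_def d_def)
  have "sqrt (a\<^sup>2 - d\<^sup>2) \<le> a" using ad by (intro real_le_lsqrt) auto
  then have "cross_integrand u \<le> v * a" unfolding S using v by simp
  then show "cross_integrand u \<le> v - v ^ 2 + (v + v ^ 2) * L / 4"
    by (simp add: a_def t_def q_def power2_eq_square algebra_simps)
  \<comment> \<open>The gap between the means is about d^2 / (4 t). Replacing one factor d by its
    bound t^3 / (8 v) gives x, and v x = t^2 d / 32 is then a combination of powers of v and of such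
    powers times L, which integrate in closed form.\<close>
  define x where "x = t\<^sup>2 * d / (32 * v)"
  have x0: "0 \<le> x" using d0 v by (simp add: x_def)
  have dx: "d\<^sup>2 \<le> 4 * t * x"
  proof -
    have "8 * v * d * d \<le> t ^ 3 * d" using d_le d0 by (rule mult_right_mono)
    then show ?thesis using v by (simp add: x_def power2_eq_square power3_eq_cube field_simps)
  qed
  have "a - x \<le> sqrt (a\<^sup>2 - d\<^sup>2)"
  \<comment> \<open>For x \<le> 2 d one has 2 a - x \<ge> 4 t, since a = 2 t + d; otherwise already
    a - d lies below the root.\<close>
  proof (cases "x \<le> 2 * d")
    case True
    have "4 * t * x \<le> (2 * a - x) * x" using True x0 by (intro mult_right_mono) (auto simp: a_def d_def)
    with dx have "(a - x)\<^sup>2 \<le> a\<^sup>2 - d\<^sup>2" by (simp add: power2_eq_square algebra_simps)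
    then show ?thesis by (rule real_le_rsqrt)
  next
    case False
    have "d * d \<le> a * d" using ad d0 by (intro mult_right_mono)
    then have "(a - d)\<^sup>2 \<le> a\<^sup>2 - d\<^sup>2" by (simp add: power2_eq_square algebra_simps)
    then have "a - d \<le> sqrt (a\<^sup>2 - d\<^sup>2)" by (rule real_le_rsqrt)
    with False d0 show ?thesis by simp
  qed
  then have "v * (a - x) \<le> cross_integrand u" unfolding S using v by simp
  moreover have "v * (a - x) = v * a - t\<^sup>2 * d / 32" using v by (simp add: x_def right_diff_distrib)
  moreover have "v * a - t\<^sup>2 * d / 32 = v - v ^ 2 + (v + v ^ 2) * L / 4 - ((1 - v - v ^ 2 + v ^ 3) * L / 4 - (1 - 3 * v + 3 * v ^ 2 - v ^ 3)) / 32"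
    by (simp add: a_def d_def t_def q_def power2_eq_square power3_eq_cube field_simps)
  ultimately show "v - v ^ 2 + (v + v ^ 2) * L / 4 - ((1 - v - v ^ 2 + v ^ 3) * L / 4 - (1 - 3 * v + 3 * v ^ 2 - v ^ 3)) / 32 \<le> cross_integrand u"
    by simp
qed

lemma gauss_score_pole_score: "0 < u \<Longrightarrow> u < 1 \<Longrightarrow> gauss_score u * pole_score u = 4 * sqrt 2 * cross_integrand u"
  by (simp add: gauss_score_def pole_score_def cross_integrand_def real_sqrt_mult[symmetric] mult_ac)

definition cross_integral :: real where "cross_integral = (\<integral>u. cross_integrand u \<partial>unif)"

lemma gauss_rank_cross_moment: "gauss_rank.cross_moment = 4 * sqrt 2 * cross_integral"
proof -
  have [measurable]: "cross_integrand \<in> borel_measurable borel" unfolding cross_integrand_def[abs_def] by measurable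
  have "gauss_rank.cross_moment = (\<integral>u. 4 * sqrt 2 * cross_integrand u \<partial>unif)"
    unfolding gauss_rank.cross_moment_def
  proof (rule integral_cong_AE)
    show "AE u in unif. gauss_score u * pole_score u = 4 * sqrt 2 * cross_integrand u"
      using AE_unif by eventually_elim (simp only: gauss_score_pole_score)
    show "(\<lambda>u. gauss_score u * pole_score u) \<in> borel_measurable unif" using gauss_rank.meas by measurable
  qed measurable
  then show ?thesis by (simp add: cross_integral_def)
qed

text \<open>B and B - C are the two sides of \<open>cross_integrand_bounds\<close>. Their integrals
  are 49 / 144 and 49 / 144 - 59 / 115200 = 39141 / 115200.\<close>

lemma cross_integral_bounds: "39141 / 115200 \<le> cross_integral" "cross_integral \<le> 49 / 144"
proof -
  let ?m = "\<lambda>k u. sqrt (1 - u) ^ k" and ?l = "\<lambda>k u. sqrt (1 - u) ^ k * - ln (1 - u)"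
  note I = unif_sqrt_power(1) unif_sqrt_power_ln(1)
  have [measurable]: "cross_integrand \<in> borel_measurable borel" unfolding cross_integrand_def[abs_def] by measurable
  define B where "B u = ?m 1 u - ?m 2 u + 1 / 4 * ?l 1 u + 1 / 4 * ?l 2 u" for u
  define C where "C u = 1 / 128 * ?l 0 u - 1 / 128 * ?l 1 u - 1 / 128 * ?l 2 u + 1 / 128 * ?l 3 u - 1 / 32 * ?m 0 u + 3 / 32 * ?m 1 u - 3 / 32 * ?m 2 u + 1 / 32 * ?m 3 u" for u
  have iB: "integrable unif B" "(\<integral>u. B u \<partial>unif) = 49 / 144"
  proof -
    show "integrable unif B" unfolding B_def[abs_def] by (intro Bochner_Integration.integrable_add Bochner_Integration.integrable_diff integrable_mult_right I)
    have "(\<integral>u. B u \<partial>unif) = (2 / (real 1 + 2)) - 2 / (real 2 + 2) + 1 / 4 * (4 / (real 1 + 2)\<^sup>2) + 1 / 4 * (4 / (real 2 + 2)\<^sup>2)"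
      unfolding B_def unif_sqrt_power(2)[symmetric] unif_sqrt_power_ln(2)[symmetric]
      by (simp only: Bochner_Integration.integral_add Bochner_Integration.integral_diff integral_mult_right_zero Bochner_Integration.integrable_add Bochner_Integration.integrable_diff integrable_mult_right I)
    also have "\<dots> = 49 / 144" by (simp add: power2_eq_square)
    finally show "(\<integral>u. B u \<partial>unif) = 49 / 144" .
  qed
  have iC: "integrable unif C" "(\<integral>u. C u \<partial>unif) = 59 / 115200"
  proof -
    show "integrable unif C" unfolding C_def[abs_def] by (intro Bochner_Integration.integrable_add Bochner_Integration.integrable_diff integrable_mult_right I)
    have "(\<integral>u. C u \<partial>unif) = 1 / 128 * (4 / (real 0 + 2)\<^sup>2) - 1 / 128 * (4 / (real 1 + 2)\<^sup>2) - 1 / 128 * (4 / (real 2 + 2)\<^sup>2) + 1 / 128 * (4 / (real 3 + 2)\<^sup>2)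
        - 1 / 32 * (2 / (real 0 + 2)) + 3 / 32 * (2 / (real 1 + 2)) - 3 / 32 * (2 / (real 2 + 2)) + 1 / 32 * (2 / (real 3 + 2))"
      unfolding C_def unif_sqrt_power(2)[symmetric] unif_sqrt_power_ln(2)[symmetric]
      by (simp only: Bochner_Integration.integral_add Bochner_Integration.integral_diff integral_mult_right_zero Bochner_Integration.integrable_add Bochner_Integration.integrable_diff integrable_mult_right I)
    also have "\<dots> = 59 / 115200" by (simp add: power2_eq_square)
    finally show "(\<integral>u. C u \<partial>unif) = 59 / 115200" .
  qed
  have le: "AE u in unif. B u - C u \<le> cross_integrand u \<and> cross_integrand u \<le> B u"
    using AE_unif
  proof eventually_elim
    case (elim u)
    have B: "B u = sqrt (1 - u) - sqrt (1 - u) ^ 2 + (sqrt (1 - u) + sqrt (1 - u) ^ 2) * - ln (1 - u) / 4"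
      unfolding B_def by (simp add: field_simps del: real_sqrt_pow2)
    have C: "C u = ((1 - sqrt (1 - u) - sqrt (1 - u) ^ 2 + sqrt (1 - u) ^ 3) * - ln (1 - u) / 4 - (1 - 3 * sqrt (1 - u) + 3 * sqrt (1 - u) ^ 2 - sqrt (1 - u) ^ 3)) / 32"
      unfolding C_def by (simp add: field_simps del: real_sqrt_pow2)
    show ?case unfolding B C using cross_integrand_bounds[of u] elim by simp
  qed
  have nn: "AE u in unif. 0 \<le> cross_integrand u"
    using AE_unif by eventually_elim (simp add: cross_integrand_def mult_nonneg_nonpos)
  have iS: "integrable unif cross_integrand"
  proof (rule Bochner_Integration.integrable_bound[OF iB(1)])
    show "AE u in unif. norm (cross_integrand u) \<le> norm (B u)" using le nn by eventually_elim simp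
  qed measurable
  have "(\<integral>u. B u - C u \<partial>unif) \<le> cross_integral" unfolding cross_integral_def
    using le by (intro integral_mono_AE Bochner_Integration.integrable_diff iB(1) iC(1) iS) auto
  then show "39141 / 115200 \<le> cross_integral" using iB iC by simp
  show "cross_integral \<le> 49 / 144" unfolding cross_integral_def iB(2)[symmetric]
    using le by (intro integral_mono_AE iS iB(1)) auto
qed

interpretation pole_test: score_test "\<lambda>u. max 0 (pole_score u)" 256 pole_radial
proof
  have eq: "score pole_radial u = max 0 (pole_score u)" if "0 < u" "u < 1" for u
    using that by (simp add: score_pole_radial pole_score_def)
  then show "score pole_radial u = max 0 (pole_score u)" if "0 < u" "u < 1" for u using that .
  show "score pole_radial \<in> borel_measurable borel" by (rule pole_family.measurable_score[OF _ eq]) auto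
qed (simp_all add: pole_rank_moments)

interpretation gauss_test: score_test gauss_score 64 gauss_radial
proof
  show "score gauss_radial \<in> borel_measurable borel"
    by (rule gauss_family.measurable_score[OF gauss_rank.meas score_gauss_radial])
  show "0 < gauss_rank.cross_moment" using cross_integral_bounds(1) by (simp add: gauss_rank_cross_moment)
qed (simp_all add: gauss_rank_second_moment score_gauss_radial)

lemma noncentrality_ratio: "pole_test.noncentrality / gauss_test.noncentrality = 1 / (6 * cross_integral\<^sup>2)"
proof -
  have 1: "pole_test.noncentrality = 2 / 3"
    by (simp add: pole_test.noncentrality_def pole_rank_moments power2_eq_square)
  have 2: "gauss_test.noncentrality = 4 * cross_integral\<^sup>2"
    by (simp add: gauss_test.noncentrality_def gauss_rank_cross_moment gauss_rank_second_moment power_mult_distrib)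
  show ?thesis unfolding 1 2 by simp
qed

context score_test
begin

lemma asymptotic_level:
  assumes \<beta>: "0 < \<beta>" "\<beta> < 1"
  shows "has_asymptotic_level (Q_test_power f) \<beta>"
proof -
  have c: "chi_square_quantile 2 (1 - \<beta>) = - 2 * ln \<beta>" "0 \<le> - 2 * ln \<beta>" using \<beta> by (simp_all add: chi_square_quantile_2)
  \<comment> \<open>The null hypothesis is the shift 0 in an arbitrary direction, with h =
    0.\<close>
  have "(\<lambda>k. Q_test_power f \<beta> (id k) (0 *\<^sub>R axis 1 1)) \<longlonglongrightarrow> chi2_tail (chi_square_quantile 2 (1 - \<beta>)) (noncentrality * 0\<^sup>2)"
    by (rule power_regular) (use c in \<open>auto simp: filterlim_ident norm_axis_1 id_def\<close>)
  then show ?thesis unfolding has_asymptotic_level_def c(1) using c(2) \<beta> by (simp add: chi2_tail_0)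
qed

lemma local_power:
  assumes \<beta>: "0 < \<beta>" "\<beta> < 1" and \<gamma>: "\<gamma> < 1" and \<tau>: "\<tau> \<noteq> 0" and x: "0 < x" "chi2_tail (- 2 * ln \<beta>) x = \<gamma>"
  shows "local_power (Q_test_power f) \<beta> \<gamma> noncentrality x (chi2_tail (- 2 * ln \<beta>)) \<tau>"
proof
  have c: "chi_square_quantile 2 (1 - \<beta>) = - 2 * ln \<beta>" "0 < - 2 * ln \<beta>" using \<beta> by (simp_all add: chi_square_quantile_2)
  have e: "norm (\<tau> /\<^sub>R norm \<tau>) = 1" using \<tau> by simp
  have c0: "0 \<le> chi_square_quantile 2 (1 - \<beta>)" using c by simp
  show "chi2_tail (- 2 * ln \<beta>) y < chi2_tail (- 2 * ln \<beta>) z" if "0 \<le> y" "y < z" for y z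
    using c(2) that by (rule chi2_tail_strict_mono)
  fix n :: "nat \<Rightarrow> nat" and s :: "nat \<Rightarrow> real"
  assume s: "filterlim n at_top sequentially" "s \<longlonglongrightarrow> 0" "\<And>k. 0 \<le> s k"
  show "(\<lambda>k. Q_test_power f \<beta> (n k) (s k *\<^sub>R (\<tau> /\<^sub>R norm \<tau>))) \<longlonglongrightarrow> chi2_tail (- 2 * ln \<beta>) (noncentrality * h\<^sup>2)"
    if "(\<lambda>k. sqrt (real (n k)) * s k) \<longlonglongrightarrow> h" for h
    using power_regular[OF s e that c0] unfolding c(1) .
  show "(\<lambda>k. Q_test_power f \<beta> (n k) (s k *\<^sub>R (\<tau> /\<^sub>R norm \<tau>))) \<longlonglongrightarrow> 1"
    if "filterlim (\<lambda>k. sqrt (real (n k)) * s k) at_top sequentially"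
    using power_diverging[OF s e that c0] .
qed (use assms noncentrality_pos in auto)

end

theorem theorem6:
  shows "\<exists>e. has_pitman_ARE (Q_test_power pole_radial) (Q_test_power gauss_radial) e \<and>
             round (100 * e) = 144"
proof (intro exI conjI)
  let ?e = "1 / (6 * cross_integral\<^sup>2)"
  show "has_pitman_ARE (Q_test_power pole_radial) (Q_test_power gauss_radial) ?e"
    unfolding has_pitman_ARE_def Let_def
  proof (intro allI impI conjI; (elim conjE)?)
    fix \<beta> :: real assume \<beta>: "0 < \<beta>" "\<beta> < 1"
    show "has_asymptotic_level (Q_test_power pole_radial) \<beta>" by (rule pole_test.asymptotic_level[OF \<beta>])
    show "has_asymptotic_level (Q_test_power gauss_radial) \<beta>" by (rule gauss_test.asymptotic_level[OF \<beta>])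
    fix \<gamma> :: real and \<tau> :: "real^2" assume \<gamma>: "\<beta> < \<gamma>" "\<gamma> < 1" and \<tau>: "\<tau> \<noteq> 0"
    have c: "0 < - 2 * ln \<beta>" "exp (- (- 2 * ln \<beta> / 2)) < \<gamma>" using \<beta> \<gamma> by simp_all
    obtain x where x: "0 < x" "chi2_tail (- 2 * ln \<beta>) x = \<gamma>" by (rule chi2_tail_surj[OF c \<gamma>(2)])
    interpret P: local_power "Q_test_power pole_radial" \<beta> \<gamma> pole_test.noncentrality x "chi2_tail (- 2 * ln \<beta>)" \<tau>
      by (rule pole_test.local_power[OF \<beta> \<gamma>(2) \<tau> x])
    interpret W: local_power "Q_test_power gauss_radial" \<beta> \<gamma> gauss_test.noncentrality x "chi2_tail (- 2 * ln \<beta>)" \<tau>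
      by (rule gauss_test.local_power[OF \<beta> \<gamma>(2) \<tau> x])
    have a: "P.alternative = (\<lambda>m. (1 / sqrt (real m)) *\<^sub>R \<tau>)" by (simp add: fun_eq_iff P.alternative_def)
    show "\<forall>\<^sub>F m in sequentially. (\<exists>N. size_suffices (Q_test_power pole_radial) \<beta> \<gamma> ((1 / sqrt (real m)) *\<^sub>R \<tau>) N) \<and>
        (\<exists>N. size_suffices (Q_test_power gauss_radial) \<beta> \<gamma> ((1 / sqrt (real m)) *\<^sub>R \<tau>) N)"
      using P.eventually_ex_size W.eventually_ex_size unfolding a by (rule eventually_conj)
    \<comment> \<open>Both needed sizes grow in proportion to m; division of each by m makes the
      limit a quotient of two size ratios.\<close>
    have "(\<lambda>m. (real (sample_size_needed (Q_test_power gauss_radial) \<beta> \<gamma> (P.alternative m)) / real m) /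
        (real (sample_size_needed (Q_test_power pole_radial) \<beta> \<gamma> (P.alternative m)) / real m)) \<longlonglongrightarrow> W.size_ratio / P.size_ratio"
      using P.size_ratio_pos by (intro tendsto_divide W.size_tendsto P.size_tendsto) simp
    \<comment> \<open>Level, power and direction enter both ratios through the same x and the same
      norm of \<tau>, hence they cancel and only the noncentralities remain.\<close>
    also have "W.size_ratio / P.size_ratio = ?e"
      unfolding noncentrality_ratio[symmetric] P.size_ratio_def W.size_ratio_def
      using x \<tau> pole_test.noncentrality_pos gauss_test.noncentrality_pos by (simp add: field_simps)
    finally show "(\<lambda>m. real (sample_size_needed (Q_test_power gauss_radial) \<beta> \<gamma> ((1 / sqrt (real m)) *\<^sub>R \<tau>)) /
        real (sample_size_needed (Q_test_power pole_radial) \<beta> \<gamma> ((1 / sqrt (real m)) *\<^sub>R \<tau>))) \<longlonglongrightarrow> ?e"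
      unfolding a
    proof (rule Lim_transform_eventually)
      show "\<forall>\<^sub>F m in sequentially. (real (sample_size_needed (Q_test_power gauss_radial) \<beta> \<gamma> ((1 / sqrt (real m)) *\<^sub>R \<tau>)) / real m) /
          (real (sample_size_needed (Q_test_power pole_radial) \<beta> \<gamma> ((1 / sqrt (real m)) *\<^sub>R \<tau>)) / real m) =
          real (sample_size_needed (Q_test_power gauss_radial) \<beta> \<gamma> ((1 / sqrt (real m)) *\<^sub>R \<tau>)) /
          real (sample_size_needed (Q_test_power pole_radial) \<beta> \<gamma> ((1 / sqrt (real m)) *\<^sub>R \<tau>))"
        using eventually_gt_at_top[of 0] by eventually_elim simp
    qed
  qed
  show "round (100 * ?e) = 144"
  proof (rule round_unique)
    \<comment> \<open>The bounds on the integral place the efficiency between 1.439 and 1.444, well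
      inside the rounding interval from 1.435 to 1.445.\<close>
    have "(39141 / 115200)\<^sup>2 \<le> cross_integral\<^sup>2" "cross_integral\<^sup>2 \<le> (49 / 144)\<^sup>2"
      using cross_integral_bounds by (intro power_mono; simp)+
    then have b: "(39141 / 115200) * (39141 / 115200) \<le> cross_integral\<^sup>2" "cross_integral\<^sup>2 \<le> (49 / 144) * (49 / 144)"
      by (simp_all only: power2_eq_square)
    have "0 < cross_integral" using cross_integral_bounds(1) by linarith
    then have p: "0 < cross_integral\<^sup>2" by simp
    show "100 * ?e - 1 / 2 < of_int 144" using b(1) p by (simp add: field_simps)
    show "of_int 144 \<le> 100 * ?e + 1 / 2" using b(2) p by (simp add: field_simps)
  qed
qed

end
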